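(* Let $\pi$ be a well-behaved $*$-representation of $\mathcal{A}$ on the Hilbert space $\mathcal{H}_\pi$ such that the graph topology of $\pi$ is metrizable. Then $\pi$ can be decomposed into a direct orthogonal sum of cyclic well-behaved $*$-representations.
   Context: A $*$-representation $\pi$ of a $*$-algebra $\mathcal{A}$ on a dense linear subspace $\mathcal{D}(\pi)$ of a Hilbert space $\mathcal{H}_\pi$ is an algebra homomorphism of $\mathcal{A}$ into the linear operators on $\mathcal{D}(\pi)$ with $\langle\pi(a)\varphi,\psi\rangle=\langle\varphi,\pi(a^* )\psi\rangle$. The graph topology of $\pi$ is the locally convex topology on $\mathcal{D}(\pi)$ given by the norms $\varphi\mapsto\|\varphi\|+\|\pi(a)\varphi\|$, $a\in\mathcal{A}$; $\pi$ is closed if $\mathcal{D}(\pi)$ is complete in it. $\pi$ is cyclic if there is $\varphi\in\mathcal{D}(\pi)$ such that $\pi(\mathcal{A})\varphi$ is dense in $\mathcal{D}(\pi)$ in the graph topology. The direct sum of closed $*$-representations $\pi_i$ acts componentwise on the domain of all $(\varphi_i)\in\bigoplus_i\mathcal{H}_{\pi_i}$ with $\varphi_i\in\mathcal{D}(\pi_i)$ and $\sum_i\|\pi_i(a)\varphi_i\|^2<\infty$ for all $a\in\mathcal{A}$. A closed $*$-representation $\pi$ of a commutative $*$-algebra $\mathcal{B}$ is integrable if $\overline{\pi(b^* )}=\pi(b)^*$ for all $b\in\mathcal{B}$. $\mathrm{Res}_{\mathcal{B}}$ denotes restriction to $\mathcal{B}$; $\sum\mathcal{A}^2$ is the set of finite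 sums of elements $a^*a$. Standing assumptions. $G$ is a discrete group and $\mathcal{A}=\bigoplus_{g\in G}\mathcal{A}_g$ is a unital $G$-graded $*$-algebra ($\mathcal{A}_g\mathcal{A}_h\subseteq\mathcal{A}_{gh}$, $\mathcal{A}_g^*\subseteq\mathcal{A}_{g^{-1}}$) such that $\mathcal{B}:=\mathcal{A}_e$ is commutative. $\widehat{\mathcal{B}}^+$ is the set of characters (nontrivial $*$-homomorphisms $\mathcal{B}\to\mathbb{C}$) that are nonnegative on $\sum\mathcal{A}^2\cap\mathcal{B}$. It is assumed that $\chi(c^*d)\chi(d^*c)=\chi(c^*c)\chi(d^*d)$ for all $\chi\in\widehat{\mathcal{B}}^+$, $g\in G$, $c,d\in\mathcal{A}_g$, and that $\widehat{\mathcal{B}}^+$ is locally compact in the weakest topology making all functions $f_b(\chi)=\chi(b)$, $b\in\mathcal{B}$, continuous. Partial action: $\mathcal{D}_g$ is the set of $\chi\in\widehat{\mathcal{B}}^+$ with $\chi(a_g^*a_g)\neq0$ for some $a_g\in\mathcal{A}_g$; for such $\chi$, $\chi^g(b)=\chi(a_g^*ba_g)/\chi(a_g^*a_g)$ (independent of $a_g$, again in $\widehat{\mathcal{B}}^+$). For $\Delta\subseteq\widehat{\mathcal{B}}^+$, $\Delta^g=\{\chi^g:\chi\in\Delta\cap\mathcal{D}_g\}$. A $*$-representation $\pi$ of $\mathcal{A}$ is well-behaved if (a) $\mathrm{Res}_{\mathcal{B}}\pi$ is integrable and there is a spectral measure $E_\pi$ on $\widehat{\mathcal{B}}^+$ with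 $\overline{\pi(b)}=\int f_b\,dE_\pi$ for $b\in\mathcal{B}$, and (b) $E_\pi(\Delta^g)\pi(a_g)\subseteq\pi(a_g)E_\pi(\Delta)$ for all $g\in G$, $a_g\in\mathcal{A}_g$ and Borel sets $\Delta\subseteq\widehat{\mathcal{B}}^+$. *)

theory Defs
  imports "HOL-Analysis.Analysis"
begin

section \<open>Complex star-algebras and complex Hilbert spaces\<close>

class complex_vector = ab_group_add +
  fixes scaleC :: "complex \<Rightarrow> 'a \<Rightarrow> 'a"  (infixr \<open>*\<^sub>C\<close> 75)
  assumes scaleC_add_right: "c *\<^sub>C (x + y) = c *\<^sub>C x + c *\<^sub>C y"
    and scaleC_add_left: "(c + d) *\<^sub>C x = c *\<^sub>C x + d *\<^sub>C x"
    and scaleC_scaleC: "c *\<^sub>C d *\<^sub>C x = (c * d) *\<^sub>C x"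
    and scaleC_one: "1 *\<^sub>C x = x"

text \<open>Unital, with \<open>0 = 1\<close> not excluded; this is why the class is not built on \<^class>\<open>ring_1\<close>.\<close>

class complex_star_algebra = ring + monoid_mult + complex_vector +
  fixes star :: "'a \<Rightarrow> 'a"
  assumes mult_scaleC_left: "(c *\<^sub>C x) * y = c *\<^sub>C (x * y)"
    and mult_scaleC_right: "x * (c *\<^sub>C y) = c *\<^sub>C (x * y)"
    and star_star: "star (star x) = x"
    and star_add: "star (x + y) = star x + star y"
    and star_scaleC: "star (c *\<^sub>C x) = cnj c *\<^sub>C star x"
    and star_mult: "star (x * y) = star y * star x"

text \<open>The complex inner product is linear in its first argument. Its real part is the inner product
  of the underlying real Hilbert space, so norm and topology are those of the library.\<close>

class complex_hilbert_space = real_inner + complete_space + complex_vector +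
  fixes cinner :: "'a \<Rightarrow> 'a \<Rightarrow> complex"
  assumes scaleC_of_real: "complex_of_real r *\<^sub>C x = r *\<^sub>R x"
    and cinner_add_left: "cinner (x + y) z = cinner x z + cinner y z"
    and cinner_scaleC_left: "cinner (c *\<^sub>C x) y = c * cinner x y"
    and cinner_commute: "cinner x y = cnj (cinner y x)"
    and Re_cinner: "Re (cinner x y) = inner x y"

definition csubspace :: "'v::complex_vector set \<Rightarrow> bool" where
  "csubspace V \<longleftrightarrow> 0 \<in> V \<and> (\<forall>x\<in>V. \<forall>y\<in>V. x + y \<in> V) \<and> (\<forall>c. \<forall>x\<in>V. c *\<^sub>C x \<in> V)"

definition clinear_on :: "'v::complex_vector set \<Rightarrow> ('v \<Rightarrow> 'w::complex_vector) \<Rightarrow> bool" where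
  "clinear_on V T \<longleftrightarrow>
     (\<forall>x\<in>V. \<forall>y\<in>V. T (x + y) = T x + T y) \<and> (\<forall>c. \<forall>x\<in>V. T (c *\<^sub>C x) = c *\<^sub>C T x)"

definition star_subalgebra :: "'a::complex_star_algebra set \<Rightarrow> bool" where
  "star_subalgebra S \<longleftrightarrow>
     csubspace S \<and> (\<forall>a\<in>S. \<forall>b\<in>S. a * b \<in> S) \<and> (\<forall>a\<in>S. star a \<in> S)"


section \<open>Unbounded operators\<close>

text \<open>A possibly unbounded operator with domain \<open>D\<close> is identified with its graph. Hence inclusion and
  equality of operators are those of sets, the closure of an operator is the topological closure of
  its graph, and the operator product \<open>S T\<close> (first \<open>T\<close>, then \<open>S\<close>) is the relation \<open>T O S\<close>.\<close>

definition op_graph :: "'h set \<Rightarrow> ('h \<Rightarrow> 'h) \<Rightarrow> ('h \<times> 'h) set" where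
  "op_graph D T = {(x, T x) | x. x \<in> D}"

definition op_adjoint :: "'h::complex_hilbert_space set \<Rightarrow> ('h \<times> 'h) set \<Rightarrow> ('h \<times> 'h) set" where
  "op_adjoint H T = {(y, z). y \<in> H \<and> z \<in> H \<and> (\<forall>(x, w)\<in>T. cinner w y = cinner x z)}"


section \<open>Star-representations\<close>

text \<open>The Hilbert space of a representation is a closed subspace \<open>hilb\<close> of an ambient Hilbert space
  type, so that subrepresentations are objects of the same kind. Only the values of \<open>act a\<close> on \<open>dom\<close>
  for \<open>a\<close> in the represented algebra \<open>alg\<close> are relevant.\<close>

record ('a, 'h) rep =
  alg :: "'a set"
  hilb :: "'h set"
  dom :: "'h set"
  act :: "'a \<Rightarrow> 'h \<Rightarrow> 'h"

definition star_rep :: "('a::complex_star_algebra, 'h::complex_hilbert_space) rep \<Rightarrow> bool" where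
  "star_rep \<pi> \<longleftrightarrow>
     star_subalgebra (alg \<pi>) \<and>
     csubspace (hilb \<pi>) \<and> closed (hilb \<pi>) \<and>
     csubspace (dom \<pi>) \<and> closure (dom \<pi>) = hilb \<pi> \<and>
     (\<forall>a\<in>alg \<pi>. clinear_on (dom \<pi>) (act \<pi> a) \<and> act \<pi> a ` dom \<pi> \<subseteq> dom \<pi>) \<and>
     (\<forall>\<phi>\<in>dom \<pi>. clinear_on (alg \<pi>) (\<lambda>a. act \<pi> a \<phi>)) \<and>
     (\<forall>a\<in>alg \<pi>. \<forall>b\<in>alg \<pi>. \<forall>\<phi>\<in>dom \<pi>. act \<pi> (a * b) \<phi> = act \<pi> a (act \<pi> b \<phi>)) \<and>
     (\<forall>a\<in>alg \<pi>. \<forall>\<phi>\<in>dom \<pi>. \<forall>\<psi>\<in>dom \<pi>.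
        cinner (act \<pi> a \<phi>) \<psi> = cinner \<phi> (act \<pi> (star a) \<psi>))"

definition Res :: "'a set \<Rightarrow> ('a, 'h) rep \<Rightarrow> ('a, 'h) rep" where
  "Res B \<pi> = \<pi>\<lparr>alg := B\<rparr>"

definition rep_op :: "('a, 'h) rep \<Rightarrow> 'a \<Rightarrow> ('h \<times> 'h) set" where
  "rep_op \<pi> a = op_graph (dom \<pi>) (act \<pi> a)"

definition graph_norm :: "('a, 'h::real_normed_vector) rep \<Rightarrow> 'a \<Rightarrow> 'h \<Rightarrow> real" where
  "graph_norm \<pi> a \<phi> = norm \<phi> + norm (act \<pi> a \<phi>)"

definition graph_topology :: "('a, 'h::real_normed_vector) rep \<Rightarrow> 'h topology" where
  "graph_topology \<pi> = topology_generated_by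
     {{\<psi> \<in> dom \<pi>. graph_norm \<pi> a (\<psi> - \<phi>) < \<epsilon>} | a \<phi> \<epsilon>. a \<in> alg \<pi> \<and> \<phi> \<in> dom \<pi> \<and> \<epsilon> > 0}"

text \<open>The graph topology need not be metrizable, so completeness is stated with Cauchy filters.\<close>

definition closed_rep :: "('a, 'h::real_normed_vector) rep \<Rightarrow> bool" where
  "closed_rep \<pi> \<longleftrightarrow>
     (\<forall>F. F \<noteq> bot \<and> F \<le> principal (dom \<pi>) \<and>
          (\<forall>a\<in>alg \<pi>. ((\<lambda>(x, y). graph_norm \<pi> a (x - y)) \<longlongrightarrow> 0) (F \<times>\<^sub>F F)) \<longrightarrow>
          (\<exists>\<phi>\<in>dom \<pi>. limitin (graph_topology \<pi>) (\<lambda>x. x) \<phi> F))"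

definition cyclic_rep :: "('a, 'h::real_normed_vector) rep \<Rightarrow> bool" where
  "cyclic_rep \<pi> \<longleftrightarrow>
     (\<exists>\<phi>\<in>dom \<pi>. graph_topology \<pi> closure_of ((\<lambda>a. act \<pi> a \<phi>) ` alg \<pi>) = dom \<pi>)"

definition integrable_rep ::
    "('a::complex_star_algebra, 'h::complex_hilbert_space) rep \<Rightarrow> bool" where
  "integrable_rep \<pi> \<longleftrightarrow>
     star_rep \<pi> \<and> closed_rep \<pi> \<and>
     (\<forall>b\<in>alg \<pi>. closure (rep_op \<pi> (star b)) = op_adjoint (hilb \<pi>) (rep_op \<pi> b))"

definition direct_sum_space :: "'i set \<Rightarrow> ('i \<Rightarrow> ('a, 'h::real_normed_vector) rep) \<Rightarrow> ('i \<Rightarrow> 'h) set" where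
  "direct_sum_space I \<rho> =
     {\<Phi> \<in> Pi\<^sub>E I (\<lambda>i. hilb (\<rho> i)). (\<lambda>i. (norm (\<Phi> i))\<^sup>2) summable_on I}"

definition direct_sum_dom ::
    "'a set \<Rightarrow> 'i set \<Rightarrow> ('i \<Rightarrow> ('a, 'h::real_normed_vector) rep) \<Rightarrow> ('i \<Rightarrow> 'h) set" where
  "direct_sum_dom S I \<rho> =
     {\<Phi> \<in> direct_sum_space I \<rho>. (\<forall>i\<in>I. \<Phi> i \<in> dom (\<rho> i)) \<and>
        (\<forall>a\<in>S. (\<lambda>i. (norm (act (\<rho> i) a (\<Phi> i)))\<^sup>2) summable_on I)}"

text \<open>The Hilbert spaces of the summands are pairwise orthogonal subspaces, and \<open>\<pi>\<close> is the direct sum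
  of the \<open>\<rho> i\<close> transported along the isometry sending a family to its sum.\<close>

definition orthogonal_direct_sum ::
    "('a::complex_star_algebra, 'h::complex_hilbert_space) rep \<Rightarrow> 'i set \<Rightarrow>
     ('i \<Rightarrow> ('a, 'h) rep) \<Rightarrow> bool" where
  "orthogonal_direct_sum \<pi> I \<rho> \<longleftrightarrow>
     (\<forall>i\<in>I. alg (\<rho> i) = alg \<pi> \<and> star_rep (\<rho> i) \<and> closed_rep (\<rho> i)) \<and>
     (\<forall>i\<in>I. \<forall>j\<in>I. i \<noteq> j \<longrightarrow> (\<forall>x\<in>hilb (\<rho> i). \<forall>y\<in>hilb (\<rho> j). cinner x y = 0)) \<and>
     hilb \<pi> = {x. \<exists>\<Phi>\<in>direct_sum_space I \<rho>. (\<Phi> has_sum x) I} \<and>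
     dom \<pi> = {x. \<exists>\<Phi>\<in>direct_sum_dom (alg \<pi>) I \<rho>. (\<Phi> has_sum x) I} \<and>
     (\<forall>a\<in>alg \<pi>. \<forall>\<Phi>\<in>direct_sum_dom (alg \<pi>) I \<rho>. \<forall>x.
        (\<Phi> has_sum x) I \<longrightarrow> ((\<lambda>i. act (\<rho> i) a (\<Phi> i)) has_sum act \<pi> a x) I)"


section \<open>Spectral measures\<close>

definition orth_projection :: "'h::complex_hilbert_space set \<Rightarrow> ('h \<Rightarrow> 'h) \<Rightarrow> bool" where
  "orth_projection H P \<longleftrightarrow>
     clinear_on H P \<and> P ` H \<subseteq> H \<and> (\<forall>x\<in>H. P (P x) = P x) \<and>
     (\<forall>x\<in>H. \<forall>y\<in>H. cinner (P x) y = cinner x (P y))"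

definition spectral_measure ::
    "'x measure \<Rightarrow> 'h::complex_hilbert_space set \<Rightarrow> ('x set \<Rightarrow> 'h \<Rightarrow> 'h) \<Rightarrow> bool" where
  "spectral_measure M H E \<longleftrightarrow>
     (\<forall>\<Delta>\<in>sets M. orth_projection H (E \<Delta>)) \<and>
     (\<forall>x\<in>H. E (space M) x = x) \<and>
     (\<forall>\<Delta>::nat \<Rightarrow> 'x set. range \<Delta> \<subseteq> sets M \<and> disjoint_family \<Delta> \<longrightarrow>
        (\<forall>x\<in>H. (\<lambda>n. E (\<Delta> n) x) sums E (\<Union>n. \<Delta> n) x))"

definition scalar_measure ::
    "'x measure \<Rightarrow> ('x set \<Rightarrow> 'h::complex_hilbert_space \<Rightarrow> 'h) \<Rightarrow> 'h \<Rightarrow> 'x measure" where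
  "scalar_measure M E \<phi> = measure_of (space M) (sets M) (\<lambda>\<Delta>. ennreal (Re (cinner (E \<Delta> \<phi>) \<phi>)))"

definition simple_spectral_integral ::
    "'x measure \<Rightarrow> ('x set \<Rightarrow> 'h::complex_hilbert_space \<Rightarrow> 'h) \<Rightarrow> ('x \<Rightarrow> complex) \<Rightarrow> 'h \<Rightarrow> 'h" where
  "simple_spectral_integral M E s \<phi> = (\<Sum>z\<in>s ` space M. z *\<^sub>C E (s -` {z} \<inter> space M) \<phi>)"

text \<open>The graph of the operator \<open>\<integral> f dE\<close>: its domain consists of the vectors \<open>\<phi>\<close> for which \<open>f\<close> is
  square integrable with respect to \<open>\<langle>E(\<cdot>)\<phi>, \<phi>\<rangle>\<close>, and its value at \<open>\<phi>\<close> is the limit of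
  \<open>\<integral> s\<^sub>n dE \<phi>\<close> for simple functions \<open>s\<^sub>n\<close> converging to \<open>f\<close> in mean square for that measure.\<close>

definition spectral_integral ::
    "'x measure \<Rightarrow> 'h::complex_hilbert_space set \<Rightarrow> ('x set \<Rightarrow> 'h \<Rightarrow> 'h) \<Rightarrow> ('x \<Rightarrow> complex) \<Rightarrow>
     ('h \<times> 'h) set" where
  "spectral_integral M H E f =
     {(\<phi>, \<psi>). \<phi> \<in> H \<and> \<psi> \<in> H \<and> f \<in> borel_measurable M \<and>
        (\<integral>\<^sup>+ x. ennreal ((cmod (f x))\<^sup>2) \<partial>scalar_measure M E \<phi>) < \<infinity> \<and>
        (\<exists>s. (\<forall>n::nat. simple_function M (s n)) \<and>
             (\<lambda>n. \<integral>\<^sup>+ x. ennreal ((cmod (f x - s n x))\<^sup>2) \<partial>scalar_measure M E \<phi>) \<longlonglongrightarrow> 0 \<and>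
             (\<lambda>n. simple_spectral_integral M E (s n) \<phi>) \<longlonglongrightarrow> \<psi>)}"


section \<open>Graded star-algebras and well-behaved representations\<close>

text \<open>\<^class>\<open>group_add\<close> is the class of arbitrary, not necessarily commutative groups. They are written
  additively: \<open>0\<close> is the neutral element \<open>e\<close> and \<open>- g\<close> the inverse of \<open>g\<close>.\<close>

definition graded_star_algebra :: "('g::group_add \<Rightarrow> 'a::complex_star_algebra set) \<Rightarrow> bool" where
  "graded_star_algebra A \<longleftrightarrow>
     (\<forall>g. csubspace (A g)) \<and>
     (\<forall>a. \<exists>!f. (\<forall>g. f g \<in> A g) \<and> finite {g. f g \<noteq> 0} \<and> a = (\<Sum>g | f g \<noteq> 0. f g)) \<and>
     (\<forall>g h. \<forall>a\<in>A g. \<forall>b\<in>A h. a * b \<in> A (g + h)) \<and>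
     (\<forall>g. \<forall>a\<in>A g. star a \<in> A (- g))"

definition sums_of_squares :: "'a::complex_star_algebra set" where
  "sums_of_squares = {\<Sum>a\<leftarrow>as. star a * a | as. True}"

text \<open>Characters are functions on \<open>B\<close>; they are normalised to be undefined outside \<open>B\<close>.\<close>

definition characters :: "'a::complex_star_algebra set \<Rightarrow> ('a \<Rightarrow> complex) set" where
  "characters B = {\<xi> \<in> extensional B.
     (\<forall>a\<in>B. \<forall>b\<in>B. \<xi> (a + b) = \<xi> a + \<xi> b) \<and>
     (\<forall>c. \<forall>a\<in>B. \<xi> (c *\<^sub>C a) = c * \<xi> a) \<and>
     (\<forall>a\<in>B. \<forall>b\<in>B. \<xi> (a * b) = \<xi> a * \<xi> b) \<and>
     (\<forall>a\<in>B. \<xi> (star a) = cnj (\<xi> a)) \<and>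
     (\<exists>a\<in>B. \<xi> a \<noteq> 0)}"

definition pos_characters ::
    "('g::group_add \<Rightarrow> 'a::complex_star_algebra set) \<Rightarrow> ('a \<Rightarrow> complex) set" where
  "pos_characters A = {\<xi> \<in> characters (A 0). \<forall>x \<in> sums_of_squares \<inter> A 0. \<xi> x \<in> \<real>\<^sub>\<ge>\<^sub>0}"

definition char_topology ::
    "('g::group_add \<Rightarrow> 'a::complex_star_algebra set) \<Rightarrow> ('a \<Rightarrow> complex) topology" where
  "char_topology A = topology_generated_by
     {{\<xi> \<in> pos_characters A. \<xi> b \<in> U} | b U. b \<in> A 0 \<and> open U}"

definition char_borel ::
    "('g::group_add \<Rightarrow> 'a::complex_star_algebra set) \<Rightarrow> ('a \<Rightarrow> complex) measure" where
  "char_borel A = sigma (pos_characters A) {U. openin (char_topology A) U}"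

definition act_dom ::
    "('g::group_add \<Rightarrow> 'a::complex_star_algebra set) \<Rightarrow> 'g \<Rightarrow> ('a \<Rightarrow> complex) set" where
  "act_dom A g = {\<xi> \<in> pos_characters A. \<exists>a\<in>A g. \<xi> (star a * a) \<noteq> 0}"

text \<open>Under the assumptions of \<open>standing_assumptions\<close> below, the value does not depend on the
  chosen \<open>a\<close>.\<close>

definition char_act ::
    "('g::group_add \<Rightarrow> 'a::complex_star_algebra set) \<Rightarrow> 'g \<Rightarrow> ('a \<Rightarrow> complex) \<Rightarrow> 'a \<Rightarrow> complex" where
  "char_act A g \<xi> =
     (let a = (SOME a. a \<in> A g \<and> \<xi> (star a * a) \<noteq> 0)
      in (\<lambda>b\<in>A 0. \<xi> (star a * b * a) / \<xi> (star a * a)))"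

definition set_act ::
    "('g::group_add \<Rightarrow> 'a::complex_star_algebra set) \<Rightarrow> 'g \<Rightarrow> ('a \<Rightarrow> complex) set \<Rightarrow>
     ('a \<Rightarrow> complex) set" where
  "set_act A g \<Delta> = char_act A g ` (\<Delta> \<inter> act_dom A g)"

definition standing_assumptions :: "('g::group_add \<Rightarrow> 'a::complex_star_algebra set) \<Rightarrow> bool" where
  "standing_assumptions A \<longleftrightarrow>
     graded_star_algebra A \<and>
     (\<forall>a\<in>A 0. \<forall>b\<in>A 0. a * b = b * a) \<and>
     (\<forall>\<xi>\<in>pos_characters A. \<forall>g. \<forall>c\<in>A g. \<forall>d\<in>A g.
        \<xi> (star c * d) * \<xi> (star d * c) = \<xi> (star c * c) * \<xi> (star d * d)) \<and>
     locally_compact_space (char_topology A)"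

definition well_behaved ::
    "('g::group_add \<Rightarrow> 'a::complex_star_algebra set) \<Rightarrow>
     ('a, 'h::complex_hilbert_space) rep \<Rightarrow> bool" where
  "well_behaved A \<pi> \<longleftrightarrow>
     alg \<pi> = UNIV \<and> star_rep \<pi> \<and> integrable_rep (Res (A 0) \<pi>) \<and>
     (\<exists>E. spectral_measure (char_borel A) (hilb \<pi>) E \<and>
        (\<forall>b\<in>A 0. closure (rep_op \<pi> b) =
            spectral_integral (char_borel A) (hilb \<pi>) E (\<lambda>\<xi>. \<xi> b)) \<and>
        (\<forall>g. \<forall>a\<in>A g. \<forall>\<Delta>\<in>sets (char_borel A).
            rep_op \<pi> a O op_graph (hilb \<pi>) (E (set_act A g \<Delta>))
              \<subseteq> op_graph (hilb \<pi>) (E \<Delta>) O rep_op \<pi> a))"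

end

theory Submission
  imports Defs
begin

text \<open>Why the theorem holds. The algebra \<open>\<B>\<close> of elements of degree zero acts by commuting normal
  operators with a joint spectral measure \<open>E\<close>. Since the graph topology is metrizable, countably many
  elements of the algebra dominate all others, so every nonzero vector has a nonzero part \<open>i = E(\<Delta>)i\<close> carried by a
  region \<open>\<Delta>\<close> on which every element of the algebra is bounded (\<open>ex_bounding\<close>). On such a region all graph norms are
  equivalent to the norm. Hence the closed span \<open>L\<close> of \<open>\<pi>(\<B>)i\<close> consists of vectors of the domain and, the
  operators of \<open>\<B>\<close> being bounded and normal there, \<open>L\<close> is invariant under the spectral projections
  (\<open>bounded_cyclic_invariant\<close>). The covariance condition moves spectral projections through homogeneous
  elements: \<open>E(\<Delta>)\<pi>(a) = \<pi>(a)E(\<Delta>')\<close> where \<open>\<Delta>'\<close> is \<open>\<Delta>\<close> transported back by the partial action. So the closed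
  span of \<open>\<pi>(\<A>)i\<close> is invariant under \<open>E\<close> as well; it reduces \<open>\<pi>\<close>, the part of \<open>\<pi>\<close> on it is well-behaved
  (\<open>well_behaved_subrep\<close>) and \<open>i\<close> is cyclic for it (\<open>cyclic_subrep\<close>). A maximal orthogonal family of such subspaces
  exhausts the Hilbert space, because a vector orthogonal to all of them would have a bounded part
  generating a further one.

  One point makes this argument insufficient. The topology on the characters comes from possibly uncountably
  many functions \<open>f\<^sub>b\<close>, and \<open>E\<close> is any countably additive measure on its Borel sets. On Borel sets not
  described by countably many \<open>f\<^sub>b\<close> it need not be determined by the operators: on the
  ordinals up to \<open>\<omega>\<^sub>1\<close>, the Dieudonne measure and the point mass at \<open>\<omega>\<^sub>1\<close> integrate all continuous functions
  in the same way. So \<open>L\<close> can fail to be invariant under \<open>E\<close>, and \<open>E\<close> must first be replaced by a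
  regular spectral measure \<open>E_reg\<close> with the same values on the open sets described by countably many
  \<open>f\<^sub>b\<close> (the family \<open>\<V>\<close>). For each vector \<open>\<psi>\<close>, Caratheodory's method extends
  \<open>\<langle>E(\<cdot>)\<psi>, \<psi>\<rangle>\<close> from \<open>\<V>\<close> to a Borel measure that is inner regular on open sets with respect to \<open>\<V>\<close>
  (\<open>regular_extension\<close>). This requires that a set in \<open>\<V>\<close> covered by members of \<open>\<V>\<close> is almost covered by countably
  many of them (\<open>scalar_tau_additive\<close>), which holds because a nonzero measure with respect to which all \<open>f\<^sub>b\<close> are
  essentially bounded has a point of support (\<open>ex_support_point\<close>), found as the limit of an ultrafilter.
  The measures so obtained are the quadratic forms of projections, and every closed linear relation that
  \<open>E\<close> respects on \<open>\<V>\<close> is respected by \<open>E_reg\<close> on all Borel sets (\<open>E_reg_relation\<close>). In this way the spectral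
  integrals, the covariance and the invariance of subspaces pass to \<open>E_reg\<close>.\<close>

section \<open>Complex Hilbert spaces\<close>

lemma scaleC_zero_left [simp]: "0 *\<^sub>C (x::'a::complex_vector) = 0"
  using scaleC_add_left[of 0 0 x] by simp

lemma scaleC_zero_right [simp]: "c *\<^sub>C (0::'a::complex_vector) = 0"
  using scaleC_add_right[of c 0 0] by simp

lemma scaleC_minus1: "(-1) *\<^sub>C (x::'a::complex_vector) = - x"
  using scaleC_add_left[of 1 "-1" x] by (simp add: scaleC_one eq_neg_iff_add_eq_0 add.commute)

lemma scaleC_minus_right: "c *\<^sub>C (- x::'a::complex_vector) = - (c *\<^sub>C x)"
  using scaleC_add_right[of c x "-x"] by (simp add: eq_neg_iff_add_eq_0 add.commute)

lemma scaleC_diff_right: "c *\<^sub>C (x - y::'a::complex_vector) = c *\<^sub>C x - c *\<^sub>C y"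
  using scaleC_add_right[of c x "-y"] by (simp add: scaleC_minus_right)

lemma scaleC_sum_right: "c *\<^sub>C (\<Sum>i\<in>I. f i) = (\<Sum>i\<in>I. c *\<^sub>C (f i::'a::complex_vector))"
  by (induction I rule: infinite_finite_induct) (auto simp: scaleC_add_right)

lemma cinner_zero_left [simp]: "cinner 0 y = 0"
  using cinner_add_left[of 0 0 y] by simp

lemma cinner_zero_right [simp]: "cinner y 0 = 0"
  using cinner_commute[of y 0] by simp

lemma cinner_add_right: "cinner z (x + y) = cinner z x + cinner z y"
  by (metis cinner_add_left cinner_commute complex_cnj_add)

lemma cinner_scaleC_right: "cinner x (c *\<^sub>C y) = cnj c * cinner x y"
  by (metis cinner_scaleC_left cinner_commute complex_cnj_mult)

lemma cinner_minus_left: "cinner (- x) y = - cinner x y"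
  using cinner_add_left[of "-x" x y] by (simp add: eq_neg_iff_add_eq_0)

lemma cinner_minus_right: "cinner x (- y) = - cinner x y"
  using cinner_add_right[of x "-y" y] by (simp add: eq_neg_iff_add_eq_0)

lemma cinner_diff_left: "cinner (x - y) z = cinner x z - cinner y z"
  using cinner_add_left[of x "-y" z] by (simp add: cinner_minus_left)

lemma cinner_diff_right: "cinner z (x - y) = cinner z x - cinner z y"
  using cinner_add_right[of z x "-y"] by (simp add: cinner_minus_right)

lemma cinner_sum_left: "cinner (\<Sum>i\<in>I. f i) y = (\<Sum>i\<in>I. cinner (f i) y)"
  by (induction I rule: infinite_finite_induct) (auto simp: cinner_add_left)

lemma cinner_sum_right: "cinner y (\<Sum>i\<in>I. f i) = (\<Sum>i\<in>I. cinner y (f i))"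
  by (induction I rule: infinite_finite_induct) (auto simp: cinner_add_right)

lemma Im_cinner_self [simp]: "Im (cinner x x) = 0"
  using cinner_commute[of x x] by (metis Reals_cnj_iff complex_is_Real_iff)

lemma cinner_self: "cinner x x = complex_of_real ((norm x)\<^sup>2)"
  by (simp add: complex_eq_iff Re_cinner power2_norm_eq_inner)

lemma Re_cinner_self: "Re (cinner x x) = (norm x)\<^sup>2"
  by (simp add: cinner_self)

lemma cinner_self_eq_0 [simp]: "cinner x x = 0 \<longleftrightarrow> x = 0"
  by (simp add: cinner_self)

lemma norm_scaleC: "norm (c *\<^sub>C (x::'h::complex_hilbert_space)) = cmod c * norm x"
proof -
  have "cinner (c *\<^sub>C x) (c *\<^sub>C x) = (c * cnj c) * cinner x x"
    by (simp add: cinner_scaleC_left cinner_scaleC_right)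
  then have "complex_of_real ((norm (c *\<^sub>C x))\<^sup>2) = complex_of_real ((cmod c * norm x)\<^sup>2)"
    by (simp only: cinner_self complex_norm_square[symmetric] power_mult_distrib of_real_mult)
  then have "(norm (c *\<^sub>C x))\<^sup>2 = (cmod c * norm x)\<^sup>2" by (simp only: of_real_eq_iff)
  then show ?thesis by (simp add: power2_eq_iff_nonneg)
qed

lemma cmod_cinner_le: "cmod (cinner x y) \<le> norm x * norm y"
proof (cases "cinner x y = 0")
  case False
  define c where "c = cnj (cinner x y) / cmod (cinner x y)"
  have c: "cmod c = 1" using False by (simp add: c_def norm_divide)
  have "cinner (c *\<^sub>C x) y = c * cinner x y" by (simp add: cinner_scaleC_left)
  also have "\<dots> = cmod (cinner x y)"
    using False by (simp add: c_def complex_norm_square[symmetric] power2_eq_square mult.commute[of "cnj _"])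
  finally have "cmod (cinner x y) = inner (c *\<^sub>C x) y" by (metis Re_complex_of_real Re_cinner)
  also have "\<dots> \<le> norm (c *\<^sub>C x) * norm y" by (rule norm_cauchy_schwarz)
  finally show ?thesis by (simp add: norm_scaleC c)
qed simp

lemma bounded_bilinear_cinner: "bounded_bilinear cinner"
proof
  show "\<exists>K. \<forall>a b. norm (cinner a b) \<le> norm a * norm b * K"
    by (rule exI[of _ 1]) (simp add: cmod_cinner_le)
next
  fix r and x y :: 'a
  show "cinner (r *\<^sub>R x) y = r *\<^sub>R cinner x y"
    by (metis cinner_scaleC_left scaleC_of_real scaleR_conv_of_real)
  show "cinner x (r *\<^sub>R y) = r *\<^sub>R cinner x y"
    by (metis cinner_scaleC_right complex_cnj_complex_of_real scaleC_of_real scaleR_conv_of_real)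
qed (simp_all add: cinner_add_left cinner_add_right)

lemmas tendsto_cinner = bounded_bilinear.tendsto[OF bounded_bilinear_cinner]

lemma bounded_linear_scaleC: "bounded_linear (\<lambda>x::'h::complex_hilbert_space. c *\<^sub>C x)"
proof
  show "\<exists>K. \<forall>x::'h. norm (c *\<^sub>C x) \<le> norm x * K"
    by (rule exI[of _ "cmod c"]) (simp add: norm_scaleC)
  fix r and x :: 'h
  show "c *\<^sub>C (r *\<^sub>R x) = r *\<^sub>R (c *\<^sub>C x)"
    by (simp add: scaleC_of_real[symmetric] scaleC_scaleC mult.commute)
qed (simp add: scaleC_add_right)

lemmas tendsto_scaleC = bounded_linear.tendsto[OF bounded_linear_scaleC]

lemma LIMSEQ_norm_sq:
  fixes f :: "nat \<Rightarrow> 'x::real_normed_vector"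
  assumes "(\<lambda>n. (norm (f n - l))\<^sup>2) \<longlonglongrightarrow> 0" shows "f \<longlonglongrightarrow> l"
proof -
  have "(\<lambda>n. sqrt ((norm (f n - l))\<^sup>2)) \<longlonglongrightarrow> sqrt 0" using assms by (rule tendsto_real_sqrt)
  then have "(\<lambda>n. norm (f n - l)) \<longlonglongrightarrow> 0" by simp
  then show ?thesis by (rule LIM_zero_cancel[OF tendsto_norm_zero_cancel])
qed

lemma norm_add_orth: "cinner x y = 0 \<Longrightarrow> (norm (x + y))\<^sup>2 = (norm x)\<^sup>2 + (norm y)\<^sup>2"
  by (metis Re_cinner cinner_commute complex_cnj_zero norm_add_Pythagorean orthogonal_def zero_complex.sel(1))

subsection \<open>Subspaces and orthogonal projections\<close>

lemma csubspaceD: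
  assumes "csubspace V"
  shows csubspace_0: "0 \<in> V" and csubspace_add: "x \<in> V \<Longrightarrow> y \<in> V \<Longrightarrow> x + y \<in> V"
    and csubspace_scaleC: "x \<in> V \<Longrightarrow> c *\<^sub>C x \<in> V"
  using assms by (auto simp: csubspace_def)

lemma csubspace_minus: "csubspace V \<Longrightarrow> x \<in> V \<Longrightarrow> - x \<in> V"
  by (metis csubspace_scaleC scaleC_minus1)

lemma csubspace_diff: "csubspace V \<Longrightarrow> x \<in> V \<Longrightarrow> y \<in> V \<Longrightarrow> x - y \<in> V"
  by (metis csubspace_add csubspace_minus diff_conv_add_uminus)

lemma csubspace_scaleR: "csubspace V \<Longrightarrow> x \<in> V \<Longrightarrow> r *\<^sub>R x \<in> (V::'h::complex_hilbert_space set)"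
  by (metis csubspace_scaleC scaleC_of_real)

lemma csubspace_sum: "csubspace V \<Longrightarrow> (\<And>i. i \<in> I \<Longrightarrow> f i \<in> V) \<Longrightarrow> (\<Sum>i\<in>I. f i) \<in> V"
  by (induction I rule: infinite_finite_induct) (auto simp: csubspace_0 csubspace_add)

lemma csubspace_Int: "csubspace V \<Longrightarrow> csubspace W \<Longrightarrow> csubspace (V \<inter> W)"
  by (auto simp: csubspace_def)

lemma csubspace_closure:
  fixes V :: "'h::complex_hilbert_space set"
  assumes "csubspace V" shows "csubspace (closure V)"
  unfolding csubspace_def
proof (intro conjI ballI allI)
  show "0 \<in> closure V" using csubspace_0[OF assms] closure_subset by auto
next
  fix x y assume "x \<in> closure V" "y \<in> closure V"
  then obtain u v where "\<forall>n. u n \<in> V" "u \<longlonglongrightarrow> x" "\<forall>n. v n \<in> V" "v \<longlonglongrightarrow> y"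
    unfolding closure_sequential by blast
  then show "x + y \<in> closure V"
    unfolding closure_sequential using csubspace_add[OF assms]
    by (intro exI[of _ "\<lambda>n. u n + v n"]) (auto intro: tendsto_add)
next
  fix c x assume "x \<in> closure V"
  then obtain u where "\<forall>n. u n \<in> V" "u \<longlonglongrightarrow> x" unfolding closure_sequential by blast
  then show "c *\<^sub>C x \<in> closure V"
    unfolding closure_sequential using csubspace_scaleC[OF assms]
    by (intro exI[of _ "\<lambda>n. c *\<^sub>C u n"]) (auto intro: tendsto_scaleC)
qed

text \<open>A minimising sequence for the distance is Cauchy by the parallelogram law, and its limit is
  the foot of the perpendicular.\<close>

lemma ex_orth_decomposition:
  fixes K :: "'h::complex_hilbert_space set"
  assumes K: "csubspace K" "closed K"
  shows "\<exists>p\<in>K. \<forall>k\<in>K. cinner (x - p) k = 0"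
proof -
  define d where "d = infdist x K"
  have ne: "K \<noteq> {}" using csubspace_0[OF K(1)] by auto
  have dle: "d \<le> norm (x - k)" if "k \<in> K" for k
    using infdist_le[OF that, of x] by (simp add: d_def dist_norm)
  have d0: "0 \<le> d" by (simp add: d_def infdist_nonneg)
  have "\<exists>k\<in>K. norm (x - k) < d + 1 / (real n + 1)" for n
  proof (rule ccontr)
    assume "\<not> ?thesis"
    then have "\<And>k. k \<in> K \<Longrightarrow> d + 1 / (real n + 1) \<le> dist x k"
      by (auto simp: dist_norm not_less)
    then have "d + 1 / (real n + 1) \<le> infdist x K"
      using ne unfolding infdist_def by (auto intro!: cINF_greatest)
    then show False by (simp add: d_def add_pos_nonneg not_le[symmetric])
  qed
  then obtain k where k: "\<And>n. k n \<in> K" "\<And>n. norm (x - k n) < d + 1 / (real n + 1)" by metis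
  have par: "(norm (k n - k m))\<^sup>2 \<le> 2 * (norm (x - k n))\<^sup>2 + 2 * (norm (x - k m))\<^sup>2 - 4 * d\<^sup>2" for n m
  proof -
    have mid: "(1/2) *\<^sub>R (k n + k m) \<in> K" using K k by (intro csubspace_scaleR csubspace_add)
    have "(norm (k n - k m))\<^sup>2 + (norm ((x - k n) + (x - k m)))\<^sup>2 = 2 * (norm (x - k n))\<^sup>2 + 2 * (norm (x - k m))\<^sup>2"
      by (simp add: power2_norm_eq_inner inner_simps inner_commute algebra_simps)
    moreover have "(x - k n) + (x - k m) = 2 *\<^sub>R (x - (1/2) *\<^sub>R (k n + k m))"
      by (simp add: algebra_simps flip: scaleR_2)
    then have "norm ((x - k n) + (x - k m)) = 2 * norm (x - (1/2) *\<^sub>R (k n + k m))" by simp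
    moreover have "d\<^sup>2 \<le> (norm (x - (1/2) *\<^sub>R (k n + k m)))\<^sup>2" using dle[OF mid] d0 by (rule power_mono)
    ultimately show ?thesis by (simp add: power_mult_distrib)
  qed
  have lim: "(\<lambda>n. norm (x - k n)) \<longlonglongrightarrow> d"
  proof (rule tendsto_sandwich[OF _ _ tendsto_const])
    show "\<forall>\<^sub>F n in sequentially. d \<le> norm (x - k n)" using dle k by auto
    show "\<forall>\<^sub>F n in sequentially. norm (x - k n) \<le> d + 1 / (real n + 1)" using k(2) by (auto intro!: always_eventually less_imp_le)
    have "(\<lambda>n. 1 / (real n + 1)) \<longlonglongrightarrow> 0" using LIMSEQ_inverse_real_of_nat by (simp add: inverse_eq_divide add.commute)
    then show "(\<lambda>n. d + 1 / (real n + 1)) \<longlonglongrightarrow> d" using tendsto_add[OF tendsto_const] by fastforce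
  qed
  have "Cauchy k"
    unfolding Cauchy_def
  proof (intro allI impI)
    fix e :: real assume e: "e > 0"
    have "(\<lambda>n. (norm (x - k n))\<^sup>2) \<longlonglongrightarrow> d\<^sup>2" using lim by (rule tendsto_power)
    then have "\<forall>\<^sub>F n in sequentially. (norm (x - k n))\<^sup>2 < d\<^sup>2 + e\<^sup>2 / 4"
      using e by (intro order_tendstoD(2)[of _ "d\<^sup>2"]) auto
    then obtain N where N: "\<And>n. n \<ge> N \<Longrightarrow> (norm (x - k n))\<^sup>2 < d\<^sup>2 + e\<^sup>2 / 4"
      by (auto simp: eventually_sequentially)
    show "\<exists>M. \<forall>m\<ge>M. \<forall>n\<ge>M. dist (k m) (k n) < e"
    proof (intro exI[of _ N] allI impI)
      fix m n assume "N \<le> m" "N \<le> n"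
      then have "(norm (k m - k n))\<^sup>2 < e\<^sup>2" using par[of m n] N[of m] N[of n] by linarith
      then show "dist (k m) (k n) < e" using e by (simp add: dist_norm power2_less_imp_less)
    qed
  qed
  then obtain p where p: "k \<longlonglongrightarrow> p" using Cauchy_convergent convergent_def by blast
  have pK: "p \<in> K" using K(2) k(1) p by (metis closed_sequentially)
  have np: "norm (x - p) = d"
    using LIMSEQ_unique[OF tendsto_norm[OF tendsto_diff[OF tendsto_const p]] lim] .
  have re: "inner (x - p) z = 0" if z: "z \<in> K" for z
  proof (cases "z = 0")
    case False
    define t where "t = inner (x - p) z / (norm z)\<^sup>2"
    have "p + t *\<^sub>R z \<in> K" using K pK z by (intro csubspace_add csubspace_scaleR)
    then have "d\<^sup>2 \<le> (norm (x - (p + t *\<^sub>R z)))\<^sup>2" using dle d0 by (intro power_mono) auto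
    also have "\<dots> = (norm (x - p))\<^sup>2 - 2 * t * inner (x - p) z + t\<^sup>2 * (norm z)\<^sup>2"
    proof -
      have "(norm ((x - p) - t *\<^sub>R z))\<^sup>2 = (norm (x - p))\<^sup>2 - 2 * t * inner (x - p) z + t\<^sup>2 * (norm z)\<^sup>2"
        unfolding power2_norm_eq_inner inner_diff_left[of "x - p" "t *\<^sub>R z"] inner_diff_right[of _ "x - p" "t *\<^sub>R z"]
        using inner_commute[of z "x - p"] by (simp add: power2_eq_square)
      then show ?thesis by (simp add: diff_diff_eq)
    qed
    also have "\<dots> = d\<^sup>2 - (inner (x - p) z)\<^sup>2 / (norm z)\<^sup>2"
      using False by (simp add: np t_def field_simps power2_eq_square)
    finally have "(inner (x - p) z)\<^sup>2 / (norm z)\<^sup>2 \<le> 0" by simp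
    then show ?thesis using False by (simp add: divide_le_0_iff)
  qed simp
  have "cinner (x - p) z = 0" if z: "z \<in> K" for z
  proof (rule complex_eqI)
    show "Re (cinner (x - p) z) = Re 0" using re[OF z] by (simp add: Re_cinner)
    have "Re (cinner (x - p) (\<i> *\<^sub>C z)) = 0" using re[OF csubspace_scaleC[OF K(1) z]] by (simp add: Re_cinner)
    then show "Im (cinner (x - p) z) = Im 0" by (simp add: cinner_scaleC_right)
  qed
  with pK show ?thesis by blast
qed

definition proj :: "'h::complex_hilbert_space set \<Rightarrow> 'h \<Rightarrow> 'h" where
  "proj K x = (SOME p. p \<in> K \<and> (\<forall>k\<in>K. cinner (x - p) k = 0))"

lemma
  fixes K :: "'h::complex_hilbert_space set"
  assumes K: "csubspace K" "closed K"
  shows proj_in: "proj K x \<in> K" and proj_orth: "k \<in> K \<Longrightarrow> cinner (x - proj K x) k = 0"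
  using someI_ex[of "\<lambda>p. p \<in> K \<and> (\<forall>k\<in>K. cinner (x - p) k = 0)"] ex_orth_decomposition[OF K, of x]
  unfolding proj_def by blast+

lemma proj_eqI:
  assumes K: "csubspace K" "closed K" and "p \<in> K" "\<And>k. k \<in> K \<Longrightarrow> cinner (x - p) k = 0"
  shows "proj K x = p"
proof -
  have d: "p - proj K x \<in> K" using assms by (intro csubspace_diff proj_in)
  have "p - proj K x = (x - proj K x) - (x - p)" by simp
  then have "cinner (p - proj K x) (p - proj K x) = cinner (x - proj K x) (p - proj K x) - cinner (x - p) (p - proj K x)"
    by (metis cinner_diff_left)
  also have "\<dots> = 0" using d assms(4) proj_orth[OF K] by simp
  finally show ?thesis by simp
qed

locale closed_csubspace =
  fixes K :: "'h::complex_hilbert_space set"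
  assumes csub: "csubspace K" and closed: "closed K"
begin

lemmas pin [simp] = proj_in[OF csub closed]
lemmas porth = proj_orth[OF csub closed]

lemma proj_id [simp]: "x \<in> K \<Longrightarrow> proj K x = x"
  by (rule proj_eqI[OF csub closed]) auto

lemma proj_0I: "(\<And>k. k \<in> K \<Longrightarrow> cinner x k = 0) \<Longrightarrow> proj K x = 0"
  by (rule proj_eqI[OF csub closed]) (auto simp: csubspace_0[OF csub])

lemma proj_add: "proj K (x + y) = proj K x + proj K y"
proof (rule proj_eqI[OF csub closed])
  show "proj K x + proj K y \<in> K" by (simp add: csubspace_add[OF csub])
  fix k assume "k \<in> K"
  then show "cinner (x + y - (proj K x + proj K y)) k = 0"
    using porth[of k x] porth[of k y] by (simp add: cinner_diff_left cinner_add_left)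
qed

lemma proj_scaleC: "proj K (c *\<^sub>C x) = c *\<^sub>C proj K x"
proof (rule proj_eqI[OF csub closed])
  show "c *\<^sub>C proj K x \<in> K" by (simp add: csubspace_scaleC[OF csub])
  fix k assume "k \<in> K"
  then show "cinner (c *\<^sub>C x - c *\<^sub>C proj K x) k = 0"
    using porth[of k x] by (simp add: cinner_scaleC_left flip: scaleC_diff_right)
qed

lemma proj_diff: "proj K (x - y) = proj K x - proj K y"
  using proj_add[of x "(-1) *\<^sub>C y"] proj_scaleC[of "-1" y] by (simp add: scaleC_minus1)

lemma proj_sa: "cinner (proj K x) y = cinner x (proj K y)"
proof -
  have "cinner (x - proj K x) (proj K y) = 0" by (rule porth) simp
  moreover have "cinner (proj K x) (y - proj K y) = 0"
    using porth[of "proj K x" y] cinner_commute[of "proj K x"] by simp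
  ultimately show ?thesis by (simp add: cinner_diff_left cinner_diff_right)
qed

lemma proj_orth_right: "k \<in> K \<Longrightarrow> cinner k (x - proj K x) = 0"
  using porth[of k x] cinner_commute[of k] by simp

lemma norm_proj_split: "(norm x)\<^sup>2 = (norm (proj K x))\<^sup>2 + (norm (x - proj K x))\<^sup>2"
  using norm_add_orth[of "proj K x" "x - proj K x"] proj_orth_right[of "proj K x" x] by simp

lemma norm_proj_le: "norm (proj K x) \<le> norm x"
  using norm_proj_split[of x] by (simp add: power2_le_imp_le)

lemma bounded_linear_proj: "bounded_linear (proj K)"
proof
  show "\<exists>B. \<forall>x. norm (proj K x) \<le> norm x * B" by (rule exI[of _ 1]) (simp add: norm_proj_le)
  fix r x show "proj K (r *\<^sub>R x) = r *\<^sub>R proj K x" by (simp add: proj_scaleC flip: scaleC_of_real)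
qed (rule proj_add)

lemmas tendsto_proj = bounded_linear.tendsto[OF bounded_linear_proj]

end

lemma closed_csubspaceI: "csubspace K \<Longrightarrow> closed K \<Longrightarrow> closed_csubspace K"
  by unfold_locales

lemma orth_projection_proj:
  assumes "csubspace K" "closed K" "K \<subseteq> H"
  shows "orth_projection H (proj K)"
proof -
  interpret closed_csubspace K using assms by unfold_locales
  show ?thesis using assms(3)
    by (auto simp: orth_projection_def clinear_on_def proj_add proj_scaleC proj_sa)
qed

locale orth_proj =
  fixes H :: "'h::complex_hilbert_space set" and P
  assumes Hsub: "csubspace H" and op: "orth_projection H P"
begin

lemma P_in [simp]: "x \<in> H \<Longrightarrow> P x \<in> H" and P_add: "x \<in> H \<Longrightarrow> y \<in> H \<Longrightarrow> P (x + y) = P x + P y"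
  and P_scaleC: "x \<in> H \<Longrightarrow> P (c *\<^sub>C x) = c *\<^sub>C P x" and P_idem [simp]: "x \<in> H \<Longrightarrow> P (P x) = P x"
  and P_sa: "x \<in> H \<Longrightarrow> y \<in> H \<Longrightarrow> cinner (P x) y = cinner x (P y)"
  using op by (auto simp: orth_projection_def clinear_on_def)

lemma P_diff: "x \<in> H \<Longrightarrow> y \<in> H \<Longrightarrow> P (x - y) = P x - P y"
  using P_add[of x "(-1) *\<^sub>C y"] P_scaleC[of y "-1"] csubspace_scaleC[OF Hsub, of y "-1"] by (simp add: scaleC_minus1)

lemma P_sum: "(\<And>i. i \<in> I \<Longrightarrow> f i \<in> H) \<Longrightarrow> P (\<Sum>i\<in>I. f i) = (\<Sum>i\<in>I. P (f i))"
proof (induction I rule: infinite_finite_induct)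
  case (insert i I)
  then show ?case by (simp add: P_add csubspace_sum[OF Hsub])
qed (use P_scaleC[OF csubspace_0[OF Hsub], of 0] in auto)

lemma norm_split: "x \<in> H \<Longrightarrow> (norm x)\<^sup>2 = (norm (P x))\<^sup>2 + (norm (x - P x))\<^sup>2"
proof -
  assume x: "x \<in> H"
  have "cinner (P x) (x - P x) = 0"
    using x P_sa[of x "x - P x"] csubspace_diff[OF Hsub x P_in[OF x]] by (simp add: P_diff)
  from norm_add_orth[OF this] show ?thesis by simp
qed

lemma norm_le: "x \<in> H \<Longrightarrow> norm (P x) \<le> norm x"
  using norm_split[of x] by (simp add: power2_le_imp_le)

lemma norm_eqD: "x \<in> H \<Longrightarrow> norm (P x) = norm x \<Longrightarrow> P x = x"
  using norm_split[of x] by simp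

lemma cinner_P: "x \<in> H \<Longrightarrow> cinner (P x) x = complex_of_real ((norm (P x))\<^sup>2)"
  using P_sa[of "P x" x] cinner_self[of "P x"] by simp

lemma P_tendsto:
  assumes "(f \<longlongrightarrow> x) F" "\<forall>\<^sub>F n in F. f n \<in> H" "x \<in> H" shows "((\<lambda>n. P (f n)) \<longlongrightarrow> P x) F"
proof -
  have lim: "((\<lambda>n. f n - x) \<longlongrightarrow> 0) F" using assms(1) by (rule LIM_zero)
  have ev: "\<forall>\<^sub>F n in F. norm (P (f n) - P x) \<le> norm (f n - x)"
    using assms(2)
  proof eventually_elim
    case (elim n)
    then show ?case using norm_le[of "f n - x"] assms(3) by (simp add: P_diff csubspace_diff[OF Hsub])
  qed
  have "((\<lambda>n. P (f n) - P x) \<longlongrightarrow> 0) F" using lim ev by (rule Lim_null_comparison[OF _ tendsto_norm_zero, rotated])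
  then show ?thesis by (rule LIM_zero_cancel)
qed

end

lemma orth_projection_compl:
  assumes "csubspace H" "orth_projection H P" shows "orth_projection H (\<lambda>x. x - P x)"
proof -
  interpret orth_proj H P using assms by unfold_locales
  show ?thesis
    using csubspace_diff[OF Hsub]
    by (auto simp: orth_projection_def clinear_on_def P_add P_diff P_scaleC scaleC_diff_right
        cinner_diff_left cinner_diff_right P_sa)
qed

subsection \<open>Orthogonal series\<close>

lemma norm_sum_orth:
  assumes "finite F" "\<And>i j. i \<in> F \<Longrightarrow> j \<in> F \<Longrightarrow> i \<noteq> j \<Longrightarrow> cinner (f i) (f j) = 0"
  shows "(norm (\<Sum>i\<in>F. f i))\<^sup>2 = (\<Sum>i\<in>F. (norm (f i))\<^sup>2)"
  using assms
proof (induction F rule: finite_induct)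
  case (insert i F)
  have "cinner (f i) (\<Sum>j\<in>F. f j) = 0" using insert by (auto simp: cinner_sum_right intro!: sum.neutral)
  then have "(norm (f i + (\<Sum>j\<in>F. f j)))\<^sup>2 = (norm (f i))\<^sup>2 + (norm (\<Sum>j\<in>F. f j))\<^sup>2" by (rule norm_add_orth)
  with insert show ?case by simp
qed simp

text \<open>The partial sums form a Cauchy net, because by Pythagoras the tails of an orthogonal series are
  measured by the tails of the series of squares.\<close>

lemma orth_summable:
  fixes f :: "'i \<Rightarrow> 'h::complex_hilbert_space"
  assumes orth: "\<And>i j. i \<in> I \<Longrightarrow> j \<in> I \<Longrightarrow> i \<noteq> j \<Longrightarrow> cinner (f i) (f j) = 0"
    and sq: "(\<lambda>i. (norm (f i))\<^sup>2) summable_on I"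
  shows "f summable_on I"
proof -
  obtain S where S: "((\<lambda>i. (norm (f i))\<^sup>2) has_sum S) I" using sq by (auto simp: summable_on_def)
  have "\<exists>P. eventually P (finite_subsets_at_top I) \<and> (\<forall>F G. P F \<and> P G \<longrightarrow> dist (sum f F) (sum f G) < e)"
    if e: "e > 0" for e
  proof -
    have "e\<^sup>2 / 8 > 0" using e by simp
    from has_sum_finite_approximation[OF S this] obtain F0
      where F0: "finite F0" "F0 \<subseteq> I" "dist (\<Sum>i\<in>F0. (norm (f i))\<^sup>2) S \<le> e\<^sup>2 / 8" by blast
    have near: "dist (sum f F) (sum f F0) < e / 2" if F: "finite F" "F0 \<subseteq> F" "F \<subseteq> I" for F
    proof -
      have "(norm (sum f F - sum f F0))\<^sup>2 = (norm (sum f (F - F0)))\<^sup>2" using F by (simp add: sum_diff)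
      also have "\<dots> = (\<Sum>i\<in>F - F0. (norm (f i))\<^sup>2)" using F by (intro norm_sum_orth orth) auto
      also have "\<dots> = (\<Sum>i\<in>F. (norm (f i))\<^sup>2) - (\<Sum>i\<in>F0. (norm (f i))\<^sup>2)" using F by (simp add: sum_diff)
      also have "\<dots> \<le> S - (\<Sum>i\<in>F0. (norm (f i))\<^sup>2)"
      proof -
        have "(\<Sum>i\<in>F. (norm (f i))\<^sup>2) \<le> S"
          by (rule has_sum_mono_neutral[OF has_sum_finite[OF F(1)] S]) (use F in auto)
        then show ?thesis by simp
      qed
      also have "\<dots> < (e / 2)\<^sup>2" 
      proof -
        have "S - (\<Sum>i\<in>F0. (norm (f i))\<^sup>2) \<le> e\<^sup>2 / 8" using F0(3) unfolding dist_real_def by linarith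
        moreover have "e\<^sup>2 / 8 < (e / 2)\<^sup>2" using e by (simp add: power_divide)
        ultimately show ?thesis by linarith
      qed
      finally have "norm (sum f F - sum f F0) < e / 2" by (rule power2_less_imp_less) (use e in simp)
      then show ?thesis by (simp add: dist_norm)
    qed
    show ?thesis
    proof (intro exI[of _ "\<lambda>F. finite F \<and> F0 \<subseteq> F \<and> F \<subseteq> I"] conjI allI impI)
      show "\<forall>\<^sub>F F in finite_subsets_at_top I. finite F \<and> F0 \<subseteq> F \<and> F \<subseteq> I"
        using F0 by (auto simp: eventually_finite_subsets_at_top)
      fix F G assume "(finite F \<and> F0 \<subseteq> F \<and> F \<subseteq> I) \<and> (finite G \<and> F0 \<subseteq> G \<and> G \<subseteq> I)"
      then have "dist (sum f F) (sum f F0) < e / 2" "dist (sum f G) (sum f F0) < e / 2" using near by auto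
      then show "dist (sum f F) (sum f G) < e" by (metis dist_commute dist_triangle_half_l)
    qed
  qed
  then have "cauchy_filter (filtermap (sum f) (finite_subsets_at_top I))"
    by (simp add: cauchy_filter_metric_filtermap)
  moreover have "complete (UNIV::'h set)"
    by (meson Cauchy_convergent UNIV_I complete_def convergent_def)
  ultimately obtain L where "(sum f \<longlongrightarrow> L) (finite_subsets_at_top I)"
    using complete_uniform[where S=UNIV] by (force simp add: filterlim_def)
  then show ?thesis using summable_on_def has_sum_def by blast
qed

lemma has_sum_norm_orth:
  fixes f :: "'i \<Rightarrow> 'h::complex_hilbert_space"
  assumes orth: "\<And>i j. i \<in> I \<Longrightarrow> j \<in> I \<Longrightarrow> i \<noteq> j \<Longrightarrow> cinner (f i) (f j) = 0"
    and x: "(f has_sum x) I"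
  shows "((\<lambda>i. (norm (f i))\<^sup>2) has_sum (norm x)\<^sup>2) I"
proof -
  have "((\<lambda>F. (norm (sum f F))\<^sup>2) \<longlongrightarrow> (norm x)\<^sup>2) (finite_subsets_at_top I)"
    using x unfolding has_sum_def by (intro tendsto_power tendsto_norm)
  moreover have "\<forall>\<^sub>F F in finite_subsets_at_top I. (norm (sum f F))\<^sup>2 = (\<Sum>i\<in>F. (norm (f i))\<^sup>2)"
    by (rule eventually_finite_subsets_at_top_weakI) (use orth in \<open>auto intro!: norm_sum_orth\<close>)
  ultimately show ?thesis unfolding has_sum_def by (rule Lim_transform_eventually)
qed

text \<open>Quadratic forms suffice to sum a series of projections. They force each \<open>P n\<close> to lie below \<open>Q\<close>, and
  then the squared distance of \<open>Q x\<close> from a partial sum is the tail of the series of squares.\<close>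

lemma orth_projections_sums:
  fixes H :: "'h::complex_hilbert_space set"
  assumes H: "csubspace H" and P: "\<And>n::nat. orth_projection H (P n)" and Q: "orth_projection H Q"
    and sq: "\<And>x. x \<in> H \<Longrightarrow> (\<lambda>n. (norm (P n x))\<^sup>2) sums (norm (Q x))\<^sup>2"
    and orth: "\<And>m n x. x \<in> H \<Longrightarrow> m \<noteq> n \<Longrightarrow> P m (P n x) = 0"
    and x: "x \<in> H"
  shows "(\<lambda>n. P n x) sums Q x"
proof -
  interpret P: orth_proj H "P n" for n using H P by unfold_locales
  interpret Q: orth_proj H Q using H Q by unfold_locales
  have QP: "Q (P n y) = P n y" if y: "y \<in> H" for n y
  proof (rule Q.norm_eqD)
    have "(norm (P n (P n y)))\<^sup>2 \<le> (norm (Q (P n y)))\<^sup>2"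
      using sum_le_suminf[OF sums_summable[OF sq[of "P n y"]], of "{n}"] sums_unique[OF sq[of "P n y"]] y by simp
    then show "norm (Q (P n y)) = norm (P n y)"
      using Q.norm_le[OF P.P_in[OF y]] y power2_le_imp_le[of "norm (P n y)" "norm (Q (P n y))"]
      by (simp add: order.antisym)
  qed (use y in simp)
  have PQ: "P n (Q y) = P n y" if y: "y \<in> H" for n y
  proof -
    have d: "P n (Q y) - P n y \<in> H" using y by (simp add: csubspace_diff[OF H])
    have "cinner (P n (Q y)) z = cinner (P n y) z" if z: "z \<in> H" for z
      using y z by (simp add: P.P_sa Q.P_sa QP)
    from this[OF d] have "cinner (P n (Q y) - P n y) (P n (Q y) - P n y) = 0"
      by (simp add: cinner_diff_left)
    then show ?thesis by simp
  qed
  have po: "cinner (P m x) (P n x) = 0" if "m \<noteq> n" for m n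
    using P.P_sa[of x "P n x" m] x orth[OF x that] by simp
  have "(norm (Q x - (\<Sum>k<n. P k x)))\<^sup>2 = (norm (Q x))\<^sup>2 - (\<Sum>k<n. (norm (P k x))\<^sup>2)" for n
  proof -
    have "cinner (\<Sum>k<n. P k x) (Q x - (\<Sum>k<n. P k x)) = 0"
    proof -
      have "cinner (P k x) (Q x - (\<Sum>k<n. P k x)) = 0" if "k < n" for k
      proof -
        have "cinner (P k x) (Q x) = cinner (P k x) (P k x)"
          using P.P_sa[of "P k x" "Q x" k] x by (simp add: PQ)
        moreover have "cinner (P k x) (\<Sum>k<n. P k x) = (\<Sum>j<n. if j = k then cinner (P k x) (P k x) else 0)"
          unfolding cinner_sum_right using po by (intro sum.cong) auto
        ultimately show ?thesis using that by (simp add: cinner_diff_right)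
      qed
      then show ?thesis by (simp add: cinner_sum_left)
    qed
    from norm_add_orth[OF this] have "(norm (Q x))\<^sup>2 = (norm (\<Sum>k<n. P k x))\<^sup>2 + (norm (Q x - (\<Sum>k<n. P k x)))\<^sup>2" by simp
    moreover have "(norm (\<Sum>k<n. P k x))\<^sup>2 = (\<Sum>k<n. (norm (P k x))\<^sup>2)" using po by (intro norm_sum_orth) auto
    ultimately show ?thesis by simp
  qed
  moreover have "(\<lambda>n. (norm (Q x))\<^sup>2 - (\<Sum>k<n. (norm (P k x))\<^sup>2)) \<longlonglongrightarrow> (norm (Q x))\<^sup>2 - (norm (Q x))\<^sup>2"
    using sq[OF x] unfolding sums_def by (intro tendsto_diff tendsto_const)
  ultimately have "(\<lambda>n. (norm (Q x - (\<Sum>k<n. P k x)))\<^sup>2) \<longlonglongrightarrow> 0" by simp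
  then have "(\<lambda>n. (norm ((\<Sum>k<n. P k x) - Q x))\<^sup>2) \<longlonglongrightarrow> 0" by (simp only: norm_minus_commute)
  then show ?thesis unfolding sums_def by (rule LIMSEQ_norm_sq)
qed

lemma ex_sum_orth_projections:
  fixes H :: "'h::complex_hilbert_space set"
  assumes H: "csubspace H" "closed H" and P: "\<And>n::nat. orth_projection H (P n)"
    and orth: "\<And>m n x. x \<in> H \<Longrightarrow> m \<noteq> n \<Longrightarrow> P m (P n x) = 0"
    and bd: "\<And>x. x \<in> H \<Longrightarrow> summable (\<lambda>n. (norm (P n x))\<^sup>2)"
  shows "\<exists>Q. orth_projection H Q \<and> (\<forall>x\<in>H. (\<lambda>n. (norm (P n x))\<^sup>2) sums (norm (Q x))\<^sup>2)"
proof -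
  interpret P: orth_proj H "P n" for n using H(1) P by unfold_locales
  have po: "cinner (P m x) (P n x) = 0" if "m \<noteq> n" "x \<in> H" for m n x
    using P.P_sa[of x "P n x" m] that orth by simp
  have "(\<lambda>n. P n x) summable_on UNIV" if "x \<in> H" for x
    using that bd[OF that] po by (intro orth_summable) (auto simp: summable_on_UNIV_nonneg_real_iff)
  then obtain Q where Q: "\<And>x. x \<in> H \<Longrightarrow> ((\<lambda>n. P n x) has_sum Q x) UNIV" unfolding summable_on_def by metis
  then have Qs: "(\<lambda>n. P n x) sums Q x" if "x \<in> H" for x using that has_sum_imp_sums by blast
  have QH: "Q x \<in> H" if "x \<in> H" for x
  proof (rule closed_sequentially[OF H(2)])
    show "(\<lambda>N. \<Sum>n<N. P n x) \<longlonglongrightarrow> Q x" using Qs[OF that] by (simp add: sums_def)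
    show "(\<Sum>n<N. P n x) \<in> H" for N using that by (intro csubspace_sum[OF H(1)]) simp
  qed
  have PQ: "P n (Q x) = P n x" if x: "x \<in> H" for x n
  proof -
    have "(\<lambda>N. P n (\<Sum>k<N. P k x)) \<longlonglongrightarrow> P n (Q x)"
      using Qs[OF x] unfolding sums_def
    proof (rule P.P_tendsto)
      show "\<forall>\<^sub>F N in sequentially. (\<Sum>k<N. P k x) \<in> H"
        using x by (intro always_eventually allI csubspace_sum[OF H(1)]) simp
    qed (use QH[OF x] in simp)
    moreover have "P n (\<Sum>k<N. P k x) = P n x" if "n < N" for N
    proof -
      have "P n (\<Sum>k<N. P k x) = (\<Sum>k<N. if k = n then P n x else 0)"
      proof (subst P.P_sum)
        show "(\<Sum>k<N. P n (P k x)) = (\<Sum>k<N. if k = n then P n x else 0)"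
          using x orth[OF x, of n] by (intro sum.cong) auto
      qed (use x in simp)
      then show ?thesis using that by simp
    qed
    then have "(\<lambda>N. P n (\<Sum>k<N. P k x)) \<longlonglongrightarrow> P n x"
      by (intro tendsto_eventually) (auto simp: eventually_sequentially intro!: exI[of _ "Suc n"])
    ultimately show ?thesis by (rule LIMSEQ_unique)
  qed
  have "orth_projection H Q"
    unfolding orth_projection_def clinear_on_def
  proof (intro conjI ballI allI)
    fix x y assume xy: "x \<in> H" "y \<in> H"
    have "(\<lambda>n. P n (x + y)) sums (Q x + Q y)" using sums_add[OF Qs Qs] xy by (simp add: P.P_add)
    then show "Q (x + y) = Q x + Q y" using Qs[of "x + y"] xy csubspace_add[OF H(1)] sums_unique2 by blast
    have "(\<lambda>n. cinner (P n x) y) sums cinner (Q x) y"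
      using Qs[OF xy(1)] by (rule bounded_linear.sums[OF bounded_bilinear.bounded_linear_left[OF bounded_bilinear_cinner]])
    moreover have "(\<lambda>n. cinner x (P n y)) sums cinner x (Q y)"
      using Qs[OF xy(2)] by (rule bounded_linear.sums[OF bounded_bilinear.bounded_linear_right[OF bounded_bilinear_cinner]])
    ultimately show "cinner (Q x) y = cinner x (Q y)" using xy by (simp add: P.P_sa sums_unique2)
  next
    fix c x assume x: "x \<in> H"
    have "(\<lambda>n. P n (c *\<^sub>C x)) sums (c *\<^sub>C Q x)"
      using bounded_linear.sums[OF bounded_linear_scaleC Qs[OF x], of c] x by (simp add: P.P_scaleC)
    then show "Q (c *\<^sub>C x) = c *\<^sub>C Q x" using Qs[of "c *\<^sub>C x"] x csubspace_scaleC[OF H(1)] sums_unique2 by blast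
  next
    fix x assume x: "x \<in> H"
    have "(\<lambda>n. P n (Q x)) sums Q x" using Qs[OF x] x by (simp add: PQ)
    then show "Q (Q x) = Q x" using Qs[OF QH[OF x]] sums_unique2 by blast
  qed (use QH in auto)
  moreover have "(\<lambda>n. (norm (P n x))\<^sup>2) sums (norm (Q x))\<^sup>2" if "x \<in> H" for x
    using has_sum_imp_sums[OF has_sum_norm_orth[OF _ Q[OF that]]] po that by auto
  ultimately show ?thesis by blast
qed

section \<open>Spectral measures and spectral integrals\<close>

locale spectral =
  fixes M :: "'x measure" and H :: "'h::complex_hilbert_space set" and E :: "'x set \<Rightarrow> 'h \<Rightarrow> 'h"
  assumes Hsub: "csubspace H" and Hclosed: "closed H" and sm: "spectral_measure M H E"
begin

lemma E_proj: "\<Delta> \<in> sets M \<Longrightarrow> orth_proj H (E \<Delta>)"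
  using Hsub sm by (auto simp: spectral_measure_def orth_proj_def)

lemmas E_in = orth_proj.P_in[OF E_proj] and E_add = orth_proj.P_add[OF E_proj]
  and E_diff = orth_proj.P_diff[OF E_proj] and E_scaleC = orth_proj.P_scaleC[OF E_proj]
  and E_idem = orth_proj.P_idem[OF E_proj] and E_sa = orth_proj.P_sa[OF E_proj]
  and E_le = orth_proj.norm_le[OF E_proj] and E_tendsto = orth_proj.P_tendsto[OF E_proj]
  and E_sum = orth_proj.P_sum[OF E_proj]

lemma E_space: "x \<in> H \<Longrightarrow> E (space M) x = x"
  using sm by (simp add: spectral_measure_def)

lemma E_sums: "range \<Delta> \<subseteq> sets M \<Longrightarrow> disjoint_family \<Delta> \<Longrightarrow> x \<in> H \<Longrightarrow>
    (\<lambda>n::nat. E (\<Delta> n) x) sums E (\<Union>n. \<Delta> n) x"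
  using sm by (simp add: spectral_measure_def)

lemma E_empty [simp]: assumes x: "x \<in> H" shows "E {} x = 0"
proof -
  have "(\<lambda>n::nat. E {} x) sums E (\<Union>n::nat. {}) x" using x by (intro E_sums) (auto simp: disjoint_family_on_def)
  then have "(\<lambda>n::nat. E {} x) \<longlonglongrightarrow> 0" using summable_LIMSEQ_zero sums_summable by blast
  then show ?thesis by (simp add: LIMSEQ_const_iff)
qed

lemma E_Un:
  assumes "\<Delta> \<in> sets M" "\<Gamma> \<in> sets M" "\<Delta> \<inter> \<Gamma> = {}" "x \<in> H" shows "E (\<Delta> \<union> \<Gamma>) x = E \<Delta> x + E \<Gamma> x"
proof -
  have "(\<lambda>n. E (binaryset \<Delta> \<Gamma> n) x) sums E (\<Union>n. binaryset \<Delta> \<Gamma> n) x"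
    using assms by (intro E_sums) (auto simp: range_binaryset_eq disjoint_family_on_def binaryset_def)
  moreover have "(\<lambda>n. E (binaryset \<Delta> \<Gamma> n) x) sums (E \<Delta> x + E \<Gamma> x)"
    by (rule binaryset_sums) (use assms in simp)
  ultimately show ?thesis by (simp add: UN_binaryset_eq sums_unique2)
qed

text \<open>The sum of the two projections is again a projection. On a vector fixed by one of them it
  would increase the norm unless the other one kills that vector.\<close>

lemma E_disjoint:
  assumes "\<Delta> \<in> sets M" "\<Gamma> \<in> sets M" "\<Delta> \<inter> \<Gamma> = {}" "x \<in> H" shows "E \<Delta> (E \<Gamma> x) = 0"
proof -
  define y where "y = E \<Gamma> x"
  interpret D: orth_proj H "E \<Delta>" using assms E_proj by blast
  interpret U: orth_proj H "E (\<Delta> \<union> \<Gamma>)" using assms E_proj by blast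
  have y: "y \<in> H" "E \<Gamma> y = y" using assms by (auto simp: y_def E_in E_idem)
  have "(norm (E \<Delta> y + y))\<^sup>2 \<le> (norm y)\<^sup>2"
    using U.norm_le[OF y(1)] E_Un[OF assms(1,2,3) y(1)] y by (simp add: power_mono)
  moreover have "(norm (E \<Delta> y + y))\<^sup>2 = (norm (E \<Delta> y))\<^sup>2 + (norm y)\<^sup>2 + 2 * inner (E \<Delta> y) y"
    by (simp add: power2_norm_eq_inner inner_add_left inner_add_right inner_commute)
  moreover have "inner (E \<Delta> y) y = (norm (E \<Delta> y))\<^sup>2"
    using D.cinner_P[OF y(1)] by (metis Re_cinner Re_complex_of_real)
  ultimately have "(norm (E \<Delta> y))\<^sup>2 \<le> 0" by linarith
  then show ?thesis by (simp add: y_def)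
qed

lemma E_Int:
  assumes "\<Delta> \<in> sets M" "\<Gamma> \<in> sets M" "x \<in> H" shows "E \<Delta> (E \<Gamma> x) = E (\<Delta> \<inter> \<Gamma>) x"
proof -
  have 1: "E \<Gamma> x = E (\<Delta> \<inter> \<Gamma>) x + E (\<Gamma> - \<Delta>) x"
  proof -
    have "(\<Delta> \<inter> \<Gamma>) \<union> (\<Gamma> - \<Delta>) = \<Gamma>" "(\<Delta> \<inter> \<Gamma>) \<inter> (\<Gamma> - \<Delta>) = {}" by auto
    then show ?thesis using E_Un[of "\<Delta> \<inter> \<Gamma>" "\<Gamma> - \<Delta>" x] assms by simp
  qed
  have 2: "E \<Delta> (E (\<Gamma> - \<Delta>) x) = 0" using assms by (intro E_disjoint) auto
  define z where "z = E (\<Delta> \<inter> \<Gamma>) x"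
  have z: "z \<in> H" "E (\<Delta> \<inter> \<Gamma>) z = z" using assms by (auto simp: z_def E_in E_idem)
  have "E \<Delta> z = E (\<Delta> \<inter> \<Gamma>) z + E (\<Delta> - \<Gamma>) z"
  proof -
    have "(\<Delta> \<inter> \<Gamma>) \<union> (\<Delta> - \<Gamma>) = \<Delta>" "(\<Delta> \<inter> \<Gamma>) \<inter> (\<Delta> - \<Gamma>) = {}" by auto
    then show ?thesis using E_Un[of "\<Delta> \<inter> \<Gamma>" "\<Delta> - \<Gamma>" z] assms z by simp
  qed
  moreover have "E (\<Delta> - \<Gamma>) z = 0" unfolding z_def using assms by (intro E_disjoint) auto
  ultimately have "E \<Delta> z = z" using z by simp
  then show ?thesis using 1 2 assms by (simp add: E_add E_in z_def)
qed

lemma E_compl: "\<Delta> \<in> sets M \<Longrightarrow> x \<in> H \<Longrightarrow> E (space M - \<Delta>) x = x - E \<Delta> x"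
  using E_Un[of \<Delta> "space M - \<Delta>" x] by (simp add: E_space Un_absorb1 sets.sets_into_space algebra_simps)

lemma E_Diff:
  assumes "\<Delta> \<in> sets M" "\<Gamma> \<in> sets M" "\<Gamma> \<subseteq> \<Delta>" "x \<in> H" shows "E (\<Delta> - \<Gamma>) x = E \<Delta> x - E \<Gamma> x"
  using E_Un[of \<Gamma> "\<Delta> - \<Gamma>" x] assms by (simp add: Un_absorb1)

lemma norm_E_sq:
  assumes "\<Delta> \<in> sets M" "x \<in> H" shows "Re (cinner (E \<Delta> x) x) = (norm (E \<Delta> x))\<^sup>2"
  using orth_proj.cinner_P[OF E_proj] assms by simp

lemma norm_E_sums:
  assumes "range \<Delta> \<subseteq> sets M" "disjoint_family \<Delta>" "x \<in> H"
  shows "(\<lambda>n::nat. (norm (E (\<Delta> n) x))\<^sup>2) sums (norm (E (\<Union>n. \<Delta> n) x))\<^sup>2"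
proof -
  have "(\<lambda>n. inner (E (\<Delta> n) x) x) sums inner (E (\<Union>n. \<Delta> n) x) x"
    using E_sums[OF assms] by (rule bounded_linear.sums[OF bounded_linear_inner_left])
  moreover have "inner (E D x) x = (norm (E D x))\<^sup>2" if "D \<in> sets M" for D
    using norm_E_sq[OF that assms(3)] by (simp add: Re_cinner)
  ultimately show ?thesis using assms(1) by (simp add: range_subsetD sets.countable_UN)
qed

abbreviation \<mu> :: "'h \<Rightarrow> 'x measure" where "\<mu> \<equiv> scalar_measure M E"

lemma sets_scalar [simp, measurable_cong]: "sets (\<mu> x) = sets M"
  and space_scalar [simp]: "space (\<mu> x) = space M"
  by (simp_all add: scalar_measure_def sets.space_closed space_measure_of_conv)

lemma emeasure_scalar:
  assumes "\<Delta> \<in> sets M" "x \<in> H"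
  shows "emeasure (\<mu> x) \<Delta> = ennreal ((norm (E \<Delta> x))\<^sup>2)"
proof -
  have "emeasure (\<mu> x) \<Delta> = ennreal (Re (cinner (E \<Delta> x) x))"
  proof (rule emeasure_measure_of[OF scalar_measure_def])
    show "sets M \<subseteq> Pow (space M)" by (rule sets.space_closed)
    show "positive (sets (\<mu> x)) (\<lambda>\<Delta>. ennreal (Re (cinner (E \<Delta> x) x)))"
      using assms by (simp add: positive_def)
    show "countably_additive (sets (\<mu> x)) (\<lambda>\<Delta>. ennreal (Re (cinner (E \<Delta> x) x)))"
    proof (rule countably_additiveI)
      fix D :: "nat \<Rightarrow> 'x set"
      assume "range D \<subseteq> sets (\<mu> x)" "disjoint_family D" "(\<Union>n. D n) \<in> sets (\<mu> x)"
      then have D: "range D \<subseteq> sets M" "disjoint_family D" "(\<Union>n. D n) \<in> sets M" by auto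
      have "(\<lambda>n. ennreal ((norm (E (D n) x))\<^sup>2)) sums ennreal ((norm (E (\<Union>n. D n) x))\<^sup>2)"
        using norm_E_sums[OF D(1,2) assms(2)] by (subst sums_ennreal) auto
      then show "(\<Sum>n. ennreal (Re (cinner (E (D n) x) x))) = ennreal (Re (cinner (E (\<Union>n. D n) x) x))"
        unfolding norm_E_sq[OF D(3) assms(2)] norm_E_sq[OF range_subsetD[OF D(1)] assms(2)]
        by (rule sums_unique[symmetric])
    qed
    show "\<Delta> \<in> sets (\<mu> x)" using assms by simp
  qed
  then show ?thesis using assms by (simp add: norm_E_sq)
qed

lemma finite_scalar: "x \<in> H \<Longrightarrow> finite_measure (\<mu> x)"
  by (rule finite_measureI) (simp add: emeasure_scalar)

lemma E_incseq:
  assumes D: "range D \<subseteq> sets M" "incseq D" and x: "x \<in> H"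
  shows "(\<lambda>n::nat. E (D n) x) \<longlonglongrightarrow> E (\<Union>n. D n) x"
proof -
  have un: "(\<Union>n. D n) \<in> sets M" using D by auto
  have "(\<lambda>n. emeasure (\<mu> x) (D n)) \<longlonglongrightarrow> emeasure (\<mu> x) (\<Union>n. D n)"
    using D by (intro Lim_emeasure_incseq) auto
  then have 1: "(\<lambda>n. (norm (E (D n) x))\<^sup>2) \<longlonglongrightarrow> (norm (E (\<Union>n. D n) x))\<^sup>2"
    using D x un by (simp add: emeasure_scalar range_subsetD)
  have "(norm (E (D n) x - E (\<Union>n. D n) x))\<^sup>2 = (norm (E (\<Union>n. D n) x))\<^sup>2 - (norm (E (D n) x))\<^sup>2" for n
  proof -
    have Dn: "D n \<in> sets M" using D by auto
    have "E (D n) (E (\<Union>n. D n) x) = E (D n) x" using E_Int[OF Dn un x] by (simp add: Int_absorb2 UN_upper)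
    then show ?thesis
      using orth_proj.norm_split[OF E_proj[OF Dn] E_in[OF un x]] by (simp add: norm_minus_commute)
  qed
  moreover have "(\<lambda>n. (norm (E (\<Union>n. D n) x))\<^sup>2 - (norm (E (D n) x))\<^sup>2) \<longlonglongrightarrow> (norm (E (\<Union>n. D n) x))\<^sup>2 - (norm (E (\<Union>n. D n) x))\<^sup>2"
    by (intro tendsto_diff tendsto_const 1)
  ultimately have "(\<lambda>n. (norm (E (D n) x - E (\<Union>n. D n) x))\<^sup>2) \<longlonglongrightarrow> 0" by simp
  then show ?thesis by (rule LIMSEQ_norm_sq)
qed

subsection \<open>Integrals of simple functions\<close>

text \<open>Several simple functions are integrated over one common partition, given by the fibres of \<open>p\<close>.\<close>

lemma simple_spectral_integral_comp:
  assumes p: "simple_function M p" and x: "x \<in> H"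
  shows "simple_spectral_integral M E (u \<circ> p) x = (\<Sum>w\<in>p ` space M. u w *\<^sub>C E (p -` {w} \<inter> space M) x)"
proof -
  have fin: "finite (p ` space M)" and ms: "\<And>w. p -` {w} \<inter> space M \<in> sets M"
    using simple_functionD[OF p] by auto
  have E_part: "E (\<Union>w\<in>W. p -` {w} \<inter> space M) x = (\<Sum>w\<in>W. E (p -` {w} \<inter> space M) x)" if "finite W" for W
    using that
  proof (induction W rule: finite_induct)
    case (insert w W)
    have "(\<Union>w\<in>W. p -` {w} \<inter> space M) \<in> sets M" using ms insert(1) by (intro sets.finite_UN) auto
    then have "E ((p -` {w} \<inter> space M) \<union> (\<Union>w\<in>W. p -` {w} \<inter> space M)) x
        = E (p -` {w} \<inter> space M) x + E (\<Union>w\<in>W. p -` {w} \<inter> space M) x"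
      using insert(2) x ms by (intro E_Un) auto
    then show ?case using insert by simp
  qed (use x in simp)
  have "simple_spectral_integral M E (u \<circ> p) x
      = (\<Sum>z\<in>u ` p ` space M. z *\<^sub>C (\<Sum>w\<in>{w \<in> p ` space M. u w = z}. E (p -` {w} \<inter> space M) x))"
    unfolding simple_spectral_integral_def image_comp[symmetric]
  proof (intro sum.cong refl)
    fix z
    have "(u \<circ> p) -` {z} \<inter> space M = (\<Union>w\<in>{w \<in> p ` space M. u w = z}. p -` {w} \<inter> space M)" by auto
    then show "z *\<^sub>C E ((u \<circ> p) -` {z} \<inter> space M) x
        = z *\<^sub>C (\<Sum>w\<in>{w \<in> p ` space M. u w = z}. E (p -` {w} \<inter> space M) x)"
      using E_part[of "{w \<in> p ` space M. u w = z}"] fin by simp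
  qed
  also have "\<dots> = (\<Sum>z\<in>u ` p ` space M. (\<Sum>w\<in>{w \<in> p ` space M. u w = z}. u w *\<^sub>C E (p -` {w} \<inter> space M) x))"
    by (intro sum.cong refl) (auto simp: scaleC_sum_right intro!: sum.cong)
  also have "\<dots> = (\<Sum>w\<in>p ` space M. u w *\<^sub>C E (p -` {w} \<inter> space M) x)"
    by (rule sum.image_gen[symmetric]) (rule fin)
  finally show ?thesis .
qed

lemma norm_simple_spectral_integral:
  assumes s: "simple_function M s" and x: "x \<in> H"
  shows "ennreal ((norm (simple_spectral_integral M E s x))\<^sup>2) = (\<integral>\<^sup>+ \<xi>. ennreal ((cmod (s \<xi>))\<^sup>2) \<partial>\<mu> x)"
proof -
  have fin: "finite (s ` space M)" and ms: "\<And>w. s -` {w} \<inter> space M \<in> sets M"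
    using simple_functionD[OF s] by auto
  have s': "simple_function (\<mu> x) s" using s by (simp add: simple_function_def)
  have "(norm (simple_spectral_integral M E s x))\<^sup>2 = (\<Sum>z\<in>s ` space M. (norm (z *\<^sub>C E (s -` {z} \<inter> space M) x))\<^sup>2)"
    unfolding simple_spectral_integral_def
  proof (rule norm_sum_orth[OF fin])
    fix i j :: complex assume "i \<noteq> j"
    then have "E (s -` {i} \<inter> space M) (E (s -` {j} \<inter> space M) x) = 0" using ms x by (intro E_disjoint) auto
    then have "cinner (E (s -` {i} \<inter> space M) x) (E (s -` {j} \<inter> space M) x) = 0"
      using E_sa[OF ms x E_in[OF ms x]] by simp
    then show "cinner (i *\<^sub>C E (s -` {i} \<inter> space M) x) (j *\<^sub>C E (s -` {j} \<inter> space M) x) = 0"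
      by (simp add: cinner_scaleC_left cinner_scaleC_right)
  qed
  also have "ennreal \<dots> = (\<Sum>z\<in>s ` space M. ennreal ((cmod z)\<^sup>2) * emeasure (\<mu> x) {\<xi> \<in> space (\<mu> x). s \<xi> = z})"
  proof (subst sum_ennreal[symmetric])
    show "(\<Sum>z\<in>s ` space M. ennreal ((norm (z *\<^sub>C E (s -` {z} \<inter> space M) x))\<^sup>2)) =
      (\<Sum>z\<in>s ` space M. ennreal ((cmod z)\<^sup>2) * emeasure (\<mu> x) {\<xi> \<in> space (\<mu> x). s \<xi> = z})"
    proof (intro sum.cong refl)
      fix z
      have "{\<xi> \<in> space (\<mu> x). s \<xi> = z} = s -` {z} \<inter> space M" by auto
      then show "ennreal ((norm (z *\<^sub>C E (s -` {z} \<inter> space M) x))\<^sup>2) =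
        ennreal ((cmod z)\<^sup>2) * emeasure (\<mu> x) {\<xi> \<in> space (\<mu> x). s \<xi> = z}"
        using ms x by (simp add: emeasure_scalar norm_scaleC power_mult_distrib ennreal_mult)
    qed
  qed simp
  also have "\<dots> = integral\<^sup>S (\<mu> x) (\<lambda>\<xi>. ennreal ((cmod (s \<xi>))\<^sup>2))"
    using s' simple_function_compose[OF s', of "\<lambda>z. ennreal ((cmod z)\<^sup>2)"]
    by (subst simple_function_partition[where g=s and v="\<lambda>z. ennreal ((cmod z)\<^sup>2)"]) (auto simp: comp_def)
  also have "\<dots> = (\<integral>\<^sup>+ \<xi>. ennreal ((cmod (s \<xi>))\<^sup>2) \<partial>\<mu> x)"
    using simple_function_compose[OF s', of "\<lambda>z. ennreal ((cmod z)\<^sup>2)"]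
    by (subst nn_integral_eq_simple_integral) (auto simp: comp_def)
  finally show ?thesis .
qed

lemma simple_spectral_integral_diff:
  assumes s: "simple_function M s" and t: "simple_function M t" and x: "x \<in> H"
  shows "simple_spectral_integral M E s x - simple_spectral_integral M E t x
     = simple_spectral_integral M E (\<lambda>\<xi>. s \<xi> - t \<xi>) x"
proof -
  define p where "p = (\<lambda>\<xi>. (s \<xi>, t \<xi>))"
  have p: "simple_function M p" unfolding p_def using s t by (rule simple_function_Pair)
  have eq: "s = fst \<circ> p" "t = snd \<circ> p" "(\<lambda>\<xi>. s \<xi> - t \<xi>) = (\<lambda>w. fst w - snd w) \<circ> p"
    by (auto simp: p_def comp_def)
  have "a *\<^sub>C y - b *\<^sub>C y = (a - b) *\<^sub>C y" for a b and y :: 'h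
    using scaleC_add_left[of "a - b" b y] by simp
  moreover have "simple_spectral_integral M E s x = (\<Sum>w\<in>p ` space M. fst w *\<^sub>C E (p -` {w} \<inter> space M) x)"
    unfolding eq(1) by (rule simple_spectral_integral_comp[OF p x])
  moreover have "simple_spectral_integral M E t x = (\<Sum>w\<in>p ` space M. snd w *\<^sub>C E (p -` {w} \<inter> space M) x)"
    unfolding eq(2) by (rule simple_spectral_integral_comp[OF p x])
  moreover have "simple_spectral_integral M E (\<lambda>\<xi>. s \<xi> - t \<xi>) x = (\<Sum>w\<in>p ` space M. (fst w - snd w) *\<^sub>C E (p -` {w} \<inter> space M) x)"
    unfolding eq(3) by (rule simple_spectral_integral_comp[OF p x])
  ultimately show ?thesis by (simp flip: sum_subtractf)
qed

lemma simple_spectral_integral_in: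
  assumes s: "simple_function M s" and x: "x \<in> H" shows "simple_spectral_integral M E s x \<in> H"
  unfolding simple_spectral_integral_def using simple_functionD(2)[OF s] x
  by (intro csubspace_sum[OF Hsub] csubspace_scaleC[OF Hsub] E_in) auto

lemma simple_spectral_integral_commute:
  assumes s: "simple_function M s" and x: "x \<in> H"
    and add: "\<And>y z. y \<in> H \<Longrightarrow> z \<in> H \<Longrightarrow> P (y + z) = P y + P z" and sc: "\<And>c y. y \<in> H \<Longrightarrow> P (c *\<^sub>C y) = c *\<^sub>C P y"
    and comm: "\<And>\<Delta>. \<Delta> \<in> sets M \<Longrightarrow> E \<Delta> (P x) = P (E \<Delta> x)"
  shows "simple_spectral_integral M E s (P x) = P (simple_spectral_integral M E s x)"
proof -
  have ms: "\<And>w. s -` {w} \<inter> space M \<in> sets M" using simple_functionD(2)[OF s] by auto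
  have P0: "P 0 = 0" using sc[OF csubspace_0[OF Hsub], of 0] by simp
  have "P (\<Sum>z\<in>Z. z *\<^sub>C E (s -` {z} \<inter> space M) x) = (\<Sum>z\<in>Z. z *\<^sub>C P (E (s -` {z} \<inter> space M) x))" for Z
  proof (induction Z rule: infinite_finite_induct)
    case (insert z Z)
    have "(\<Sum>z\<in>Z. z *\<^sub>C E (s -` {z} \<inter> space M) x) \<in> H" "z *\<^sub>C E (s -` {z} \<inter> space M) x \<in> H"
      using ms x by (auto intro!: csubspace_sum[OF Hsub] csubspace_scaleC[OF Hsub] E_in)
    then show ?case using insert ms x by (simp add: add sc E_in)
  qed (auto simp: P0)
  then show ?thesis unfolding simple_spectral_integral_def using comm ms by simp
qed

end

subsection \<open>Spectral integrals by a canonical approximation\<close>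

text \<open>Approximating the identity of the complex plane once and for all gives, by composition, simple
  functions that are measurable for the smallest sigma-algebra making the integrand measurable. So a spectral
  integral only depends on the values of the spectral measure on that sigma-algebra.\<close>

definition approx_id :: "nat \<Rightarrow> complex \<Rightarrow> complex" where
  "approx_id = (SOME d. (\<forall>n. simple_function borel (d n)) \<and> (\<forall>z. (\<lambda>n. d n z) \<longlonglongrightarrow> z) \<and> (\<forall>n z. cmod (d n z) \<le> 2 * cmod z))"

lemma approx_id:
  shows approx_id_simple: "simple_function borel (approx_id n)"
    and approx_id_lim: "(\<lambda>n. approx_id n z) \<longlonglongrightarrow> z"
    and approx_id_le: "cmod (approx_id n z) \<le> 2 * cmod z"
proof -
  have "\<exists>d::nat \<Rightarrow> complex \<Rightarrow> complex. (\<forall>n. simple_function borel (d n)) \<and> (\<forall>z. (\<lambda>n. d n z) \<longlonglongrightarrow> z) \<and> (\<forall>n z. cmod (d n z) \<le> 2 * cmod z)"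
    using borel_measurable_implies_sequence_metric[of "\<lambda>z::complex. z" borel 0] by (auto simp: dist_norm)
  from someI_ex[OF this, folded approx_id_def]
  show "simple_function borel (approx_id n)" "(\<lambda>n. approx_id n z) \<longlonglongrightarrow> z" "cmod (approx_id n z) \<le> 2 * cmod z"
    by blast+
qed

lemma simple_function_approx_id:
  assumes "f \<in> borel_measurable M" shows "simple_function M (\<lambda>\<xi>. approx_id n (f \<xi>))"
proof -
  have "simple_function M (\<lambda>\<xi>. approx_id n (f \<xi>))"
    unfolding simple_function_def
  proof (intro conjI ballI)
    have "finite (range (approx_id n))" using approx_id_simple[of n] by (simp add: simple_function_def)
    then show "finite ((\<lambda>\<xi>. approx_id n (f \<xi>)) ` space M)" by (rule rev_finite_subset) auto
    fix z assume "z \<in> (\<lambda>\<xi>. approx_id n (f \<xi>)) ` space M"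
    have "approx_id n -` {z} \<in> sets borel" using simple_functionD(2)[OF approx_id_simple, of n "{z}"] by simp
    then have "f -` (approx_id n -` {z}) \<inter> space M \<in> sets M" using assms by (rule measurable_sets[rotated])
    then show "(\<lambda>\<xi>. approx_id n (f \<xi>)) -` {z} \<inter> space M \<in> sets M" by (simp add: vimage_def)
  qed
  then show ?thesis .
qed

lemma cmod_add_sq_le: "(cmod (u + v))\<^sup>2 \<le> 2 * (cmod u)\<^sup>2 + 2 * (cmod v)\<^sup>2"
proof -
  have "(cmod (u + v))\<^sup>2 \<le> (cmod u + cmod v)\<^sup>2" by (intro power_mono norm_triangle_ineq) simp
  also have "\<dots> \<le> 2 * (cmod u)\<^sup>2 + 2 * (cmod v)\<^sup>2"
    using sum_squares_bound[of "cmod u" "cmod v"] by (simp add: power2_sum)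
  finally show ?thesis .
qed

context spectral
begin

lemma approx_id_mean_square:
  assumes f: "f \<in> borel_measurable M" and int: "(\<integral>\<^sup>+ \<xi>. ennreal ((cmod (f \<xi>))\<^sup>2) \<partial>\<mu> x) < \<infinity>"
  shows "(\<lambda>n. \<integral>\<^sup>+ \<xi>. ennreal ((cmod (f \<xi> - approx_id n (f \<xi>)))\<^sup>2) \<partial>\<mu> x) \<longlonglongrightarrow> 0" (is ?A)
    and "(\<lambda>n. \<integral>\<^sup>+ \<xi>. ennreal ((cmod (approx_id n (f \<xi>)))\<^sup>2) \<partial>\<mu> x)
      \<longlonglongrightarrow> (\<integral>\<^sup>+ \<xi>. ennreal ((cmod (f \<xi>))\<^sup>2) \<partial>\<mu> x)" (is ?B)
proof -
  have [measurable]: "f \<in> borel_measurable M" by (rule f)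
  have [measurable]: "(\<lambda>\<xi>. approx_id n (f \<xi>)) \<in> borel_measurable M" for n
    by (rule borel_measurable_simple_function[OF simple_function_approx_id[OF f]])
  have b1: "(cmod (approx_id n z))\<^sup>2 \<le> 9 * (cmod z)\<^sup>2" for n z
  proof -
    have "(cmod (approx_id n z))\<^sup>2 \<le> (3 * cmod z)\<^sup>2"
      by (intro power_mono order.trans[OF approx_id_le]) auto
    then show ?thesis by (simp add: power_mult_distrib)
  qed
  have b2: "(cmod (z - approx_id n z))\<^sup>2 \<le> 9 * (cmod z)\<^sup>2" for n z
  proof -
    have "cmod (z - approx_id n z) \<le> 3 * cmod z" using norm_triangle_ineq4[of z "approx_id n z"] approx_id_le[of n z] by linarith
    then have "(cmod (z - approx_id n z))\<^sup>2 \<le> (3 * cmod z)\<^sup>2" by (intro power_mono) auto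
    then show ?thesis by (simp add: power_mult_distrib)
  qed
  have "(\<integral>\<^sup>+ \<xi>. 9 * ennreal ((cmod (f \<xi>))\<^sup>2) \<partial>\<mu> x) < \<infinity>"
    using int by (subst nn_integral_cmult) (auto simp: ennreal_mult_less_top)
  then have dom: "(\<integral>\<^sup>+ \<xi>. ennreal (9 * (cmod (f \<xi>))\<^sup>2) \<partial>\<mu> x) < \<infinity>"
    by (simp add: ennreal_mult)
  have "(\<lambda>n. \<integral>\<^sup>+ \<xi>. ennreal ((cmod (f \<xi> - approx_id n (f \<xi>)))\<^sup>2) \<partial>\<mu> x) \<longlonglongrightarrow> (\<integral>\<^sup>+ \<xi>. 0 \<partial>\<mu> x)"
  proof (rule nn_integral_dominated_convergence[OF _ _ _ _ dom])
    show "AE \<xi> in \<mu> x. (\<lambda>n. ennreal ((cmod (f \<xi> - approx_id n (f \<xi>)))\<^sup>2)) \<longlonglongrightarrow> 0"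
    proof (rule AE_I2)
      fix \<xi>
      have "(\<lambda>n. ennreal ((cmod (f \<xi> - approx_id n (f \<xi>)))\<^sup>2)) \<longlonglongrightarrow> ennreal ((cmod (f \<xi> - f \<xi>))\<^sup>2)"
        by (intro tendsto_ennrealI tendsto_power tendsto_norm tendsto_diff tendsto_const approx_id_lim)
      then show "(\<lambda>n. ennreal ((cmod (f \<xi> - approx_id n (f \<xi>)))\<^sup>2)) \<longlonglongrightarrow> 0" by simp
    qed
  qed (auto simp: b2 intro!: ennreal_leI)
  then show ?A by simp
  show ?B
  proof (rule nn_integral_dominated_convergence[OF _ _ _ _ dom])
    show "AE \<xi> in \<mu> x. (\<lambda>n. ennreal ((cmod (approx_id n (f \<xi>)))\<^sup>2)) \<longlonglongrightarrow> ennreal ((cmod (f \<xi>))\<^sup>2)"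
      by (intro AE_I2 tendsto_ennrealI tendsto_power tendsto_norm approx_id_lim)
  qed (auto simp: b1 intro!: ennreal_leI)
qed

text \<open>The approximating sequence in the definition can be prescribed: two simple integrals differ in
  norm by the distance of the simple functions in mean square.\<close>

lemma spectral_integral_iff:
  "(x, y) \<in> spectral_integral M H E f \<longleftrightarrow> x \<in> H \<and> y \<in> H \<and> f \<in> borel_measurable M \<and>
     (\<integral>\<^sup>+ \<xi>. ennreal ((cmod (f \<xi>))\<^sup>2) \<partial>\<mu> x) < \<infinity> \<and>
     (\<lambda>n. simple_spectral_integral M E (\<lambda>\<xi>. approx_id n (f \<xi>)) x) \<longlonglongrightarrow> y" (is "?L \<longleftrightarrow> ?R")
proof
  assume ?R
  then show ?L
    unfolding spectral_integral_def
    using simple_function_approx_id[of f M] approx_id_mean_square(1)[of f x]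
    by (auto intro!: exI[of _ "\<lambda>n \<xi>. approx_id n (f \<xi>)"])
next
  assume ?L
  then obtain s where x: "x \<in> H" and y: "y \<in> H" and f: "f \<in> borel_measurable M"
    and int: "(\<integral>\<^sup>+ \<xi>. ennreal ((cmod (f \<xi>))\<^sup>2) \<partial>\<mu> x) < \<infinity>"
    and s: "\<And>n. simple_function M (s n)"
    and ms: "(\<lambda>n. \<integral>\<^sup>+ \<xi>. ennreal ((cmod (f \<xi> - s n \<xi>))\<^sup>2) \<partial>\<mu> x) \<longlonglongrightarrow> 0"
    and lim: "(\<lambda>n. simple_spectral_integral M E (s n) x) \<longlonglongrightarrow> y"
    unfolding spectral_integral_def by blast
  have [measurable]: "f \<in> borel_measurable M" by (rule f)
  have [measurable]: "(\<lambda>\<xi>. approx_id n (f \<xi>)) \<in> borel_measurable M" for n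
    by (rule borel_measurable_simple_function[OF simple_function_approx_id[OF f]])
  have [measurable]: "s n \<in> borel_measurable M" for n by (rule borel_measurable_simple_function[OF s])
  define D where "D n = norm (simple_spectral_integral M E (\<lambda>\<xi>. approx_id n (f \<xi>)) x - simple_spectral_integral M E (s n) x)" for n
  have bound: "ennreal ((D n)\<^sup>2) \<le> 2 * (\<integral>\<^sup>+ \<xi>. ennreal ((cmod (f \<xi> - s n \<xi>))\<^sup>2) \<partial>\<mu> x)
      + 2 * (\<integral>\<^sup>+ \<xi>. ennreal ((cmod (f \<xi> - approx_id n (f \<xi>)))\<^sup>2) \<partial>\<mu> x)" for n
  proof -
    have "ennreal ((D n)\<^sup>2) = (\<integral>\<^sup>+ \<xi>. ennreal ((cmod (approx_id n (f \<xi>) - s n \<xi>))\<^sup>2) \<partial>\<mu> x)"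
      unfolding D_def simple_spectral_integral_diff[OF simple_function_approx_id[OF f] s x]
      by (rule norm_simple_spectral_integral[OF simple_function_diff[OF simple_function_approx_id[OF f] s] x])
    also have "\<dots> \<le> (\<integral>\<^sup>+ \<xi>. 2 * ennreal ((cmod (f \<xi> - s n \<xi>))\<^sup>2) + 2 * ennreal ((cmod (f \<xi> - approx_id n (f \<xi>)))\<^sup>2) \<partial>\<mu> x)"
    proof (rule nn_integral_mono)
      fix \<xi>
      have "(cmod (approx_id n (f \<xi>) - s n \<xi>))\<^sup>2 \<le> 2 * (cmod (f \<xi> - s n \<xi>))\<^sup>2 + 2 * (cmod (f \<xi> - approx_id n (f \<xi>)))\<^sup>2"
        using cmod_add_sq_le[of "f \<xi> - s n \<xi>" "- (f \<xi> - approx_id n (f \<xi>))"] by (simp add: norm_minus_commute)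
      then have "ennreal ((cmod (approx_id n (f \<xi>) - s n \<xi>))\<^sup>2) \<le> ennreal (2 * (cmod (f \<xi> - s n \<xi>))\<^sup>2 + 2 * (cmod (f \<xi> - approx_id n (f \<xi>)))\<^sup>2)"
        by (rule ennreal_leI)
      then show "ennreal ((cmod (approx_id n (f \<xi>) - s n \<xi>))\<^sup>2) \<le> 2 * ennreal ((cmod (f \<xi> - s n \<xi>))\<^sup>2) + 2 * ennreal ((cmod (f \<xi> - approx_id n (f \<xi>)))\<^sup>2)"
        by (simp add: ennreal_plus ennreal_mult)
    qed
    also have "\<dots> = 2 * (\<integral>\<^sup>+ \<xi>. ennreal ((cmod (f \<xi> - s n \<xi>))\<^sup>2) \<partial>\<mu> x)
      + 2 * (\<integral>\<^sup>+ \<xi>. ennreal ((cmod (f \<xi> - approx_id n (f \<xi>)))\<^sup>2) \<partial>\<mu> x)"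
      by (subst nn_integral_add; (subst nn_integral_cmult)?; measurable?) (simp add: nn_integral_cmult)
    finally show ?thesis .
  qed
  have "(\<lambda>n. 2 * (\<integral>\<^sup>+ \<xi>. ennreal ((cmod (f \<xi> - s n \<xi>))\<^sup>2) \<partial>\<mu> x)
      + 2 * (\<integral>\<^sup>+ \<xi>. ennreal ((cmod (f \<xi> - approx_id n (f \<xi>)))\<^sup>2) \<partial>\<mu> x)) \<longlonglongrightarrow> 2 * 0 + 2 * 0"
    by (intro tendsto_add ennreal_tendsto_cmult ms approx_id_mean_square(1) f int) auto
  then have zero: "(\<lambda>n. 2 * (\<integral>\<^sup>+ \<xi>. ennreal ((cmod (f \<xi> - s n \<xi>))\<^sup>2) \<partial>\<mu> x)
      + 2 * (\<integral>\<^sup>+ \<xi>. ennreal ((cmod (f \<xi> - approx_id n (f \<xi>)))\<^sup>2) \<partial>\<mu> x)) \<longlonglongrightarrow> 0" by simp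
  have "(\<lambda>n. ennreal ((D n)\<^sup>2)) \<longlonglongrightarrow> 0"
  proof (rule tendsto_sandwich[OF _ _ tendsto_const zero])
    show "\<forall>\<^sub>F n in sequentially. 0 \<le> ennreal ((D n)\<^sup>2)" by simp
    show "\<forall>\<^sub>F n in sequentially. ennreal ((D n)\<^sup>2) \<le> 2 * (\<integral>\<^sup>+ \<xi>. ennreal ((cmod (f \<xi> - s n \<xi>))\<^sup>2) \<partial>\<mu> x)
      + 2 * (\<integral>\<^sup>+ \<xi>. ennreal ((cmod (f \<xi> - approx_id n (f \<xi>)))\<^sup>2) \<partial>\<mu> x)"
      by (rule always_eventually) (rule allI, rule bound)
  qed
  then have "(\<lambda>n. ennreal ((D n)\<^sup>2)) \<longlonglongrightarrow> ennreal 0" by simp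
  then have "(\<lambda>n. (D n)\<^sup>2) \<longlonglongrightarrow> 0" by (subst (asm) tendsto_ennreal_iff) auto
  then have "(\<lambda>n. sqrt ((D n)\<^sup>2)) \<longlonglongrightarrow> sqrt 0" by (rule tendsto_real_sqrt)
  then have "(\<lambda>n. D n) \<longlonglongrightarrow> 0" by (simp add: D_def)
  then have "(\<lambda>n. simple_spectral_integral M E (\<lambda>\<xi>. approx_id n (f \<xi>)) x - simple_spectral_integral M E (s n) x) \<longlonglongrightarrow> 0"
    unfolding D_def by (rule tendsto_norm_zero_cancel)
  from tendsto_add[OF this lim]
  show ?R using x y f int by simp
qed

lemma norm_spectral_integral:
  assumes "(x, y) \<in> spectral_integral M H E f"
  shows "(\<integral>\<^sup>+ \<xi>. ennreal ((cmod (f \<xi>))\<^sup>2) \<partial>\<mu> x) = ennreal ((norm y)\<^sup>2)"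
proof -
  have x: "x \<in> H" and f: "f \<in> borel_measurable M" and int: "(\<integral>\<^sup>+ \<xi>. ennreal ((cmod (f \<xi>))\<^sup>2) \<partial>\<mu> x) < \<infinity>"
    and lim: "(\<lambda>n. simple_spectral_integral M E (\<lambda>\<xi>. approx_id n (f \<xi>)) x) \<longlonglongrightarrow> y"
    using assms by (auto simp: spectral_integral_iff)
  have "(\<lambda>n. ennreal ((norm (simple_spectral_integral M E (\<lambda>\<xi>. approx_id n (f \<xi>)) x))\<^sup>2)) \<longlonglongrightarrow> ennreal ((norm y)\<^sup>2)"
    by (intro tendsto_ennrealI tendsto_power tendsto_norm lim)
  then show ?thesis
    using approx_id_mean_square(2)[OF f int] LIMSEQ_unique
    unfolding norm_simple_spectral_integral[OF simple_function_approx_id[OF f] x] by blast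
qed

text \<open>Contractions commuting with the spectral measure preserve the graph of a spectral integral.\<close>

lemma spectral_integral_commute:
  assumes xy: "(x, y) \<in> spectral_integral M H E f"
    and add: "\<And>y z. y \<in> H \<Longrightarrow> z \<in> H \<Longrightarrow> P (y + z) = P y + P z" and sc: "\<And>c y. y \<in> H \<Longrightarrow> P (c *\<^sub>C y) = c *\<^sub>C P y"
    and PH: "\<And>y. y \<in> H \<Longrightarrow> P y \<in> H" and le: "\<And>y. y \<in> H \<Longrightarrow> norm (P y) \<le> norm y"
    and cont: "\<And>f y. f \<longlonglongrightarrow> y \<Longrightarrow> (\<And>n. f n \<in> H) \<Longrightarrow> y \<in> H \<Longrightarrow> (\<lambda>n. P (f n)) \<longlonglongrightarrow> P y"
    and comm: "\<And>\<Delta>. \<Delta> \<in> sets M \<Longrightarrow> E \<Delta> (P x) = P (E \<Delta> x)"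
  shows "(P x, P y) \<in> spectral_integral M H E f"
proof -
  have x: "x \<in> H" and y: "y \<in> H" and f: "f \<in> borel_measurable M" and int: "(\<integral>\<^sup>+ \<xi>. ennreal ((cmod (f \<xi>))\<^sup>2) \<partial>\<mu> x) < \<infinity>"
    and lim: "(\<lambda>n. simple_spectral_integral M E (\<lambda>\<xi>. approx_id n (f \<xi>)) x) \<longlonglongrightarrow> y"
    using xy by (auto simp: spectral_integral_iff)
  have "(\<integral>\<^sup>+ \<xi>. ennreal ((cmod (f \<xi>))\<^sup>2) \<partial>\<mu> (P x)) \<le> (\<integral>\<^sup>+ \<xi>. ennreal ((cmod (f \<xi>))\<^sup>2) \<partial>\<mu> x)"
  proof (rule nn_integral_mono_measure)
    show "\<mu> (P x) \<le> \<mu> x"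
    proof (subst le_measure)
      show "\<forall>A\<in>sets (\<mu> (P x)). emeasure (\<mu> (P x)) A \<le> emeasure (\<mu> x) A"
        using x by (auto simp: emeasure_scalar PH comm E_in intro!: ennreal_leI power_mono le)
    qed simp
  qed simp
  moreover have "(\<lambda>n. simple_spectral_integral M E (\<lambda>\<xi>. approx_id n (f \<xi>)) (P x)) \<longlonglongrightarrow> P y"
  proof -
    have "simple_spectral_integral M E (\<lambda>\<xi>. approx_id n (f \<xi>)) (P x) = P (simple_spectral_integral M E (\<lambda>\<xi>. approx_id n (f \<xi>)) x)" for n
      by (rule simple_spectral_integral_commute[OF simple_function_approx_id[OF f] x]) (auto simp: add sc comm)
    then show ?thesis using cont[OF lim simple_spectral_integral_in[OF simple_function_approx_id[OF f] x] y] by simp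
  qed
  ultimately show ?thesis using x y f int PH by (auto simp: spectral_integral_iff)
qed

lemma spectral_integral_E:
  assumes "(x, y) \<in> spectral_integral M H E f" "\<Gamma> \<in> sets M"
  shows "(E \<Gamma> x, E \<Gamma> y) \<in> spectral_integral M H E f"
proof (rule spectral_integral_commute[OF assms(1)])
  have x: "x \<in> H" using assms(1) by (simp add: spectral_integral_iff)
  show "E \<Delta> (E \<Gamma> x) = E \<Gamma> (E \<Delta> x)" if "\<Delta> \<in> sets M" for \<Delta>
    using E_Int[OF that assms(2) x] E_Int[OF assms(2) that x] by (simp add: Int_commute)
  show "(\<lambda>n. E \<Gamma> (f n)) \<longlonglongrightarrow> E \<Gamma> y" if "f \<longlonglongrightarrow> y" "\<And>n. f n \<in> H" "y \<in> H" for f y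
    using that assms(2) by (intro E_tendsto) auto
qed (use assms(2) in \<open>auto simp: E_add E_scaleC E_in E_le\<close>)

text \<open>Bounds on the integrand over a set carrying the vector pass to the operator.\<close>

lemma AE_scalar:
  assumes "\<Delta> \<in> sets M" "x \<in> H" "E \<Delta> x = x" shows "AE \<xi> in \<mu> x. \<xi> \<in> \<Delta>"
proof (rule AE_I')
  show "space M - \<Delta> \<in> null_sets (\<mu> x)"
    using assms by (auto simp: null_sets_def emeasure_scalar E_compl)
qed auto

lemma spectral_integral_le:
  assumes xy: "(x, y) \<in> spectral_integral M H E f" and D: "\<Delta> \<in> sets M" "E \<Delta> x = x"
    and le: "\<And>\<xi>. \<xi> \<in> \<Delta> \<Longrightarrow> cmod (f \<xi>) \<le> r" and r: "0 \<le> r"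
  shows "norm y \<le> r * norm x"
proof -
  have x: "x \<in> H" using xy by (simp add: spectral_integral_iff)
  have "ennreal ((norm y)\<^sup>2) \<le> (\<integral>\<^sup>+ \<xi>. ennreal (r\<^sup>2) \<partial>\<mu> x)"
    unfolding norm_spectral_integral[OF xy, symmetric]
  proof (rule nn_integral_mono_AE)
    show "AE \<xi> in \<mu> x. ennreal ((cmod (f \<xi>))\<^sup>2) \<le> ennreal (r\<^sup>2)"
      using AE_scalar[OF D(1) x D(2)] by eventually_elim (intro ennreal_leI power_mono le, auto)
  qed
  also have "\<dots> = ennreal ((r * norm x)\<^sup>2)"
    using x by (simp add: emeasure_scalar E_space power_mult_distrib ennreal_mult)
  finally have "(norm y)\<^sup>2 \<le> (r * norm x)\<^sup>2" by (simp add: ennreal_le_iff)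
  then show ?thesis by (rule power2_le_imp_le) (use r in simp)
qed

lemma spectral_integral_ge:
  assumes xy: "(x, y) \<in> spectral_integral M H E f" and D: "\<Delta> \<in> sets M" "E \<Delta> x = x"
    and ge: "\<And>\<xi>. \<xi> \<in> \<Delta> \<Longrightarrow> r \<le> cmod (f \<xi>)" and r: "0 \<le> r"
  shows "r * norm x \<le> norm y"
proof -
  have x: "x \<in> H" using xy by (simp add: spectral_integral_iff)
  have "ennreal ((r * norm x)\<^sup>2) = (\<integral>\<^sup>+ \<xi>. ennreal (r\<^sup>2) \<partial>\<mu> x)"
    using x by (simp add: emeasure_scalar E_space power_mult_distrib ennreal_mult)
  also have "\<dots> \<le> ennreal ((norm y)\<^sup>2)"
    unfolding norm_spectral_integral[OF xy, symmetric]
  proof (rule nn_integral_mono_AE)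
    show "AE \<xi> in \<mu> x. ennreal (r\<^sup>2) \<le> ennreal ((cmod (f \<xi>))\<^sup>2)"
      using AE_scalar[OF D(1) x D(2)] by eventually_elim (intro ennreal_leI power_mono ge r)
  qed
  finally have "(r * norm x)\<^sup>2 \<le> (norm y)\<^sup>2" by (simp add: ennreal_le_iff)
  then show ?thesis by (rule power2_le_imp_le) simp
qed

end

lemma spectral_integral_cong:
  assumes "spectral M H E" "spectral M H F"
    and eq: "\<And>U x. open U \<Longrightarrow> x \<in> H \<Longrightarrow> E (f -` U \<inter> space M) x = F (f -` U \<inter> space M) x"
  shows "spectral_integral M H E f = spectral_integral M H F f"
proof (cases "f \<in> borel_measurable M")
  case False
  then show ?thesis by (simp add: spectral_integral_def)
next
  case f: True
  interpret E: spectral M H E by fact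
  interpret F: spectral M H F by fact
  have ms: "f -` T \<inter> space M \<in> sets M" if "T \<in> sets borel" for T using f that by (rule measurable_sets)
  have eq': "E (f -` T \<inter> space M) x = F (f -` T \<inter> space M) x" if x: "x \<in> H" and T: "T \<in> sigma_sets UNIV {U. open U}" for x T
  proof -
    have st: "Int_stable {U::complex set. open U}" "{U::complex set. open U} \<subseteq> Pow UNIV" by (auto simp: Int_stable_def)
    show ?thesis using st T
  proof (induction T rule: sigma_sets_induct_disjoint)
    case (basic U) then show ?case using eq x by simp
  next
    case (compl T)
    then have "T \<in> sets borel" by (simp add: borel_def)
    moreover have "f -` (UNIV - T) \<inter> space M = space M - (f -` T \<inter> space M)" by auto
    ultimately show ?case using compl x ms[of T] by (simp add: E.E_compl F.E_compl)
  next
    case (union T)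
    have T: "range (\<lambda>n. f -` T n \<inter> space M) \<subseteq> sets M" using union(2) ms by (auto simp: borel_def)
    have d: "disjoint_family (\<lambda>n. f -` T n \<inter> space M)" using union(1) by (auto simp: disjoint_family_on_def)
    have "f -` (\<Union>n. T n) \<inter> space M = (\<Union>n. f -` T n \<inter> space M)" by auto
    moreover have "(\<lambda>n. E (f -` T n \<inter> space M) x) sums F (\<Union>n. f -` T n \<inter> space M) x"
      using F.E_sums[OF T d x] union(3) by simp
    ultimately show ?case using E.E_sums[OF T d x] sums_unique2 by metis
  qed (use x in auto)
  qed
  have ssi: "simple_spectral_integral M E (\<lambda>\<xi>. approx_id n (f \<xi>)) x = simple_spectral_integral M F (\<lambda>\<xi>. approx_id n (f \<xi>)) x"
    if x: "x \<in> H" for n x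
    unfolding simple_spectral_integral_def
  proof (intro sum.cong refl)
    fix z
    have "approx_id n -` {z} \<in> sets borel" using simple_functionD(2)[OF approx_id_simple, of n "{z}"] by simp
    then have "approx_id n -` {z} \<in> sigma_sets UNIV {U. open U}" by (simp add: borel_def)
    from eq'[OF x this]
    show "z *\<^sub>C E ((\<lambda>\<xi>. approx_id n (f \<xi>)) -` {z} \<inter> space M) x = z *\<^sub>C F ((\<lambda>\<xi>. approx_id n (f \<xi>)) -` {z} \<inter> space M) x"
      by (simp add: vimage_def)
  qed
  have int: "(\<integral>\<^sup>+ \<xi>. ennreal ((cmod (f \<xi>))\<^sup>2) \<partial>scalar_measure M E x) = (\<integral>\<^sup>+ \<xi>. ennreal ((cmod (f \<xi>))\<^sup>2) \<partial>scalar_measure M F x)"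
    if x: "x \<in> H" for x
  proof -
    have "(\<integral>\<^sup>+ \<xi>. ennreal ((cmod (f \<xi>))\<^sup>2) \<partial>scalar_measure M E x) = (\<integral>\<^sup>+ z. ennreal ((cmod z)\<^sup>2) \<partial>distr (scalar_measure M E x) borel f)"
      using f by (subst nn_integral_distr) auto
    also have "distr (scalar_measure M E x) borel f = distr (scalar_measure M F x) borel f"
    proof (rule measure_eqI)
      fix T assume "T \<in> sets (distr (scalar_measure M E x) borel f)"
      then have T: "T \<in> sets borel" by simp
      have "T \<in> sigma_sets UNIV {U. open U}" using T by (simp add: borel_def)
      from eq'[OF x this] show "emeasure (distr (scalar_measure M E x) borel f) T = emeasure (distr (scalar_measure M F x) borel f) T"
        using f x ms[OF T] T by (simp add: emeasure_distr E.emeasure_scalar F.emeasure_scalar)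
    qed simp
    also have "(\<integral>\<^sup>+ z. ennreal ((cmod z)\<^sup>2) \<partial>distr (scalar_measure M F x) borel f) = (\<integral>\<^sup>+ \<xi>. ennreal ((cmod (f \<xi>))\<^sup>2) \<partial>scalar_measure M F x)"
      using f by (subst nn_integral_distr) auto
    finally show ?thesis .
  qed
  have "(x, y) \<in> spectral_integral M H E f \<longleftrightarrow> (x, y) \<in> spectral_integral M H F f" for x y
    unfolding E.spectral_integral_iff F.spectral_integral_iff using ssi int by auto
  then show ?thesis by auto
qed

lemma spectral_integral_restrict:
  assumes "K \<subseteq> H" shows "spectral_integral M K E f = spectral_integral M H E f \<inter> K \<times> K"
  using assms by (auto simp: spectral_integral_def)

section \<open>Ultrafilters\<close>

definition ultrafilter :: "'x filter \<Rightarrow> bool" where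
  "ultrafilter U \<longleftrightarrow> U \<noteq> bot \<and> (\<forall>P. eventually P U \<or> eventually (\<lambda>x. \<not> P x) U)"

text \<open>Zorn's lemma is applied to the families of sets whose finite intersections are met frequently along \<open>F\<close>.\<close>

lemma ex_ultrafilter:
  assumes "F \<noteq> bot" shows "\<exists>U\<le>F. ultrafilter U"
proof -
  define \<A> where "\<A> = {S. \<forall>T\<subseteq>S. finite T \<longrightarrow> frequently (\<lambda>x. x \<in> \<Inter>T) F}"
  have "\<exists>S\<in>\<A>. \<forall>R\<in>\<A>. S \<subseteq> R \<longrightarrow> R = S"
  proof (rule subset_Zorn')
    fix \<C> assume c: "subset.chain \<A> \<C>"
    show "\<Union>\<C> \<in> \<A>"
      unfolding \<A>_def
    proof (intro CollectI allI impI)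
      fix T assume T: "T \<subseteq> \<Union>\<C>" "finite T"
      show "frequently (\<lambda>x. x \<in> \<Inter>T) F"
      proof (cases "\<C> = {}")
        case True
        then have "T = {}" using T by auto
        then show ?thesis using assms by (simp add: frequently_const)
      next
        case False
        obtain S where "S \<in> \<C>" "T \<subseteq> S"
          using finite_subset_Union_chain[OF T(2,1) False c] by blast
        then show ?thesis using c T by (auto simp: \<A>_def subset.chain_def)
      qed
    qed
  qed
  then obtain S where S: "S \<in> \<A>" and mx: "\<And>R. R \<in> \<A> \<Longrightarrow> S \<subseteq> R \<Longrightarrow> R = S" by blast
  define U where "U = Abs_filter (\<lambda>P. \<exists>T\<subseteq>S. finite T \<and> eventually (\<lambda>x. x \<in> \<Inter>T \<longrightarrow> P x) F)"
  have ev: "eventually P U \<longleftrightarrow> (\<exists>T\<subseteq>S. finite T \<and> eventually (\<lambda>x. x \<in> \<Inter>T \<longrightarrow> P x) F)" for P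
    unfolding U_def
  proof (rule eventually_Abs_filter, rule is_filter.intro)
    show "\<exists>T\<subseteq>S. finite T \<and> eventually (\<lambda>x. x \<in> \<Inter>T \<longrightarrow> True) F" by (intro exI[of _ "{}"]) auto
    fix P Q
    assume "\<exists>T\<subseteq>S. finite T \<and> eventually (\<lambda>x. x \<in> \<Inter>T \<longrightarrow> P x) F"
      and "\<exists>T\<subseteq>S. finite T \<and> eventually (\<lambda>x. x \<in> \<Inter>T \<longrightarrow> Q x) F"
    then obtain A B where "A \<subseteq> S" "finite A" "B \<subseteq> S" "finite B"
      "eventually (\<lambda>x. x \<in> \<Inter>A \<longrightarrow> P x) F" "eventually (\<lambda>x. x \<in> \<Inter>B \<longrightarrow> Q x) F" by blast
    then show "\<exists>T\<subseteq>S. finite T \<and> eventually (\<lambda>x. x \<in> \<Inter>T \<longrightarrow> P x \<and> Q x) F"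
      by (intro exI[of _ "A \<union> B"]) (auto elim: eventually_elim2)
  next
    fix P Q assume PQ: "\<forall>x. P x \<longrightarrow> Q x" and "\<exists>T\<subseteq>S. finite T \<and> eventually (\<lambda>x. x \<in> \<Inter>T \<longrightarrow> P x) F"
    then obtain T where T: "T \<subseteq> S" "finite T" "eventually (\<lambda>x. x \<in> \<Inter>T \<longrightarrow> P x) F" by blast
    from T(3) have "eventually (\<lambda>x. x \<in> \<Inter>T \<longrightarrow> Q x) F" by (rule eventually_mono) (use PQ in blast)
    with T show "\<exists>T\<subseteq>S. finite T \<and> eventually (\<lambda>x. x \<in> \<Inter>T \<longrightarrow> Q x) F" by blast
  qed
  have le: "U \<le> F" unfolding le_filter_def ev by (intro allI impI exI[of _ "{}"]) auto
  have nb: "U \<noteq> bot"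
  proof
    assume "U = bot"
    then have "eventually (\<lambda>x. False) U" by simp
    then obtain T where "T \<subseteq> S" "finite T" "eventually (\<lambda>x. x \<notin> \<Inter>T) F" by (auto simp: ev)
    with S show False by (auto simp: \<A>_def frequently_def)
  qed
  have out: "\<exists>T\<subseteq>S. finite T \<and> eventually (\<lambda>x. x \<in> \<Inter>T \<longrightarrow> x \<notin> A) F" if "A \<notin> S" for A
  proof -
    have "insert A S \<notin> \<A>" using mx[of "insert A S"] that by auto
    then obtain T where T: "T \<subseteq> insert A S" "finite T" "eventually (\<lambda>x. x \<notin> \<Inter>T) F"
      by (auto simp: \<A>_def frequently_def)
    show ?thesis
      using T by (intro exI[of _ "T - {A}"]) (auto elim!: eventually_mono)
  qed
  have "eventually P U \<or> eventually (\<lambda>x. \<not> P x) U" for P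
  proof (cases "{x. P x} \<in> S")
    case True
    then have "eventually P U" unfolding ev by (intro exI[of _ "{{x. P x}}"]) auto
    then show ?thesis ..
  next
    case False
    from out[OF this] show ?thesis by (auto simp: ev)
  qed
  with le nb show ?thesis by (auto simp: ultrafilter_def)
qed

lemma ultrafilter_tendsto:
  fixes f :: "'x \<Rightarrow> 'y::topological_space"
  assumes U: "ultrafilter U" and K: "compact K" and ev: "eventually (\<lambda>x. f x \<in> K) U"
  shows "\<exists>l\<in>K. (f \<longlongrightarrow> l) U"
proof (rule ccontr)
  assume none: "\<not> (\<exists>l\<in>K. (f \<longlongrightarrow> l) U)"
  define \<M> where "\<M> = {N. open N \<and> eventually (\<lambda>x. f x \<notin> N) U}"
  have "K \<subseteq> \<Union>\<M>"
  proof
    fix l assume "l \<in> K"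
    then have "\<not> (f \<longlongrightarrow> l) U" using none by blast
    then obtain N where N: "open N" "l \<in> N" "\<not> eventually (\<lambda>x. f x \<in> N) U"
      unfolding tendsto_def by blast
    then have "eventually (\<lambda>x. f x \<notin> N) U" using U unfolding ultrafilter_def by blast
    with N show "l \<in> \<Union>\<M>" by (auto simp: \<M>_def)
  qed
  moreover have "\<And>N. N \<in> \<M> \<Longrightarrow> open N" by (simp add: \<M>_def)
  ultimately obtain \<N> where N: "\<N> \<subseteq> \<M>" "finite \<N>" "K \<subseteq> \<Union>\<N>"
    using compactE[OF K] by metis
  have "eventually (\<lambda>x. \<forall>N\<in>\<N>. f x \<notin> N) U" using N by (intro eventually_ball_finite) (auto simp: \<M>_def)
  with ev have "eventually (\<lambda>x. False) U" by eventually_elim (use N in blast)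
  then show False using U by (simp add: ultrafilter_def)
qed

lemma limitin_topology_generated_by:
  assumes "l \<in> \<Union>\<S>" "\<And>U. U \<in> \<S> \<Longrightarrow> l \<in> U \<Longrightarrow> eventually (\<lambda>x. f x \<in> U) F"
  shows "limitin (topology_generated_by \<S>) f l F"
  unfolding limitin_def
proof (intro conjI allI impI)
  show "l \<in> topspace (topology_generated_by \<S>)" using assms by simp
  fix U assume U: "openin (topology_generated_by \<S>) U \<and> l \<in> U"
  then have "generate_topology_on \<S> U" by (simp add: openin_topology_generated_by_iff)
  then have "l \<in> U \<longrightarrow> eventually (\<lambda>x. f x \<in> U) F"
  proof induction
    case (Int a b) then show ?case by (auto intro: eventually_conj)
  next
    case (UN K)
    show ?case
    proof
      assume "l \<in> \<Union>K"
      then obtain k where k: "k \<in> K" "l \<in> k" by blast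
      then have "eventually (\<lambda>x. f x \<in> k) F" using UN by blast
      then show "eventually (\<lambda>x. f x \<in> \<Union>K) F" by (rule eventually_mono) (use k in blast)
    qed
  qed (use assms in auto)
  with U show "eventually (\<lambda>x. f x \<in> U) F" by blast
qed

section \<open>Extension to a tau-additive Borel measure\<close>

text \<open>The outer measure of a set is the infimum of \<open>m U\<close> over open \<open>U\<close> containing it, where \<open>m U\<close> is the supremum of \<open>\<mu>\<close> over
  members of \<open>\<V>\<close> inside \<open>U\<close>. The covering hypothesis makes \<open>m\<close> countably subadditive. The approximation of
  members of \<open>\<V>\<close> from inside by closed sets \<open>Z n\<close> makes open sets measurable in the sense of Caratheodory: a part of \<open>W\<close>
  inside \<open>Z n\<close> and the open remainder \<open>W - Z n\<close> are disjoint.\<close>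

lemma regular_extension:
  fixes T :: "'x topology"
  assumes fin: "finite_measure \<mu>" and sets: "sets \<mu> = sigma_sets (topspace T) {U. openin T U}"
    and V_open: "\<And>V. V \<in> \<V> \<Longrightarrow> openin T V"
    and V_Int: "\<And>V W. V \<in> \<V> \<Longrightarrow> W \<in> \<V> \<Longrightarrow> V \<inter> W \<in> \<V>"
    and V_UN: "\<And>S. (\<And>n::nat. S n \<in> \<V>) \<Longrightarrow> (\<Union>n. S n) \<in> \<V>"
    and V_empty: "{} \<in> \<V>"
    and V_base: "\<And>U x. openin T U \<Longrightarrow> x \<in> U \<Longrightarrow> \<exists>V\<in>\<V>. x \<in> V \<and> V \<subseteq> U"
    and inner: "\<And>V. V \<in> \<V> \<Longrightarrow> \<exists>W Z. incseq W \<and> (\<Union>n. W n) = V \<and> (\<forall>n::nat. W n \<in> \<V> \<and> closedin T (Z n) \<and> W n \<subseteq> Z n \<and> Z n \<subseteq> V)"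
    and tau: "\<And>V \<W>. V \<in> \<V> \<Longrightarrow> \<W> \<subseteq> \<V> \<Longrightarrow> V \<subseteq> \<Union>\<W> \<Longrightarrow> \<exists>\<C>\<subseteq>\<W>. countable \<C> \<and> emeasure \<mu> (V - \<Union>\<C>) = 0"
  shows "\<exists>\<nu>. sets \<nu> = sigma_sets (topspace T) {U. openin T U} \<and>
    (\<forall>U. openin T U \<longrightarrow> emeasure \<nu> U = (SUP V\<in>{V\<in>\<V>. V \<subseteq> U}. emeasure \<mu> V))"
proof -
  define X where "X = topspace T"
  define m where "m U = (SUP V\<in>{V\<in>\<V>. V \<subseteq> U}. emeasure \<mu> V)" for U
  define \<o> where "\<o> S = (INF U\<in>{U. openin T U \<and> S \<subseteq> U}. m U)" for S
  have subX: "{U. openin T U} \<subseteq> Pow X" by (auto simp: X_def dest: openin_subset)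
  have open_ms: "openin T U \<Longrightarrow> U \<in> sets \<mu>" for U using sets by auto
  have V_ms: "V \<in> \<V> \<Longrightarrow> V \<in> sets \<mu>" for V using V_open open_ms by blast
  have V_cUn: "\<Union>\<C> \<in> \<V>" if "countable \<C>" "\<C> \<subseteq> \<V>" for \<C>
  proof (cases "\<C> = {}")
    case False
    have "(\<Union>n. from_nat_into \<C> n) \<in> \<V>" using from_nat_into[OF False] that(2) by (intro V_UN) auto
    then show ?thesis using False that(1) by (simp add: range_from_nat_into)
  qed (simp add: V_empty)
  have V_Un: "V \<union> W \<in> \<V>" if "V \<in> \<V>" "W \<in> \<V>" for V W using V_cUn[of "{V, W}"] that by auto
  have m_mono: "U \<subseteq> U' \<Longrightarrow> m U \<le> m U'" for U U' unfolding m_def by (intro SUP_subset_mono) auto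
  have m_V: "m V = emeasure \<mu> V" if "V \<in> \<V>" for V
    unfolding m_def using that V_ms by (intro antisym SUP_least SUP_upper) (auto intro: emeasure_mono)
  have V_le_m: "V \<in> \<V> \<Longrightarrow> V \<subseteq> U \<Longrightarrow> emeasure \<mu> V \<le> m U" for V U
    using m_V m_mono by metis
  have m_sub: "m (\<Union>n. U n) \<le> (\<Sum>n. m (U n))" if U: "\<And>n::nat. openin T (U n)" for U
    unfolding m_def[of "\<Union>n. U n"]
  proof (rule SUP_least)
    fix V assume "V \<in> {V \<in> \<V>. V \<subseteq> (\<Union>n. U n)}"
    then have V: "V \<in> \<V>" "V \<subseteq> (\<Union>n. U n)" by auto
    have "V \<subseteq> \<Union>{W\<in>\<V>. \<exists>n. W \<subseteq> U n}"
    proof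
      fix x assume "x \<in> V"
      then obtain n where "x \<in> U n" using V by auto
      then show "x \<in> \<Union>{W\<in>\<V>. \<exists>n. W \<subseteq> U n}" using V_base[OF U] by blast
    qed
    from tau[OF V(1) _ this] obtain \<C>
      where C: "\<C> \<subseteq> {W\<in>\<V>. \<exists>n. W \<subseteq> U n}" "countable \<C>" "emeasure \<mu> (V - \<Union>\<C>) = 0" by auto
    define C where "C n = \<Union>{W\<in>\<C>. W \<subseteq> U n}" for n
    have CV: "C n \<in> \<V>" "C n \<subseteq> U n" for n
      unfolding C_def using C by (auto intro!: V_cUn)
    have "\<Union>\<C> = (\<Union>n. C n)"
    proof
      show "\<Union>\<C> \<subseteq> (\<Union>n. C n)"
      proof
        fix x assume "x \<in> \<Union>\<C>"
        then obtain W where W: "W \<in> \<C>" "x \<in> W" by blast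
        then obtain n where "W \<subseteq> U n" using C(1) by blast
        with W have "x \<in> C n" unfolding C_def by blast
        then show "x \<in> (\<Union>n. C n)" by blast
      qed
    qed (auto simp: C_def)
    moreover have CU: "(\<Union>n. C n) \<in> sets \<mu>" using V_ms CV by auto
    ultimately have "emeasure \<mu> V \<le> emeasure \<mu> ((\<Union>n. C n) \<union> (V - (\<Union>n. C n)))"
      using V_ms[OF V(1)] by (intro emeasure_mono) auto
    also have "\<dots> \<le> emeasure \<mu> (\<Union>n. C n) + emeasure \<mu> (V - (\<Union>n. C n))"
      using V_ms[OF V(1)] CU by (intro emeasure_subadditive) auto
    also have "\<dots> = emeasure \<mu> (\<Union>n. C n)" using C(3) \<open>\<Union>\<C> = _\<close> by simp
    also have "\<dots> \<le> (\<Sum>n. emeasure \<mu> (C n))" using V_ms CV by (intro emeasure_subadditive_countably) auto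
    also have "\<dots> \<le> (\<Sum>n. m (U n))" using CV by (intro suminf_le V_le_m) auto
    finally show "emeasure \<mu> V \<le> (\<Sum>n. m (U n))" .
  qed
  have o_open: "\<o> U = m U" if "openin T U" for U
    unfolding \<o>_def using that by (intro antisym INF_greatest INF_lower m_mono) auto
  have o_mono: "S \<subseteq> S' \<Longrightarrow> \<o> S \<le> \<o> S'" for S S' unfolding \<o>_def by (intro INF_superset_mono) auto
  have o_empty: "\<o> {} = 0" using o_open[of "{}"] m_V[OF V_empty] by simp
  have o_sub: "\<o> (\<Union>n. A n) \<le> (\<Sum>n. \<o> (A n))" if A: "range A \<subseteq> Pow X" for A :: "nat \<Rightarrow> 'x set"
  proof (rule ennreal_le_epsilon)
    fix e :: real assume top: "(\<Sum>n. \<o> (A n)) < top" and e: "0 < e"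
    have "\<exists>U. openin T U \<and> A n \<subseteq> U \<and> m U \<le> \<o> (A n) + ennreal (e * (1/2) ^ Suc n)" for n
    proof -
      have "\<o> (A n) < top"
      proof -
        have "\<o> (A n) \<le> (\<Sum>n. \<o> (A n))" using sum_le_suminf[of "\<lambda>n. \<o> (A n)" "{n}"] by simp
        with top show ?thesis by order
      qed
      then have "\<o> (A n) < \<o> (A n) + ennreal (e * (1/2) ^ Suc n)"
        using e by (simp add: ennreal_zero_less_mult_iff ennreal_add_left_cancel_less)
      then show ?thesis unfolding \<o>_def[of "A n"] INF_less_iff by (auto simp: \<o>_def less_imp_le)
    qed
    then obtain U where U: "\<And>n. openin T (U n)" "\<And>n. A n \<subseteq> U n" "\<And>n. m (U n) \<le> \<o> (A n) + ennreal (e * (1/2) ^ Suc n)"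
      by metis
    have "\<o> (\<Union>n. A n) \<le> \<o> (\<Union>n. U n)" using U(2) by (intro o_mono) auto
    also have "\<dots> = m (\<Union>n. U n)" using U(1) by (intro o_open) auto
    also have "\<dots> \<le> (\<Sum>n. m (U n))" by (rule m_sub[OF U(1)])
    also have "\<dots> \<le> (\<Sum>n. \<o> (A n) + ennreal (e * (1/2) ^ Suc n))" by (intro suminf_le U) auto
    also have "\<dots> = (\<Sum>n. \<o> (A n)) + (\<Sum>n. ennreal (e * (1/2) ^ Suc n))" by (rule suminf_add[symmetric]) auto
    also have "(\<Sum>n. ennreal (e * (1/2) ^ Suc n)) = ennreal e"
      using sums_mult[OF power_half_series, of e] e by (intro suminf_ennreal_eq) auto
    finally show "\<o> (\<Union>n. A n) \<le> (\<Sum>n. \<o> (A n)) + ennreal e" .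
  qed
  interpret P: sigma_algebra X "Pow X" by (rule sigma_algebra_Pow)
  have oms: "outer_measure_space (Pow X) \<o>"
    unfolding outer_measure_space_def positive_def increasing_def countably_subadditive_def
    using o_empty o_mono o_sub by auto
  have "subadditive (Pow X) \<o>"
    using oms by (intro P.countably_subadditive_subadditive) (auto simp: outer_measure_space_def)
  then have o_add: "\<o> (A \<union> B) \<le> \<o> A + \<o> B" if "A \<subseteq> X" "B \<subseteq> X" "A \<inter> B = {}" for A B
    using that by (auto simp: subadditive_def)
  have split: "m (W \<inter> U) + \<o> (W - U) \<le> m W" if W: "openin T W" and U: "openin T U" for U W
  proof -
    have ne: "{V\<in>\<V>. V \<subseteq> S} \<noteq> {}" for S using V_empty by auto
    have "emeasure \<mu> V + \<o> (W - U) \<le> m W" if V: "V \<in> \<V>" "V \<subseteq> W \<inter> U" for V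
    proof -
      obtain V' Z where inc: "incseq V'" "(\<Union>n. V' n) = V"
        and Z: "\<And>n::nat. V' n \<in> \<V> \<and> closedin T (Z n) \<and> V' n \<subseteq> Z n \<and> Z n \<subseteq> V"
        using inner[OF V(1)] by blast
      have "emeasure \<mu> (V' n) + \<o> (W - U) \<le> m W" for n
      proof -
        have WZ: "openin T (W - Z n)" using W Z by (intro openin_diff) auto
        have "\<o> (W - U) \<le> m (W - Z n)"
          using o_open[OF WZ] o_mono[of "W - U" "W - Z n"] Z[of n] V by auto
        then have "emeasure \<mu> (V' n) + \<o> (W - U) \<le> emeasure \<mu> (V' n) + m (W - Z n)" by (intro add_left_mono)
        also have "\<dots> = (SUP V\<in>{V\<in>\<V>. V \<subseteq> W - Z n}. emeasure \<mu> (V' n) + emeasure \<mu> V)"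
          unfolding m_def by (rule ennreal_SUP_add_right[OF ne])
        also have "\<dots> \<le> m W"
        proof (rule SUP_least)
          fix V2 assume V2: "V2 \<in> {V\<in>\<V>. V \<subseteq> W - Z n}"
          have "emeasure \<mu> (V' n) + emeasure \<mu> V2 = emeasure \<mu> (V' n \<union> V2)"
            using V2 Z[of n] V_ms by (intro plus_emeasure) auto
          also have "\<dots> \<le> m W" using V2 Z[of n] V by (intro V_le_m V_Un) auto
          finally show "emeasure \<mu> (V' n) + emeasure \<mu> V2 \<le> m W" .
        qed
        finally show ?thesis .
      qed
      then have "(SUP n. emeasure \<mu> (V' n) + \<o> (W - U)) \<le> m W" by (intro SUP_least)
      moreover have "(SUP n. emeasure \<mu> (V' n) + \<o> (W - U)) = (SUP n. emeasure \<mu> (V' n)) + \<o> (W - U)"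
        by (rule ennreal_SUP_add_left) simp
      moreover have "(SUP n. emeasure \<mu> (V' n)) = emeasure \<mu> V"
        using inc V_ms Z by (subst SUP_emeasure_incseq) auto
      ultimately show ?thesis by simp
    qed
    then have "(SUP V\<in>{V\<in>\<V>. V \<subseteq> W \<inter> U}. emeasure \<mu> V + \<o> (W - U)) \<le> m W" by (intro SUP_least) auto
    then show ?thesis unfolding m_def[of "W \<inter> U"] by (subst (asm) ennreal_SUP_add_left[OF ne])
  qed
  define L where "L = lambda_system X (Pow X) \<o>"
  have ms: "measure_space X L \<o>" unfolding L_def by (rule P.caratheodory_lemma[OF oms])
  have "U \<in> L" if U: "openin T U" for U
    unfolding L_def lambda_system_def
  proof (intro CollectI conjI ballI antisym)
    show UX: "U \<in> Pow X" using U subX by auto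
    fix S assume S: "S \<in> Pow X"
    have "\<o> ((U \<inter> S) \<union> ((X - U) \<inter> S)) \<le> \<o> (U \<inter> S) + \<o> ((X - U) \<inter> S)" using S by (intro o_add) auto
    moreover have "(U \<inter> S) \<union> ((X - U) \<inter> S) = S" using S by auto
    ultimately show "\<o> S \<le> \<o> (U \<inter> S) + \<o> ((X - U) \<inter> S)" by simp
    show "\<o> (U \<inter> S) + \<o> ((X - U) \<inter> S) \<le> \<o> S"
      unfolding \<o>_def[of S]
    proof (rule INF_greatest)
      fix W assume W: "W \<in> {U. openin T U \<and> S \<subseteq> U}"
      have "\<o> (U \<inter> S) + \<o> ((X - U) \<inter> S) \<le> \<o> (W \<inter> U) + \<o> (W - U)"
        using W by (intro add_mono o_mono) auto
      also have "\<dots> = m (W \<inter> U) + \<o> (W - U)" using W U by (subst o_open) auto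
      also have "\<dots> \<le> m W" using W U split by auto
      finally show "\<o> (U \<inter> S) + \<o> ((X - U) \<inter> S) \<le> m W" .
    qed
  qed
  then have "sigma_sets X {U. openin T U} \<subseteq> L"
    using ms by (intro sigma_algebra.sigma_sets_subset) (auto simp: measure_space_def)
  then have ca: "countably_additive (sigma_sets X {U. openin T U}) \<o>" "positive (sigma_sets X {U. openin T U}) \<o>"
    using ms unfolding measure_space_def countably_additive_def positive_def by blast+
  define \<nu> where "\<nu> = measure_of X (sigma_sets X {U. openin T U}) \<o>"
  have "emeasure \<nu> A = \<o> A" if "A \<in> sigma_sets X {U. openin T U}" for A
    unfolding \<nu>_def
    by (rule emeasure_measure_of_sigma[OF sigma_algebra_sigma_sets[OF subX] ca(2,1) that])
  then have "emeasure \<nu> U = (SUP V\<in>{V\<in>\<V>. V \<subseteq> U}. emeasure \<mu> V)" if "openin T U" for U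
    using o_open[OF that] that by (simp add: m_def)
  moreover have "sets \<nu> = sigma_sets X {U. openin T U}"
  proof -
    have "sigma_sets X {U. openin T U} \<subseteq> Pow X" using sigma_sets_into_sp[OF subX] by blast
    then show ?thesis unfolding \<nu>_def by (simp only: sets_measure_of sigma_sets_sigma_sets_eq[OF subX])
  qed
  ultimately show ?thesis unfolding X_def by blast
qed

section \<open>Star-representations\<close>

locale star_representation =
  fixes \<pi> :: "('a::complex_star_algebra, 'h::complex_hilbert_space) rep"
  assumes sr: "star_rep \<pi>"
begin

lemma alg_sub: "star_subalgebra (alg \<pi>)" and hilb_sub: "csubspace (hilb \<pi>)" and hilb_closed: "closed (hilb \<pi>)"
  and dom_sub: "csubspace (dom \<pi>)" and dom_dense: "closure (dom \<pi>) = hilb \<pi>"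
  using sr by (auto simp: star_rep_def)

lemma alg_csub: "csubspace (alg \<pi>)" and alg_mult: "a \<in> alg \<pi> \<Longrightarrow> b \<in> alg \<pi> \<Longrightarrow> a * b \<in> alg \<pi>"
  and alg_star: "a \<in> alg \<pi> \<Longrightarrow> star a \<in> alg \<pi>"
  using alg_sub by (auto simp: star_subalgebra_def)

lemma dom_hilb: "x \<in> dom \<pi> \<Longrightarrow> x \<in> hilb \<pi>"
  using dom_dense closure_subset by blast

lemma act_in: "a \<in> alg \<pi> \<Longrightarrow> x \<in> dom \<pi> \<Longrightarrow> act \<pi> a x \<in> dom \<pi>"
  using sr by (auto simp: star_rep_def)

lemma act_hilb: "a \<in> alg \<pi> \<Longrightarrow> x \<in> dom \<pi> \<Longrightarrow> act \<pi> a x \<in> hilb \<pi>"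
  by (intro dom_hilb act_in)

lemma act_add: "a \<in> alg \<pi> \<Longrightarrow> x \<in> dom \<pi> \<Longrightarrow> y \<in> dom \<pi> \<Longrightarrow> act \<pi> a (x + y) = act \<pi> a x + act \<pi> a y"
  and act_scaleC: "a \<in> alg \<pi> \<Longrightarrow> x \<in> dom \<pi> \<Longrightarrow> act \<pi> a (c *\<^sub>C x) = c *\<^sub>C act \<pi> a x"
  and act_add_alg: "a \<in> alg \<pi> \<Longrightarrow> b \<in> alg \<pi> \<Longrightarrow> x \<in> dom \<pi> \<Longrightarrow> act \<pi> (a + b) x = act \<pi> a x + act \<pi> b x"
  and act_scaleC_alg: "a \<in> alg \<pi> \<Longrightarrow> x \<in> dom \<pi> \<Longrightarrow> act \<pi> (c *\<^sub>C a) x = c *\<^sub>C act \<pi> a x"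
  and act_mult: "a \<in> alg \<pi> \<Longrightarrow> b \<in> alg \<pi> \<Longrightarrow> x \<in> dom \<pi> \<Longrightarrow> act \<pi> (a * b) x = act \<pi> a (act \<pi> b x)"
  and act_star: "a \<in> alg \<pi> \<Longrightarrow> x \<in> dom \<pi> \<Longrightarrow> y \<in> dom \<pi> \<Longrightarrow> cinner (act \<pi> a x) y = cinner x (act \<pi> (star a) y)"
  using sr by (auto simp: star_rep_def clinear_on_def)

lemma act_diff: "a \<in> alg \<pi> \<Longrightarrow> x \<in> dom \<pi> \<Longrightarrow> y \<in> dom \<pi> \<Longrightarrow> act \<pi> a (x - y) = act \<pi> a x - act \<pi> a y"
  using act_add[of a x "(-1) *\<^sub>C y"] act_scaleC[of a y "-1"] csubspace_scaleC[OF dom_sub, of y "-1"]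
  by (simp add: scaleC_minus1)

lemma act_zero [simp]: "a \<in> alg \<pi> \<Longrightarrow> act \<pi> a 0 = 0"
  using act_scaleC[of a 0 0] csubspace_0[OF dom_sub] by simp

lemma act_sum: "a \<in> alg \<pi> \<Longrightarrow> (\<And>i. i \<in> I \<Longrightarrow> f i \<in> dom \<pi>) \<Longrightarrow> act \<pi> a (\<Sum>i\<in>I. f i) = (\<Sum>i\<in>I. act \<pi> a (f i))"
  by (induction I rule: infinite_finite_induct) (auto simp: act_add csubspace_sum[OF dom_sub])

lemma act_sum_alg: "x \<in> dom \<pi> \<Longrightarrow> (\<And>i. i \<in> I \<Longrightarrow> f i \<in> alg \<pi>) \<Longrightarrow> act \<pi> (\<Sum>i\<in>I. f i) x = (\<Sum>i\<in>I. act \<pi> (f i) x)"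
proof (induction I rule: infinite_finite_induct)
  case (insert i I)
  then show ?case by (simp add: act_add_alg csubspace_sum[OF alg_csub])
qed (use act_scaleC_alg[OF csubspace_0[OF alg_csub], of x 0] in auto)

lemma norm_act_sq:
  assumes "a \<in> alg \<pi>" "x \<in> dom \<pi>"
  shows "(norm (act \<pi> a x))\<^sup>2 = Re (cinner (act \<pi> (star a * a) x) x)"
proof -
  have "cinner (act \<pi> (star a * a) x) x = cinner (act \<pi> a x) (act \<pi> a x)"
    using assms by (simp add: act_mult alg_star act_star act_in star_star)
  then show ?thesis by (simp add: Re_cinner_self)
qed

lemma norm_act_sq_le:
  assumes "a \<in> alg \<pi>" "x \<in> dom \<pi>"
  shows "(norm (act \<pi> a x))\<^sup>2 \<le> norm (act \<pi> (star a * a) x) * norm x"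
  unfolding norm_act_sq[OF assms] using complex_Re_le_cmod cmod_cinner_le order.trans by blast

text \<open>This makes the graph norms directed: one of them dominates two others up to a factor.\<close>

lemma norm_act_dominated:
  assumes "c \<in> alg \<pi>" "d \<in> alg \<pi>" "x \<in> dom \<pi>"
  shows "(norm (act \<pi> c x))\<^sup>2 \<le> norm (act \<pi> (star c * c + star d * d) x) * norm x"
proof -
  let ?e = "star c * c + star d * d"
  have "act \<pi> ?e x = act \<pi> (star c * c) x + act \<pi> (star d * d) x"
    using assms by (intro act_add_alg alg_mult alg_star)
  then have "Re (cinner (act \<pi> ?e x) x) = (norm (act \<pi> c x))\<^sup>2 + (norm (act \<pi> d x))\<^sup>2"
    using assms by (simp add: cinner_add_left norm_act_sq)
  then show ?thesis
    using complex_Re_le_cmod[of "cinner (act \<pi> ?e x) x"] cmod_cinner_le[of "act \<pi> ?e x" x]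
      zero_le_power2[of "norm (act \<pi> d x)"] by linarith
qed

subsection \<open>Closures of the representing operators\<close>

lemma closure_rep_op_iff:
  "(x, y) \<in> closure (rep_op \<pi> a) \<longleftrightarrow> (\<exists>u. (\<forall>n. u n \<in> dom \<pi>) \<and> u \<longlonglongrightarrow> x \<and> (\<lambda>n. act \<pi> a (u n)) \<longlonglongrightarrow> y)"
proof
  assume "(x, y) \<in> closure (rep_op \<pi> a)"
  then obtain p where p: "\<And>n. p n \<in> rep_op \<pi> a" "p \<longlonglongrightarrow> (x, y)" unfolding closure_sequential by blast
  have "fst (p n) \<in> dom \<pi>" "snd (p n) = act \<pi> a (fst (p n))" for n
    using p(1)[of n] by (auto simp: rep_op_def op_graph_def)
  then show "\<exists>u. (\<forall>n. u n \<in> dom \<pi>) \<and> u \<longlonglongrightarrow> x \<and> (\<lambda>n. act \<pi> a (u n)) \<longlonglongrightarrow> y"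
    using tendsto_fst[OF p(2)] tendsto_snd[OF p(2)] by (intro exI[of _ "\<lambda>n. fst (p n)"]) auto
next
  assume "\<exists>u. (\<forall>n. u n \<in> dom \<pi>) \<and> u \<longlonglongrightarrow> x \<and> (\<lambda>n. act \<pi> a (u n)) \<longlonglongrightarrow> y"
  then obtain u where u: "\<And>n. u n \<in> dom \<pi>" "u \<longlonglongrightarrow> x" "(\<lambda>n. act \<pi> a (u n)) \<longlonglongrightarrow> y" by blast
  show "(x, y) \<in> closure (rep_op \<pi> a)"
    unfolding closure_sequential
    using u by (intro exI[of _ "\<lambda>n. (u n, act \<pi> a (u n))"]) (auto simp: rep_op_def op_graph_def intro: tendsto_Pair)
qed

lemma rep_op_closure: "x \<in> dom \<pi> \<Longrightarrow> (x, act \<pi> a x) \<in> closure (rep_op \<pi> a)"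
  using closure_subset by (fastforce simp: rep_op_def op_graph_def)

lemma closure_rep_op_hilb:
  assumes "a \<in> alg \<pi>" "(x, y) \<in> closure (rep_op \<pi> a)" shows "x \<in> hilb \<pi>" "y \<in> hilb \<pi>"
proof -
  obtain u where u: "\<And>n. u n \<in> dom \<pi>" "u \<longlonglongrightarrow> x" "(\<lambda>n. act \<pi> a (u n)) \<longlonglongrightarrow> y"
    using assms(2) by (auto simp: closure_rep_op_iff)
  show "x \<in> hilb \<pi>" using closed_sequentially[OF hilb_closed _ u(2)] u(1) dom_hilb by blast
  show "y \<in> hilb \<pi>" using closed_sequentially[OF hilb_closed _ u(3)] act_hilb[OF assms(1) u(1)] by blast
qed

lemma closure_rep_op_cinner:
  assumes "a \<in> alg \<pi>" "(x, y) \<in> closure (rep_op \<pi> a)" "z \<in> dom \<pi>"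
  shows "cinner y z = cinner x (act \<pi> (star a) z)"
proof -
  obtain u where u: "\<And>n. u n \<in> dom \<pi>" "u \<longlonglongrightarrow> x" "(\<lambda>n. act \<pi> a (u n)) \<longlonglongrightarrow> y"
    using assms(2) by (auto simp: closure_rep_op_iff)
  have "(\<lambda>n. cinner (act \<pi> a (u n)) z) \<longlonglongrightarrow> cinner y z" by (intro tendsto_cinner u tendsto_const)
  moreover have "(\<lambda>n. cinner (u n) (act \<pi> (star a) z)) \<longlonglongrightarrow> cinner x (act \<pi> (star a) z)"
    by (intro tendsto_cinner u tendsto_const)
  ultimately show ?thesis using act_star[OF assms(1) u(1) assms(3)] by (simp add: LIMSEQ_unique)
qed

lemma eq_if_cinner_dom:
  assumes "x \<in> hilb \<pi>" "y \<in> hilb \<pi>" "\<And>z. z \<in> dom \<pi> \<Longrightarrow> cinner x z = cinner y z" shows "x = y"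
proof -
  have "x - y \<in> closure (dom \<pi>)" using assms csubspace_diff[OF hilb_sub] dom_dense by simp
  then obtain u where u: "\<And>n. u n \<in> dom \<pi>" "u \<longlonglongrightarrow> x - y" unfolding closure_sequential by blast
  have "(\<lambda>n. cinner (x - y) (u n)) \<longlonglongrightarrow> cinner (x - y) (x - y)" by (intro tendsto_cinner u tendsto_const)
  moreover have "cinner (x - y) (u n) = 0" for n using assms(3)[OF u(1)] by (simp add: cinner_diff_left)
  ultimately have "cinner (x - y) (x - y) = 0" using LIMSEQ_unique tendsto_const by fastforce
  then show ?thesis by simp
qed

lemma closure_rep_op_unique:
  assumes "a \<in> alg \<pi>" "(x, y) \<in> closure (rep_op \<pi> a)" "(x, y') \<in> closure (rep_op \<pi> a)" shows "y = y'"
  using assms by (intro eq_if_cinner_dom) (auto simp: closure_rep_op_cinner closure_rep_op_hilb)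

lemma closure_rep_op_dom:
  assumes "a \<in> alg \<pi>" "(x, y) \<in> closure (rep_op \<pi> a)" "x \<in> dom \<pi>" shows "y = act \<pi> a x"
  using closure_rep_op_unique[OF assms(1,2) rep_op_closure[OF assms(3)]] .

lemma closure_rep_op_diff:
  assumes "a \<in> alg \<pi>" "(x, y) \<in> closure (rep_op \<pi> a)" "(x', y') \<in> closure (rep_op \<pi> a)"
  shows "(x - x', y - y') \<in> closure (rep_op \<pi> a)"
proof -
  obtain u where u: "\<And>n. u n \<in> dom \<pi>" "u \<longlonglongrightarrow> x" "(\<lambda>n. act \<pi> a (u n)) \<longlonglongrightarrow> y"
    using assms(2) by (auto simp: closure_rep_op_iff)
  obtain v where v: "\<And>n. v n \<in> dom \<pi>" "v \<longlonglongrightarrow> x'" "(\<lambda>n. act \<pi> a (v n)) \<longlonglongrightarrow> y'"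
    using assms(3) by (auto simp: closure_rep_op_iff)
  show ?thesis
    unfolding closure_rep_op_iff
  proof (intro exI[of _ "\<lambda>n. u n - v n"] conjI allI)
    show "u n - v n \<in> dom \<pi>" for n using u v by (intro csubspace_diff[OF dom_sub])
    show "(\<lambda>n. u n - v n) \<longlonglongrightarrow> x - x'" by (intro tendsto_diff u v)
    have "(\<lambda>n. act \<pi> a (u n) - act \<pi> a (v n)) \<longlonglongrightarrow> y - y'" by (intro tendsto_diff u v)
    then show "(\<lambda>n. act \<pi> a (u n - v n)) \<longlonglongrightarrow> y - y'" using u v assms(1) by (simp add: act_diff)
  qed
qed

text \<open>Domination of graph norms passes to the closed operators. The value \<open>z\<close> is reached along any sequence on which
  the dominating operator converges.\<close>

lemma closure_rep_op_dominated:
  assumes c: "c \<in> alg \<pi>" "d \<in> alg \<pi>" and u: "u \<in> dom \<pi>"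
    and xy: "(x, y) \<in> closure (rep_op \<pi> (star c * c + star d * d))" and xz: "(x, z) \<in> closure (rep_op \<pi> c)"
  shows "(norm (act \<pi> c u - z))\<^sup>2 \<le> norm (act \<pi> (star c * c + star d * d) u - y) * norm (u - x)"
proof -
  define e where "e = star c * c + star d * d"
  have e: "e \<in> alg \<pi>" unfolding e_def using c by (intro csubspace_add[OF alg_csub] alg_mult alg_star)
  have xy': "(x, y) \<in> closure (rep_op \<pi> e)" using xy by (simp add: e_def)
  obtain v where v: "\<And>n. v n \<in> dom \<pi>" "v \<longlonglongrightarrow> x" "(\<lambda>n. act \<pi> e (v n)) \<longlonglongrightarrow> y"
    using xy' by (auto simp: closure_rep_op_iff)
  have dominated: "(norm (act \<pi> c w))\<^sup>2 \<le> norm (act \<pi> e w) * norm w" if "w \<in> dom \<pi>" for w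
    unfolding e_def by (rule norm_act_dominated[OF c that])
  have "Cauchy (\<lambda>n. act \<pi> c (v n))"
    unfolding Cauchy_def
  proof (intro allI impI)
    fix \<epsilon> :: real assume \<epsilon>: "\<epsilon> > 0"
    from LIMSEQ_imp_Cauchy[OF v(2)] obtain N1 where N1: "\<And>m n. m \<ge> N1 \<Longrightarrow> n \<ge> N1 \<Longrightarrow> dist (v m) (v n) < \<epsilon>"
      using \<epsilon> unfolding Cauchy_def by blast
    from LIMSEQ_imp_Cauchy[OF v(3)] obtain N2 where N2: "\<And>m n. m \<ge> N2 \<Longrightarrow> n \<ge> N2 \<Longrightarrow> dist (act \<pi> e (v m)) (act \<pi> e (v n)) < \<epsilon>"
      using \<epsilon> unfolding Cauchy_def by blast
    show "\<exists>N. \<forall>m\<ge>N. \<forall>n\<ge>N. dist (act \<pi> c (v m)) (act \<pi> c (v n)) < \<epsilon>"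
    proof (intro exI[of _ "max N1 N2"] allI impI)
      fix m n assume mn: "max N1 N2 \<le> m" "max N1 N2 \<le> n"
      have "(norm (act \<pi> c (v m - v n)))\<^sup>2 \<le> norm (act \<pi> e (v m - v n)) * norm (v m - v n)"
        using v by (intro dominated csubspace_diff[OF dom_sub])
      also have "\<dots> < \<epsilon> * \<epsilon>"
        using N1[of m n] N2[of m n] mn v e by (intro mult_strict_mono') (auto simp: act_diff dist_norm)
      finally have "norm (act \<pi> c (v m - v n)) < \<epsilon>"
        using \<epsilon> by (intro power2_less_imp_less[of _ \<epsilon>]) (auto simp: power2_eq_square)
      then show "dist (act \<pi> c (v m)) (act \<pi> c (v n)) < \<epsilon>" using v c by (simp add: act_diff dist_norm)
    qed
  qed
  then obtain z' where z': "(\<lambda>n. act \<pi> c (v n)) \<longlonglongrightarrow> z'" using Cauchy_convergent convergent_def by blast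
  have "(x, z') \<in> closure (rep_op \<pi> c)" using v z' by (auto simp: closure_rep_op_iff)
  then have "z' = z" using closure_rep_op_unique[OF c(1) _ xz] by blast
  have "(\<lambda>n. (norm (act \<pi> c u - act \<pi> c (v n)))\<^sup>2) \<longlonglongrightarrow> (norm (act \<pi> c u - z))\<^sup>2"
    using z' \<open>z' = z\<close> by (intro tendsto_power tendsto_norm tendsto_diff tendsto_const) simp
  moreover have "(\<lambda>n. norm (act \<pi> e u - act \<pi> e (v n)) * norm (u - v n)) \<longlonglongrightarrow> norm (act \<pi> e u - y) * norm (u - x)"
    by (intro tendsto_mult tendsto_norm tendsto_diff tendsto_const v)
  moreover have "(norm (act \<pi> c u - act \<pi> c (v n)))\<^sup>2 \<le> norm (act \<pi> e u - act \<pi> e (v n)) * norm (u - v n)" for n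
    using dominated[OF csubspace_diff[OF dom_sub u v(1)], of n] c e u v(1)[of n] by (simp add: act_diff)
  ultimately show ?thesis unfolding e_def[symmetric] by (intro LIMSEQ_le) auto
qed

subsection \<open>The graph topology\<close>

lemma topspace_graph: "topspace (graph_topology \<pi>) = dom \<pi>"
proof -
  let ?S = "{{\<psi> \<in> dom \<pi>. graph_norm \<pi> a (\<psi> - \<phi>) < \<epsilon>} | a \<phi> \<epsilon>. a \<in> alg \<pi> \<and> \<phi> \<in> dom \<pi> \<and> \<epsilon> > 0}"
  have "x \<in> \<Union>?S" if x: "x \<in> dom \<pi>" for x
  proof -
    have "{\<psi> \<in> dom \<pi>. graph_norm \<pi> 0 (\<psi> - x) < 1} \<in> ?S"
      using x csubspace_0[OF alg_csub] zero_less_one by blast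
    moreover have "x \<in> {\<psi> \<in> dom \<pi>. graph_norm \<pi> 0 (\<psi> - x) < 1}"
      using x csubspace_0[OF alg_csub] by (simp add: graph_norm_def)
    ultimately show ?thesis by blast
  qed
  then show ?thesis unfolding graph_topology_def topology_generated_by_topspace by blast
qed

lemma graph_norm_triangle:
  assumes "a \<in> alg \<pi>" "x \<in> dom \<pi>" "y \<in> dom \<pi>"
  shows "graph_norm \<pi> a (x + y) \<le> graph_norm \<pi> a x + graph_norm \<pi> a y"
  using norm_triangle_ineq[of x y] norm_triangle_ineq[of "act \<pi> a x" "act \<pi> a y"] assms
  by (simp add: graph_norm_def act_add)

lemma openin_graph_ball:
  "a \<in> alg \<pi> \<Longrightarrow> \<phi> \<in> dom \<pi> \<Longrightarrow> \<epsilon> > 0 \<Longrightarrow> openin (graph_topology \<pi>) {\<psi> \<in> dom \<pi>. graph_norm \<pi> a (\<psi> - \<phi>) < \<epsilon>}"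
  unfolding graph_topology_def by (rule topology_generated_by_Basis) blast

text \<open>The balls form a subbase by definition; they are a base because the graph norms are directed.\<close>

lemma graph_ball_subset:
  assumes "openin (graph_topology \<pi>) U" "x \<in> U"
  shows "\<exists>a\<in>alg \<pi>. \<exists>\<epsilon>>0. {\<psi> \<in> dom \<pi>. graph_norm \<pi> a (\<psi> - x) < \<epsilon>} \<subseteq> U"
proof -
  let ?S = "{{\<psi> \<in> dom \<pi>. graph_norm \<pi> a (\<psi> - \<phi>) < \<epsilon>} | a \<phi> \<epsilon>. a \<in> alg \<pi> \<and> \<phi> \<in> dom \<pi> \<and> \<epsilon> > 0}"
  have "generate_topology_on ?S U" using assms(1) by (simp add: graph_topology_def openin_topology_generated_by_iff)
  then have "x \<in> U \<Longrightarrow> ?thesis"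
  proof induction
    case Empty then show ?case by simp
  next
    case (UN K)
    then obtain k where "k \<in> K" "x \<in> k" by blast
    with UN show ?case by (meson Union_upper subset_trans)
  next
    case (Basis s)
    then obtain a \<phi> \<epsilon> where s: "s = {\<psi> \<in> dom \<pi>. graph_norm \<pi> a (\<psi> - \<phi>) < \<epsilon>}" "a \<in> alg \<pi>" "\<phi> \<in> dom \<pi>" by blast
    have x: "x \<in> dom \<pi>" "graph_norm \<pi> a (x - \<phi>) < \<epsilon>" using Basis s by auto
    have "{\<psi> \<in> dom \<pi>. graph_norm \<pi> a (\<psi> - x) < \<epsilon> - graph_norm \<pi> a (x - \<phi>)} \<subseteq> s"
    proof safe
      fix \<psi> assume \<psi>: "\<psi> \<in> dom \<pi>" "graph_norm \<pi> a (\<psi> - x) < \<epsilon> - graph_norm \<pi> a (x - \<phi>)"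
      have "graph_norm \<pi> a ((\<psi> - x) + (x - \<phi>)) \<le> graph_norm \<pi> a (\<psi> - x) + graph_norm \<pi> a (x - \<phi>)"
        using \<psi> x s by (intro graph_norm_triangle csubspace_diff[OF dom_sub])
      then show "\<psi> \<in> s" using \<psi> s by simp
    qed
    moreover have "0 < \<epsilon> - graph_norm \<pi> a (x - \<phi>)" using x by simp
    ultimately show ?case using s(2) by blast
  next
    case (Int S T)
    then obtain c d \<epsilon> \<delta> where cd: "c \<in> alg \<pi>" "d \<in> alg \<pi>" "\<epsilon> > 0" "\<delta> > 0"
      "{\<psi> \<in> dom \<pi>. graph_norm \<pi> c (\<psi> - x) < \<epsilon>} \<subseteq> S" "{\<psi> \<in> dom \<pi>. graph_norm \<pi> d (\<psi> - x) < \<delta>} \<subseteq> T" by auto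
    have xd: "x \<in> dom \<pi>"
    proof -
      have "openin (graph_topology \<pi>) S" using Int by (simp add: graph_topology_def openin_topology_generated_by_iff)
      then have "S \<subseteq> dom \<pi>" using topspace_graph openin_subset by metis
      then show ?thesis using Int by auto
    qed
    define e where "e = star c * c + star d * d"
    have e: "e \<in> alg \<pi>" unfolding e_def using cd by (intro csubspace_add[OF alg_csub] alg_mult alg_star)
    have *: "graph_norm \<pi> k w \<le> 2 * graph_norm \<pi> e w" if w: "w \<in> dom \<pi>" and k: "k = c \<or> k = d" for w k
    proof -
      have "(norm (act \<pi> k w))\<^sup>2 \<le> norm (act \<pi> e w) * norm w"
        using k norm_act_dominated[OF cd(1,2) w] norm_act_dominated[OF cd(2,1) w] by (auto simp: e_def add.commute)
      also have "\<dots> \<le> (graph_norm \<pi> e w)\<^sup>2" by (simp add: graph_norm_def power2_eq_square mult_mono)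
      finally have "norm (act \<pi> k w) \<le> graph_norm \<pi> e w" by (rule power2_le_imp_le) (simp add: graph_norm_def)
      moreover have "k \<le> r + s \<Longrightarrow> 0 \<le> s \<Longrightarrow> r + k \<le> 2 * (r + s)" for r s k :: real by simp
      ultimately show ?thesis by (simp only: graph_norm_def norm_ge_zero)
    qed
    have "{\<psi> \<in> dom \<pi>. graph_norm \<pi> e (\<psi> - x) < min \<epsilon> \<delta> / 2} \<subseteq> S \<inter> T"
    proof
      fix \<psi> assume \<psi>: "\<psi> \<in> {\<psi> \<in> dom \<pi>. graph_norm \<pi> e (\<psi> - x) < min \<epsilon> \<delta> / 2}"
      then have "\<psi> - x \<in> dom \<pi>" using xd csubspace_diff[OF dom_sub] by auto
      then have "graph_norm \<pi> c (\<psi> - x) < \<epsilon>" "graph_norm \<pi> d (\<psi> - x) < \<delta>"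
        using *[of "\<psi> - x" c] *[of "\<psi> - x" d] \<psi> by auto
      then show "\<psi> \<in> S \<inter> T" using \<psi> cd by auto
    qed
    moreover have "0 < min \<epsilon> \<delta> / 2" using cd by simp
    ultimately show ?case using e by blast
  qed
  with assms(2) show ?thesis by blast
qed

lemma limitin_graph_iff:
  "limitin (graph_topology \<pi>) f \<phi> F \<longleftrightarrow>
     \<phi> \<in> dom \<pi> \<and> (\<forall>\<^sub>F x in F. f x \<in> dom \<pi>) \<and> (\<forall>a\<in>alg \<pi>. ((\<lambda>x. graph_norm \<pi> a (f x - \<phi>)) \<longlongrightarrow> 0) F)"
proof
  assume L: "limitin (graph_topology \<pi>) f \<phi> F"
  have \<phi>: "\<phi> \<in> dom \<pi>" using L topspace_graph by (auto simp: limitin_def)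
  have "\<forall>\<^sub>F x in F. f x \<in> dom \<pi>" using L topspace_graph openin_topspace \<phi> by (metis limitin_def)
  moreover have "((\<lambda>x. graph_norm \<pi> a (f x - \<phi>)) \<longlongrightarrow> 0) F" if a: "a \<in> alg \<pi>" for a
  proof (rule tendstoI)
    fix \<epsilon> :: real assume \<epsilon>: "\<epsilon> > 0"
    have "\<phi> \<in> {\<psi> \<in> dom \<pi>. graph_norm \<pi> a (\<psi> - \<phi>) < \<epsilon>}" using \<phi> a \<epsilon> by (simp add: graph_norm_def)
    then have "\<forall>\<^sub>F x in F. f x \<in> {\<psi> \<in> dom \<pi>. graph_norm \<pi> a (\<psi> - \<phi>) < \<epsilon>}"
      using L openin_graph_ball[OF a \<phi> \<epsilon>] by (auto simp: limitin_def)
    then show "\<forall>\<^sub>F x in F. dist (graph_norm \<pi> a (f x - \<phi>)) 0 < \<epsilon>"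
      by eventually_elim (simp add: graph_norm_def)
  qed
  ultimately show "\<phi> \<in> dom \<pi> \<and> (\<forall>\<^sub>F x in F. f x \<in> dom \<pi>) \<and> (\<forall>a\<in>alg \<pi>. ((\<lambda>x. graph_norm \<pi> a (f x - \<phi>)) \<longlongrightarrow> 0) F)"
    using \<phi> by blast
next
  assume R: "\<phi> \<in> dom \<pi> \<and> (\<forall>\<^sub>F x in F. f x \<in> dom \<pi>) \<and> (\<forall>a\<in>alg \<pi>. ((\<lambda>x. graph_norm \<pi> a (f x - \<phi>)) \<longlongrightarrow> 0) F)"
  show "limitin (graph_topology \<pi>) f \<phi> F"
    unfolding limitin_def
  proof (intro conjI allI impI)
    show "\<phi> \<in> topspace (graph_topology \<pi>)" using R by (simp add: topspace_graph)
    fix U assume "openin (graph_topology \<pi>) U \<and> \<phi> \<in> U"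
    then obtain a \<epsilon> where a: "a \<in> alg \<pi>" "\<epsilon> > 0" "{\<psi> \<in> dom \<pi>. graph_norm \<pi> a (\<psi> - \<phi>) < \<epsilon>} \<subseteq> U"
      using graph_ball_subset by blast
    have "((\<lambda>x. graph_norm \<pi> a (f x - \<phi>)) \<longlongrightarrow> 0) F" using R a by blast
    then have "\<forall>\<^sub>F x in F. graph_norm \<pi> a (f x - \<phi>) < \<epsilon>" using a(2) by (rule order_tendstoD)
    moreover have "\<forall>\<^sub>F x in F. f x \<in> dom \<pi>" using R by blast
    ultimately show "\<forall>\<^sub>F x in F. f x \<in> U" by eventually_elim (use a in auto)
  qed
qed

text \<open>A closed representation is the intersection of the domains of the closed operators: the sets of
  approximations of a vector \<open>x\<close> in the graph norms form a Cauchy filter base, because the graph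
  norms are directed.\<close>

lemma in_dom_if_closed:
  assumes cl: "closed_rep \<pi>" and ex: "\<And>b. b \<in> alg \<pi> \<Longrightarrow> \<exists>y. (x, y) \<in> closure (rep_op \<pi> b)"
  shows "x \<in> dom \<pi>"
proof -
  obtain y where y: "\<And>b. b \<in> alg \<pi> \<Longrightarrow> (x, y b) \<in> closure (rep_op \<pi> b)" using ex by metis
  define S where "S p = {u \<in> dom \<pi>. norm (u - x) < snd p \<and> norm (act \<pi> (fst p) u - y (fst p)) < snd p}" for p
  define I where "I = alg \<pi> \<times> {(0::real)<..}"
  define F where "F = (INF p\<in>I. principal (S p))"
  have ne: "I \<noteq> {}" using csubspace_0[OF alg_csub] by (auto simp: I_def intro!: exI[of _ 1])
  have Sne: "S p \<noteq> {}" if "p \<in> I" for p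
  proof -
    have "(x, y (fst p)) \<in> closure (rep_op \<pi> (fst p))" using that y by (auto simp: I_def)
    then obtain u where u: "\<And>n. u n \<in> dom \<pi>" "u \<longlonglongrightarrow> x" "(\<lambda>n. act \<pi> (fst p) (u n)) \<longlonglongrightarrow> y (fst p)"
      by (auto simp: closure_rep_op_iff)
    have pos: "snd p > 0" using that by (auto simp: I_def)
    have "\<forall>\<^sub>F n in sequentially. dist (u n) x < snd p \<and> dist (act \<pi> (fst p) (u n)) (y (fst p)) < snd p"
      using tendstoD[OF u(2) pos] tendstoD[OF u(3) pos] by eventually_elim simp
    then obtain n where "dist (u n) x < snd p \<and> dist (act \<pi> (fst p) (u n)) (y (fst p)) < snd p"
      using eventually_happens sequentially_bot by blast
    then have "u n \<in> S p" using u by (auto simp: S_def dist_norm)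
    then show ?thesis by blast
  qed
  have dir: "\<exists>r\<in>I. S r \<subseteq> S p \<inter> S q" if pq: "p \<in> I" "q \<in> I" for p q
  proof -
    obtain c \<epsilon> d \<delta> where cd: "p = (c, \<epsilon>)" "q = (d, \<delta>)" "c \<in> alg \<pi>" "d \<in> alg \<pi>" "\<epsilon> > 0" "\<delta> > 0"
      using pq by (auto simp: I_def)
    define e where "e = star c * c + star d * d"
    have e: "e \<in> alg \<pi>" unfolding e_def using cd by (intro csubspace_add[OF alg_csub] alg_mult alg_star)
    have e2: "e = star d * d + star c * c" by (simp add: e_def add.commute)
    have "S (e, min \<epsilon> \<delta>) \<subseteq> S p \<inter> S q"
    proof
      fix u assume u: "u \<in> S (e, min \<epsilon> \<delta>)"
      then have u': "u \<in> dom \<pi>" "norm (u - x) < min \<epsilon> \<delta>" "norm (act \<pi> e u - y e) < min \<epsilon> \<delta>" by (auto simp: S_def)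
      have prod: "norm (act \<pi> e u - y e) * norm (u - x) < (min \<epsilon> \<delta>)\<^sup>2"
        unfolding power2_eq_square using u' by (intro mult_strict_mono') auto
      have "(norm (act \<pi> c u - y c))\<^sup>2 < (min \<epsilon> \<delta>)\<^sup>2"
        using closure_rep_op_dominated[OF cd(3,4) u'(1), of x "y e" "y c"] y cd(3) e prod by (simp add: e_def)
      then have c': "norm (act \<pi> c u - y c) < min \<epsilon> \<delta>" by (rule power2_less_imp_less) (use cd in simp)
      have "(norm (act \<pi> d u - y d))\<^sup>2 < (min \<epsilon> \<delta>)\<^sup>2"
        using closure_rep_op_dominated[OF cd(4,3) u'(1), of x "y e" "y d"] y cd(4) e prod by (simp add: e2)
      then have d': "norm (act \<pi> d u - y d) < min \<epsilon> \<delta>" by (rule power2_less_imp_less) (use cd in simp)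
      show "u \<in> S p \<inter> S q" using u' c' d' cd by (auto simp: S_def)
    qed
    then show ?thesis using e cd by (intro bexI[of _ "(e, min \<epsilon> \<delta>)"]) (auto simp: I_def)
  qed
  have ev: "eventually P F \<longleftrightarrow> (\<exists>p\<in>I. \<forall>u\<in>S p. P u)" for P
    unfolding F_def
  proof (subst eventually_INF_base[OF ne])
    fix p q assume "p \<in> I" "q \<in> I"
    then show "\<exists>r\<in>I. principal (S r) \<le> inf (principal (S p)) (principal (S q))" using dir by simp
  qed (simp add: eventually_principal)
  have "F \<noteq> bot"
  proof
    assume "F = bot"
    then have "eventually (\<lambda>u. False) F" by simp
    then show False using Sne unfolding ev by blast
  qed
  moreover have "F \<le> principal (dom \<pi>)"
    unfolding le_principal ev using ne by (auto simp: S_def)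
  moreover have "((\<lambda>(u, v). graph_norm \<pi> a (u - v)) \<longlongrightarrow> 0) (F \<times>\<^sub>F F)" if a: "a \<in> alg \<pi>" for a
  proof (rule tendstoI)
    fix \<epsilon> :: real assume \<epsilon>: "\<epsilon> > 0"
    have "eventually (\<lambda>u. u \<in> S (a, \<epsilon> / 4)) F" unfolding ev using a \<epsilon> by (intro bexI[of _ "(a, \<epsilon> / 4)"]) (auto simp: I_def)
    then have "eventually (\<lambda>p. fst p \<in> S (a, \<epsilon> / 4) \<and> snd p \<in> S (a, \<epsilon> / 4)) (F \<times>\<^sub>F F)"
      by (intro eventually_conj eventually_compose_filterlim[OF _ filterlim_fst] eventually_compose_filterlim[OF _ filterlim_snd])
    then show "\<forall>\<^sub>F p in F \<times>\<^sub>F F. dist (case p of (u, v) \<Rightarrow> graph_norm \<pi> a (u - v)) 0 < \<epsilon>"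
    proof eventually_elim
      case (elim p)
      obtain u v where p: "p = (u, v)" by (cases p)
      have uv: "u \<in> dom \<pi>" "v \<in> dom \<pi>" "norm (u - x) < \<epsilon> / 4" "norm (v - x) < \<epsilon> / 4"
        "norm (act \<pi> a u - y a) < \<epsilon> / 4" "norm (act \<pi> a v - y a) < \<epsilon> / 4"
        using elim by (auto simp: p S_def)
      have "norm (u - v) < \<epsilon> / 2"
        using norm_triangle_ineq4[of "u - x" "v - x"] uv by simp
      moreover have "norm (act \<pi> a u - act \<pi> a v) < \<epsilon> / 2"
        using norm_triangle_ineq4[of "act \<pi> a u - y a" "act \<pi> a v - y a"] uv by simp
      ultimately show ?case using uv a by (simp add: p graph_norm_def act_diff)
    qed
  qed
  ultimately obtain \<phi> where \<phi>: "\<phi> \<in> dom \<pi>" "limitin (graph_topology \<pi>) (\<lambda>x. x) \<phi> F"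
    using cl unfolding closed_rep_def by blast
  have "((\<lambda>u. graph_norm \<pi> 0 (u - \<phi>)) \<longlongrightarrow> 0) F"
    using \<phi>(2) csubspace_0[OF alg_csub] unfolding limitin_graph_iff by blast
  then have "((\<lambda>u. norm (u - \<phi>)) \<longlongrightarrow> 0) F"
    by (rule Lim_null_comparison[rotated]) (simp add: graph_norm_def)
  then have 1: "((\<lambda>u. u) \<longlongrightarrow> \<phi>) F" by (rule LIM_zero_cancel[OF tendsto_norm_zero_cancel])
  have 2: "((\<lambda>u. u) \<longlongrightarrow> x) F"
  proof (rule tendstoI)
    fix \<epsilon> :: real assume "\<epsilon> > 0"
    then show "\<forall>\<^sub>F u in F. dist u x < \<epsilon>"
      unfolding ev using csubspace_0[OF alg_csub] by (intro bexI[of _ "(0, \<epsilon>)"]) (auto simp: I_def S_def dist_norm)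
  qed
  from tendsto_unique[OF \<open>F \<noteq> bot\<close> 1 2] \<phi>(1) show ?thesis by simp
qed

end

section \<open>The space of positive characters and the partial action\<close>

lemma star_one [simp]: "star (1::'a::complex_star_algebra) = 1"
  by (metis mult_1_right star_mult star_star)

locale graded_algebra =
  fixes A :: "'g::group_add \<Rightarrow> 'a::complex_star_algebra set"
  assumes sa: "standing_assumptions A"
begin

lemma A_csub: "csubspace (A g)" and A_mult: "a \<in> A g \<Longrightarrow> b \<in> A h \<Longrightarrow> a * b \<in> A (g + h)"
  and A_star: "a \<in> A g \<Longrightarrow> star a \<in> A (- g)"
  and A_comm: "b \<in> A 0 \<Longrightarrow> c \<in> A 0 \<Longrightarrow> b * c = c * b"
  using sa by (auto simp: standing_assumptions_def graded_star_algebra_def)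

lemma A_decomp: "\<exists>!f. (\<forall>g. f g \<in> A g) \<and> finite {g. f g \<noteq> 0} \<and> a = (\<Sum>g | f g \<noteq> 0. f g)"
  using sa unfolding standing_assumptions_def graded_star_algebra_def by blast

lemma ex_homogeneous_sum:
  obtains f F where "finite F" "\<And>g. g \<in> F \<Longrightarrow> f g \<in> A g" "a = (\<Sum>g\<in>F. f g)"
proof -
  from ex1_implies_ex[OF A_decomp] obtain f where
    f: "(\<forall>g. f g \<in> A g) \<and> finite {g. f g \<noteq> 0} \<and> a = (\<Sum>g | f g \<noteq> 0. f g)" by blast
  show thesis by (rule that[of "{g. f g \<noteq> 0}" f]) (use f in blast)+
qed

lemma A_zero: "0 \<in> A g" and A_add: "a \<in> A g \<Longrightarrow> b \<in> A g \<Longrightarrow> a + b \<in> A g" and A_scaleC: "a \<in> A g \<Longrightarrow> c *\<^sub>C a \<in> A g"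
  using A_csub csubspaceD by blast+

lemma A0_mult: "a \<in> A 0 \<Longrightarrow> b \<in> A 0 \<Longrightarrow> a * b \<in> A 0" and A0_star: "a \<in> A 0 \<Longrightarrow> star a \<in> A 0"
  using A_mult[of a 0 b 0] A_star[of a 0] by auto

lemma A0_star_mult: "a \<in> A g \<Longrightarrow> c \<in> A g \<Longrightarrow> star a * c \<in> A 0" and A0_mult_star: "a \<in> A g \<Longrightarrow> c \<in> A g \<Longrightarrow> a * star c \<in> A 0"
  using A_mult[of "star a" "-g" c g] A_mult[of a g "star c" "-g"] A_star by auto

lemma A0_conj: "a \<in> A g \<Longrightarrow> c \<in> A g \<Longrightarrow> b \<in> A 0 \<Longrightarrow> star a * b * c \<in> A 0"
  using A_mult[of "star a * b" "-g" c g] A_mult[of "star a" "-g" b 0] A_star[of a g] by simp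

lemma A0_conj': "a \<in> A g \<Longrightarrow> b \<in> A 0 \<Longrightarrow> a * b * star a \<in> A 0"
  using A0_conj[of "star a" "-g" "star a" b] A_star by (simp add: star_star)

text \<open>The component of \<open>1\<close> of degree \<open>0\<close> acts as a unit on homogeneous elements, by uniqueness of
  homogeneous components.\<close>

lemma one_in_A0: "1 \<in> A 0"
proof -
  obtain f where f: "\<And>g. f g \<in> A g" "finite {g. f g \<noteq> 0}" "1 = (\<Sum>g | f g \<noteq> 0. f g)"
    using ex1_implies_ex[OF A_decomp[of 1]] by blast
  have unit: "f 0 * a = a" if a: "a \<in> A h" for a h
  proof -
    define F1 where "F1 k = (if k = h then a else 0)" for k
    define F2 where "F2 k = f (k - h) * a" for k
    have F1: "(\<forall>g. F1 g \<in> A g) \<and> finite {g. F1 g \<noteq> 0} \<and> a = (\<Sum>g | F1 g \<noteq> 0. F1 g)"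
    proof (intro conjI allI)
      show "F1 g \<in> A g" for g using a by (simp add: F1_def A_zero)
      have sub: "{g. F1 g \<noteq> 0} \<subseteq> {h}" by (auto simp: F1_def)
      then show fin: "finite {g. F1 g \<noteq> 0}" by (rule finite_subset) simp
      have "(\<Sum>g | F1 g \<noteq> 0. F1 g) = (\<Sum>g\<in>{h}. F1 g)" using sub by (intro sum.mono_neutral_left) auto
      then show "a = (\<Sum>g | F1 g \<noteq> 0. F1 g)" by (simp add: F1_def)
    qed
    have F2: "(\<forall>g. F2 g \<in> A g) \<and> finite {g. F2 g \<noteq> 0} \<and> a = (\<Sum>g | F2 g \<noteq> 0. F2 g)"
    proof (intro conjI allI)
      show "F2 g \<in> A g" for g using A_mult[OF f(1)[of "g - h"] a] by (simp add: F2_def)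
      have sub: "{g. F2 g \<noteq> 0} \<subseteq> (\<lambda>g. g + h) ` {g. f g \<noteq> 0}"
      proof
        fix k assume "k \<in> {g. F2 g \<noteq> 0}"
        then have "f (k - h) \<noteq> 0" by (auto simp: F2_def)
        then show "k \<in> (\<lambda>g. g + h) ` {g. f g \<noteq> 0}" by (intro image_eqI[of _ _ "k - h"]) auto
      qed
      then show "finite {g. F2 g \<noteq> 0}" using f(2) finite_subset by blast
      have "(\<Sum>g | F2 g \<noteq> 0. F2 g) = (\<Sum>g\<in>(\<lambda>g. g + h) ` {g. f g \<noteq> 0}. F2 g)"
        using sub f(2) by (intro sum.mono_neutral_left) auto
      also have "\<dots> = (\<Sum>g | f g \<noteq> 0. f g * a)" by (subst sum.reindex) (auto simp: F2_def inj_on_def)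
      also have "\<dots> = (\<Sum>g | f g \<noteq> 0. f g) * a" by (simp add: sum_distrib_right)
      also have "\<dots> = a" using f(3) by simp
      finally show "a = (\<Sum>g | F2 g \<noteq> 0. F2 g)" by simp
    qed
    have "F1 = F2" using A_decomp[of a] F1 F2 by blast
    then have "F1 h = F2 h" by simp
    then show ?thesis by (simp add: F1_def F2_def)
  qed
  have "f 0 * 1 = (\<Sum>g | f g \<noteq> 0. f 0 * f g)" by (subst f(3)) (simp add: sum_distrib_left)
  also have "\<dots> = (\<Sum>g | f g \<noteq> 0. f g)" using unit f(1) by (intro sum.cong) auto
  also have "\<dots> = 1" using f(3) by simp
  finally show ?thesis using f(1)[of 0] by simp
qed

lemma A0_subalgebra: "star_subalgebra (A 0)"
  by (auto simp: star_subalgebra_def A_csub A0_mult A0_star)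

subsection \<open>Characters\<close>

abbreviation X where "X \<equiv> pos_characters A"
abbreviation T where "T \<equiv> char_topology A"
abbreviation M where "M \<equiv> char_borel A"

lemma
  assumes "\<xi> \<in> X"
  shows char_add: "a \<in> A 0 \<Longrightarrow> b \<in> A 0 \<Longrightarrow> \<xi> (a + b) = \<xi> a + \<xi> b"
    and char_scaleC: "a \<in> A 0 \<Longrightarrow> \<xi> (c *\<^sub>C a) = c * \<xi> a"
    and char_mult: "a \<in> A 0 \<Longrightarrow> b \<in> A 0 \<Longrightarrow> \<xi> (a * b) = \<xi> a * \<xi> b"
    and char_star: "a \<in> A 0 \<Longrightarrow> \<xi> (star a) = cnj (\<xi> a)"
    and char_ext: "\<xi> \<in> extensional (A 0)"
    and char_pos: "x \<in> sums_of_squares \<Longrightarrow> x \<in> A 0 \<Longrightarrow> \<xi> x \<in> \<real>\<^sub>\<ge>\<^sub>0"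
  using assms by (auto simp: pos_characters_def characters_def)

lemma char_one: assumes "\<xi> \<in> X" shows "\<xi> 1 = 1"
proof -
  obtain a where a: "a \<in> A 0" "\<xi> a \<noteq> 0" using assms by (auto simp: pos_characters_def characters_def)
  have "\<xi> a = \<xi> a * \<xi> 1" using char_mult[OF assms a(1) one_in_A0] by simp
  with a(2) show ?thesis by simp
qed

lemma topspace_T: "topspace T = X"
proof -
  have "X \<in> {{\<xi> \<in> X. \<xi> b \<in> U} | b U. b \<in> A 0 \<and> open U}" using A_zero open_UNIV by blast
  then show ?thesis unfolding char_topology_def topology_generated_by_topspace by blast
qed

lemma openin_eval: "b \<in> A 0 \<Longrightarrow> open U \<Longrightarrow> openin T {\<xi> \<in> X. \<xi> b \<in> U}"
  unfolding char_topology_def by (rule topology_generated_by_Basis) blast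

lemma opens_Pow: "{U. openin T U} \<subseteq> Pow X"
  using openin_subset topspace_T by blast

lemma sets_M: "sets M = sigma_sets X {U. openin T U}" and space_M [simp]: "space M = X"
  using opens_Pow by (simp_all add: char_borel_def space_measure_of)

lemma openin_sets: "openin T U \<Longrightarrow> U \<in> sets M"
  by (simp add: sets_M sigma_sets.Basic)

lemma continuous_map_eval: "b \<in> A 0 \<Longrightarrow> continuous_map T euclidean (\<lambda>\<xi>. \<xi> b)"
  by (simp add: continuous_map_def topspace_T openin_eval)

lemma eval_measurable [measurable]: "b \<in> A 0 \<Longrightarrow> (\<lambda>\<xi>. \<xi> b) \<in> borel_measurable M"
  by (rule borel_measurableI) (auto intro!: openin_sets openin_eval simp: vimage_def Int_def conj_commute)

text \<open>Open sets described by countably many elements of the algebra. They generate the topology, and unlike arbitrary open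
  sets they are controlled by the operators of the representation.\<close>

definition cyl :: "(nat \<Rightarrow> 'a) \<Rightarrow> (nat \<Rightarrow> complex) set \<Rightarrow> ('a \<Rightarrow> complex) set" where
  "cyl \<beta> U = {\<xi> \<in> X. (\<lambda>n. \<xi> (\<beta> n)) \<in> U}"

definition \<V> :: "('a \<Rightarrow> complex) set set" where
  "\<V> = {cyl \<beta> U | \<beta> U. range \<beta> \<subseteq> A 0 \<and> open U}"

lemma \<V>I: "range \<beta> \<subseteq> A 0 \<Longrightarrow> open U \<Longrightarrow> cyl \<beta> U \<in> \<V>"
  by (auto simp: \<V>_def)

lemma openin_cyl: assumes "range \<beta> \<subseteq> A 0" "open U" shows "openin T (cyl \<beta> U)"
proof -
  have "continuous_map T (product_topology (\<lambda>n::nat. euclidean :: complex topology) UNIV) (\<lambda>\<xi> n. \<xi> (\<beta> n))"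
    using assms(1) by (subst continuous_map_componentwise_UNIV) (auto intro!: continuous_map_eval)
  then have "continuous_map T euclidean (\<lambda>\<xi> n. \<xi> (\<beta> n))" by (simp add: euclidean_product_topology)
  then have "openin T {\<xi> \<in> topspace T. (\<lambda>n. \<xi> (\<beta> n)) \<in> U}" using assms(2) by (intro openin_continuous_map_preimage) auto
  then show ?thesis by (simp add: cyl_def topspace_T)
qed

lemma closedin_cyl: assumes "range \<beta> \<subseteq> A 0" "closed U" shows "closedin T (cyl \<beta> U)"
proof -
  have "openin T (cyl \<beta> (- U))" using assms by (intro openin_cyl) auto
  moreover have "cyl \<beta> U \<subseteq> X" "topspace T - cyl \<beta> U = cyl \<beta> (- U)" by (auto simp: cyl_def topspace_T)
  ultimately show ?thesis by (simp add: closedin_def topspace_T)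
qed

lemma \<V>_openin: "V \<in> \<V> \<Longrightarrow> openin T V"
  by (auto simp: \<V>_def openin_cyl)

lemma \<V>_sets: "V \<in> \<V> \<Longrightarrow> V \<in> sets M"
  by (simp add: \<V>_openin openin_sets)

lemma continuous_on_reindex: "continuous_on UNIV (\<lambda>(x::nat \<Rightarrow> complex) n. x (r n :: nat))"
  by (intro continuous_on_coordinatewise_then_product) (auto intro: continuous_on_product_coordinates)

lemma open_reindex: "open U \<Longrightarrow> open {x :: nat \<Rightarrow> complex. (\<lambda>n. x (r n :: nat)) \<in> U}" for U :: "(nat \<Rightarrow> complex) set"
  using open_vimage[OF _ continuous_on_reindex, of U r] by (simp add: vimage_def)

lemma \<V>_UN: assumes "\<And>n::nat. S n \<in> \<V>" shows "(\<Union>n. S n) \<in> \<V>"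
proof -
  have "\<forall>n. \<exists>\<beta> U. S n = cyl \<beta> U \<and> range \<beta> \<subseteq> A 0 \<and> open U" using assms by (auto simp: \<V>_def)
  then obtain \<beta> U where S: "\<And>n. S n = cyl (\<beta> n) (U n)" "\<And>n. range (\<beta> n) \<subseteq> A 0" "\<And>n. open (U n)" by metis
  define \<gamma> where "\<gamma> k = \<beta> (fst (prod_decode k)) (snd (prod_decode k))" for k
  define W where "W = (\<Union>n. {x. (\<lambda>m. x (prod_encode (n, m))) \<in> U n})"
  have "open W" unfolding W_def using S(3) by (intro open_UN ballI open_reindex)
  moreover have "range \<gamma> \<subseteq> A 0" using S(2) by (auto simp: \<gamma>_def)
  moreover have "(\<Union>n. S n) = cyl \<gamma> W" unfolding S(1) by (auto simp: cyl_def W_def \<gamma>_def)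
  ultimately show ?thesis by (simp add: \<V>I)
qed

lemma \<V>_Int: assumes "V \<in> \<V>" "W \<in> \<V>" shows "V \<inter> W \<in> \<V>"
proof -
  obtain \<beta> U where V: "V = cyl \<beta> U" "range \<beta> \<subseteq> A 0" "open U" using assms by (auto simp: \<V>_def)
  obtain \<gamma> U' where W: "W = cyl \<gamma> U'" "range \<gamma> \<subseteq> A 0" "open U'" using assms by (auto simp: \<V>_def)
  define \<delta> where "\<delta> n = (if even n then \<beta> (n div 2) else \<gamma> (n div 2))" for n
  define Q where "Q = {x. (\<lambda>n. x (2 * n)) \<in> U} \<inter> {x. (\<lambda>n. x (2 * n + 1)) \<in> U'}"
  have "open Q" unfolding Q_def using V W by (intro open_Int open_reindex)
  moreover have "range \<delta> \<subseteq> A 0" using V W by (auto simp: \<delta>_def)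
  moreover have "V \<inter> W = cyl \<delta> Q" unfolding V W by (auto simp: cyl_def Q_def \<delta>_def)
  ultimately show ?thesis by (simp add: \<V>I)
qed

lemma \<V>_empty: "{} \<in> \<V>"
proof -
  have "cyl (\<lambda>_. 0) {} \<in> \<V>" by (intro \<V>I) (auto simp: A_zero)
  then show ?thesis by (simp add: cyl_def)
qed

lemma \<V>_space: "X \<in> \<V>"
proof -
  have "cyl (\<lambda>_. 0) UNIV \<in> \<V>" by (intro \<V>I) (auto simp: A_zero)
  then show ?thesis by (simp add: cyl_def)
qed

lemma \<V>_Un: assumes "V \<in> \<V>" "W \<in> \<V>" shows "V \<union> W \<in> \<V>"
proof -
  have "(\<Union>n. binaryset V W n) \<in> \<V>" using assms \<V>_empty by (intro \<V>_UN) (auto simp: binaryset_def)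
  then show ?thesis by (simp add: UN_binaryset_eq)
qed

lemma \<V>_eval: assumes "b \<in> A 0" "open U" shows "{\<xi> \<in> X. \<xi> b \<in> U} \<in> \<V>"
proof -
  have "open {x :: nat \<Rightarrow> complex. x 0 \<in> U}"
    using open_vimage[OF assms(2) continuous_on_product_coordinates, of "0::nat"] by (simp add: vimage_def)
  then have "cyl (\<lambda>_. b) {x. x 0 \<in> U} \<in> \<V>" using assms by (intro \<V>I) auto
  then show ?thesis by (simp add: cyl_def)
qed

lemma \<V>_base: assumes "openin T U" "\<xi> \<in> U" shows "\<exists>V\<in>\<V>. \<xi> \<in> V \<and> V \<subseteq> U"
proof -
  have "generate_topology_on {{\<xi> \<in> X. \<xi> b \<in> U} | b U. b \<in> A 0 \<and> open U} U"
    using assms(1) by (simp add: char_topology_def openin_topology_generated_by_iff)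
  then have "\<xi> \<in> U \<Longrightarrow> ?thesis"
  proof induction
    case (Int a b)
    have "\<exists>V\<in>\<V>. \<xi> \<in> V \<and> V \<subseteq> a" "\<exists>W\<in>\<V>. \<xi> \<in> W \<and> W \<subseteq> b" using Int by blast+
    then obtain V W where VW: "V \<in> \<V>" "\<xi> \<in> V" "V \<subseteq> a" "W \<in> \<V>" "\<xi> \<in> W" "W \<subseteq> b" by blast
    show ?case using \<V>_Int[OF VW(1,4)] VW by (intro bexI[of _ "V \<inter> W"]) auto
  next
    case (UN K)
    then obtain k where "k \<in> K" "\<xi> \<in> k" by blast
    with UN(2)[of k] show ?case by blast
  next
    case (Basis s)
    then have "s \<in> \<V>" using \<V>_eval by blast
    with Basis(2) show ?case by (intro bexI[of _ s]) auto
  qed simp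
  with assms(2) show ?thesis by blast
qed

text \<open>Over the metric space of sequences, an open set is exhausted by the points at distance more than
  \<open>1 / (n + 1)\<close> from its complement.\<close>

lemma \<V>_inner: assumes "V \<in> \<V>"
  shows "\<exists>W Z. incseq W \<and> (\<Union>n. W n) = V \<and> (\<forall>n::nat. W n \<in> \<V> \<and> closedin T (Z n) \<and> W n \<subseteq> Z n \<and> Z n \<subseteq> V)"
proof -
  obtain \<beta> U where V: "V = cyl \<beta> U" "range \<beta> \<subseteq> A 0" "open U" using assms by (auto simp: \<V>_def)
  show ?thesis
  proof (cases "U = UNIV")
    case True
    then have "closedin T V" unfolding V using V(2) by (intro closedin_cyl) auto
    then show ?thesis using assms by (intro exI[of _ "\<lambda>_. V"]) auto
  next
    case False
    define C where "C = - U"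
    have C: "closed C" "C \<noteq> {}" using V(3) False by (auto simp: C_def)
    define P where "P n = {x. 1 / real (Suc n) < infdist x C}" for n
    define Q where "Q n = {x. 1 / real (Suc n) \<le> infdist x C}" for n
    have P: "open (P n)" for n unfolding P_def by (intro open_Collect_less continuous_intros)
    have Q: "closed (Q n)" for n unfolding Q_def by (intro closed_Collect_le continuous_intros)
    have pos: "x \<in> U \<longleftrightarrow> 0 < infdist x C" for x
      using in_closed_iff_infdist_zero[OF C, of x] infdist_nonneg[of x C] by (auto simp: C_def less_le)
    have QU: "Q n \<subseteq> U" for n
    proof
      fix x assume "x \<in> Q n"
      then have "1 / real (Suc n) \<le> infdist x C" by (simp add: Q_def)
      then have "0 < infdist x C" by (rule less_le_trans[rotated]) simp
      then show "x \<in> U" by (simp add: pos)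
    qed
    have inc: "P m \<subseteq> P n" if "m \<le> n" for m n
    proof
      fix x assume x: "x \<in> P m"
      have "1 / real (Suc n) \<le> 1 / real (Suc m)" using that by (intro divide_left_mono) auto
      with x show "x \<in> P n" by (simp add: P_def)
    qed
    have UP: "\<exists>n. x \<in> P n" if "x \<in> U" for x
      using that reals_Archimedean[of "infdist x C"] unfolding pos P_def by (auto simp: inverse_eq_divide)
    show ?thesis
    proof (rule exI[of _ "\<lambda>n. cyl \<beta> (P n)"], rule exI[of _ "\<lambda>n. cyl \<beta> (Q n)"], intro conjI allI)
      show "incseq (\<lambda>n. cyl \<beta> (P n))" using inc by (intro monoI) (auto simp: cyl_def)
      have "P n \<subseteq> U" for n using QU[of n] by (auto simp: P_def Q_def)
      then show "(\<Union>n. cyl \<beta> (P n)) = V" using UP unfolding V by (fastforce simp: cyl_def)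
      fix n
      show "cyl \<beta> (P n) \<in> \<V>" using V P by (intro \<V>I) auto
      show "closedin T (cyl \<beta> (Q n))" using V Q by (intro closedin_cyl) auto
      show "cyl \<beta> (P n) \<subseteq> cyl \<beta> (Q n)" by (auto simp: cyl_def P_def Q_def)
      show "cyl \<beta> (Q n) \<subseteq> V" using QU[of n] unfolding V by (auto simp: cyl_def)
    qed
  qed
qed

subsection \<open>The partial action of the group on the characters\<close>

text \<open>The standing assumption on mixed products makes the defining quotient independent of the chosen
  homogeneous element.\<close>

lemma char_act_eq:
  assumes \<xi>: "\<xi> \<in> X" and a: "a \<in> A g" "\<xi> (star a * a) \<noteq> 0"
  shows "char_act A g \<xi> = (\<lambda>b\<in>A 0. \<xi> (star a * b * a) / \<xi> (star a * a))"
proof -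
  define c where "c = (SOME a. a \<in> A g \<and> \<xi> (star a * a) \<noteq> 0)"
  have c: "c \<in> A g" "\<xi> (star c * c) \<noteq> 0"
    unfolding c_def using someI[of "\<lambda>a. a \<in> A g \<and> \<xi> (star a * a) \<noteq> 0" a] a by auto
  have mixed: "\<xi> (star a * c) * \<xi> (star c * a) = \<xi> (star a * a) * \<xi> (star c * c)"
    using sa \<xi> a c unfolding standing_assumptions_def by blast
  then have nz: "\<xi> (star c * a) \<noteq> 0" using a c by auto
  have key: "\<xi> (star d * b * d) * \<xi> (star c * a) = \<xi> (star d * d) * \<xi> (star c * b * a)"
    if d: "d = a \<or> d = c" and b: "b \<in> A 0" for d b
  proof -
    have mult: "\<xi> (x * y) = \<xi> x * \<xi> y" if "x \<in> A 0" "y \<in> A 0" for x y using char_mult[OF \<xi>] that by blast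
    show ?thesis
    proof (cases "d = a")
      case True
      have "(star c * a) * (star a * b * a) = star c * ((a * star a) * b) * a" by (simp add: mult.assoc)
      also have "(a * star a) * b = b * (a * star a)" using a b by (intro A_comm A0_mult_star)
      also have "star c * (b * (a * star a)) * a = (star c * b * a) * (star a * a)" by (simp add: mult.assoc)
      finally have "\<xi> ((star c * a) * (star a * b * a)) = \<xi> ((star c * b * a) * (star a * a))" by simp
      then show ?thesis using True a c b by (simp add: mult A0_conj A0_star_mult mult.commute)
    next
      case False
      then have d: "d = c" using that by blast
      have "(star c * b * c) * (star c * a) = star c * (b * (c * star c)) * a" by (simp add: mult.assoc)
      also have "b * (c * star c) = (c * star c) * b" using c b by (intro A_comm A0_mult_star)
      also have "star c * ((c * star c) * b) * a = (star c * c) * (star c * b * a)" by (simp add: mult.assoc)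
      finally have "\<xi> ((star c * b * c) * (star c * a)) = \<xi> ((star c * c) * (star c * b * a))" by simp
      then show ?thesis using d a c b by (simp add: mult A0_conj A0_star_mult)
    qed
  qed
  have "\<xi> (star c * b * c) / \<xi> (star c * c) = \<xi> (star a * b * a) / \<xi> (star a * a)" if b: "b \<in> A 0" for b
  proof -
    have "\<xi> (star c * b * c) / \<xi> (star c * c) = \<xi> (star c * b * a) / \<xi> (star c * a)"
      using key[of c b] b c nz by (simp add: frac_eq_eq mult.commute)
    also have "\<dots> = \<xi> (star a * b * a) / \<xi> (star a * a)"
      using key[of a b] b a nz by (simp add: frac_eq_eq mult.commute)
    finally show ?thesis .
  qed
  then show ?thesis unfolding char_act_def Let_def c_def[symmetric] by (intro restrict_ext) auto
qed

lemma char_sq_nonneg: "\<xi> \<in> X \<Longrightarrow> a \<in> A g \<Longrightarrow> \<xi> (star a * a) \<in> \<real>\<^sub>\<ge>\<^sub>0"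
proof -
  assume "\<xi> \<in> X" "a \<in> A g"
  have "star a * a \<in> sums_of_squares"
    unfolding sums_of_squares_def by (rule CollectI, rule exI[of _ "[a]"]) simp
  then show ?thesis using \<open>\<xi> \<in> X\<close> \<open>a \<in> A g\<close> by (intro char_pos A0_star_mult)
qed

lemma sums_of_squares_conj: "x \<in> sums_of_squares \<Longrightarrow> star a * x * a \<in> sums_of_squares"
proof -
  assume "x \<in> sums_of_squares"
  then obtain as where x: "x = (\<Sum>c\<leftarrow>as. star c * c)" by (auto simp: sums_of_squares_def)
  have "star a * (\<Sum>c\<leftarrow>as. star c * c) * a = (\<Sum>c\<leftarrow>map (\<lambda>c. c * a) as. star c * c)"
    by (induction as) (auto simp: algebra_simps star_mult mult.assoc)
  then show ?thesis unfolding x sums_of_squares_def by blast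
qed

text \<open>Multiplicativity rests on \<open>a * star a\<close> having degree zero, so that it commutes with \<open>b\<close>.\<close>

lemma char_act_in:
  assumes \<xi>: "\<xi> \<in> X" and a: "a \<in> A g" "\<xi> (star a * a) \<noteq> 0"
  shows "char_act A g \<xi> \<in> X"
proof -
  define \<eta> where "\<eta> = (\<lambda>b\<in>A 0. \<xi> (star a * b * a) / \<xi> (star a * a))"
  have \<eta>: "\<eta> b = \<xi> (star a * b * a) / \<xi> (star a * a)" if "b \<in> A 0" for b using that by (simp add: \<eta>_def)
  have aa: "star a * a \<in> A 0" using a by (intro A0_star_mult)
  have "\<eta> \<in> characters (A 0)"
    unfolding characters_def
  proof (intro CollectI conjI ballI allI)
    show "\<eta> \<in> extensional (A 0)" by (simp add: \<eta>_def)
    fix b assume b: "b \<in> A 0"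
    show "\<eta> (c *\<^sub>C b) = c * \<eta> b" for c
      using b a by (simp add: \<eta> A_scaleC mult_scaleC_left mult_scaleC_right char_scaleC[OF \<xi>] A0_conj)
    have "cnj (\<xi> (star a * a)) = \<xi> (star (star a * a))" by (rule char_star[OF \<xi> aa, symmetric])
    then have r: "cnj (\<xi> (star a * a)) = \<xi> (star a * a)" by (simp add: star_mult star_star)
    have "\<xi> (star (star a * b * a)) = cnj (\<xi> (star a * b * a))" using a b by (intro char_star[OF \<xi>] A0_conj)
    then show "\<eta> (star b) = cnj (\<eta> b)" using b r by (simp add: \<eta> A0_star star_mult star_star mult.assoc)
    fix c assume c: "c \<in> A 0"
    show "\<eta> (b + c) = \<eta> b + \<eta> c"
      using b c a by (simp add: \<eta> A_add distrib_left distrib_right char_add[OF \<xi>] A0_conj add_divide_distrib)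
    have "(star a * b * a) * (star a * c * a) = star a * (b * (a * star a)) * c * a" by (simp add: mult.assoc)
    also have "b * (a * star a) = (a * star a) * b" using a b by (intro A_comm A0_mult_star)
    also have "star a * ((a * star a) * b) * c * a = (star a * a) * (star a * (b * c) * a)" by (simp add: mult.assoc)
    finally have "\<xi> ((star a * b * a) * (star a * c * a)) = \<xi> ((star a * a) * (star a * (b * c) * a))" by simp
    then have "\<xi> (star a * b * a) * \<xi> (star a * c * a) = \<xi> (star a * a) * \<xi> (star a * (b * c) * a)"
      using a b c by (simp add: char_mult[OF \<xi>] A0_conj A0_mult aa)
    then show "\<eta> (b * c) = \<eta> b * \<eta> c" using a(2) b c by (simp add: \<eta> A0_mult field_simps)
  next
    show "\<exists>b\<in>A 0. \<eta> b \<noteq> 0" using one_in_A0 a(2) by (intro bexI[of _ 1]) (auto simp: \<eta>)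
  qed
  moreover have "\<eta> x \<in> \<real>\<^sub>\<ge>\<^sub>0" if "x \<in> sums_of_squares \<inter> A 0" for x
    using that a \<xi> by (simp add: \<eta> nonneg_Reals_divide_I char_pos char_sq_nonneg sums_of_squares_conj A0_conj)
  ultimately show ?thesis unfolding char_act_eq[OF assms] \<eta>_def[symmetric] by (simp add: pos_characters_def)
qed

lemma char_act_mult_star:
  assumes \<xi>: "\<xi> \<in> X" and a: "a \<in> A g" "\<xi> (star a * a) \<noteq> 0"
  shows "char_act A g \<xi> (a * star a) = \<xi> (star a * a)"
proof -
  have aa: "star a * a \<in> A 0" "a * star a \<in> A 0" using a by (auto intro: A0_star_mult A0_mult_star)
  have "star a * (a * star a) * a = (star a * a) * (star a * a)" by (simp add: mult.assoc)
  then show ?thesis using a aa by (simp add: char_act_eq[OF assms] char_mult[OF \<xi>])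
qed

lemma char_act_inverse:
  assumes \<xi>: "\<xi> \<in> X" and a: "a \<in> A g" "\<xi> (star a * a) \<noteq> 0"
  shows "char_act A (- g) (char_act A g \<xi>) = \<xi>"
proof
  fix b
  have aa: "star a * a \<in> A 0" using a by (auto intro: A0_star_mult)
  have s: "star (star a) * star a = a * star a" by (simp add: star_star)
  have nz: "char_act A g \<xi> (star (star a) * star a) \<noteq> 0" using char_act_mult_star[OF assms] a(2) by (simp add: s)
  note eq = char_act_eq[OF char_act_in[OF assms] A_star[OF a(1)] nz]
  show "char_act A (- g) (char_act A g \<xi>) b = \<xi> b"
  proof (cases "b \<in> A 0")
    case True
    have "star a * (a * b * star a) * a = (star a * a) * b * (star a * a)" by (simp add: mult.assoc)
    then have "char_act A g \<xi> (a * b * star a) = \<xi> (star a * a) * \<xi> b"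
      using True a aa by (simp add: char_act_eq[OF assms] A0_conj' char_mult[OF \<xi>] A0_mult)
    then show ?thesis using True a(2) char_act_mult_star[OF assms] by (simp add: eq star_star)
  next
    case False
    then show ?thesis using char_ext[OF \<xi>] by (simp add: eq extensional_def)
  qed
qed

lemma char_act_zero: assumes "\<xi> \<in> X" shows "char_act A 0 \<xi> = \<xi>"
proof -
  have "char_act A 0 \<xi> = (\<lambda>b\<in>A 0. \<xi> b)" using char_act_eq[OF assms one_in_A0] char_one[OF assms] by simp
  then show ?thesis using char_ext[OF assms] by (simp add: extensional_restrict)
qed

lemma set_act_zero: assumes "\<Delta> \<subseteq> X" shows "set_act A 0 \<Delta> = \<Delta>"
proof -
  have "X \<subseteq> act_dom A 0" using one_in_A0 char_one by (force simp: act_dom_def)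
  then show ?thesis using assms char_act_zero by (force simp: set_act_def)
qed

text \<open>The open set where a homogeneous element does not vanish, and the transport of a set of
  characters by such an element.\<close>

definition nonvanishing :: "'a \<Rightarrow> ('a \<Rightarrow> complex) set" where
  "nonvanishing a = {\<xi> \<in> X. \<xi> (star a * a) \<noteq> 0}"

definition transport :: "'g \<Rightarrow> 'a \<Rightarrow> ('a \<Rightarrow> complex) set \<Rightarrow> ('a \<Rightarrow> complex) set" where
  "transport g a \<Delta> = {\<xi> \<in> nonvanishing (star a). char_act A (- g) \<xi> \<in> \<Delta>}"

lemma nonvanishing_\<V>: "a \<in> A g \<Longrightarrow> nonvanishing a \<in> \<V>"
  using \<V>_eval[OF A0_star_mult, of a g a "- {0}"] by (simp add: nonvanishing_def open_Compl)

lemma nonvanishing_sets: "a \<in> A g \<Longrightarrow> nonvanishing a \<in> sets M"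
  by (simp add: nonvanishing_\<V> \<V>_sets)

lemma char_act_nonvanishing: assumes "a \<in> A g" "\<xi> \<in> nonvanishing a" shows "char_act A g \<xi> \<in> nonvanishing (star a)"
  using assms char_act_in[of \<xi> a g] char_act_mult_star[of \<xi> a g] by (simp add: nonvanishing_def star_star)

lemma char_act_nonvanishing': assumes "a \<in> A g" "\<xi> \<in> nonvanishing (star a)" shows "char_act A (- g) \<xi> \<in> nonvanishing a" "char_act A g (char_act A (- g) \<xi>) = \<xi>"
  using char_act_nonvanishing[OF A_star[OF assms(1)] assms(2)] char_act_inverse[OF _ A_star[OF assms(1)], of \<xi>] assms
  by (simp_all add: star_star nonvanishing_def)

lemma transport_eq: assumes "a \<in> A g" "\<Delta> \<subseteq> X" shows "transport g a \<Delta> = char_act A g ` (\<Delta> \<inter> nonvanishing a)"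
proof
  show "transport g a \<Delta> \<subseteq> char_act A g ` (\<Delta> \<inter> nonvanishing a)"
    using char_act_nonvanishing'[OF assms(1)] by (force simp: transport_def)
  show "char_act A g ` (\<Delta> \<inter> nonvanishing a) \<subseteq> transport g a \<Delta>"
    using char_act_nonvanishing[OF assms(1)] char_act_inverse[OF _ assms(1)] by (auto simp: transport_def nonvanishing_def)
qed

lemma set_act_nonvanishing: assumes "a \<in> A g" "\<Delta> \<subseteq> X" shows "set_act A g (\<Delta> \<inter> nonvanishing a) = transport g a \<Delta>"
proof -
  have "nonvanishing a \<subseteq> act_dom A g" using assms by (auto simp: nonvanishing_def act_dom_def)
  then show ?thesis unfolding transport_eq[OF assms] set_act_def by (metis Int_absorb2 Int_assoc)
qed

lemma transport_inverse:
  assumes "a \<in> A g" "V \<subseteq> X" shows "transport g a (transport (- g) (star a) V) = V \<inter> nonvanishing (star a)"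
  using char_act_nonvanishing'[OF assms(1)] by (auto simp: transport_def star_star)

lemma transport_subset: "transport g a \<Delta> \<subseteq> nonvanishing (star a)" "nonvanishing a \<subseteq> X"
  by (auto simp: transport_def nonvanishing_def)

lemma transport_\<V>: assumes a: "a \<in> A g" and V: "V \<in> \<V>" shows "transport g a V \<in> \<V>"
proof -
  obtain \<beta> U where V: "V = cyl \<beta> U" "range \<beta> \<subseteq> A 0" "open U" using V by (auto simp: \<V>_def)
  define \<gamma> where "\<gamma> n = (case n of 0 \<Rightarrow> a * star a | Suc k \<Rightarrow> a * \<beta> k * star a)" for n
  define Q where "Q = {x :: nat \<Rightarrow> complex. x 0 \<noteq> 0} \<inter> (\<lambda>x n. x (Suc n) / x 0) -` U"
  have o: "open {x :: nat \<Rightarrow> complex. x 0 \<noteq> 0}"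
    by (rule open_Collect_neq) (auto intro: continuous_on_product_coordinates continuous_on_const)
  have c: "continuous_on {x :: nat \<Rightarrow> complex. x 0 \<noteq> 0} (\<lambda>x n. x (Suc n) / x 0)"
    by (intro continuous_on_coordinatewise_then_product continuous_on_divide
        continuous_on_subset[OF continuous_on_product_coordinates]) auto
  have "open Q" unfolding Q_def by (rule continuous_open_preimage[OF c o V(3)])
  moreover have "range \<gamma> \<subseteq> A 0" 
  proof -
    have "\<beta> k \<in> A 0" for k using V(2) by blast
    then show ?thesis using a by (auto simp: \<gamma>_def A0_mult_star A0_conj' split: nat.split)
  qed
  moreover have "transport g a V = cyl \<gamma> Q"
  proof -
    have "char_act A (- g) \<xi> \<in> V \<longleftrightarrow> (\<lambda>n. \<xi> (\<gamma> (Suc n)) / \<xi> (\<gamma> 0)) \<in> U" if \<xi>: "\<xi> \<in> X" "\<xi> (a * star a) \<noteq> 0" for \<xi>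
    proof -
      have nz: "\<xi> (star (star a) * star a) \<noteq> 0" using \<xi> by (simp add: star_star)
      have "char_act A (- g) \<xi> (\<beta> n) = \<xi> (\<gamma> (Suc n)) / \<xi> (\<gamma> 0)" for n
        using V(2) by (simp add: char_act_eq[OF \<xi>(1) A_star[OF a] nz] star_star \<gamma>_def range_subsetD)
      then show ?thesis using char_act_in[OF \<xi>(1) A_star[OF a] nz] by (simp add: V(1) cyl_def)
    qed
    then show ?thesis by (auto simp: transport_def nonvanishing_def cyl_def Q_def star_star \<gamma>_def)
  qed
  ultimately show ?thesis by (simp add: \<V>I)
qed

lemma transport_openin: assumes a: "a \<in> A g" and U: "openin T U" shows "openin T (transport g a U)"
proof (subst openin_subopen, intro ballI)
  fix \<xi> assume \<xi>: "\<xi> \<in> transport g a U"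
  then obtain V where V: "V \<in> \<V>" "char_act A (- g) \<xi> \<in> V" "V \<subseteq> U" using \<V>_base[OF U] by (auto simp: transport_def)
  show "\<exists>S. openin T S \<and> \<xi> \<in> S \<and> S \<subseteq> transport g a U"
    using \<xi> V \<V>_openin[OF transport_\<V>[OF a V(1)]] by (intro exI[of _ "transport g a V"]) (auto simp: transport_def)
qed

lemma set_act_eq: assumes "\<Delta> \<subseteq> X" shows "set_act A g \<Delta> = {\<xi> \<in> act_dom A (- g). char_act A (- g) \<xi> \<in> \<Delta>}"
proof -
  have "act_dom A g = (\<Union>a\<in>A g. nonvanishing a)" by (auto simp: act_dom_def nonvanishing_def)
  then have "set_act A g \<Delta> = (\<Union>a\<in>A g. char_act A g ` (\<Delta> \<inter> nonvanishing a))" by (auto simp: set_act_def)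
  also have "\<dots> = (\<Union>a\<in>A g. transport g a \<Delta>)" using transport_eq assms by simp
  also have "\<dots> = {\<xi> \<in> act_dom A (- g). char_act A (- g) \<xi> \<in> \<Delta>}"
  proof -
    have "act_dom A (- g) = (\<Union>a\<in>A g. nonvanishing (star a))"
    proof
      show "act_dom A (- g) \<subseteq> (\<Union>a\<in>A g. nonvanishing (star a))"
      proof
        fix \<xi> assume "\<xi> \<in> act_dom A (- g)"
        then obtain c where c: "\<xi> \<in> X" "c \<in> A (- g)" "\<xi> (star c * c) \<noteq> 0" by (auto simp: act_dom_def)
        then show "\<xi> \<in> (\<Union>a\<in>A g. nonvanishing (star a))"
          using A_star[OF c(2)] by (intro UN_I[of "star c"]) (auto simp: nonvanishing_def star_star)
      qed
      show "(\<Union>a\<in>A g. nonvanishing (star a)) \<subseteq> act_dom A (- g)"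
      proof
        fix \<xi> assume "\<xi> \<in> (\<Union>a\<in>A g. nonvanishing (star a))"
        then obtain a where a: "a \<in> A g" "\<xi> \<in> nonvanishing (star a)" by blast
        from a(2) A_star[OF a(1)] show "\<xi> \<in> act_dom A (- g)" unfolding act_dom_def nonvanishing_def by blast
      qed
    qed
    then show ?thesis by (auto simp: transport_def)
  qed
  finally show ?thesis .
qed

lemma set_act_transport: assumes "a \<in> A g" "\<Delta> \<subseteq> X" shows "set_act A g \<Delta> \<inter> nonvanishing (star a) = transport g a \<Delta>"
proof -
  have "nonvanishing (star a) \<subseteq> act_dom A (- g)" unfolding act_dom_def nonvanishing_def using A_star[OF assms(1)] by blast
  then show ?thesis unfolding set_act_eq[OF assms(2)] by (auto simp: transport_def)
qed

lemma set_act_sets: assumes "\<Delta> \<in> sets M" shows "set_act A g \<Delta> \<in> sets M"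
proof -
  have opn: "openin T (set_act A g U)" if U: "openin T U" for U
  proof -
    have UX: "U \<subseteq> X" using U opens_Pow by blast
    have "set_act A g U = (\<Union>a\<in>A g. transport g a U)"
    proof -
      have "act_dom A g = (\<Union>a\<in>A g. nonvanishing a)" by (auto simp: act_dom_def nonvanishing_def)
      then have "set_act A g U = (\<Union>a\<in>A g. char_act A g ` (U \<inter> nonvanishing a))" by (auto simp: set_act_def)
      then show ?thesis using transport_eq UX by simp
    qed
    then show ?thesis using transport_openin U by auto
  qed
  have "\<Delta> \<in> sigma_sets X {U. openin T U}" using assms by (simp add: sets_M)
  then show ?thesis
  proof induction
    case (Basic U) then show ?case using opn openin_sets by blast
  next
    case Empty then show ?case by (simp add: set_act_def)
  next
    case (Compl \<Delta>)
    have D: "\<Delta> \<subseteq> X" using Compl sigma_sets_into_sp[OF opens_Pow] by blast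
    have "set_act A g (X - \<Delta>) = set_act A g X - set_act A g \<Delta>"
      using char_act_in by (auto simp: set_act_eq[OF D] set_act_eq act_dom_def)
    moreover have "set_act A g X \<in> sets M" using openin_sets[OF opn[OF \<V>_openin[OF \<V>_space]]] .
    ultimately show ?case using Compl by auto
  next
    case (Union S)
    have "set_act A g (\<Union>n. S n) = (\<Union>n. set_act A g (S n))" by (auto simp: set_act_def)
    then show ?case using Union by auto
  qed
qed

lemma transport_sets: assumes "a \<in> A g" "\<Delta> \<in> sets M" shows "transport g a \<Delta> \<in> sets M"
proof -
  have "\<Delta> \<subseteq> X" using sets.sets_into_space[OF assms(2)] by simp
  then show ?thesis
    using set_act_transport[OF assms(1), of \<Delta>] set_act_sets[OF assms(2), of g] nonvanishing_sets[OF A_star[OF assms(1)]]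
    by (metis sets.Int)
qed

end

section \<open>Truncation of well-behaved representations\<close>

text \<open>A countable base at \<open>0\<close> of the graph topology gives countably many algebra elements whose
  graph norms dominate all others.\<close>

lemma (in star_representation) ex_countable_dominating:
  assumes "metrizable_space (graph_topology \<pi>)"
  shows "\<exists>S\<subseteq>alg \<pi>. countable S \<and> (\<forall>a\<in>alg \<pi>. \<exists>c\<in>S. \<exists>C\<ge>0. \<forall>u\<in>dom \<pi>. norm (act \<pi> a u) \<le> C * (norm u + norm (act \<pi> c u)))"
proof -
  have d0: "0 \<in> dom \<pi>" by (rule csubspace_0[OF dom_sub])
  obtain \<B> where B: "countable \<B>" "\<And>V. V \<in> \<B> \<Longrightarrow> openin (graph_topology \<pi>) V"
    "\<And>U. openin (graph_topology \<pi>) U \<Longrightarrow> 0 \<in> U \<Longrightarrow> \<exists>V\<in>\<B>. 0 \<in> V \<and> V \<subseteq> U"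
    using metrizable_imp_first_countable[OF assms] d0 unfolding first_countable_def topspace_graph by meson
  have "\<exists>a e. V \<in> \<B> \<and> 0 \<in> V \<longrightarrow> a \<in> alg \<pi> \<and> e > (0::real) \<and> {\<psi> \<in> dom \<pi>. graph_norm \<pi> a \<psi> < e} \<subseteq> V" for V
    using graph_ball_subset[OF B(2), of V 0] by auto
  then obtain c e where ce: "\<And>V. V \<in> \<B> \<Longrightarrow> 0 \<in> V \<Longrightarrow> c V \<in> alg \<pi> \<and> e V > (0::real) \<and> {\<psi> \<in> dom \<pi>. graph_norm \<pi> (c V) \<psi> < e V} \<subseteq> V"
    by metis
  show ?thesis
  proof (intro exI[of _ "c ` {V \<in> \<B>. 0 \<in> V}"] conjI ballI)
    show "c ` {V \<in> \<B>. 0 \<in> V} \<subseteq> alg \<pi>" using ce by auto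
    show "countable (c ` {V \<in> \<B>. 0 \<in> V})" using B(1) by auto
    fix a assume a: "a \<in> alg \<pi>"
    have o: "openin (graph_topology \<pi>) {\<psi> \<in> dom \<pi>. graph_norm \<pi> a (\<psi> - 0) < 1}"
      using a d0 by (rule openin_graph_ball) simp
    have "0 \<in> {\<psi> \<in> dom \<pi>. graph_norm \<pi> a (\<psi> - 0) < 1}" using d0 a by (simp add: graph_norm_def)
    from B(3)[OF o this] obtain V where V: "V \<in> \<B>" "0 \<in> V" "V \<subseteq> {\<psi> \<in> dom \<pi>. graph_norm \<pi> a (\<psi> - 0) < 1}"
      by blast
    have bound: "norm (act \<pi> a u) \<le> 2 / e V * (norm u + norm (act \<pi> (c V) u))" if u: "u \<in> dom \<pi>" for u
    proof (cases "u = 0")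
      case True then show ?thesis using a ce[OF V(1,2)] by simp
    next
      case False
      define t where "t = 2 / e V * (norm u + norm (act \<pi> (c V) u))"
      have e: "e V > 0" using ce V by blast
      have t: "t > 0" using False e by (simp add: t_def add_pos_nonneg)
      define w where "w = complex_of_real (1 / t) *\<^sub>C u"
      have w: "w \<in> dom \<pi>" unfolding w_def using u by (intro csubspace_scaleC[OF dom_sub])
      have nw: "graph_norm \<pi> d w = (1 / t) * graph_norm \<pi> d u" if "d \<in> alg \<pi>" for d
        using that u t unfolding graph_norm_def w_def by (simp add: act_scaleC norm_scaleC norm_divide add_divide_distrib)
      have "graph_norm \<pi> (c V) w = e V / 2"
      proof -
        define q where "q = norm u + norm (act \<pi> (c V) u)"
        have "q > 0" using False by (simp add: q_def add_pos_nonneg)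
        have "graph_norm \<pi> (c V) w = 1 / t * q" using nw[of "c V"] ce[OF V(1,2)] by (simp add: graph_norm_def q_def)
        also have "\<dots> = e V / 2" unfolding t_def q_def[symmetric] using \<open>q > 0\<close> e by (simp add: field_simps)
        finally show ?thesis .
      qed
      then have "w \<in> V" using ce[OF V(1,2)] w e by auto
      then have "graph_norm \<pi> a w < 1" using V by auto
      then have "graph_norm \<pi> a u < t" using t by (simp add: nw[OF a] field_simps)
      then have "norm (act \<pi> a u) \<le> t" using norm_ge_zero[of u] unfolding graph_norm_def by linarith
      then show ?thesis by (simp add: t_def)
    qed
    have "0 \<le> 2 / e V" using ce[OF V(1,2)] by simp
    with bound V show "\<exists>c\<in>c ` {V \<in> \<B>. 0 \<in> V}. \<exists>C\<ge>0. \<forall>u\<in>dom \<pi>. norm (act \<pi> a u) \<le> C * (norm u + norm (act \<pi> c u))"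
      by blast
  qed
qed

lemma Res_simps [simp]: "alg (Res B \<pi>) = B" "dom (Res B \<pi>) = dom \<pi>" "hilb (Res B \<pi>) = hilb \<pi>" "act (Res B \<pi>) = act \<pi>"
  "rep_op (Res B \<pi>) b = rep_op \<pi> b" "graph_norm (Res B \<pi>) = graph_norm \<pi>"
  by (simp_all add: Res_def rep_op_def graph_norm_def fun_eq_iff)

locale well_behaved_rep = graded_algebra A + star_representation \<pi>
  for A :: "'g::group_add \<Rightarrow> 'a::complex_star_algebra set" and \<pi> :: "('a, 'h::complex_hilbert_space) rep" +
  fixes E :: "('a \<Rightarrow> complex) set \<Rightarrow> 'h \<Rightarrow> 'h"
  assumes alg_UNIV: "alg \<pi> = UNIV"
    and int: "integrable_rep (Res (A 0) \<pi>)"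
    and spec: "spectral_measure (char_borel A) (hilb \<pi>) E"
    and SI: "\<And>b. b \<in> A 0 \<Longrightarrow> closure (rep_op \<pi> b) = spectral_integral (char_borel A) (hilb \<pi>) E (\<lambda>\<xi>. \<xi> b)"
    and cov: "\<And>g a \<Delta>. a \<in> A g \<Longrightarrow> \<Delta> \<in> sets (char_borel A) \<Longrightarrow>
      rep_op \<pi> a O op_graph (hilb \<pi>) (E (set_act A g \<Delta>)) \<subseteq> op_graph (hilb \<pi>) (E \<Delta>) O rep_op \<pi> a"
    and metr: "metrizable_space (graph_topology \<pi>)"

sublocale well_behaved_rep \<subseteq> spectral "char_borel A" "hilb \<pi>" E
  by unfold_locales (rule hilb_sub hilb_closed spec)+

context well_behaved_rep
begin

abbreviation D where "D \<equiv> dom \<pi>"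
abbreviation H where "H \<equiv> hilb \<pi>"

lemma in_alg [simp]: "a \<in> alg \<pi>"
  by (simp add: alg_UNIV)

lemma in_domI:
  assumes "\<And>b. b \<in> A 0 \<Longrightarrow> \<exists>y. (x, y) \<in> closure (rep_op \<pi> b)" shows "x \<in> D"
proof -
  have i: "star_rep (Res (A 0) \<pi>)" "closed_rep (Res (A 0) \<pi>)" using int by (auto simp: integrable_rep_def)
  interpret R: star_representation "Res (A 0) \<pi>" using i(1) by unfold_locales
  show ?thesis using R.in_dom_if_closed[OF i(2), of x] assms by simp
qed

lemma E_dom_cov:
  assumes "a \<in> A g" "\<Delta> \<in> sets M" "x \<in> D"
  shows "E \<Delta> x \<in> D \<and> act \<pi> a (E \<Delta> x) = E (set_act A g \<Delta>) (act \<pi> a x)"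
proof -
  have "(x, E (set_act A g \<Delta>) (act \<pi> a x)) \<in> rep_op \<pi> a O op_graph H (E (set_act A g \<Delta>))"
    using assms(3) act_hilb[of a x] by (auto simp: rep_op_def op_graph_def)
  then have "(x, E (set_act A g \<Delta>) (act \<pi> a x)) \<in> op_graph H (E \<Delta>) O rep_op \<pi> a" using cov[OF assms(1,2)] by blast
  then show ?thesis by (auto simp: rep_op_def op_graph_def)
qed

lemma E_dom: "\<Delta> \<in> sets M \<Longrightarrow> x \<in> D \<Longrightarrow> E \<Delta> x \<in> D"
  using E_dom_cov[OF A_zero] by blast

lemma act_E: "b \<in> A 0 \<Longrightarrow> \<Delta> \<in> sets M \<Longrightarrow> x \<in> D \<Longrightarrow> act \<pi> b (E \<Delta> x) = E \<Delta> (act \<pi> b x)"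
  using E_dom_cov[of b 0 \<Delta> x] sets.sets_into_space[of \<Delta> M] by (simp add: set_act_zero)

lemma act_SI: "b \<in> A 0 \<Longrightarrow> x \<in> D \<Longrightarrow> (x, act \<pi> b x) \<in> spectral_integral M H E (\<lambda>\<xi>. \<xi> b)"
  using SI rep_op_closure by blast

lemma norm_act_le:
  assumes "b \<in> A 0" "x \<in> D" "\<Delta> \<in> sets M" "E \<Delta> x = x" "\<And>\<xi>. \<xi> \<in> \<Delta> \<Longrightarrow> cmod (\<xi> b) \<le> r" "0 \<le> r"
  shows "norm (act \<pi> b x) \<le> r * norm x"
  using spectral_integral_le[OF act_SI[OF assms(1,2)] assms(3,4)] assms(5,6) by blast

lemma norm_act_ge:
  assumes "b \<in> A 0" "x \<in> D" "\<Delta> \<in> sets M" "E \<Delta> x = x" "\<And>\<xi>. \<xi> \<in> \<Delta> \<Longrightarrow> r \<le> cmod (\<xi> b)" "0 \<le> r"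
  shows "r * norm x \<le> norm (act \<pi> b x)"
  using spectral_integral_ge[OF act_SI[OF assms(1,2)] assms(3,4)] assms(5,6) by blast

text \<open>The operator of \<open>1\<close> is idempotent and symmetric, hence a projection; it does not decrease
  norms because it is the spectral integral of the constant function \<open>1\<close>.\<close>

lemma act_one: assumes x: "x \<in> D" shows "act \<pi> 1 x = x"
proof -
  have P: "act \<pi> 1 (act \<pi> 1 x) = act \<pi> 1 x" using act_mult[of 1 1 x] x by simp
  have "1 * norm x \<le> norm (act \<pi> 1 x)"
    using x by (intro norm_act_ge[of _ _ X]) (auto simp: one_in_A0 E_space[simplified] dom_hilb char_one \<V>_sets[OF \<V>_space])
  then have le: "(norm x)\<^sup>2 \<le> (norm (act \<pi> 1 x))\<^sup>2" by (simp add: power_mono)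
  have "cinner (act \<pi> 1 x) (x - act \<pi> 1 x) = 0"
    using x P by (simp add: act_star act_diff act_in csubspace_diff[OF dom_sub])
  from norm_add_orth[OF this] have "(norm x)\<^sup>2 = (norm (act \<pi> 1 x))\<^sup>2 + (norm (x - act \<pi> 1 x))\<^sup>2" by simp
  then have "(norm (x - act \<pi> 1 x))\<^sup>2 \<le> 0" using le by linarith
  then show ?thesis by simp
qed

text \<open>A homogeneous element annihilates the part of a vector living outside its support.\<close>

lemma act_transport:
  assumes a: "a \<in> A g" and D: "\<Delta> \<in> sets M" and x: "x \<in> D"
  shows "act \<pi> a (E \<Delta> x) = E (transport g a \<Delta>) (act \<pi> a x)"
proof -
  have DX: "\<Delta> \<subseteq> X" using sets.sets_into_space[OF D] by simp
  define z where "z = E (\<Delta> - nonvanishing a) x"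
  have ms: "\<Delta> \<inter> nonvanishing a \<in> sets M" "\<Delta> - nonvanishing a \<in> sets M" using D nonvanishing_sets[OF a] by auto
  have z: "z \<in> D" "E (\<Delta> - nonvanishing a) z = z" using x ms by (auto simp: z_def E_dom E_idem dom_hilb)
  have "norm (act \<pi> (star a * a) z) \<le> 0 * norm z"
    using z ms DX a by (intro norm_act_le[of _ _ "\<Delta> - nonvanishing a"]) (auto simp: A0_star_mult nonvanishing_def)
  then have "(norm (act \<pi> a z))\<^sup>2 \<le> 0" using norm_act_sq_le[of a z] z by simp
  then have az: "act \<pi> a z = 0" by simp
  have "(\<Delta> \<inter> nonvanishing a) \<union> (\<Delta> - nonvanishing a) = \<Delta>" "(\<Delta> \<inter> nonvanishing a) \<inter> (\<Delta> - nonvanishing a) = {}" by auto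
  then have "E \<Delta> x = E (\<Delta> \<inter> nonvanishing a) x + z"
    using E_Un[OF ms, of x] x by (simp add: z_def dom_hilb)
  then have "act \<pi> a (E \<Delta> x) = act \<pi> a (E (\<Delta> \<inter> nonvanishing a) x)" using x z ms az by (simp add: act_add E_dom)
  also have "\<dots> = E (transport g a \<Delta>) (act \<pi> a x)"
    using E_dom_cov[OF a ms(1) x] set_act_nonvanishing[OF a DX] by simp
  finally show ?thesis .
qed

lemma E_nonvanishing_act: assumes a: "a \<in> A g" and x: "x \<in> D" shows "E (nonvanishing (star a)) (act \<pi> a x) = act \<pi> a x"
proof -
  have "transport g a X = nonvanishing (star a)"
    using char_act_nonvanishing'(1)[OF a] by (auto simp: transport_def nonvanishing_def)
  then show ?thesis
    using act_transport[OF a \<V>_sets[OF \<V>_space] x] E_space x by (simp add: dom_hilb)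
qed

text \<open>The covariance condition read backwards. It is what makes orbits invariant under spectral projections.\<close>

lemma E_transport:
  assumes a: "a \<in> A g" and x: "x \<in> D" and W: "\<Gamma> \<in> sets M"
  shows "E \<Gamma> (act \<pi> a x) = act \<pi> a (E (transport (- g) (star a) \<Gamma>) x)"
proof -
  have WX: "\<Gamma> \<subseteq> X" using sets.sets_into_space[OF W] by simp
  have ms: "transport (- g) (star a) \<Gamma> \<in> sets M" by (rule transport_sets[OF A_star[OF a] W])
  have "act \<pi> a (E (transport (- g) (star a) \<Gamma>) x) = E (\<Gamma> \<inter> nonvanishing (star a)) (act \<pi> a x)"
    using act_transport[OF a ms x] transport_inverse[OF a WX] by simp
  also have "\<dots> = E \<Gamma> (E (nonvanishing (star a)) (act \<pi> a x))"
    using E_Int[OF W nonvanishing_sets[OF A_star[OF a]]] x act_hilb by simp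
  finally show ?thesis using E_nonvanishing_act[OF a x] by simp
qed

subsection \<open>Regions on which every element of the algebra is bounded\<close>

definition bounding :: "('a \<Rightarrow> complex) set \<Rightarrow> bool" where
  "bounding \<Delta> \<longleftrightarrow> \<Delta> \<in> sets M \<and> (\<forall>a. \<exists>C\<ge>0. \<forall>x\<in>D. E \<Delta> x = x \<longrightarrow> norm (act \<pi> a x) \<le> C * norm x)"

lemma norm_act_homogeneous_le:
  assumes "a \<in> A g" "x \<in> D" "\<Delta> \<in> sets M" "E \<Delta> x = x" "\<And>\<xi>. \<xi> \<in> \<Delta> \<Longrightarrow> cmod (\<xi> (star a * a)) \<le> r" "0 \<le> r"
  shows "norm (act \<pi> a x) \<le> sqrt r * norm x"
proof -
  have "(norm (act \<pi> a x))\<^sup>2 \<le> norm (act \<pi> (star a * a) x) * norm x" using assms(2) by (intro norm_act_sq_le) auto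
  also have "\<dots> \<le> (r * norm x) * norm x"
    using assms by (intro mult_right_mono norm_act_le[of _ _ \<Delta>]) (auto intro: A0_star_mult)
  also have "\<dots> = (sqrt r * norm x)\<^sup>2" using assms(6) by (simp add: power_mult_distrib power2_eq_square)
  finally show ?thesis by (rule power2_le_imp_le) (use assms(6) in simp)
qed

lemma le_sets: "b \<in> A 0 \<Longrightarrow> {\<xi> \<in> X. cmod (\<xi> b) \<le> r} \<in> sets M"
  and ge_sets: "b \<in> A 0 \<Longrightarrow> {\<xi> \<in> X. r \<le> cmod (\<xi> b)} \<in> sets M"
proof -
  assume b: "b \<in> A 0"
  have [measurable]: "(\<lambda>\<xi>. \<xi> b) \<in> borel_measurable M" by (rule eval_measurable[OF b])
  have "{\<xi> \<in> space M. cmod (\<xi> b) \<le> r} \<in> sets M" "{\<xi> \<in> space M. r \<le> cmod (\<xi> b)} \<in> sets M" by measurable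
  then show "{\<xi> \<in> X. cmod (\<xi> b) \<le> r} \<in> sets M" "{\<xi> \<in> X. r \<le> cmod (\<xi> b)} \<in> sets M" by simp_all
qed

lemma E_le_tendsto:
  assumes b: "b \<in> A 0" and x: "x \<in> H" shows "(\<lambda>n. E {\<xi> \<in> X. cmod (\<xi> b) \<le> real n} x) \<longlonglongrightarrow> x"
proof -
  have "(\<lambda>n. E {\<xi> \<in> X. cmod (\<xi> b) \<le> real n} x) \<longlonglongrightarrow> E (\<Union>n. {\<xi> \<in> X. cmod (\<xi> b) \<le> real n}) x"
  proof (rule E_incseq[OF _ _ x])
    show "incseq (\<lambda>n. {\<xi> \<in> X. cmod (\<xi> b) \<le> real n})" by (intro monoI) auto
  qed (use le_sets[OF b] in auto)
  moreover have "(\<Union>n. {\<xi> \<in> X. cmod (\<xi> b) \<le> real n}) = space M" using real_arch_simple by auto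
  ultimately show ?thesis using E_space[OF x] by simp
qed

text \<open>Choosing bounds for countably many dominating elements that cut off little enough mass leaves
  a nonzero part of any given vector.\<close>

lemma ex_bounding:
  assumes \<psi>: "\<psi> \<in> H" "\<psi> \<noteq> 0" shows "\<exists>\<Delta>. bounding \<Delta> \<and> E \<Delta> \<psi> \<noteq> 0"
proof -
  obtain S where S: "countable S" "\<And>a. \<exists>c\<in>S. \<exists>C\<ge>0. \<forall>u\<in>D. norm (act \<pi> a u) \<le> C * (norm u + norm (act \<pi> c u))"
    using ex_countable_dominating[OF metr] by auto
  have "\<exists>F f. finite F \<and> (\<forall>g\<in>F. f g \<in> A g) \<and> c = (\<Sum>g\<in>F. f g)" for c
    by (rule ex_homogeneous_sum[of c]) blast
  then obtain F f where Ff: "\<And>c. finite (F c)" "\<And>c g. g \<in> F c \<Longrightarrow> f c g \<in> A g" "\<And>c. c = (\<Sum>g\<in>F c. f c g)" by metis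
  define B where "B = insert 0 (\<Union>c\<in>S. (\<lambda>g. star (f c g) * f c g) ` F c)"
  have B0: "B \<subseteq> A 0" using A0_star_mult[OF Ff(2) Ff(2)] by (auto simp: B_def A_zero)
  have cB: "countable B" unfolding B_def using S(1) Ff(1) by (intro countable_insert countable_UN) (auto intro: countable_finite)
  have neB: "B \<noteq> {}" by (auto simp: B_def)
  define b where "b = from_nat_into B"
  have b: "b n \<in> A 0" for n using from_nat_into[OF neB] B0 by (auto simp: b_def)
  have rb: "range b = B" unfolding b_def by (rule range_from_nat_into[OF neB cB])
  have "\<exists>N. (norm (\<psi> - E {\<xi> \<in> X. cmod (\<xi> (b n)) \<le> real N} \<psi>))\<^sup>2 \<le> (norm \<psi>)\<^sup>2 / 4 * (1/2) ^ n" for n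
  proof -
    have "(\<lambda>N. (norm (\<psi> - E {\<xi> \<in> X. cmod (\<xi> (b n)) \<le> real N} \<psi>))\<^sup>2) \<longlonglongrightarrow> (norm (\<psi> - \<psi>))\<^sup>2"
      by (intro tendsto_power tendsto_norm tendsto_diff tendsto_const E_le_tendsto b \<psi>)
    then have "\<forall>\<^sub>F N in sequentially. (norm (\<psi> - E {\<xi> \<in> X. cmod (\<xi> (b n)) \<le> real N} \<psi>))\<^sup>2 < (norm \<psi>)\<^sup>2 / 4 * (1/2) ^ n"
      by (rule order_tendstoD(2)) (use \<psi> in simp)
    then obtain N where "(norm (\<psi> - E {\<xi> \<in> X. cmod (\<xi> (b n)) \<le> real N} \<psi>))\<^sup>2 < (norm \<psi>)\<^sup>2 / 4 * (1/2) ^ n"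
      using eventually_happens sequentially_bot by blast
    then show ?thesis by (auto intro: less_imp_le)
  qed
  then have "\<forall>n. \<exists>N. (norm (\<psi> - E {\<xi> \<in> X. cmod (\<xi> (b n)) \<le> real N} \<psi>))\<^sup>2 \<le> (norm \<psi>)\<^sup>2 / 4 * (1/2) ^ n" by (rule allI)
  from choice[OF this] obtain N where N: "\<And>n. (norm (\<psi> - E {\<xi> \<in> X. cmod (\<xi> (b n)) \<le> real (N n)} \<psi>))\<^sup>2 \<le> (norm \<psi>)\<^sup>2 / 4 * (1/2) ^ n" by blast
  define \<Delta> where "\<Delta> = (\<Inter>n. {\<xi> \<in> X. cmod (\<xi> (b n)) \<le> real (N n)})"
  have ms: "{\<xi> \<in> X. cmod (\<xi> (b n)) \<le> real (N n)} \<in> sets M" for n using b by (rule le_sets)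
  have D: "\<Delta> \<in> sets M" unfolding \<Delta>_def using ms by auto
  have "bounding \<Delta>"
    unfolding bounding_def
  proof (intro conjI allI D)
    fix a
    obtain c C where c: "c \<in> S" "0 \<le> C" "\<And>u. u \<in> D \<Longrightarrow> norm (act \<pi> a u) \<le> C * (norm u + norm (act \<pi> c u))" using S(2)[of a] by blast
    have "\<exists>r\<ge>0. \<forall>x\<in>D. E \<Delta> x = x \<longrightarrow> norm (act \<pi> (f c g) x) \<le> r * norm x" if g: "g \<in> F c" for g
    proof -
      have "star (f c g) * f c g \<in> B" using g c by (auto simp: B_def)
      then obtain n where n: "b n = star (f c g) * f c g" using rb by (metis rangeE)
      have "norm (act \<pi> (f c g) x) \<le> sqrt (real (N n)) * norm x" if "x \<in> D" "E \<Delta> x = x" for x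
        using that Ff(2)[OF g] by (intro norm_act_homogeneous_le[OF _ _ D]) (auto simp: \<Delta>_def simp flip: n)
      then show ?thesis by (intro exI[of _ "sqrt (real (N n))"]) auto
    qed
    then obtain r where r: "\<And>g. g \<in> F c \<Longrightarrow> r g \<ge> 0" "\<And>g x. g \<in> F c \<Longrightarrow> x \<in> D \<Longrightarrow> E \<Delta> x = x \<Longrightarrow> norm (act \<pi> (f c g) x) \<le> r g * norm x"
      by metis
    have "norm (act \<pi> a x) \<le> C * (1 + (\<Sum>g\<in>F c. r g)) * norm x" if x: "x \<in> D" "E \<Delta> x = x" for x
    proof -
      have "act \<pi> c x = (\<Sum>g\<in>F c. act \<pi> (f c g) x)" by (subst Ff(3)[of c]) (use x in \<open>simp add: act_sum_alg\<close>)
      then have "norm (act \<pi> c x) \<le> (\<Sum>g\<in>F c. r g * norm x)" using r(2) x by (auto intro!: sum_norm_le)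
      then have "norm (act \<pi> c x) \<le> (\<Sum>g\<in>F c. r g) * norm x" by (simp add: sum_distrib_right)
      then have "norm x + norm (act \<pi> c x) \<le> (1 + (\<Sum>g\<in>F c. r g)) * norm x" by (simp add: distrib_right)
      then have "C * (norm x + norm (act \<pi> c x)) \<le> C * ((1 + (\<Sum>g\<in>F c. r g)) * norm x)" using c(2) by (rule mult_left_mono)
      then show ?thesis using c(3)[OF x(1)] by (simp add: mult.assoc)
    qed
    moreover have "0 \<le> C * (1 + (\<Sum>g\<in>F c. r g))" using c r(1) by (intro mult_nonneg_nonneg add_nonneg_nonneg sum_nonneg) auto
    ultimately show "\<exists>C\<ge>0. \<forall>x\<in>D. E \<Delta> x = x \<longrightarrow> norm (act \<pi> a x) \<le> C * norm x" by blast
  qed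
  moreover have "E \<Delta> \<psi> \<noteq> 0"
  proof
    assume 0: "E \<Delta> \<psi> = 0"
    have "ennreal ((norm \<psi>)\<^sup>2) = emeasure (\<mu> \<psi>) (X - \<Delta>)"
      using E_compl[OF D \<psi>(1)] 0 D \<psi> by (simp add: emeasure_scalar \<V>_sets[OF \<V>_space] sets.Diff)
    also have "X - \<Delta> = (\<Union>n. X - {\<xi> \<in> X. cmod (\<xi> (b n)) \<le> real (N n)})" by (auto simp: \<Delta>_def)
    also have "emeasure (\<mu> \<psi>) \<dots> \<le> (\<Sum>n. emeasure (\<mu> \<psi>) (X - {\<xi> \<in> X. cmod (\<xi> (b n)) \<le> real (N n)}))"
      using ms \<V>_sets[OF \<V>_space] by (intro emeasure_subadditive_countably) auto
    also have "\<dots> \<le> (\<Sum>n. ennreal ((norm \<psi>)\<^sup>2 / 4 * (1/2) ^ n))"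
    proof (rule suminf_le)
      fix n
      have "emeasure (\<mu> \<psi>) (X - {\<xi> \<in> X. cmod (\<xi> (b n)) \<le> real (N n)}) = ennreal ((norm (E (space M - {\<xi> \<in> X. cmod (\<xi> (b n)) \<le> real (N n)}) \<psi>))\<^sup>2)"
        using ms[of n] \<psi> by (subst emeasure_scalar) (auto simp: \<V>_sets[OF \<V>_space] sets.Diff)
      also have "\<dots> \<le> ennreal ((norm \<psi>)\<^sup>2 / 4 * (1/2) ^ n)" using N[of n] E_compl[OF ms[of n] \<psi>(1)] by (intro ennreal_leI) simp
      finally show "emeasure (\<mu> \<psi>) (X - {\<xi> \<in> X. cmod (\<xi> (b n)) \<le> real (N n)}) \<le> ennreal ((norm \<psi>)\<^sup>2 / 4 * (1/2) ^ n)" .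
    qed auto
    also have "\<dots> = ennreal ((norm \<psi>)\<^sup>2 / 4 * 2)"
      using sums_mult[OF geometric_sums[of "1/2::real"], of "(norm \<psi>)\<^sup>2 / 4"] by (intro suminf_ennreal_eq) auto
    finally have "(norm \<psi>)\<^sup>2 \<le> (norm \<psi>)\<^sup>2 / 4 * 2" by (subst (asm) ennreal_le_iff) auto
    then show False using \<psi> by simp
  qed
  ultimately show ?thesis by blast
qed

lemma bounding_sets: "bounding \<Delta> \<Longrightarrow> \<Delta> \<in> sets M"
  by (simp add: bounding_def)

text \<open>Where all operators are bounded, norm limits of vectors of the domain are limits in every graph norm.\<close>

lemma bounding_dom:
  assumes B: "bounding \<Delta>" and x: "x \<in> H" "E \<Delta> x = x" shows "x \<in> D"
proof (rule in_domI)
  fix b assume b: "b \<in> A 0"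
  have D: "\<Delta> \<in> sets M" by (rule bounding_sets[OF B])
  obtain C where C: "0 \<le> C" "\<And>x. x \<in> D \<Longrightarrow> E \<Delta> x = x \<Longrightarrow> norm (act \<pi> b x) \<le> C * norm x" using B unfolding bounding_def by blast
  obtain u where u: "\<And>n. u n \<in> D" "u \<longlonglongrightarrow> x" using x(1) dom_dense unfolding closure_sequential[symmetric] by (metis closure_sequential)
  define v where "v n = E \<Delta> (u n)" for n
  have v: "v n \<in> D" "E \<Delta> (v n) = v n" for n using u D by (auto simp: v_def E_dom E_idem dom_hilb)
  have vx: "v \<longlonglongrightarrow> x" using E_tendsto[OF D u(2), of] u(1) x dom_hilb unfolding v_def by (auto intro: always_eventually)
  have "Cauchy (\<lambda>n. act \<pi> b (v n))"
    unfolding Cauchy_def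
  proof (intro allI impI)
    fix e :: real assume e: "e > 0"
    from LIMSEQ_imp_Cauchy[OF vx] obtain N where N: "\<And>m n. m \<ge> N \<Longrightarrow> n \<ge> N \<Longrightarrow> dist (v m) (v n) < e / (C + 1)"
      using e C unfolding Cauchy_def by (meson add_nonneg_pos divide_pos_pos zero_less_one)
    show "\<exists>N. \<forall>m\<ge>N. \<forall>n\<ge>N. dist (act \<pi> b (v m)) (act \<pi> b (v n)) < e"
    proof (intro exI[of _ N] allI impI)
      fix m n assume mn: "N \<le> m" "N \<le> n"
      have "norm (act \<pi> b (v m - v n)) \<le> C * norm (v m - v n)"
        using v D by (intro C csubspace_diff[OF dom_sub]) (auto simp: E_diff dom_hilb)
      also have "\<dots> \<le> C * (e / (C + 1))" using N[OF mn] C by (intro mult_left_mono) (auto simp: dist_norm)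
      also have "\<dots> < e" using e C by (simp add: field_simps)
      finally show "dist (act \<pi> b (v m)) (act \<pi> b (v n)) < e" using v by (simp add: dist_norm act_diff)
    qed
  qed
  then obtain y where "(\<lambda>n. act \<pi> b (v n)) \<longlonglongrightarrow> y" using Cauchy_convergent convergent_def by blast
  then show "\<exists>y. (x, y) \<in> closure (rep_op \<pi> b)" using v vx by (auto simp: closure_rep_op_iff)
qed

lemma bounding_bound:
  assumes "bounding \<Delta>" shows "\<exists>C\<ge>0. \<forall>x\<in>H. E \<Delta> x = x \<longrightarrow> norm (act \<pi> a x) \<le> C * norm x"
  using assms bounding_dom[OF assms] unfolding bounding_def by blast

end

section \<open>Regularisation of the spectral measure\<close>

text \<open>A countable subfamily whose union has the largest possible measure misses only null parts of the other members.\<close>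

lemma (in finite_measure) ex_countable_essential_union:
  assumes W: "\<W> \<subseteq> sets M"
  shows "\<exists>\<C>\<subseteq>\<W>. countable \<C> \<and> (\<forall>V\<in>\<W>. emeasure M (V - \<Union>\<C>) = 0)"
proof -
  define K where "K = {\<C>. \<C> \<subseteq> \<W> \<and> countable \<C>}"
  have K: "\<Union>\<C> \<in> sets M" if "\<C> \<in> K" for \<C> using that W by (auto simp: K_def intro!: sets.countable_Union)
  have "{} \<in> K" by (simp add: K_def)
  then obtain m :: "nat \<Rightarrow> ennreal" where m: "range m \<subseteq> (\<lambda>\<C>. emeasure M (\<Union>\<C>)) ` K" "(SUP \<C>\<in>K. emeasure M (\<Union>\<C>)) = (SUP n. m n)"
    using ennreal_SUP_countable_SUP[of K "\<lambda>\<C>. emeasure M (\<Union>\<C>)"] by auto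
  then have "\<forall>n. \<exists>\<C>\<in>K. m n = emeasure M (\<Union>\<C>)" by auto
  then obtain C where C: "\<And>n. C n \<in> K" "\<And>n. m n = emeasure M (\<Union>(C n))" by metis
  define \<C> where "\<C> = (\<Union>n. C n)"
  have cK: "\<C> \<in> K" using C(1) by (auto simp: K_def \<C>_def)
  have "m n \<le> emeasure M (\<Union>\<C>)" for n unfolding C(2) using K[OF cK] by (intro emeasure_mono) (auto simp: \<C>_def)
  then have sup: "(SUP \<C>\<in>K. emeasure M (\<Union>\<C>)) \<le> emeasure M (\<Union>\<C>)" unfolding m(2) by (intro SUP_least)
  have "emeasure M (V - \<Union>\<C>) = 0" if V: "V \<in> \<W>" for V
  proof -
    have VK: "insert V \<C> \<in> K" using cK V by (auto simp: K_def)
    have ms: "V - \<Union>\<C> \<in> sets M" using V W K[OF cK] by auto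
    have "emeasure M (\<Union>\<C>) + emeasure M (V - \<Union>\<C>) = emeasure M (\<Union>\<C> \<union> (V - \<Union>\<C>))"
      using K[OF cK] ms by (intro plus_emeasure) auto
    also have "\<Union>\<C> \<union> (V - \<Union>\<C>) = \<Union>(insert V \<C>)" by auto
    also have "emeasure M (\<Union>(insert V \<C>)) \<le> (SUP \<C>\<in>K. emeasure M (\<Union>\<C>))" using VK by (intro SUP_upper)
    also note sup
    finally have "emeasure M (\<Union>\<C>) + emeasure M (V - \<Union>\<C>) \<le> emeasure M (\<Union>\<C>) + 0" by simp
    then have "emeasure M (V - \<Union>\<C>) \<le> 0" by (subst (asm) ennreal_add_left_cancel_le) (auto simp: emeasure_eq_measure)
    then show ?thesis by simp
  qed
  with cK show ?thesis by (auto simp: K_def)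
qed

text \<open>The point is the limit of an ultrafilter of sets of full measure: the limit
  exists because each coordinate is essentially bounded, and it is a character because all the
  relations defining positive characters are closed.\<close>

lemma (in graded_algebra) ex_support_point:
  assumes sets: "sets \<mu> = sets M" and nz: "emeasure \<mu> X \<noteq> 0"
    and bd: "\<And>b. b \<in> A 0 \<Longrightarrow> \<exists>C. AE \<xi> in \<mu>. cmod (\<xi> b) \<le> C"
  shows "\<exists>\<eta>\<in>X. \<forall>U. openin T U \<longrightarrow> \<eta> \<in> U \<longrightarrow> emeasure \<mu> U \<noteq> 0"
proof -
  have sp: "space \<mu> = X" using sets_eq_imp_space_eq[OF sets] by simp
  have "ae_filter \<mu> \<noteq> bot" using nz by (simp add: ae_filter_eq_bot_iff sp)
  then obtain \<U> where U: "\<U> \<le> ae_filter \<mu>" "ultrafilter \<U>" using ex_ultrafilter by blast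
  have nb: "\<U> \<noteq> bot" using U by (simp add: ultrafilter_def)
  have AE: "eventually P \<U>" if "AE \<xi> in \<mu>. P \<xi>" for P using that U(1) by (auto simp: le_filter_def)
  have evX: "\<forall>\<^sub>F \<xi> in \<U>. \<xi> \<in> X" using AE[OF AE_space] by (simp add: sp)
  have "\<exists>l. ((\<lambda>\<xi>. \<xi> b) \<longlongrightarrow> l) \<U>" if b: "b \<in> A 0" for b
  proof -
    obtain C where C: "AE \<xi> in \<mu>. cmod (\<xi> b) \<le> C" using bd[OF b] by blast
    have "\<forall>\<^sub>F \<xi> in \<U>. \<xi> b \<in> cball 0 C" using AE[OF C] by simp
    from ultrafilter_tendsto[OF U(2) compact_cball this] show ?thesis by blast
  qed
  then obtain l where l: "\<And>b. b \<in> A 0 \<Longrightarrow> ((\<lambda>\<xi>. \<xi> b) \<longlongrightarrow> l b) \<U>" by metis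
  have eqI: "x = y" if "(f \<longlongrightarrow> x) \<U>" "(h \<longlongrightarrow> y) \<U>" "\<And>\<xi>. \<xi> \<in> X \<Longrightarrow> f \<xi> = h \<xi>" for f h and x y :: complex
  proof -
    have "\<forall>\<^sub>F \<xi> in \<U>. f \<xi> = h \<xi>" using evX by eventually_elim (rule that(3))
    then have "(h \<longlongrightarrow> x) \<U>" using that(1) by (rule Lim_transform_eventually[rotated])
    then show ?thesis using that(2) tendsto_unique[OF nb] by blast
  qed
  define \<eta> where "\<eta> = (\<lambda>b\<in>A 0. l b)"
  have "\<eta> \<in> characters (A 0)"
    unfolding characters_def
  proof (intro CollectI conjI ballI allI)
    show "\<eta> \<in> extensional (A 0)" by (simp add: \<eta>_def)
    fix b assume b: "b \<in> A 0"
    have "l (c *\<^sub>C b) = c * l b" for c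
      by (rule eqI[OF l tendsto_mult[OF tendsto_const l]]) (auto simp: b A_scaleC char_scaleC)
    then show "\<eta> (c *\<^sub>C b) = c * \<eta> b" for c using b by (simp add: \<eta>_def A_scaleC)
    have "l (star b) = cnj (l b)"
      by (rule eqI[OF l tendsto_cnj[OF l]]) (auto simp: b A0_star char_star)
    then show "\<eta> (star b) = cnj (\<eta> b)" using b by (simp add: \<eta>_def A0_star)
    fix c assume c: "c \<in> A 0"
    have "l (b + c) = l b + l c"
      by (rule eqI[OF l tendsto_add[OF l l]]) (auto simp: b c A_add char_add)
    then show "\<eta> (b + c) = \<eta> b + \<eta> c" using b c by (simp add: \<eta>_def A_add)
    have "l (b * c) = l b * l c"
      by (rule eqI[OF l tendsto_mult[OF l l]]) (auto simp: b c A0_mult char_mult)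
    then show "\<eta> (b * c) = \<eta> b * \<eta> c" using b c by (simp add: \<eta>_def A0_mult)
  next
    have "l 1 = 1" by (rule eqI[OF l tendsto_const]) (auto simp: one_in_A0 char_one)
    then show "\<exists>b\<in>A 0. \<eta> b \<noteq> 0" using one_in_A0 by (intro bexI[of _ 1]) (auto simp: \<eta>_def)
  qed
  moreover have "\<eta> x \<in> \<real>\<^sub>\<ge>\<^sub>0" if x: "x \<in> sums_of_squares \<inter> A 0" for x
  proof -
    have "\<forall>\<^sub>F \<xi> in \<U>. \<xi> x \<in> \<real>\<^sub>\<ge>\<^sub>0" using evX by eventually_elim (use x char_pos in auto)
    then have "l x \<in> \<real>\<^sub>\<ge>\<^sub>0" using l x nb by (intro Lim_in_closed_set[OF closed_nonneg_Reals_complex]) auto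
    then show ?thesis using x by (simp add: \<eta>_def)
  qed
  ultimately have \<eta>: "\<eta> \<in> X" by (simp add: pos_characters_def)
  have lim: "limitin T (\<lambda>\<xi>. \<xi>) \<eta> \<U>"
    unfolding char_topology_def
  proof (rule limitin_topology_generated_by)
    show "\<eta> \<in> \<Union>{{\<xi> \<in> X. \<xi> b \<in> U} |b U. b \<in> A 0 \<and> open U}"
      using \<eta> topspace_T unfolding char_topology_def topology_generated_by_topspace by blast
    fix S assume "S \<in> {{\<xi> \<in> X. \<xi> b \<in> U} |b U. b \<in> A 0 \<and> open U}" "\<eta> \<in> S"
    then obtain b V where S: "S = {\<xi> \<in> X. \<xi> b \<in> V}" "b \<in> A 0" "open V" "\<eta> b \<in> V" by blast
    then have "l b \<in> V" by (simp add: \<eta>_def)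
    then have "\<forall>\<^sub>F \<xi> in \<U>. \<xi> b \<in> V" using topological_tendstoD[OF l[OF S(2)] S(3)] by blast
    with evX show "\<forall>\<^sub>F \<xi> in \<U>. \<xi> \<in> S" by eventually_elim (simp add: S(1))
  qed
  have "emeasure \<mu> U \<noteq> 0" if o: "openin T U" and m: "\<eta> \<in> U" for U
  proof
    assume "emeasure \<mu> U = 0"
    then have "U \<in> null_sets \<mu>" using openin_sets[OF o] sets by (simp add: null_sets_def)
    then have "AE \<xi> in \<mu>. \<xi> \<notin> U" by (rule AE_not_in)
    from AE[OF this] have "\<forall>\<^sub>F \<xi> in \<U>. \<xi> \<notin> U" .
    moreover have "\<forall>\<^sub>F \<xi> in \<U>. \<xi> \<in> U" using lim o m by (auto simp: limitin_def)
    ultimately have "\<forall>\<^sub>F \<xi> in \<U>. False" by eventually_elim simp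
    then show False using nb by simp
  qed
  with \<eta> show ?thesis by blast
qed

context well_behaved_rep
begin

lemma bounding_AE:
  assumes B: "bounding \<Delta>" and x: "x \<in> H" "E \<Delta> x = x" and b: "b \<in> A 0"
  shows "\<exists>C. AE \<xi> in \<mu> x. cmod (\<xi> b) \<le> C"
proof -
  obtain C where C: "C \<ge> 0" "\<And>y. y \<in> H \<Longrightarrow> E \<Delta> y = y \<Longrightarrow> norm (act \<pi> b y) \<le> C * norm y" using bounding_bound[OF B] by blast
  have D: "\<Delta> \<in> sets M" by (rule bounding_sets[OF B])
  define Q where "Q = {\<xi> \<in> X. C + 1 \<le> cmod (\<xi> b)}"
  have Q: "Q \<in> sets M" unfolding Q_def by (rule ge_sets[OF b])
  define y where "y = E Q x"
  have y: "y \<in> H" "E Q y = y" using x Q by (auto simp: y_def E_in E_idem)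
  have yD: "E \<Delta> y = y" unfolding y_def using E_Int[OF D Q x(1)] E_Int[OF Q D x(1)] x(2) by (simp add: Int_commute)
  have "(C + 1) * norm y \<le> norm (act \<pi> b y)"
    using b C y Q bounding_dom[OF B y(1) yD] by (intro norm_act_ge[of _ _ Q]) (auto simp: Q_def)
  also have "\<dots> \<le> C * norm y" by (rule C(2)[OF y(1) yD])
  finally have "norm y \<le> 0" by (simp add: distrib_right)
  then have "E Q x = 0" by (simp add: y_def)
  then have "Q \<in> null_sets (\<mu> x)" using Q x by (simp add: null_sets_def emeasure_scalar)
  then have "AE \<xi> in \<mu> x. \<xi> \<notin> Q" by (rule AE_not_in)
  moreover have "AE \<xi> in \<mu> x. \<xi> \<in> X" using AE_space[of "\<mu> x"] by simp
  ultimately have "AE \<xi> in \<mu> x. cmod (\<xi> b) \<le> C + 1" by eventually_elim (auto simp: Q_def)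
  then show ?thesis by blast
qed

text \<open>The scalar measures are tau-additive on the sets in \<open>\<V>\<close>: mass not exhausted by a covering
  could be localised on a closed piece and on a bounding region, and would then have a support point, which lies in one of the covering sets.\<close>

lemma scalar_tau_additive:
  assumes \<psi>: "\<psi> \<in> H" and V: "V \<in> \<V>" and W: "\<W> \<subseteq> \<V>" "V \<subseteq> \<Union>\<W>"
  shows "\<exists>\<C>\<subseteq>\<W>. countable \<C> \<and> emeasure (\<mu> \<psi>) (V - \<Union>\<C>) = 0"
proof -
  interpret fm: finite_measure "\<mu> \<psi>" by (rule finite_scalar[OF \<psi>])
  have "\<W> \<subseteq> sets (\<mu> \<psi>)" using W(1) \<V>_sets by auto
  from fm.ex_countable_essential_union[OF this] obtain \<C>
    where C: "\<C> \<subseteq> \<W>" "countable \<C>" "\<And>Q. Q \<in> \<W> \<Longrightarrow> emeasure (\<mu> \<psi>) (Q - \<Union>\<C>) = 0" by blast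
  have UC: "\<Union>\<C> \<in> sets M" using C W(1) \<V>_sets by (intro sets.countable_Union) auto
  obtain R Z where R: "incseq R" "(\<Union>n. R n) = V" "\<And>n::nat. R n \<in> \<V>" "\<And>n. closedin T (Z n)" "\<And>n. R n \<subseteq> Z n" "\<And>n. Z n \<subseteq> V"
    using \<V>_inner[OF V] by blast
  have Zs: "Z n \<in> sets M" for n
  proof -
    have "X - Z n \<in> sets M" using R(4)[of n] topspace_T by (intro openin_sets) (auto simp: closedin_def)
    then have "X - (X - Z n) \<in> sets M" using \<V>_sets[OF \<V>_space] by (rule sets.Diff[rotated])
    moreover have "Z n \<subseteq> X" using R(4)[of n] topspace_T by (auto simp: closedin_def)
    ultimately show ?thesis by (simp add: double_diff)
  qed
  have "E (Z n - \<Union>\<C>) \<psi> = 0" for n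
  proof (rule ccontr)
    assume nz: "E (Z n - \<Union>\<C>) \<psi> \<noteq> 0"
    define \<psi>1 where "\<psi>1 = E (Z n - \<Union>\<C>) \<psi>"
    have s1: "Z n - \<Union>\<C> \<in> sets M" using Zs UC by auto
    have \<psi>1: "\<psi>1 \<in> H" "\<psi>1 \<noteq> 0" using nz \<psi> s1 by (auto simp: \<psi>1_def E_in)
    obtain \<Delta> where D: "bounding \<Delta>" "E \<Delta> \<psi>1 \<noteq> 0" using ex_bounding[OF \<psi>1] by blast
    have Ds: "\<Delta> \<in> sets M" by (rule bounding_sets[OF D(1)])
    define \<psi>2 where "\<psi>2 = E \<Delta> \<psi>1"
    have \<psi>2: "\<psi>2 \<in> H" "E \<Delta> \<psi>2 = \<psi>2" "\<psi>2 \<noteq> 0" using D \<psi>1 Ds by (auto simp: \<psi>2_def E_in E_idem)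
    have eq: "emeasure (\<mu> \<psi>2) Q \<le> emeasure (\<mu> \<psi>) (Q \<inter> (Z n - \<Union>\<C>))" if Q: "Q \<in> sets M" for Q
    proof -
      have "E Q \<psi>2 = E \<Delta> (E (Q \<inter> (Z n - \<Union>\<C>)) \<psi>)"
        unfolding \<psi>2_def \<psi>1_def using Q Ds s1 \<psi> by (simp add: E_Int E_in Int_ac)
      also have "norm \<dots> \<le> norm (E (Q \<inter> (Z n - \<Union>\<C>)) \<psi>)" using Q Ds s1 \<psi> by (intro E_le E_in) auto
      finally show ?thesis using Q s1 \<psi> \<psi>2 by (simp add: emeasure_scalar ennreal_leI power_mono)
    qed
    have "emeasure (\<mu> \<psi>2) X \<noteq> 0"
      using \<psi>2 E_space[OF \<psi>2(1)] by (simp add: emeasure_scalar \<V>_sets[OF \<V>_space])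
    from ex_support_point[OF sets_scalar this bounding_AE[OF D(1) \<psi>2(1,2)]]
    obtain \<eta> where \<eta>: "\<eta> \<in> X" "\<And>U. openin T U \<Longrightarrow> \<eta> \<in> U \<Longrightarrow> emeasure (\<mu> \<psi>2) U \<noteq> 0" by blast
    have o: "openin T (X - Z n)" using R(4)[of n] topspace_T by (auto simp: closedin_def)
    have "(X - Z n) \<inter> (Z n - \<Union>\<C>) = {}" by auto
    then have "emeasure (\<mu> \<psi>2) (X - Z n) = 0" using eq[OF openin_sets[OF o]] by simp
    then have "\<eta> \<in> Z n" using \<eta>(2)[OF o] \<eta>(1) by blast
    then obtain Q where Q: "Q \<in> \<W>" "\<eta> \<in> Q" using R(6) W(2) by blast
    have Qo: "openin T Q" using Q W(1) \<V>_openin by blast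
    have "emeasure (\<mu> \<psi>) (Q \<inter> (Z n - \<Union>\<C>)) \<le> emeasure (\<mu> \<psi>) (Q - \<Union>\<C>)"
      using openin_sets[OF Qo] UC by (intro emeasure_mono) auto
    then have "emeasure (\<mu> \<psi>2) Q = 0" using eq[OF openin_sets[OF Qo]] C(3)[OF Q(1)] by simp
    then show False using \<eta>(2)[OF Qo Q(2)] by simp
  qed
  then have "Z n - \<Union>\<C> \<in> null_sets (\<mu> \<psi>)" for n
    using Zs UC \<psi> by (simp add: null_sets_def emeasure_scalar sets.Diff)
  then have "(\<Union>n. Z n - \<Union>\<C>) \<in> null_sets (\<mu> \<psi>)" by (rule null_sets_UN)
  moreover have "V - \<Union>\<C> = (\<Union>n. Z n - \<Union>\<C>)" using R(2,5,6) by blast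
  ultimately show ?thesis using C by (auto simp: null_sets_def)
qed

text \<open>The Borel measure extending the scalar measure of \<open>\<psi>\<close> from \<open>\<V>\<close> regularly.\<close>

definition reg_measure :: "'h \<Rightarrow> ('a \<Rightarrow> complex) measure" where
  "reg_measure \<psi> = (SOME \<nu>. sets \<nu> = sets M \<and>
     (\<forall>U. openin T U \<longrightarrow> emeasure \<nu> U = (SUP V\<in>{V\<in>\<V>. V \<subseteq> U}. emeasure (\<mu> \<psi>) V)))"

lemma
  assumes \<psi>: "\<psi> \<in> H"
  shows sets_reg_measure: "sets (reg_measure \<psi>) = sets M"
    and reg_measure_open: "openin T U \<Longrightarrow> emeasure (reg_measure \<psi>) U = (SUP V\<in>{V\<in>\<V>. V \<subseteq> U}. emeasure (\<mu> \<psi>) V)"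
proof -
  have "\<exists>\<nu>. sets \<nu> = sigma_sets (topspace T) {U. openin T U} \<and>
    (\<forall>U. openin T U \<longrightarrow> emeasure \<nu> U = (SUP V\<in>{V\<in>\<V>. V \<subseteq> U}. emeasure (\<mu> \<psi>) V))"
  proof (rule regular_extension[OF finite_scalar[OF \<psi>]])
    show "sets (\<mu> \<psi>) = sigma_sets (topspace T) {U. openin T U}" by (simp add: sets_M topspace_T)
    show "openin T V" if "V \<in> \<V>" for V using that by (rule \<V>_openin)
    show "V \<inter> W \<in> \<V>" if "V \<in> \<V>" "W \<in> \<V>" for V W using that by (rule \<V>_Int)
    show "(\<Union>n. S n) \<in> \<V>" if "\<And>n::nat. S n \<in> \<V>" for S using that by (rule \<V>_UN)
    show "{} \<in> \<V>" by (rule \<V>_empty)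
    show "\<exists>V\<in>\<V>. \<xi> \<in> V \<and> V \<subseteq> U" if "openin T U" "\<xi> \<in> U" for U \<xi> using that by (rule \<V>_base)
    show "\<exists>W Z. incseq W \<and> (\<Union>n. W n) = V \<and> (\<forall>n::nat. W n \<in> \<V> \<and> closedin T (Z n) \<and> W n \<subseteq> Z n \<and> Z n \<subseteq> V)"
      if "V \<in> \<V>" for V using that by (rule \<V>_inner)
    show "\<exists>\<C>\<subseteq>\<W>. countable \<C> \<and> emeasure (\<mu> \<psi>) (V - \<Union>\<C>) = 0"
      if "V \<in> \<V>" "\<W> \<subseteq> \<V>" "V \<subseteq> \<Union>\<W>" for V \<W> using that by (rule scalar_tau_additive[OF \<psi>])
  qed
  then have "\<exists>\<nu>. sets \<nu> = sets M \<and>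
    (\<forall>U. openin T U \<longrightarrow> emeasure \<nu> U = (SUP V\<in>{V\<in>\<V>. V \<subseteq> U}. emeasure (\<mu> \<psi>) V))"
    by (simp add: sets_M topspace_T)
  from someI_ex[OF this, folded reg_measure_def]
  show "sets (reg_measure \<psi>) = sets M"
    "openin T U \<Longrightarrow> emeasure (reg_measure \<psi>) U = (SUP V\<in>{V\<in>\<V>. V \<subseteq> U}. emeasure (\<mu> \<psi>) V)" by blast+
qed

lemma space_reg_measure: "\<psi> \<in> H \<Longrightarrow> space (reg_measure \<psi>) = X"
  using sets_eq_imp_space_eq[OF sets_reg_measure] by simp

lemma reg_measure_\<V>: assumes \<psi>: "\<psi> \<in> H" and V: "V \<in> \<V>" shows "emeasure (reg_measure \<psi>) V = ennreal ((norm (E V \<psi>))\<^sup>2)"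
proof -
  have "(SUP W\<in>{W\<in>\<V>. W \<subseteq> V}. emeasure (\<mu> \<psi>) W) = emeasure (\<mu> \<psi>) V"
    using V \<V>_sets by (intro antisym SUP_least SUP_upper) (auto intro: emeasure_mono)
  then show ?thesis using reg_measure_open[OF \<psi> \<V>_openin[OF V]] \<V>_sets[OF V] \<psi> by (simp add: emeasure_scalar)
qed

lemma reg_measure_space: "\<psi> \<in> H \<Longrightarrow> emeasure (reg_measure \<psi>) X = ennreal ((norm \<psi>)\<^sup>2)"
  using reg_measure_\<V>[OF _ \<V>_space] E_space by simp

lemma finite_reg_measure: "\<psi> \<in> H \<Longrightarrow> finite_measure (reg_measure \<psi>)"
  by (rule finite_measureI) (simp add: space_reg_measure reg_measure_space)

text \<open>A vector in the range of \<open>Q\<close> has its whole regular measure on \<open>R\<close>, so nothing is left for \<open>S\<close>.\<close>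

lemma reg_disjoint_orth:
  assumes P: "orth_projection H P" and Q: "orth_projection H Q"
    and S: "S \<in> sets M" "\<And>\<psi>. \<psi> \<in> H \<Longrightarrow> emeasure (reg_measure \<psi>) S = ennreal ((norm (P \<psi>))\<^sup>2)"
    and R: "R \<in> sets M" "\<And>\<psi>. \<psi> \<in> H \<Longrightarrow> emeasure (reg_measure \<psi>) R = ennreal ((norm (Q \<psi>))\<^sup>2)"
    and disj: "S \<inter> R = {}" and \<psi>: "\<psi> \<in> H"
  shows "P (Q \<psi>) = 0"
proof -
  interpret Q: orth_proj H Q using hilb_sub Q by unfold_locales
  define y where "y = Q \<psi>"
  have y: "y \<in> H" "Q y = y" using \<psi> by (auto simp: y_def)
  have "emeasure (reg_measure y) R + emeasure (reg_measure y) S = emeasure (reg_measure y) (R \<union> S)"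
    using S(1) R(1) sets_reg_measure[OF y(1)] disj by (intro plus_emeasure) auto
  also have "\<dots> \<le> emeasure (reg_measure y) (space (reg_measure y))" by (rule emeasure_space)
  also have "\<dots> = ennreal ((norm y)\<^sup>2)" using y by (simp add: space_reg_measure reg_measure_space)
  finally have "ennreal ((norm y)\<^sup>2 + (norm (P y))\<^sup>2) \<le> ennreal ((norm y)\<^sup>2)" using y by (simp add: S(2) R(2))
  then have "(norm y)\<^sup>2 + (norm (P y))\<^sup>2 \<le> (norm y)\<^sup>2" by (subst (asm) ennreal_le_iff) auto
  then show ?thesis by (simp add: y_def)
qed

text \<open>The ranges of the projections \<open>E V\<close> for \<open>V \<subseteq> U\<close> form a directed family; the projection is the one
  onto the closure of their union.\<close>

lemma ex_open_projection:
  assumes U: "openin T U"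
  shows "\<exists>Q. orth_projection H Q \<and> (\<forall>\<psi>\<in>H. emeasure (reg_measure \<psi>) U = ennreal ((norm (Q \<psi>))\<^sup>2))"
proof -
  define R0 where "R0 = (\<Union>V\<in>{V\<in>\<V>. V \<subseteq> U}. E V ` H)"
  have R0: "x \<in> R0 \<longleftrightarrow> (\<exists>V\<in>\<V>. V \<subseteq> U \<and> x \<in> H \<and> E V x = x)" for x
    unfolding R0_def using \<V>_sets by (auto simp: E_in E_idem) (metis image_eqI)
  have mono: "E W x = x" if "V \<in> \<V>" "W \<in> \<V>" "V \<subseteq> W" "x \<in> H" "E V x = x" for V W x
  proof -
    have "E W (E V x) = E (W \<inter> V) x" using that \<V>_sets by (intro E_Int) auto
    then show ?thesis using that by (simp add: Int_absorb1)
  qed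
  have cs: "csubspace R0"
    unfolding csubspace_def
  proof (intro conjI ballI allI)
    show "0 \<in> R0" unfolding R0 using \<V>_empty csubspace_0[OF hilb_sub] by (intro bexI[of _ "{}"]) auto
    fix x y assume "x \<in> R0" "y \<in> R0"
    then obtain V W where VW: "V \<in> \<V>" "V \<subseteq> U" "x \<in> H" "E V x = x" "W \<in> \<V>" "W \<subseteq> U" "y \<in> H" "E W y = y" by (auto simp: R0)
    have VWs: "V \<union> W \<in> \<V>" using VW by (intro \<V>_Un)
    have "E (V \<union> W) x = x" "E (V \<union> W) y = y" using mono[OF _ VWs] VW by auto
    then have "E (V \<union> W) (x + y) = x + y" using E_add[OF \<V>_sets[OF VWs]] VW by simp
    then show "x + y \<in> R0" unfolding R0 using VW VWs csubspace_add[OF hilb_sub] by (intro bexI[of _ "V \<union> W"]) auto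
  next
    fix c x assume "x \<in> R0"
    then show "c *\<^sub>C x \<in> R0" unfolding R0 using csubspace_scaleC[OF hilb_sub] E_scaleC[OF \<V>_sets] by metis
  qed
  define R where "R = closure R0"
  have R: "csubspace R" "closed R" unfolding R_def using cs by (auto intro: csubspace_closure)
  have "R0 \<subseteq> H" by (auto simp: R0)
  then have RH: "R \<subseteq> H" unfolding R_def using hilb_closed by (rule closure_minimal)
  interpret R: closed_csubspace R using R by unfold_locales
  have "emeasure (reg_measure \<psi>) U = ennreal ((norm (proj R \<psi>))\<^sup>2)" if \<psi>: "\<psi> \<in> H" for \<psi>
  proof (rule antisym)
    show "emeasure (reg_measure \<psi>) U \<le> ennreal ((norm (proj R \<psi>))\<^sup>2)"
      unfolding reg_measure_open[OF \<psi> U]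
    proof (rule SUP_least)
      fix V assume V: "V \<in> {V\<in>\<V>. V \<subseteq> U}"
      then have Vs: "V \<in> sets M" using \<V>_sets by auto
      have inR: "E V y \<in> R" if "y \<in> H" for y
        unfolding R_def using that V Vs closure_subset[of R0] R0[of "E V y"] by (auto simp: E_in E_idem)
      have pH: "proj R \<psi> \<in> H" using RH R.pin by blast
      have "cinner (E V (\<psi> - proj R \<psi>)) (E V (\<psi> - proj R \<psi>)) = cinner (\<psi> - proj R \<psi>) (E V (\<psi> - proj R \<psi>))"
        using E_sa[OF Vs, of "\<psi> - proj R \<psi>" "E V (\<psi> - proj R \<psi>)"] csubspace_diff[OF hilb_sub \<psi> pH] Vs by (simp add: E_in E_idem)
      also have "\<dots> = 0" using inR csubspace_diff[OF hilb_sub \<psi> pH] by (intro R.porth)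
      finally have "E V (\<psi> - proj R \<psi>) = 0" by simp
      then have "E V \<psi> = E V (proj R \<psi>)" using E_diff[OF Vs \<psi> pH] by simp
      then have "norm (E V \<psi>) \<le> norm (proj R \<psi>)" using E_le[OF Vs pH] by simp
      then show "emeasure (\<mu> \<psi>) V \<le> ennreal ((norm (proj R \<psi>))\<^sup>2)"
        using Vs \<psi> by (simp add: emeasure_scalar ennreal_leI power_mono)
    qed
    have "proj R \<psi> \<in> closure R0" using R.pin by (simp add: R_def)
    then obtain u where u: "\<And>n. u n \<in> R0" "u \<longlonglongrightarrow> proj R \<psi>" unfolding closure_sequential by blast
    have "ennreal ((norm (cinner (u n) \<psi>))\<^sup>2) \<le> emeasure (reg_measure \<psi>) U * ennreal ((norm (u n))\<^sup>2)" for n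
    proof -
      obtain V where V: "V \<in> \<V>" "V \<subseteq> U" "u n \<in> H" "E V (u n) = u n" using u(1)[of n] by (auto simp: R0)
      have Vs: "V \<in> sets M" using V \<V>_sets by auto
      have "cinner (u n) \<psi> = cinner (u n) (E V \<psi>)" using E_sa[OF Vs V(3) \<psi>] V(4) by simp
      then have "norm (cinner (u n) \<psi>) \<le> norm (E V \<psi>) * norm (u n)" using cmod_cinner_le[of "u n" "E V \<psi>"] by (simp add: mult.commute)
      then have "(norm (cinner (u n) \<psi>))\<^sup>2 \<le> (norm (E V \<psi>))\<^sup>2 * (norm (u n))\<^sup>2" by (metis norm_ge_zero power_mono power_mult_distrib)
      then have "ennreal ((norm (cinner (u n) \<psi>))\<^sup>2) \<le> ennreal ((norm (E V \<psi>))\<^sup>2) * ennreal ((norm (u n))\<^sup>2)"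
        by (simp add: ennreal_leI flip: ennreal_mult)
      also have "ennreal ((norm (E V \<psi>))\<^sup>2) = emeasure (\<mu> \<psi>) V" using Vs \<psi> by (simp add: emeasure_scalar)
      also have "\<dots> \<le> emeasure (reg_measure \<psi>) U" unfolding reg_measure_open[OF \<psi> U] using V by (intro SUP_upper) auto
      finally show ?thesis by (simp add: mult_right_mono)
    qed
    moreover obtain m where m: "0 \<le> m" "emeasure (reg_measure \<psi>) U = ennreal m"
    proof -
      interpret fm: finite_measure "reg_measure \<psi>" by (rule finite_reg_measure[OF \<psi>])
      show thesis by (rule that[of "measure (reg_measure \<psi>) U"]) (auto simp: fm.emeasure_eq_measure)
    qed
    ultimately have "(norm (cinner (u n) \<psi>))\<^sup>2 \<le> m * (norm (u n))\<^sup>2" for n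
      by (simp add: m flip: ennreal_mult)
    moreover have "(\<lambda>n. (norm (cinner (u n) \<psi>))\<^sup>2) \<longlonglongrightarrow> (norm (cinner (proj R \<psi>) \<psi>))\<^sup>2"
      by (intro tendsto_power tendsto_norm tendsto_cinner u tendsto_const)
    moreover have "(\<lambda>n. m * (norm (u n))\<^sup>2) \<longlonglongrightarrow> m * (norm (proj R \<psi>))\<^sup>2"
      by (intro tendsto_mult tendsto_power tendsto_norm u tendsto_const)
    ultimately have "(norm (cinner (proj R \<psi>) \<psi>))\<^sup>2 \<le> m * (norm (proj R \<psi>))\<^sup>2" by (intro LIMSEQ_le) auto
    moreover have "norm (cinner (proj R \<psi>) \<psi>) = (norm (proj R \<psi>))\<^sup>2"
    proof -
      have "cinner (proj R \<psi>) \<psi> = cinner (proj R \<psi>) (proj R \<psi>)"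
        using R.proj_orth_right[of "proj R \<psi>" \<psi>] by (simp add: cinner_diff_right)
      then show ?thesis by (simp add: cinner_self norm_power)
    qed
    ultimately have key: "(norm (proj R \<psi>))\<^sup>2 * (norm (proj R \<psi>))\<^sup>2 \<le> m * (norm (proj R \<psi>))\<^sup>2" by (simp add: power2_eq_square)
    have "(norm (proj R \<psi>))\<^sup>2 \<le> m"
    proof (cases "proj R \<psi> = 0")
      case False
      then have "0 < (norm (proj R \<psi>))\<^sup>2" by simp
      with key show ?thesis by (rule mult_right_le_imp_le)
    qed (use m in simp)
    then show "ennreal ((norm (proj R \<psi>))\<^sup>2) \<le> emeasure (reg_measure \<psi>) U" unfolding m(2) by (rule ennreal_leI)
  qed
  then show ?thesis using orth_projection_proj[OF R RH] by blast
qed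

text \<open>The Borel sets whose regular measures are quadratic forms of projections form a Dynkin
  system.\<close>

lemma ex_reg_projection:
  assumes "\<Delta> \<in> sets M"
  shows "\<exists>Q. orth_projection H Q \<and> (\<forall>\<psi>\<in>H. emeasure (reg_measure \<psi>) \<Delta> = ennreal ((norm (Q \<psi>))\<^sup>2))"
proof -
  have st: "Int_stable {U. openin T U}" by (auto simp: Int_stable_def)
  have "\<Delta> \<in> sigma_sets X {U. openin T U}" using assms by (simp add: sets_M)
  with st opens_Pow show ?thesis
  proof (induction \<Delta> rule: sigma_sets_induct_disjoint)
    case (basic U)
    then show ?case using ex_open_projection by blast
  next
    case empty
    then show ?case using ex_open_projection[of "{}"] by auto
  next
    case (compl \<Delta>)
    then obtain Q where Q: "orth_projection H Q" "\<And>\<psi>. \<psi> \<in> H \<Longrightarrow> emeasure (reg_measure \<psi>) \<Delta> = ennreal ((norm (Q \<psi>))\<^sup>2)" by blast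
    interpret Q: orth_proj H Q using hilb_sub Q(1) by unfold_locales
    have "emeasure (reg_measure \<psi>) (X - \<Delta>) = ennreal ((norm (\<psi> - Q \<psi>))\<^sup>2)" if \<psi>: "\<psi> \<in> H" for \<psi>
    proof -
      have D: "\<Delta> \<in> sets (reg_measure \<psi>)" using compl(1) sets_reg_measure[OF \<psi>] by (simp add: sets_M)
      have "emeasure (reg_measure \<psi>) (space (reg_measure \<psi>) - \<Delta>) = emeasure (reg_measure \<psi>) (space (reg_measure \<psi>)) - emeasure (reg_measure \<psi>) \<Delta>"
        using D Q(2)[OF \<psi>] by (intro emeasure_compl) auto
      also have "\<dots> = ennreal ((norm \<psi>)\<^sup>2 - (norm (Q \<psi>))\<^sup>2)"
        using Q(2)[OF \<psi>] by (simp add: space_reg_measure[OF \<psi>] reg_measure_space[OF \<psi>] ennreal_minus)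
      finally show ?thesis using Q.norm_split[OF \<psi>] by (simp add: space_reg_measure[OF \<psi>])
    qed
    then show ?case using orth_projection_compl[OF hilb_sub Q(1)] by blast
  next
    case (union \<Delta>)
    then obtain P where P: "\<And>n. orth_projection H (P n)" "\<And>n \<psi>. \<psi> \<in> H \<Longrightarrow> emeasure (reg_measure \<psi>) (\<Delta> n) = ennreal ((norm (P n \<psi>))\<^sup>2)" by metis
    interpret P: orth_proj H "P n" for n using hilb_sub P(1) by unfold_locales
    have D: "\<Delta> n \<in> sets (reg_measure \<psi>)" if "\<psi> \<in> H" for n \<psi> using union(2) sets_reg_measure[OF that] by (auto simp: sets_M)
    have sq: "(\<lambda>n. (norm (P n \<psi>))\<^sup>2) sums enn2real (emeasure (reg_measure \<psi>) (\<Union>n. \<Delta> n))"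
      "ennreal (enn2real (emeasure (reg_measure \<psi>) (\<Union>n. \<Delta> n))) = emeasure (reg_measure \<psi>) (\<Union>n. \<Delta> n)" if \<psi>: "\<psi> \<in> H" for \<psi>
    proof -
      interpret fm: finite_measure "reg_measure \<psi>" by (rule finite_reg_measure[OF \<psi>])
      show e: "ennreal (enn2real (emeasure (reg_measure \<psi>) (\<Union>n. \<Delta> n))) = emeasure (reg_measure \<psi>) (\<Union>n. \<Delta> n)"
        by (simp add: fm.emeasure_eq_measure)
      have "(\<Sum>n. emeasure (reg_measure \<psi>) (\<Delta> n)) = emeasure (reg_measure \<psi>) (\<Union>n. \<Delta> n)"
        using D[OF \<psi>] union(1) by (intro suminf_emeasure) auto
      then have "(\<lambda>n. ennreal ((norm (P n \<psi>))\<^sup>2)) sums ennreal (enn2real (emeasure (reg_measure \<psi>) (\<Union>n. \<Delta> n)))"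
        unfolding e P(2)[OF \<psi>] by (metis summableI summable_sums)
      then show "(\<lambda>n. (norm (P n \<psi>))\<^sup>2) sums enn2real (emeasure (reg_measure \<psi>) (\<Union>n. \<Delta> n))"
        by (subst (asm) sums_ennreal) auto
    qed
    have orth: "P m (P n \<psi>) = 0" if \<psi>: "\<psi> \<in> H" and mn: "m \<noteq> n" for m n \<psi>
      using union(1,2) mn by (intro reg_disjoint_orth[OF P(1) P(1) _ P(2) _ P(2) _ \<psi>, of m n]) (auto simp: sets_M disjoint_family_on_def)
    obtain Q where Q: "orth_projection H Q" "\<And>x. x \<in> H \<Longrightarrow> (\<lambda>n. (norm (P n x))\<^sup>2) sums (norm (Q x))\<^sup>2"
      using ex_sum_orth_projections[OF hilb_sub hilb_closed P(1) orth sums_summable[OF sq(1)]] by blast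
    have "emeasure (reg_measure \<psi>) (\<Union>n. \<Delta> n) = ennreal ((norm (Q \<psi>))\<^sup>2)" if \<psi>: "\<psi> \<in> H" for \<psi>
      using sums_unique2[OF sq(1)[OF \<psi>] Q(2)[OF \<psi>]] sq(2)[OF \<psi>] by simp
    with Q(1) show ?case by blast
  qed
qed

text \<open>The regular spectral measure: \<open>E_reg \<Delta>\<close> is the projection with quadratic form \<open>\<psi> \<mapsto> reg_measure \<psi> \<Delta>\<close>.\<close>

definition E_reg :: "('a \<Rightarrow> complex) set \<Rightarrow> 'h \<Rightarrow> 'h" where
  "E_reg \<Delta> = (SOME Q. orth_projection H Q \<and> (\<forall>\<psi>\<in>H. emeasure (reg_measure \<psi>) \<Delta> = ennreal ((norm (Q \<psi>))\<^sup>2)))"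

lemma
  assumes "\<Delta> \<in> sets M"
  shows E_reg_proj: "orth_projection H (E_reg \<Delta>)"
    and reg_measure_E_reg: "\<psi> \<in> H \<Longrightarrow> emeasure (reg_measure \<psi>) \<Delta> = ennreal ((norm (E_reg \<Delta> \<psi>))\<^sup>2)"
  using someI_ex[OF ex_reg_projection[OF assms], folded E_reg_def] by auto

lemma spectral_E_reg: "spectral_measure M H E_reg"
  unfolding spectral_measure_def
proof (intro conjI ballI allI impI)
  show "orth_projection H (E_reg \<Delta>)" if "\<Delta> \<in> sets M" for \<Delta> using that by (rule E_reg_proj)
  have XM: "X \<in> sets M" by (rule \<V>_sets[OF \<V>_space])
  show "E_reg (space M) x = x" if x: "x \<in> H" for x
  proof -
    interpret Q: orth_proj H "E_reg X" using hilb_sub E_reg_proj[OF XM] by unfold_locales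
    have "ennreal ((norm (E_reg X x))\<^sup>2) = ennreal ((norm x)\<^sup>2)" using reg_measure_E_reg[OF XM x] reg_measure_space[OF x] by simp
    then have "norm (E_reg X x) = norm x" by (simp add: power2_eq_iff_nonneg)
    from Q.norm_eqD[OF x this] show ?thesis by simp
  qed
  fix \<Delta> :: "nat \<Rightarrow> ('a \<Rightarrow> complex) set" and x
  assume D: "range \<Delta> \<subseteq> sets M \<and> disjoint_family \<Delta>" and x: "x \<in> H"
  have Dn: "\<Delta> n \<in> sets M" "(\<Union>n. \<Delta> n) \<in> sets M" for n using D by auto
  interpret P: orth_proj H "E_reg (\<Delta> n)" for n using hilb_sub E_reg_proj[OF Dn(1)] by unfold_locales
  show "(\<lambda>n. E_reg (\<Delta> n) x) sums E_reg (\<Union>n. \<Delta> n) x"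
  proof (rule orth_projections_sums[OF hilb_sub E_reg_proj[OF Dn(1)] E_reg_proj[OF Dn(2)] _ _ x])
    show "(\<lambda>n. (norm (E_reg (\<Delta> n) y))\<^sup>2) sums (norm (E_reg (\<Union>n. \<Delta> n) y))\<^sup>2" if y: "y \<in> H" for y
    proof -
      have "(\<Sum>n. emeasure (reg_measure y) (\<Delta> n)) = emeasure (reg_measure y) (\<Union>n. \<Delta> n)"
        using Dn D sets_reg_measure[OF y] by (intro suminf_emeasure) auto
      then have "(\<lambda>n. ennreal ((norm (E_reg (\<Delta> n) y))\<^sup>2)) sums ennreal ((norm (E_reg (\<Union>n. \<Delta> n) y))\<^sup>2)"
        unfolding reg_measure_E_reg[OF Dn(1) y] reg_measure_E_reg[OF Dn(2) y] by (metis summableI summable_sums)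
      then show ?thesis by (subst (asm) sums_ennreal) auto
    qed
    show "E_reg (\<Delta> m) (E_reg (\<Delta> n) y) = 0" if y: "y \<in> H" and mn: "m \<noteq> n" for m n y
      using D mn by (intro reg_disjoint_orth[OF E_reg_proj[OF Dn(1)] E_reg_proj[OF Dn(1)] Dn(1) reg_measure_E_reg[OF Dn(1)] Dn(1) reg_measure_E_reg[OF Dn(1)] _ y])
        (auto simp: disjoint_family_on_def)
  qed
qed

end

lemma orth_projection_eqI:
  assumes "csubspace H" "orth_projection H P" "orth_projection H Q"
    and eq: "\<And>x. x \<in> H \<Longrightarrow> norm (P x) = norm (Q x)" and x: "x \<in> H"
  shows "P x = Q x"
proof -
  interpret P: orth_proj H P using assms by unfold_locales
  interpret Q: orth_proj H Q using assms by unfold_locales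
  have PQ: "P (Q y) = Q y" if "y \<in> H" for y using that eq[of "Q y"] by (intro P.norm_eqD) auto
  have QP: "Q (P y) = P y" if "y \<in> H" for y using that eq[of "P y"] by (intro Q.norm_eqD) auto
  have "cinner (P x) z = cinner (Q x) z" if z: "z \<in> H" for z
    using x z P.P_sa[of x "Q z"] Q.P_sa[of "P x" z] Q.P_sa[of x z] by (simp add: PQ QP)
  from this[of "P x - Q x"] have "cinner (P x - Q x) (P x - Q x) = 0"
    using x csubspace_diff[OF assms(1)] by (simp add: cinner_diff_left)
  then show ?thesis by simp
qed

sublocale well_behaved_rep \<subseteq> reg: spectral "char_borel A" "hilb \<pi>" E_reg
  by unfold_locales (rule hilb_sub hilb_closed spectral_E_reg)+

context well_behaved_rep
begin

lemma E_reg_\<V>: assumes "V \<in> \<V>" "x \<in> H" shows "E_reg V x = E V x"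
proof (rule orth_projection_eqI[OF hilb_sub _ _ _ assms(2)])
  have V: "V \<in> sets M" by (rule \<V>_sets[OF assms(1)])
  show "orth_projection H (E_reg V)" by (rule E_reg_proj[OF V])
  show "orth_projection H (E V)" using V sm by (simp add: spectral_measure_def)
  fix y assume "y \<in> H"
  then have "ennreal ((norm (E_reg V y))\<^sup>2) = ennreal ((norm (E V y))\<^sup>2)" using reg_measure_E_reg[OF V] reg_measure_\<V>[OF _ assms(1)] by simp
  then show "norm (E_reg V y) = norm (E V y)" by (simp add: power2_eq_iff_nonneg)
qed

text \<open>The projections \<open>E W\<close>, for \<open>W\<close> in \<open>\<V>\<close> increasing to an open set, converge strongly as a net. In this form
  two such approximations can be made at the same time.\<close>

lemma E_reg_open_approx:
  assumes U: "openin T U" and x: "x \<in> H" and e: "e > 0"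
  shows "\<exists>V\<in>\<V>. V \<subseteq> U \<and> (\<forall>W\<in>\<V>. V \<subseteq> W \<longrightarrow> W \<subseteq> U \<longrightarrow> norm (E W x - E_reg U x) < e)"
proof -
  have Us: "U \<in> sets M" by (rule openin_sets[OF U])
  have "\<exists>V\<in>\<V>. V \<subseteq> U \<and> (norm (E_reg U x))\<^sup>2 - e\<^sup>2 < (norm (E V x))\<^sup>2"
  proof (cases "E_reg U x = 0")
    case True
    then show ?thesis using \<V>_empty e x by (intro bexI[of _ "{}"]) auto
  next
    case False
    then have "ennreal ((norm (E_reg U x))\<^sup>2 - e\<^sup>2) < ennreal ((norm (E_reg U x))\<^sup>2)" using e by (intro ennreal_lessI) auto
    also have "\<dots> = (SUP V\<in>{V\<in>\<V>. V \<subseteq> U}. emeasure (\<mu> x) V)" using reg_measure_E_reg[OF Us x] reg_measure_open[OF x U] by simp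
    finally obtain V where V: "V \<in> \<V>" "V \<subseteq> U" "ennreal ((norm (E_reg U x))\<^sup>2 - e\<^sup>2) < ennreal ((norm (E V x))\<^sup>2)"
      using x \<V>_sets by (auto simp: less_SUP_iff emeasure_scalar)
    then have "(norm (E_reg U x))\<^sup>2 - e\<^sup>2 < (norm (E V x))\<^sup>2" using ennreal_leI not_le by metis
    then show ?thesis using V by blast
  qed
  then obtain V where V: "V \<in> \<V>" "V \<subseteq> U" "(norm (E_reg U x))\<^sup>2 - e\<^sup>2 < (norm (E V x))\<^sup>2" by blast
  have "norm (E W x - E_reg U x) < e" if W: "W \<in> \<V>" "V \<subseteq> W" "W \<subseteq> U" for W
  proof -
    have s: "V \<in> sets M" "W \<in> sets M" using V W \<V>_sets by auto
    have "E_reg W (E_reg U x) = E_reg W x" using reg.E_Int[OF s(2) Us x] W by (simp add: Int_absorb2)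
    then have "(norm (E_reg U x))\<^sup>2 = (norm (E W x))\<^sup>2 + (norm (E_reg U x - E W x))\<^sup>2"
      using orth_proj.norm_split[OF reg.E_proj[OF s(2)] reg.E_in[OF Us x]] W x by (simp add: E_reg_\<V>)
    moreover have "norm (E V x) \<le> norm (E W x)"
      using E_Int[OF s(1) s(2) x] E_le[OF s(1) E_in[OF s(2) x]] W by (simp add: Int_absorb2)
    then have "(norm (E V x))\<^sup>2 \<le> (norm (E W x))\<^sup>2" by (simp add: power_mono)
    ultimately have "(norm (E_reg U x - E W x))\<^sup>2 < e\<^sup>2" using V(3) by linarith
    then have "(norm (E W x - E_reg U x))\<^sup>2 < e\<^sup>2" by (simp only: norm_minus_commute)
    then show ?thesis by (rule power2_less_imp_less) (use e in simp)
  qed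
  with V show ?thesis by blast
qed

text \<open>The principle by which all properties pass from the original spectral measure to the regular
  one: a closed linear relation respected on the sets in \<open>\<V>\<close> is respected on open sets by
  approximation from inside, and then on all Borel sets because these form a Dynkin system.\<close>

lemma E_reg_relation:
  assumes a: "a \<in> A g" and G: "closed G" "G \<subseteq> H \<times> H" "(0, 0) \<in> G"
    and diff: "\<And>x y x' y'. (x, y) \<in> G \<Longrightarrow> (x', y') \<in> G \<Longrightarrow> (x - x', y - y') \<in> G"
    and hyp: "\<And>V x y. V \<in> \<V> \<Longrightarrow> (x, y) \<in> G \<Longrightarrow> (E V x, E (transport g a V) y) \<in> G"
    and xy: "(x, y) \<in> G" and D: "\<Delta> \<in> sets M"
  shows "(E_reg \<Delta> x, E_reg (transport g a \<Delta>) y) \<in> G"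
proof -
  have add: "(x + x', y + y') \<in> G" if "(x, y) \<in> G" "(x', y') \<in> G" for x y x' y'
    using diff[OF that(1) diff[OF G(3) that(2)]] by simp
  have opn: "(E_reg U x, E_reg (transport g a U) y) \<in> G" if xy: "(x, y) \<in> G" and U: "openin T U" for U x y
  proof -
    have H: "x \<in> H" "y \<in> H" using xy G by auto
    have tU: "openin T (transport g a U)" by (rule transport_openin[OF a U])
    have "\<exists>p\<in>G. dist p (E_reg U x, E_reg (transport g a U) y) < e" if e: "e > 0" for e
    proof -
      have e2: "e / 2 > 0" using e by simp
      obtain V1 where V1: "V1 \<in> \<V>" "V1 \<subseteq> U" "\<And>W. W \<in> \<V> \<Longrightarrow> V1 \<subseteq> W \<Longrightarrow> W \<subseteq> U \<Longrightarrow> norm (E W x - E_reg U x) < e / 2"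
        using E_reg_open_approx[OF U H(1) e2] by blast
      obtain V2 where V2: "V2 \<in> \<V>" "V2 \<subseteq> transport g a U"
        "\<And>W. W \<in> \<V> \<Longrightarrow> V2 \<subseteq> W \<Longrightarrow> W \<subseteq> transport g a U \<Longrightarrow> norm (E W y - E_reg (transport g a U) y) < e / 2"
        using E_reg_open_approx[OF tU H(2) e2] by blast
      \<comment> \<open>The set found for \<open>y\<close> is pulled back, so that one \<open>V\<close> serves for both vectors.\<close>
      define V3 where "V3 = transport (- g) (star a) V2"
      have V2X: "V2 \<subseteq> X" "V2 \<subseteq> nonvanishing (star a)" using V2(2) transport_subset by blast+
      have V3: "V3 \<in> \<V>" unfolding V3_def by (rule transport_\<V>[OF A_star[OF a] V2(1)])
      have V3U: "V3 \<subseteq> U"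
        unfolding V3_def transport_eq[OF A_star[OF a] V2X(1)] using V2(2) by (auto simp: transport_def)
      define V where "V = V1 \<union> V3"
      have V: "V \<in> \<V>" "V \<subseteq> U" "V1 \<subseteq> V" using V1 V3 V3U \<V>_Un by (auto simp: V_def)
      have "V2 = transport g a V3" unfolding V3_def using transport_inverse[OF a V2X(1)] V2X(2) by auto
      then have V2': "V2 \<subseteq> transport g a V" "transport g a V \<subseteq> transport g a U" using V(2) by (auto simp: transport_def V_def)
      have "norm (E V x - E_reg U x) < e / 2" by (rule V1(3)[OF V(1,3,2)])
      moreover have "norm (E (transport g a V) y - E_reg (transport g a U) y) < e / 2"
        by (rule V2(3)[OF transport_\<V>[OF a V(1)] V2'])
      ultimately have "dist (E V x, E (transport g a V) y) (E_reg U x, E_reg (transport g a U) y) < e"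
        using norm_Pair_le[of "E V x - E_reg U x" "E (transport g a V) y - E_reg (transport g a U) y"] by (simp add: dist_norm)
      then show ?thesis using hyp[OF V(1) xy] by blast
    qed
    then have "(E_reg U x, E_reg (transport g a U) y) \<in> closure G" unfolding closure_approachable by blast
    then show ?thesis using G(1) by simp
  qed
  have st: "Int_stable {U. openin T U}" by (auto simp: Int_stable_def)
  have "\<Delta> \<in> sigma_sets X {U. openin T U}" using D by (simp add: sets_M)
  with st opens_Pow have "\<forall>x y. (x, y) \<in> G \<longrightarrow> (E_reg \<Delta> x, E_reg (transport g a \<Delta>) y) \<in> G"
  proof (induction \<Delta> rule: sigma_sets_induct_disjoint)
    case (basic U)
    then show ?case using opn by blast
  next
    case empty
    have "transport g a {} = {}" by (simp add: transport_def)
    then show ?case using G by auto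
  next
    case (compl \<Delta>)
    have D: "\<Delta> \<in> sets M" using compl(1) by (simp add: sets_M)
    have XT: "openin T X" by (rule \<V>_openin[OF \<V>_space])
    show ?case
    proof (intro allI impI)
      fix x y assume xy: "(x, y) \<in> G"
      have H: "x \<in> H" "y \<in> H" using xy G by auto
      have "transport g a (X - \<Delta>) = transport g a X - transport g a \<Delta>" by (auto simp: transport_def)
      moreover have "transport g a \<Delta> \<subseteq> transport g a X" using sets.sets_into_space[OF D] by (auto simp: transport_def)
      ultimately have "E_reg (transport g a (X - \<Delta>)) y = E_reg (transport g a X) y - E_reg (transport g a \<Delta>) y"
        using H transport_sets[OF a D] openin_sets[OF transport_openin[OF a XT]] by (simp add: reg.E_Diff)
      moreover have "E_reg (X - \<Delta>) x = E_reg X x - E_reg \<Delta> x"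
        using reg.E_compl[OF D H(1)] reg.E_space[OF H(1)] by simp
      ultimately show "(E_reg (X - \<Delta>) x, E_reg (transport g a (X - \<Delta>)) y) \<in> G"
        using diff[OF opn[OF xy XT]] compl(2) xy by simp
    qed
  next
    case (union \<Delta>)
    have D: "range \<Delta> \<subseteq> sets M" using union(2) by (simp add: sets_M)
    show ?case
    proof (intro allI impI)
      fix x y assume xy: "(x, y) \<in> G"
      have H: "x \<in> H" "y \<in> H" using xy G by auto
      have t: "range (\<lambda>n. transport g a (\<Delta> n)) \<subseteq> sets M" using D transport_sets[OF a] by auto
      have td: "disjoint_family (\<lambda>n. transport g a (\<Delta> n))" using union(1) by (auto simp: disjoint_family_on_def transport_def)
      have tu: "transport g a (\<Union>n. \<Delta> n) = (\<Union>n. transport g a (\<Delta> n))" by (auto simp: transport_def)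
      have "((\<Sum>k<n. E_reg (\<Delta> k) x), (\<Sum>k<n. E_reg (transport g a (\<Delta> k)) y)) \<in> G" for n
        by (induction n) (use G(3) add union(3) xy in auto)
      moreover have "(\<lambda>n. ((\<Sum>k<n. E_reg (\<Delta> k) x), (\<Sum>k<n. E_reg (transport g a (\<Delta> k)) y))) \<longlonglongrightarrow> (E_reg (\<Union>n. \<Delta> n) x, E_reg (\<Union>n. transport g a (\<Delta> n)) y)"
        using reg.E_sums[OF D union(1) H(1)] reg.E_sums[OF t td H(2)] unfolding sums_def by (rule tendsto_Pair)
      ultimately show "(E_reg (\<Union>n. \<Delta> n) x, E_reg (transport g a (\<Union>n. \<Delta> n)) y) \<in> G"
        unfolding tu by (rule closed_sequentially[OF G(1)])
    qed
  qed
  with xy show ?thesis by blast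
qed

lemma transport_one: assumes "\<Delta> \<subseteq> X" shows "transport 0 1 \<Delta> = \<Delta>"
proof -
  have "\<xi> 1 \<noteq> 0" if "\<xi> \<in> X" for \<xi> using char_one[OF that] by simp
  then have "nonvanishing (star 1) = X" by (auto simp: nonvanishing_def)
  then show ?thesis using assms char_act_zero by (auto simp: transport_def)
qed

lemma E_reg_relation':
  assumes "closed G" "G \<subseteq> H \<times> H" "(0, 0) \<in> G"
    and "\<And>x y x' y'. (x, y) \<in> G \<Longrightarrow> (x', y') \<in> G \<Longrightarrow> (x - x', y - y') \<in> G"
    and "\<And>V x y. V \<in> \<V> \<Longrightarrow> (x, y) \<in> G \<Longrightarrow> (E V x, E V y) \<in> G"
    and "(x, y) \<in> G" "\<Delta> \<in> sets M"
  shows "(E_reg \<Delta> x, E_reg \<Delta> y) \<in> G"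
proof -
  have t: "transport 0 1 S = S" if "S \<in> sets M" for S using sets.sets_into_space[OF that] by (simp add: transport_one)
  have "(E_reg \<Delta> x, E_reg (transport 0 1 \<Delta>) y) \<in> G"
  proof (rule E_reg_relation[OF one_in_A0 assms(1-4) _ assms(6,7)])
    fix V x y assume V: "V \<in> \<V>" and "(x, y) \<in> G"
    then show "(E V x, E (transport 0 1 V) y) \<in> G" using assms(5) by (simp add: t[OF \<V>_sets[OF V]])
  qed
  then show ?thesis using t[OF assms(7)] by simp
qed

text \<open>The relation \<open>L \<times> L\<close> turns invariance of a subspace into an instance of the principle.\<close>

lemma E_reg_invariant:
  assumes L: "csubspace L" "closed L" "L \<subseteq> H" and inv: "\<And>V y. V \<in> \<V> \<Longrightarrow> y \<in> L \<Longrightarrow> E V y \<in> L"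
    and "\<Delta> \<in> sets M" "x \<in> L"
  shows "E_reg \<Delta> x \<in> L"
proof -
  have "(E_reg \<Delta> x, E_reg \<Delta> x) \<in> L \<times> L"
    using assms by (intro E_reg_relation') (auto intro: closed_Times csubspace_0 csubspace_diff)
  then show ?thesis by simp
qed

lemma E_closure_rep_op:
  assumes a: "a \<in> A g" and V: "V \<in> sets M" and xy: "(x, y) \<in> closure (rep_op \<pi> a)"
  shows "(E V x, E (transport g a V) y) \<in> closure (rep_op \<pi> a)"
proof -
  obtain u where u: "\<And>n. u n \<in> D" "u \<longlonglongrightarrow> x" "(\<lambda>n. act \<pi> a (u n)) \<longlonglongrightarrow> y" using xy by (auto simp: closure_rep_op_iff)
  have H: "x \<in> H" "y \<in> H" using closure_rep_op_hilb[OF in_alg xy] by auto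
  have t: "transport g a V \<in> sets M" by (rule transport_sets[OF a V])
  have "(\<lambda>n. E V (u n)) \<longlonglongrightarrow> E V x" using u H V dom_hilb by (intro E_tendsto) auto
  moreover have "(\<lambda>n. E (transport g a V) (act \<pi> a (u n))) \<longlonglongrightarrow> E (transport g a V) y"
    using u H t act_hilb by (intro E_tendsto) auto
  then have "(\<lambda>n. act \<pi> a (E V (u n))) \<longlonglongrightarrow> E (transport g a V) y" using act_transport[OF a V u(1)] by simp
  ultimately show ?thesis using E_dom[OF V u(1)] unfolding closure_rep_op_iff by (intro exI[of _ "\<lambda>n. E V (u n)"]) simp
qed

lemma E_reg_closure_rep_op:
  assumes a: "a \<in> A g" and V: "\<Delta> \<in> sets M" and xy: "(x, y) \<in> closure (rep_op \<pi> a)"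
  shows "(E_reg \<Delta> x, E_reg (transport g a \<Delta>) y) \<in> closure (rep_op \<pi> a)"
proof (rule E_reg_relation[OF a _ _ _ _ _ xy V])
  show "closure (rep_op \<pi> a) \<subseteq> H \<times> H" using closure_rep_op_hilb[OF in_alg] by auto
  show "(0, 0) \<in> closure (rep_op \<pi> a)" using rep_op_closure[OF csubspace_0[OF dom_sub], of a] by simp
qed (use E_closure_rep_op[OF a \<V>_sets] closure_rep_op_diff in auto)

text \<open>For elements of degree zero the closed operators themselves are relations respected by \<open>E\<close>, and the
  domain is the intersection of their domains.\<close>

lemma E_reg_dom: assumes "\<Delta> \<in> sets M" "x \<in> D" shows "E_reg \<Delta> x \<in> D"
proof (rule in_domI)
  fix b assume b: "b \<in> A 0"
  have "(E_reg \<Delta> x, E_reg \<Delta> (act \<pi> b x)) \<in> closure (rep_op \<pi> b)"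
  proof (rule E_reg_relation'[OF _ _ _ _ _ rep_op_closure[OF assms(2)] assms(1)])
    show "closure (rep_op \<pi> b) \<subseteq> H \<times> H" using closure_rep_op_hilb[OF in_alg] by auto
    show "(0, 0) \<in> closure (rep_op \<pi> b)" using rep_op_closure[OF csubspace_0[OF dom_sub], of b] by simp
    show "(E V x, E V y) \<in> closure (rep_op \<pi> b)" if "V \<in> \<V>" "(x, y) \<in> closure (rep_op \<pi> b)" for V x y
      using that(2) spectral_integral_E[OF _ \<V>_sets[OF that(1)]] unfolding SI[OF b] by blast
  qed (use closure_rep_op_diff in auto)
  then show "\<exists>y. (E_reg \<Delta> x, y) \<in> closure (rep_op \<pi> b)" by blast
qed

lemma act_E_reg_transport:
  assumes a: "a \<in> A g" and D: "\<Delta> \<in> sets M" and x: "x \<in> D"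
  shows "act \<pi> a (E_reg \<Delta> x) = E_reg (transport g a \<Delta>) (act \<pi> a x)"
  using closure_rep_op_dom[OF in_alg E_reg_closure_rep_op[OF a D rep_op_closure[OF x]] E_reg_dom[OF D x]] by simp

text \<open>The spectral integrals do not change because the sets \<open>{\<xi>. \<xi> b \<in> U}\<close> with \<open>U\<close> open belong to \<open>\<V>\<close>. For the covariance,
  \<open>\<pi>(a)x\<close> is carried by the set where \<open>star a\<close> does not vanish, and there the partial action agrees with the transport by \<open>a\<close>.\<close>

theorem well_behaved_rep_E_reg: "well_behaved_rep A \<pi> E_reg"
proof unfold_locales
  show "spectral_measure M H E_reg" by (rule spectral_E_reg)
  show "closure (rep_op \<pi> b) = spectral_integral M H E_reg (\<lambda>\<xi>. \<xi> b)" if b: "b \<in> A 0" for b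
    unfolding SI[OF b]
  proof (rule spectral_integral_cong)
    show "spectral M H E" "spectral M H E_reg" by unfold_locales
    fix U :: "complex set" and x assume "open U" "x \<in> H"
    then show "E ((\<lambda>\<xi>. \<xi> b) -` U \<inter> space M) x = E_reg ((\<lambda>\<xi>. \<xi> b) -` U \<inter> space M) x"
      using E_reg_\<V>[OF \<V>_eval[OF b], of U x] by (simp add: vimage_def Int_def conj_commute)
  qed
  fix g a \<Delta> assume a: "a \<in> A g" and D: "\<Delta> \<in> sets M"
  have DX: "\<Delta> \<subseteq> X" using sets.sets_into_space[OF D] by simp
  have "E_reg (set_act A g \<Delta>) (act \<pi> a x) = E_reg (transport g a \<Delta>) (act \<pi> a x)" if x: "x \<in> D" for x
  proof -
    have "act \<pi> a x = E_reg (nonvanishing (star a)) (act \<pi> a x)"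
      using E_nonvanishing_act[OF a x] E_reg_\<V>[OF nonvanishing_\<V>[OF A_star[OF a]] act_hilb[OF in_alg x]] by simp
    then have "E_reg (set_act A g \<Delta>) (act \<pi> a x) = E_reg (set_act A g \<Delta>) (E_reg (nonvanishing (star a)) (act \<pi> a x))" by simp
    also have "\<dots> = E_reg (transport g a \<Delta>) (act \<pi> a x)"
      using reg.E_Int[OF set_act_sets[OF D] nonvanishing_sets[OF A_star[OF a]] act_hilb[OF in_alg x]] set_act_transport[OF a DX] by simp
    finally show ?thesis .
  qed
  then show "rep_op \<pi> a O op_graph H (E_reg (set_act A g \<Delta>)) \<subseteq> op_graph H (E_reg \<Delta>) O rep_op \<pi> a"
    using E_reg_dom[OF D] act_E_reg_transport[OF a D] dom_hilb by (auto simp: rep_op_def op_graph_def relcomp_unfold)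
qed (use alg_UNIV int metr in auto)

end

text \<open>A spectral measure is regular here if it has no fewer invariant subspaces than its restriction to
  \<open>\<V>\<close>.\<close>

locale regular_well_behaved_rep = well_behaved_rep A \<pi> E
  for A :: "'g::group_add \<Rightarrow> 'a::complex_star_algebra set" and \<pi> :: "('a, 'h::complex_hilbert_space) rep" and E +
  assumes invariant: "\<And>L \<Delta> x. csubspace L \<Longrightarrow> closed L \<Longrightarrow> L \<subseteq> H \<Longrightarrow> (\<And>V y. V \<in> \<V> \<Longrightarrow> y \<in> L \<Longrightarrow> E V y \<in> L) \<Longrightarrow>
    \<Delta> \<in> sets M \<Longrightarrow> x \<in> L \<Longrightarrow> E \<Delta> x \<in> L"

lemma (in well_behaved_rep) regular_well_behaved_rep_E_reg: "regular_well_behaved_rep A \<pi> E_reg"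
proof -
  interpret W: well_behaved_rep A \<pi> E_reg by (rule well_behaved_rep_E_reg)
  show ?thesis
  proof unfold_locales
    fix L \<Delta> x
    assume L: "csubspace L" "closed L" "L \<subseteq> H" and inv: "\<And>V y. V \<in> \<V> \<Longrightarrow> y \<in> L \<Longrightarrow> E_reg V y \<in> L"
      and D: "\<Delta> \<in> sets M" and x: "x \<in> L"
    have "E V y \<in> L" if "V \<in> \<V>" "y \<in> L" for V y using inv[OF that] E_reg_\<V>[OF that(1)] L(3) that(2) by auto
    then show "E_reg \<Delta> x \<in> L" by (rule E_reg_invariant[OF L _ D x])
  qed
qed

lemma closure_sequenceI: "(\<And>n::nat. u n \<in> S) \<Longrightarrow> u \<longlonglongrightarrow> l \<Longrightarrow> l \<in> closure (S :: 'x::metric_space set)"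
  unfolding closure_sequential by blast

lemma limit_eq_zero: "(\<And>n::nat. f n = 0) \<Longrightarrow> f \<longlonglongrightarrow> l \<Longrightarrow> l = (0::'x::real_normed_vector)"
  using LIMSEQ_const_iff[of 0 l] by (metis ext)

lemma LIMSEQ_norm_le:
  fixes f :: "nat \<Rightarrow> 'x::real_normed_vector" and u :: "nat \<Rightarrow> 'y::real_normed_vector"
  assumes le: "\<And>n. norm (f n - l) \<le> C * norm (u n - k)" and u: "u \<longlonglongrightarrow> k"
  shows "f \<longlonglongrightarrow> l"
proof -
  have "(\<lambda>n. C * norm (u n - k)) \<longlonglongrightarrow> C * 0" using u by (intro tendsto_mult tendsto_const tendsto_norm_zero LIM_zero)
  then have "(\<lambda>n. C * norm (u n - k)) \<longlonglongrightarrow> 0" by simp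
  moreover have "\<forall>\<^sub>F n in sequentially. norm (f n - l) \<le> C * norm (u n - k)" by (rule always_eventually) (rule allI, rule le)
  ultimately have "(\<lambda>n. f n - l) \<longlonglongrightarrow> 0" by (rule Lim_null_comparison[rotated])
  then show ?thesis by (rule LIM_zero_cancel)
qed

section \<open>Reducing subspaces\<close>

definition subrep :: "('a, 'h) rep \<Rightarrow> 'h set \<Rightarrow> ('a, 'h) rep" where
  "subrep \<pi> K = \<pi>\<lparr>hilb := K, dom := dom \<pi> \<inter> K\<rparr>"

lemma subrep_simps [simp]: "alg (subrep \<pi> K) = alg \<pi>" "hilb (subrep \<pi> K) = K" "dom (subrep \<pi> K) = dom \<pi> \<inter> K"
  "act (subrep \<pi> K) = act \<pi>" "graph_norm (subrep \<pi> K) = graph_norm \<pi>"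
  by (simp_all add: subrep_def graph_norm_def fun_eq_iff)

context well_behaved_rep
begin

definition E_invariant :: "'h set \<Rightarrow> bool" where
  "E_invariant K \<longleftrightarrow> csubspace K \<and> closed K \<and> K \<subseteq> H \<and> (\<forall>\<Delta>\<in>sets M. \<forall>x\<in>K. E \<Delta> x \<in> K)"

definition reducing :: "'h set \<Rightarrow> bool" where
  "reducing K \<longleftrightarrow> E_invariant K \<and> (\<forall>a. \<forall>x\<in>D \<inter> K. act \<pi> a x \<in> K)"

lemma E_invariant_closed_csubspace: "E_invariant K \<Longrightarrow> closed_csubspace K"
  by (simp add: E_invariant_def closed_csubspaceI)

lemma proj_E:
  assumes K: "E_invariant K" and x: "x \<in> H" and D: "\<Delta> \<in> sets M"
  shows "E \<Delta> (proj K x) = proj K (E \<Delta> x)"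
proof -
  interpret K: closed_csubspace K by (rule E_invariant_closed_csubspace[OF K])
  have KH: "K \<subseteq> H" and inv: "\<And>k. k \<in> K \<Longrightarrow> E \<Delta> k \<in> K" using K D by (auto simp: E_invariant_def)
  have p: "proj K x \<in> H" using KH K.pin by blast
  have "proj K (E \<Delta> x) = E \<Delta> (proj K x)"
  proof (rule proj_eqI[OF K.csub K.closed])
    show "E \<Delta> (proj K x) \<in> K" by (rule inv) simp
    fix k assume k: "k \<in> K"
    have "cinner (E \<Delta> x - E \<Delta> (proj K x)) k = cinner (E \<Delta> (x - proj K x)) k" using E_diff[OF D x p] by simp
    also have "\<dots> = cinner (x - proj K x) (E \<Delta> k)" using E_sa[OF D] csubspace_diff[OF hilb_sub x p] k KH by blast
    also have "\<dots> = 0" using inv[OF k] by (rule K.porth)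
    finally show "cinner (E \<Delta> x - E \<Delta> (proj K x)) k = 0" .
  qed
  then show ?thesis by simp
qed

lemma proj_spectral_integral:
  assumes K: "E_invariant K" and xy: "(x, y) \<in> closure (rep_op \<pi> b)" and b: "b \<in> A 0"
  shows "(proj K x, proj K y) \<in> closure (rep_op \<pi> b)"
proof -
  interpret K: closed_csubspace K by (rule E_invariant_closed_csubspace[OF K])
  have KH: "K \<subseteq> H" using K by (simp add: E_invariant_def)
  have x: "x \<in> H" using closure_rep_op_hilb[OF in_alg xy] by simp
  show ?thesis
    unfolding SI[OF b]
  proof (rule spectral_integral_commute[OF xy[unfolded SI[OF b]]])
    show "proj K z \<in> H" for z using KH K.pin by blast
    show "(\<lambda>n. proj K (f n)) \<longlonglongrightarrow> proj K z" if "f \<longlonglongrightarrow> z" for f z using that by (rule K.tendsto_proj)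
    show "E \<Delta> (proj K x) = proj K (E \<Delta> x)" if "\<Delta> \<in> sets M" for \<Delta> by (rule proj_E[OF K x that])
  qed (auto simp: K.proj_add K.proj_scaleC K.norm_proj_le)
qed

lemma proj_dom: assumes K: "E_invariant K" and x: "x \<in> D" shows "proj K x \<in> D"
  using proj_spectral_integral[OF K rep_op_closure[OF x]] by (intro in_domI) blast

lemma E_invariant_dense: assumes K: "E_invariant K" shows "closure (D \<inter> K) = K"
proof
  interpret K: closed_csubspace K by (rule E_invariant_closed_csubspace[OF K])
  show "closure (D \<inter> K) \<subseteq> K" using K.closed by (intro closure_minimal) auto
  show "K \<subseteq> closure (D \<inter> K)"
  proof
    fix k assume k: "k \<in> K"
    then have "k \<in> closure D" using K dom_dense by (auto simp: E_invariant_def)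
    then obtain u where u: "\<And>n. u n \<in> D" "u \<longlonglongrightarrow> k" unfolding closure_sequential by blast
    have "(\<lambda>n. proj K (u n)) \<longlonglongrightarrow> k" using K.tendsto_proj[OF u(2)] k by simp
    moreover have "proj K (u n) \<in> D \<inter> K" for n using proj_dom[OF K u(1)] by simp
    ultimately show "k \<in> closure (D \<inter> K)" by (rule closure_sequenceI[rotated])
  qed
qed

text \<open>The operators are symmetric, so they map the orthogonal complement of a reducing subspace into itself.\<close>

lemma reducing_proj:
  assumes R: "reducing K" and x: "x \<in> D" shows "act \<pi> a (proj K x) = proj K (act \<pi> a x)"
proof -
  have K: "E_invariant K" and inv: "\<And>a x. x \<in> D \<Longrightarrow> x \<in> K \<Longrightarrow> act \<pi> a x \<in> K" using R by (auto simp: reducing_def)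
  interpret K: closed_csubspace K by (rule E_invariant_closed_csubspace[OF K])
  have p: "proj K x \<in> D" by (rule proj_dom[OF K x])
  define y where "y = x - proj K x"
  have y: "y \<in> D" unfolding y_def using x p by (rule csubspace_diff[OF dom_sub])
  have "proj K (act \<pi> a y) = 0"
  proof (rule K.proj_0I)
    fix k assume "k \<in> K"
    then have "k \<in> closure (D \<inter> K)" using E_invariant_dense[OF K] by simp
    then obtain u where u: "\<And>n. u n \<in> D \<inter> K" "u \<longlonglongrightarrow> k" unfolding closure_sequential by blast
    have "cinner (act \<pi> a y) (u n) = 0" for n
    proof -
      have "cinner (act \<pi> a y) (u n) = cinner y (act \<pi> (star a) (u n))" using y u(1)[of n] by (intro act_star) auto
      also have "\<dots> = 0" unfolding y_def using u(1)[of n] inv by (intro K.porth) auto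
      finally show ?thesis .
    qed
    moreover have "(\<lambda>n. cinner (act \<pi> a y) (u n)) \<longlonglongrightarrow> cinner (act \<pi> a y) k" by (intro tendsto_cinner tendsto_const u)
    ultimately show "cinner (act \<pi> a y) k = 0" by (rule limit_eq_zero)
  qed
  then have "proj K (act \<pi> a x - act \<pi> a (proj K x)) = 0" using x p by (simp add: y_def act_diff)
  then show ?thesis using inv[OF p K.pin] by (simp add: K.proj_diff)
qed

lemma star_rep_subrep:
  assumes R: "reducing K" and S: "star_subalgebra S" shows "star_rep (Res S (subrep \<pi> K))"
proof -
  have K: "E_invariant K" and inv: "\<And>a x. x \<in> D \<Longrightarrow> x \<in> K \<Longrightarrow> act \<pi> a x \<in> K" using R by (auto simp: reducing_def)
  have Kc: "csubspace K" "closed K" using K by (auto simp: E_invariant_def)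
  show ?thesis
    unfolding star_rep_def clinear_on_def
    using S Kc csubspace_Int[OF dom_sub Kc(1)] E_invariant_dense[OF K] inv
    by (auto simp: act_add act_scaleC act_add_alg act_scaleC_alg act_mult act_star act_in)
qed

text \<open>The degree-zero part determines the graph topology, because \<open>\<parallel>\<pi>(a)x\<parallel>\<^sup>2 \<le> \<parallel>\<pi>(a\<^sup>* a)x\<parallel> \<parallel>x\<parallel>\<close> for homogeneous \<open>a\<close>.\<close>

lemma act_tendsto_zero:
  assumes D: "\<forall>\<^sub>F x in F. u x \<in> D" and lim: "((\<lambda>x. norm (u x)) \<longlongrightarrow> 0) F"
    and lim0: "\<And>b. b \<in> A 0 \<Longrightarrow> ((\<lambda>x. norm (act \<pi> b (u x))) \<longlongrightarrow> 0) F"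
  shows "((\<lambda>x. norm (act \<pi> a (u x))) \<longlongrightarrow> 0) F"
proof -
  obtain f I where f: "finite I" "\<And>g. g \<in> I \<Longrightarrow> f g \<in> A g" "a = (\<Sum>g\<in>I. f g)" by (rule ex_homogeneous_sum[of a]) (rule that)
  have "((\<lambda>x. \<Sum>g\<in>I. sqrt (norm (act \<pi> (star (f g) * f g) (u x)) * norm (u x))) \<longlongrightarrow> (\<Sum>g\<in>I. sqrt (0 * 0))) F"
    using f(2) by (intro tendsto_sum tendsto_real_sqrt tendsto_mult lim lim0) (auto intro: A0_star_mult)
  then have "((\<lambda>x. \<Sum>g\<in>I. sqrt (norm (act \<pi> (star (f g) * f g) (u x)) * norm (u x))) \<longlongrightarrow> 0) F" by simp
  moreover have "\<forall>\<^sub>F x in F. norm (norm (act \<pi> a (u x))) \<le> (\<Sum>g\<in>I. sqrt (norm (act \<pi> (star (f g) * f g) (u x)) * norm (u x)))"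
    using D
  proof eventually_elim
    case (elim x)
    have "act \<pi> a (u x) = (\<Sum>g\<in>I. act \<pi> (f g) (u x))" unfolding f(3) using elim by (intro act_sum_alg) auto
    then have "norm (act \<pi> a (u x)) \<le> (\<Sum>g\<in>I. norm (act \<pi> (f g) (u x)))" by (simp add: norm_sum)
    also have "\<dots> \<le> (\<Sum>g\<in>I. sqrt (norm (act \<pi> (star (f g) * f g) (u x)) * norm (u x)))"
      using elim by (intro sum_mono real_le_rsqrt norm_act_sq_le) auto
    finally show ?case by simp
  qed
  ultimately show ?thesis by (rule Lim_null_comparison[rotated])
qed

lemma closed_rep_subrep:
  assumes R: "reducing K" and S: "star_subalgebra S" "A 0 \<subseteq> S" shows "closed_rep (Res S (subrep \<pi> K))"
  unfolding closed_rep_def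
proof (intro allI impI)
  have K: "closed K" using R by (auto simp: reducing_def E_invariant_def)
  interpret S: star_representation "Res S (subrep \<pi> K)" using star_rep_subrep[OF R S(1)] by unfold_locales
  have i: "star_rep (Res (A 0) \<pi>)" "closed_rep (Res (A 0) \<pi>)" using int by (auto simp: integrable_rep_def)
  interpret R: star_representation "Res (A 0) \<pi>" using i(1) by unfold_locales
  fix F :: "'h filter"
  assume F: "F \<noteq> bot \<and> F \<le> principal (dom (Res S (subrep \<pi> K))) \<and>
    (\<forall>a\<in>alg (Res S (subrep \<pi> K)). ((\<lambda>(x, y). graph_norm (Res S (subrep \<pi> K)) a (x - y)) \<longlongrightarrow> 0) (F \<times>\<^sub>F F))"
  have DK: "\<forall>\<^sub>F x in F. x \<in> D \<inter> K" using F by (simp add: le_principal)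
  then have "F \<le> principal D" unfolding le_principal by eventually_elim simp
  then obtain \<phi> where \<phi>: "\<phi> \<in> D" "limitin (graph_topology (Res (A 0) \<pi>)) (\<lambda>x. x) \<phi> F"
    using i(2) F S(2) unfolding closed_rep_def by (auto simp: subset_iff)
  then have gn: "((\<lambda>x. norm (x - \<phi>) + norm (act \<pi> b (x - \<phi>))) \<longlongrightarrow> 0) F" if "b \<in> A 0" for b
    using that unfolding R.limitin_graph_iff by (simp add: graph_norm_def)
  have n0: "((\<lambda>x. norm (x - \<phi>)) \<longlongrightarrow> 0) F" by (rule Lim_null_comparison[OF _ gn[OF A_zero]]) simp
  have nb: "((\<lambda>x. norm (act \<pi> b (x - \<phi>))) \<longlongrightarrow> 0) F" if "b \<in> A 0" for b by (rule Lim_null_comparison[OF _ gn[OF that]]) simp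
  have "((\<lambda>x. x) \<longlongrightarrow> \<phi>) F" using n0 by (rule LIM_zero_cancel[OF tendsto_norm_zero_cancel])
  moreover have "\<forall>\<^sub>F x in F. x \<in> K" using DK by eventually_elim simp
  ultimately have \<phi>K: "\<phi> \<in> K" using F by (intro Lim_in_closed_set[OF K, of "\<lambda>x. x" F]) auto
  have uD: "\<forall>\<^sub>F x in F. x - \<phi> \<in> D" using DK by eventually_elim (use \<phi>(1) csubspace_diff[OF dom_sub] in auto)
  have "((\<lambda>x. norm (x - \<phi>) + norm (act \<pi> a (x - \<phi>))) \<longlongrightarrow> 0 + 0) F" for a
    by (intro tendsto_add n0 act_tendsto_zero[OF uD n0 nb])
  then have "limitin (graph_topology (Res S (subrep \<pi> K))) (\<lambda>x. x) \<phi> F"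
    unfolding S.limitin_graph_iff using \<phi>(1) \<phi>K DK by (simp add: graph_norm_def)
  then show "\<exists>\<phi>\<in>dom (Res S (subrep \<pi> K)). limitin (graph_topology (Res S (subrep \<pi> K))) (\<lambda>x. x) \<phi> F"
    using \<phi>(1) \<phi>K by auto
qed

lemma closure_rep_op_subrep:
  assumes R: "reducing K" shows "closure (rep_op (subrep \<pi> K) b) = closure (rep_op \<pi> b) \<inter> K \<times> K"
proof
  have K: "E_invariant K" and inv: "\<And>a x. x \<in> D \<Longrightarrow> x \<in> K \<Longrightarrow> act \<pi> a x \<in> K" using R by (auto simp: reducing_def)
  interpret K: closed_csubspace K by (rule E_invariant_closed_csubspace[OF K])
  have "rep_op (subrep \<pi> K) b \<subseteq> rep_op \<pi> b \<inter> K \<times> K" using inv by (auto simp: rep_op_def op_graph_def)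
  then show "closure (rep_op (subrep \<pi> K) b) \<subseteq> closure (rep_op \<pi> b) \<inter> K \<times> K"
    using closure_subset[of "rep_op \<pi> b"] K.closed by (intro closure_minimal closed_Int closed_Times) auto
  show "closure (rep_op \<pi> b) \<inter> K \<times> K \<subseteq> closure (rep_op (subrep \<pi> K) b)"
  proof
    fix p assume "p \<in> closure (rep_op \<pi> b) \<inter> K \<times> K"
    then obtain x y where p: "p = (x, y)" "(x, y) \<in> closure (rep_op \<pi> b)" "x \<in> K" "y \<in> K" by auto
    obtain u where u: "\<And>n. u n \<in> D" "u \<longlonglongrightarrow> x" "(\<lambda>n. act \<pi> b (u n)) \<longlonglongrightarrow> y" using p(2) by (auto simp: closure_rep_op_iff)
    have "(\<lambda>n. (proj K (u n), act \<pi> b (proj K (u n)))) \<longlonglongrightarrow> (x, y)"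
      unfolding reducing_proj[OF R u(1)] using K.tendsto_proj[OF u(2)] K.tendsto_proj[OF u(3)] p by (auto intro: tendsto_Pair)
    moreover have "(proj K (u n), act \<pi> b (proj K (u n))) \<in> rep_op (subrep \<pi> K) b" for n
      using proj_dom[OF K u(1)] by (auto simp: rep_op_def op_graph_def)
    ultimately show "p \<in> closure (rep_op (subrep \<pi> K) b)" unfolding p(1) by (rule closure_sequenceI[rotated])
  qed
qed

lemma op_adjoint_subrep:
  assumes R: "reducing K" shows "op_adjoint K (rep_op (subrep \<pi> K) b) = op_adjoint H (rep_op \<pi> b) \<inter> K \<times> K"
proof -
  have K: "E_invariant K" using R by (auto simp: reducing_def)
  interpret K: closed_csubspace K by (rule E_invariant_closed_csubspace[OF K])
  have KH: "K \<subseteq> H" using K by (simp add: E_invariant_def)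
  have "(\<forall>x\<in>D. cinner (act \<pi> b x) y = cinner x z) \<longleftrightarrow> (\<forall>x\<in>D \<inter> K. cinner (act \<pi> b x) y = cinner x z)"
    if yz: "y \<in> K" "z \<in> K" for y z
  proof safe
    fix x assume *: "\<forall>x\<in>D \<inter> K. cinner (act \<pi> b x) y = cinner x z" and x: "x \<in> D"
    have "cinner (act \<pi> b x) y = cinner (proj K (act \<pi> b x)) y" using yz by (simp add: K.proj_sa)
    also have "\<dots> = cinner (proj K x) z" using * proj_dom[OF K x] by (simp flip: reducing_proj[OF R x])
    also have "\<dots> = cinner x z" using yz by (simp add: K.proj_sa)
    finally show "cinner (act \<pi> b x) y = cinner x z" .
  qed auto
  then show ?thesis using KH by (auto simp: op_adjoint_def rep_op_def op_graph_def)
qed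

lemma Res_UNIV_subrep: "Res UNIV (subrep \<pi> K) = subrep \<pi> K"
  using alg_UNIV by (simp add: Res_def subrep_def)

lemma UNIV_subalgebra: "star_subalgebra (UNIV :: 'a set)"
  by (simp add: star_subalgebra_def csubspace_def)

text \<open>The graph of the closure, the graph of the adjoint and that of the spectral integral are all cut down to
  \<open>K \<times> K\<close>, so the identities between them survive restriction to a reducing subspace.\<close>

lemma well_behaved_subrep:
  assumes R: "reducing K" shows "well_behaved A (subrep \<pi> K)"
  unfolding well_behaved_def
proof (intro conjI exI[of _ E] ballI allI)
  have K: "E_invariant K" and inv: "\<And>a x. x \<in> D \<Longrightarrow> x \<in> K \<Longrightarrow> act \<pi> a x \<in> K" using R by (auto simp: reducing_def)
  have KH: "K \<subseteq> H" and EK: "\<And>\<Delta> x. \<Delta> \<in> sets M \<Longrightarrow> x \<in> K \<Longrightarrow> E \<Delta> x \<in> K" using K by (auto simp: E_invariant_def)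
  show "alg (subrep \<pi> K) = UNIV" by (simp add: alg_UNIV)
  show "star_rep (subrep \<pi> K)" using star_rep_subrep[OF R UNIV_subalgebra] by (simp add: Res_UNIV_subrep)
  show "integrable_rep (Res (A 0) (subrep \<pi> K))"
    unfolding integrable_rep_def
  proof (intro conjI ballI)
    show "star_rep (Res (A 0) (subrep \<pi> K))" by (rule star_rep_subrep[OF R A0_subalgebra])
    show "closed_rep (Res (A 0) (subrep \<pi> K))" by (rule closed_rep_subrep[OF R A0_subalgebra]) simp
    fix b assume "b \<in> alg (Res (A 0) (subrep \<pi> K))"
    then have "closure (rep_op \<pi> (star b)) = op_adjoint H (rep_op \<pi> b)" using int by (simp add: integrable_rep_def)
    then show "closure (rep_op (Res (A 0) (subrep \<pi> K)) (star b)) = op_adjoint (hilb (Res (A 0) (subrep \<pi> K))) (rep_op (Res (A 0) (subrep \<pi> K)) b)"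
      by (simp add: closure_rep_op_subrep[OF R] op_adjoint_subrep[OF R])
  qed
  show "spectral_measure M (hilb (subrep \<pi> K)) E"
    using sm KH EK unfolding spectral_measure_def orth_projection_def clinear_on_def by (auto simp: subset_iff)
  show "closure (rep_op (subrep \<pi> K) b) = spectral_integral M (hilb (subrep \<pi> K)) E (\<lambda>\<xi>. \<xi> b)" if "b \<in> A 0" for b
    using SI[OF that] by (simp add: closure_rep_op_subrep[OF R] spectral_integral_restrict[OF KH])
  fix g a \<Delta> assume a: "a \<in> A g" and D: "\<Delta> \<in> sets M"
  show "rep_op (subrep \<pi> K) a O op_graph (hilb (subrep \<pi> K)) (E (set_act A g \<Delta>))
      \<subseteq> op_graph (hilb (subrep \<pi> K)) (E \<Delta>) O rep_op (subrep \<pi> K) a"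
    using E_dom_cov[OF a D] EK[OF D] by (auto simp: rep_op_def op_graph_def relcomp_unfold)
qed

end

section \<open>Cyclic subspaces\<close>

context regular_well_behaved_rep
begin

definition bounded_vector :: "'h \<Rightarrow> bool" where
  "bounded_vector i \<longleftrightarrow> i \<in> H \<and> (\<exists>\<Delta>. bounding \<Delta> \<and> E \<Delta> i = i)"

definition cyclic_span :: "'h \<Rightarrow> 'h set" where
  "cyclic_span i = closure (range (\<lambda>a. act \<pi> a i))"

lemma bounded_vector_dom: "bounded_vector i \<Longrightarrow> i \<in> D"
  using bounding_dom by (auto simp: bounded_vector_def)

lemma csubspace_orbit: assumes S: "csubspace S" and i: "i \<in> D" shows "csubspace ((\<lambda>a. act \<pi> a i) ` S)"
  unfolding csubspace_def
proof (intro conjI ballI allI)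
  show "0 \<in> (\<lambda>a. act \<pi> a i) ` S"
    using csubspace_0[OF S] act_scaleC_alg[OF in_alg i, of 0 0] by (intro image_eqI[of _ _ 0]) auto
  fix x y assume "x \<in> (\<lambda>a. act \<pi> a i) ` S" "y \<in> (\<lambda>a. act \<pi> a i) ` S"
  then show "x + y \<in> (\<lambda>a. act \<pi> a i) ` S"
    using csubspace_add[OF S] act_add_alg[OF in_alg in_alg i] by (auto intro!: image_eqI[where x="_ + _"])
next
  fix c x assume "x \<in> (\<lambda>a. act \<pi> a i) ` S"
  then show "c *\<^sub>C x \<in> (\<lambda>a. act \<pi> a i) ` S"
    using csubspace_scaleC[OF S] act_scaleC_alg[OF in_alg i] by (auto intro!: image_eqI[where x="_ *\<^sub>C _"])
qed

text \<open>On a bounding region the degree-zero operators are bounded and normal. The range of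
  the spectral projection for a disc of radius \<open>r\<close> consists of the vectors whose orbit under the operator grows
  at most like \<open>r\<^sup>n\<close>; this growth condition is inherited by orthogonal projections onto invariant subspaces, which
  therefore commute with the spectral projection.\<close>

lemma bounded_cyclic_invariant:
  assumes B: "bounding \<Delta>" and i: "i \<in> H" "E \<Delta> i = i"
    and L: "L = closure ((\<lambda>b. act \<pi> b i) ` A 0)" and G: "\<Gamma> \<in> sets M" and x: "x \<in> L"
  shows "E \<Gamma> x \<in> L"
proof -
  have Ds: "\<Delta> \<in> sets M" by (rule bounding_sets[OF B])
  have iD: "i \<in> D" by (rule bounding_dom[OF B i])
  define HD where "HD = {x \<in> H. E \<Delta> x = x}"
  have HD_D: "x \<in> D" "x \<in> H" "E \<Delta> x = x" if "x \<in> HD" for x using that bounding_dom[OF B] by (auto simp: HD_def)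
  have HD_sub: "csubspace HD"
    using csubspaceD[OF hilb_sub] Ds E_add[OF Ds] E_scaleC[OF Ds] orth_proj.P_sum[OF E_proj[OF Ds], of "{}"]
    by (auto simp: HD_def csubspace_def)
  have HD_closed: "closed HD"
  proof (unfold closed_sequential_limits, intro allI impI)
    fix u l assume ul: "(\<forall>n. u n \<in> HD) \<and> u \<longlonglongrightarrow> l"
    then have l: "l \<in> H" using closed_sequentially[OF hilb_closed] HD_D by blast
    have "(\<lambda>n. E \<Delta> (u n)) \<longlonglongrightarrow> E \<Delta> l" using ul l HD_D by (intro E_tendsto[OF Ds]) (auto intro!: always_eventually)
    moreover have "(\<lambda>n. E \<Delta> (u n)) = u" using ul HD_D by auto
    ultimately have "E \<Delta> l = l" using ul LIMSEQ_unique by metis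
    with l show "l \<in> HD" by (simp add: HD_def)
  qed
  have E_HD: "E S x \<in> HD" if S: "S \<in> sets M" and x: "x \<in> HD" for S x
  proof -
    have "E \<Delta> (E S x) = E S (E \<Delta> x)"
      using E_Int[OF Ds S HD_D(2)[OF x]] E_Int[OF S Ds HD_D(2)[OF x]] by (simp add: Int_commute)
    then show ?thesis using HD_D[OF x] E_in[OF S] by (simp add: HD_def)
  qed
  have act_HD: "act \<pi> b x \<in> HD" if "b \<in> A 0" "x \<in> HD" for b x
    using act_E[OF that(1) Ds, of x] HD_D[OF that(2)] act_hilb[OF in_alg, of x] by (simp add: HD_def)
  have cs: "csubspace L" unfolding L by (intro csubspace_closure csubspace_orbit A_csub iD)
  have cl: "closed L" by (simp add: L)
  interpret L: closed_csubspace L using cs cl by unfold_locales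
  have iHD: "i \<in> HD" using i by (simp add: HD_def)
  have LHD: "L \<subseteq> HD" unfolding L using act_HD[OF _ iHD] by (intro closure_minimal HD_closed) auto
  have cont: "(\<lambda>n. act \<pi> b (u n)) \<longlonglongrightarrow> act \<pi> b l" if u: "\<And>n. u n \<in> HD" "l \<in> HD" "u \<longlonglongrightarrow> l" for u l b
  proof -
    obtain C where C: "\<And>x. x \<in> HD \<Longrightarrow> norm (act \<pi> b x) \<le> C * norm x" using bounding_bound[OF B, of b] by (auto simp: HD_def)
    have "norm (act \<pi> b (u n) - act \<pi> b l) \<le> C * norm (u n - l)" for n
      using C[OF csubspace_diff[OF HD_sub u(1,2)], of n] HD_D[OF u(1)] HD_D[OF u(2)] by (simp add: act_diff)
    then show ?thesis using u(3) by (rule LIMSEQ_norm_le)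
  qed
  have act_L: "act \<pi> b l \<in> L" if b: "b \<in> A 0" and l: "l \<in> L" for b l
  proof -
    obtain u where u: "\<And>n. u n \<in> (\<lambda>b. act \<pi> b i) ` A 0" "u \<longlonglongrightarrow> l" using l unfolding L closure_sequential by blast
    have "act \<pi> b (u n) \<in> (\<lambda>b. act \<pi> b i) ` A 0" for n
      using u(1)[of n] A0_mult[OF b] act_mult[OF in_alg in_alg iD] by (auto intro!: image_eqI[where x="b * _"])
    moreover have "(\<lambda>n. act \<pi> b (u n)) \<longlonglongrightarrow> act \<pi> b l"
    proof (rule cont[OF _ _ u(2)])
      show "u n \<in> HD" for n using u(1)[of n] act_HD[OF _ iHD] by auto
      show "l \<in> HD" using l LHD by blast
    qed
    ultimately show ?thesis unfolding L by (rule closure_sequenceI)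
  qed
  have proj_act: "act \<pi> b (proj L u) = proj L (act \<pi> b u)" if b: "b \<in> A 0" and u: "u \<in> HD" for b u
  proof -
    have p: "proj L u \<in> HD" using LHD by auto
    have "proj L (act \<pi> b u) = act \<pi> b (proj L u)"
    proof (rule proj_eqI[OF cs cl act_L[OF b L.pin]])
      fix k assume k: "k \<in> L"
      have "cinner (act \<pi> b u - act \<pi> b (proj L u)) k = cinner (act \<pi> b (u - proj L u)) k"
        using HD_D[OF u] HD_D[OF p] by (simp add: act_diff)
      also have "\<dots> = cinner (u - proj L u) (act \<pi> (star b) k)"
        using HD_D(1)[OF csubspace_diff[OF HD_sub u p]] k LHD HD_D(1) by (intro act_star) auto
      also have "\<dots> = 0" using act_L[OF A0_star[OF b] k] by (rule L.porth)
      finally show "cinner (act \<pi> b u - act \<pi> b (proj L u)) k = 0" .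
    qed
    then show ?thesis by simp
  qed
  \<comment> \<open>The case of discs: the component of \<open>w\<close> orthogonal to \<open>L\<close> is both in the range of the spectral projection and
    orthogonal to it.\<close>
  have disc: "E {\<xi> \<in> X. cmod (\<xi> b) \<le> r} l \<in> L" if b: "b \<in> A 0" and r: "0 < r" and l: "l \<in> L" for b r l
  proof -
    define Q where "Q = {\<xi> \<in> X. cmod (\<xi> b) \<le> r}"
    have Q: "Q \<in> sets M" unfolding Q_def by (rule le_sets[OF b])
    define w where "w = E Q l"
    have lHD: "l \<in> HD" using l LHD by auto
    have w: "w \<in> HD" unfolding w_def by (rule E_HD[OF Q lHD])
    have wQ: "E Q w = w" unfolding w_def using E_idem[OF Q] HD_D[OF lHD] by simp
    define v where "v = proj L w"
    have v: "v \<in> HD" using LHD by (auto simp: v_def)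
    define P where "P n = ((act \<pi> b) ^^ n)" for n :: nat
    have P_HD: "P n u \<in> HD" if "u \<in> HD" for n u by (induction n) (auto simp: P_def that act_HD[OF b])
    have P_E: "P n (E S u) = E S (P n u)" if "u \<in> HD" "S \<in> sets M" for n u S
    proof (induction n)
      case (Suc n)
      have "P (Suc n) (E S u) = act \<pi> b (E S (P n u))" using Suc by (simp add: P_def)
      also have "\<dots> = E S (act \<pi> b (P n u))" using HD_D(1)[OF P_HD[OF that(1)]] that(2) by (rule act_E[OF b, rotated])
      finally show ?case by (simp add: P_def)
    qed (simp add: P_def)
    have P_proj: "P n (proj L u) = proj L (P n u)" if "u \<in> HD" for n u
    proof (induction n)
      case (Suc n)
      have "P (Suc n) (proj L u) = act \<pi> b (proj L (P n u))" using Suc by (simp add: P_def)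
      also have "\<dots> = proj L (act \<pi> b (P n u))" by (rule proj_act[OF b P_HD[OF that]])
      finally show ?case by (simp add: P_def)
    qed (simp add: P_def)
    have growth: "norm (P n w) \<le> r ^ n * norm w" for n
    proof (induction n)
      case (Suc n)
      have "E Q (P n w) = P n w" using P_E[OF w Q] wQ by simp
      then have "norm (act \<pi> b (P n w)) \<le> r * norm (P n w)"
        using r HD_D(1)[OF P_HD[OF w]] by (intro norm_act_le[OF b _ Q]) (auto simp: Q_def)
      also have "\<dots> \<le> r * (r ^ n * norm w)" using Suc r by (intro mult_left_mono) auto
      finally show ?case by (simp add: P_def)
    qed (simp add: P_def)
    have growth_v: "norm (P n v) \<le> r ^ n * norm w" for n
      unfolding v_def P_proj[OF w] using L.norm_proj_le growth order.trans by blast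
    define R where "R m = {\<xi> \<in> X. r + 1 / real (Suc m) \<le> cmod (\<xi> b)}" for m :: nat
    have R: "R m \<in> sets M" for m unfolding R_def by (rule ge_sets[OF b])
    have "E (R m) v = 0" for m
    proof (rule ccontr)
      assume nz: "E (R m) v \<noteq> 0"
      define z where "z = E (R m) v"
      define s where "s = r + 1 / real (Suc m)"
      have rs: "r < s" "0 < s" using r by (auto simp: s_def add_pos_pos)
      have z: "z \<in> HD" "E (R m) z = z" using E_HD[OF R v] E_idem[OF R] HD_D[OF v] by (auto simp: z_def)
      have low: "s ^ n * norm z \<le> norm (P n z)" for n
      proof (induction n)
        case (Suc n)
        have "E (R m) (P n z) = P n z" using P_E[OF z(1) R[of m], of n] z(2) by simp
        then have "s * norm (P n z) \<le> norm (act \<pi> b (P n z))"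
          using rs HD_D(1)[OF P_HD[OF z(1)]] by (intro norm_act_ge[OF b _ R]) (auto simp: R_def s_def)
        moreover have "s * (s ^ n * norm z) \<le> s * norm (P n z)" using Suc rs by (intro mult_left_mono) auto
        ultimately show ?case by (simp add: P_def)
      qed (simp add: P_def)
      have up: "norm (P n z) \<le> r ^ n * norm w" for n
        unfolding z_def P_E[OF v R] using E_le[OF R HD_D(2)[OF P_HD[OF v]]] growth_v order.trans by blast
      have "(s / r) ^ n \<le> norm w / norm z" for n
        using order.trans[OF low[of n] up[of n]] r nz by (simp add: z_def power_divide field_simps)
      moreover obtain n where "norm w / norm z < (s / r) ^ n" using real_arch_pow[of "s / r"] rs r by auto
      ultimately show False by (meson not_le)
    qed
    moreover have "(\<lambda>m. E (R m) v) \<longlonglongrightarrow> E (\<Union>m. R m) v"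
    proof (rule E_incseq[OF _ _ HD_D(2)[OF v]])
      show "incseq R"
      proof (rule monoI)
        fix m n :: nat assume "m \<le> n"
        then have "1 / real (Suc n) \<le> 1 / real (Suc m)" by (intro divide_left_mono) auto
        then show "R m \<subseteq> R n" by (auto simp: R_def)
      qed
    qed (use R in auto)
    ultimately have "E (\<Union>m. R m) v = 0" by (rule limit_eq_zero)
    moreover have "(\<Union>m. R m) = space M - Q"
    proof -
      have "(\<exists>m. r + 1 / real (Suc m) \<le> t) \<longleftrightarrow> \<not> t \<le> r" for t
      proof
        assume "\<exists>m. r + 1 / real (Suc m) \<le> t"
        then obtain m where "r + 1 / real (Suc m) \<le> t" by blast
        moreover have "0 < 1 / real (Suc m)" by simp
        ultimately show "\<not> t \<le> r" by linarith
      next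
        assume "\<not> t \<le> r"
        then have "0 < t - r" by simp
        then obtain m where "inverse (real (Suc m)) < t - r" using reals_Archimedean by blast
        then show "\<exists>m. r + 1 / real (Suc m) \<le> t" by (intro exI[of _ m]) (simp add: inverse_eq_divide)
      qed
      then show ?thesis unfolding R_def Q_def by auto
    qed
    ultimately have vQ: "E Q v = v" using E_compl[OF Q HD_D(2)[OF v]] by simp
    define y where "y = w - v"
    have y: "y \<in> HD" unfolding y_def using w v by (rule csubspace_diff[OF HD_sub])
    have yQ: "E Q y = y" unfolding y_def using E_diff[OF Q] HD_D(2)[OF w] HD_D(2)[OF v] wQ vQ by simp
    have yL: "cinner y k = 0" if "k \<in> L" for k unfolding y_def v_def using that by (rule L.porth)
    have "cinner y y = cinner y w - cinner y v" by (subst (2) y_def) (rule cinner_diff_right)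
    also have "cinner y v = 0" unfolding v_def by (rule yL) simp
    also have "cinner y w = cinner (E Q y) l" unfolding w_def using E_sa[OF Q] HD_D(2)[OF y] HD_D(2)[OF lHD] by simp
    also have "\<dots> = 0" using yQ yL[OF l] by simp
    finally have "y = 0" by simp
    then show ?thesis using L.pin[of w] by (simp add: y_def v_def w_def Q_def)
  qed
  define \<S> where "\<S> = {S \<in> sets M. \<forall>x\<in>L. E S x \<in> L}"
  have LH: "L \<subseteq> H" using LHD HD_D(2) by blast
  have S_compl: "X - S \<in> \<S>" if "S \<in> \<S>" for S
    using that E_compl[of S] LH csubspace_diff[OF cs] \<V>_sets[OF \<V>_space] by (auto simp: \<S>_def subset_iff)
  have S_Un: "S \<union> S' \<in> \<S>" if "S \<in> \<S>" "S' \<in> \<S>" for S S'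
  proof -
    have s: "S \<in> sets M" "S' \<in> sets M" using that by (auto simp: \<S>_def)
    have "E (S \<union> S') x \<in> L" if x: "x \<in> L" for x
    proof -
      have xH: "x \<in> H" using x LH by blast
      have "S \<union> S' = S \<union> (S' - S' \<inter> S)" by auto
      then have "E (S \<union> S') x = E S x + (E S' x - E S' (E S x))"
        using E_Un[of S "S' - S' \<inter> S" x] E_Diff[of S' "S' \<inter> S" x] E_Int[OF s(2,1) xH] s xH by (simp add: Int_Diff) (metis Diff_disjoint Int_commute Diff_Int2 Diff_Int Un_empty_right Diff_cancel)
      then show ?thesis using that \<open>S \<in> \<S>\<close> \<open>S' \<in> \<S>\<close> x by (auto simp: \<S>_def intro!: csubspace_add[OF cs] csubspace_diff[OF cs])
    qed
    then show ?thesis using s by (auto simp: \<S>_def)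
  qed
  have "sigma_algebra X \<S>"
    unfolding sigma_algebra_iff2
  proof (intro conjI ballI allI impI)
    show "\<S> \<subseteq> Pow X" using sets.space_closed[of M] by (auto simp: \<S>_def)
    show empty: "{} \<in> \<S>" using csubspace_0[OF cs] LH by (auto simp: \<S>_def subset_iff)
    show "X - S \<in> \<S>" if "S \<in> \<S>" for S using that by (rule S_compl)
    fix S :: "nat \<Rightarrow> ('a \<Rightarrow> complex) set" assume S: "range S \<subseteq> \<S>"
    have fin: "(\<Union>k<n. S k) \<in> \<S>" for n
      by (induction n) (use empty S S_Un in \<open>auto simp: lessThan_Suc\<close>)
    have "E (\<Union>n. S n) x \<in> L" if x: "x \<in> L" for x
    proof -
      have "(\<lambda>n. E (\<Union>k<n. S k) x) \<longlonglongrightarrow> E (\<Union>n. \<Union>k<n. S k) x"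
        using fin x LH by (intro E_incseq) (auto simp: \<S>_def incseq_def intro: less_le_trans)
      moreover have "(\<Union>n. \<Union>k<n. S k) = (\<Union>n. S n)" by auto
      moreover have "E (\<Union>k<n. S k) x \<in> L" for n using fin[of n] x by (simp add: \<S>_def)
      ultimately show ?thesis using closed_sequentially[OF cl, of "\<lambda>n. E (\<Union>k<n. S k) x" "E (\<Union>n. S n) x"] by simp
    qed
    moreover have "(\<Union>n. S n) \<in> sets M" using S by (auto simp: \<S>_def)
    ultimately show "(\<Union>n. S n) \<in> \<S>" by (simp add: \<S>_def)
  qed
  then interpret S: sigma_algebra X \<S> .
  define N where "N = sigma X \<S>"
  have N: "sets N = \<S>" "space N = X" unfolding N_def using S.sets_measure_of_eq S.space_measure_of_eq by auto
  \<comment> \<open>A half-plane is the union of the discs of radius \<open>n + 1\<close> touching its boundary, applied to the hermitian part of \<open>b\<close>.\<close>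
  have meas_Re: "(\<lambda>\<xi>. Re (\<xi> b)) \<in> borel_measurable N" if b: "b \<in> A 0" for b
    unfolding borel_measurable_iff_le N(2)
  proof
    fix t :: real
    define h where "h n = (1/2) *\<^sub>C (b + star b) + complex_of_real (real n - t) *\<^sub>C 1" for n :: nat
    have h: "h n \<in> A 0" for n unfolding h_def by (intro A_add A_scaleC b A0_star one_in_A0)
    have eval: "\<xi> (h n) = complex_of_real (Re (\<xi> b) + real n - t)" if \<xi>: "\<xi> \<in> X" for \<xi> n
    proof -
      have "\<xi> (h n) = (1/2) * (\<xi> b + cnj (\<xi> b)) + complex_of_real (real n - t)"
        unfolding h_def using b by (simp add: char_add[OF \<xi>] char_scaleC[OF \<xi>] char_star[OF \<xi>] char_one[OF \<xi>] A_add A_scaleC A0_star one_in_A0)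
      then show ?thesis by (simp add: complex_eq_iff)
    qed
    have "{\<xi> \<in> X. Re (\<xi> b) \<le> t} = (\<Union>n. {\<xi> \<in> X. cmod (\<xi> (h (Suc n))) \<le> real (Suc n)})"
    proof (intro set_eqI iffI)
      fix \<xi> assume "\<xi> \<in> {\<xi> \<in> X. Re (\<xi> b) \<le> t}"
      then have \<xi>: "\<xi> \<in> X" "Re (\<xi> b) \<le> t" by auto
      obtain n :: nat where "t - Re (\<xi> b) \<le> real n" using real_arch_simple by blast
      then have "cmod (\<xi> (h (Suc n))) \<le> real (Suc n)" using \<xi> unfolding eval[OF \<xi>(1)] norm_of_real by (simp add: abs_le_iff)
      then show "\<xi> \<in> (\<Union>n. {\<xi> \<in> X. cmod (\<xi> (h (Suc n))) \<le> real (Suc n)})" using \<xi> by auto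
    next
      fix \<xi> assume "\<xi> \<in> (\<Union>n. {\<xi> \<in> X. cmod (\<xi> (h (Suc n))) \<le> real (Suc n)})"
      then obtain n where \<xi>: "\<xi> \<in> X" "cmod (\<xi> (h (Suc n))) \<le> real (Suc n)" by auto
      then have "Re (\<xi> b) \<le> t" unfolding eval[OF \<xi>(1)] norm_of_real by (simp add: abs_le_iff)
      then show "\<xi> \<in> {\<xi> \<in> X. Re (\<xi> b) \<le> t}" using \<xi> by auto
    qed
    moreover have "{\<xi> \<in> X. cmod (\<xi> (h (Suc n))) \<le> real (Suc n)} \<in> \<S>" for n
      using disc[OF h, of "real (Suc n)"] le_sets[OF h] by (auto simp: \<S>_def)
    ultimately show "{\<xi> \<in> X. Re (\<xi> b) \<le> t} \<in> sets N" unfolding N(1) by auto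
  qed
  have meas: "(\<lambda>\<xi>. \<xi> b) \<in> borel_measurable N" if b: "b \<in> A 0" for b
    unfolding borel_measurable_complex_iff
  proof
    show "(\<lambda>\<xi>. Re (\<xi> b)) \<in> borel_measurable N" by (rule meas_Re[OF b])
    have "(\<lambda>\<xi>. Re (\<xi> ((- \<i>) *\<^sub>C b))) \<in> borel_measurable N" by (rule meas_Re[OF A_scaleC[OF b]])
    then show "(\<lambda>\<xi>. Im (\<xi> b)) \<in> borel_measurable N"
      by (rule measurable_cong[THEN iffD1, rotated]) (simp add: N(2) char_scaleC b)
  qed
  have V_inv: "E V y \<in> L" if V: "V \<in> \<V>" and y: "y \<in> L" for V y
  proof -
    obtain \<beta> U where bU: "V = cyl \<beta> U" "range \<beta> \<subseteq> A 0" "open U" using V by (auto simp: \<V>_def)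
    have "(\<lambda>\<xi> n. \<xi> (\<beta> n)) \<in> borel_measurable N"
      using bU(2) by (intro measurable_coordinatewise_then_product meas) auto
    then have "(\<lambda>\<xi> n. \<xi> (\<beta> n)) -` U \<inter> space N \<in> sets N" by (rule measurable_sets) (use bU(3) in simp)
    moreover have "(\<lambda>\<xi> n. \<xi> (\<beta> n)) -` U \<inter> space N = V" by (auto simp: N(2) bU(1) cyl_def)
    ultimately show ?thesis using y by (simp add: N(1) \<S>_def)
  qed
  show ?thesis by (rule invariant[OF cs cl LH V_inv G x])
qed

text \<open>Spectral projections are moved through homogeneous elements by the partial action, so that the
  previous lemma reaches the whole orbit of a bounded vector.\<close>

lemma E_orbit_approx:
  assumes i: "bounded_vector i" and D: "\<Delta> \<in> sets M"
  shows "\<exists>s. \<forall>c. (\<lambda>n::nat. act \<pi> c (act \<pi> (s n) i)) \<longlonglongrightarrow> act \<pi> c (E \<Delta> (act \<pi> a i))"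
proof -
  obtain \<Delta>0 where B: "bounding \<Delta>0" and iH: "i \<in> H" "E \<Delta>0 i = i" using i by (auto simp: bounded_vector_def)
  have D0: "\<Delta>0 \<in> sets M" by (rule bounding_sets[OF B])
  have iD: "i \<in> D" by (rule bounded_vector_dom[OF i])
  obtain f F where f: "finite F" "\<And>g. g \<in> F \<Longrightarrow> f g \<in> A g" "a = (\<Sum>g\<in>F. f g)" by (rule ex_homogeneous_sum[of a]) (rule that)
  define t where "t g = E (transport (- g) (star (f g)) \<Delta>) i" for g
  define L where "L = closure ((\<lambda>b. act \<pi> b i) ` A 0)"
  have iL: "i \<in> L" unfolding L_def using act_one[OF iD] one_in_A0 closure_subset by (metis image_eqI subsetD)
  have ms: "transport (- g) (star (f g)) \<Delta> \<in> sets M" if "g \<in> F" for g using f(2)[OF that] D by (intro transport_sets A_star)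
  have "t g \<in> L" if "g \<in> F" for g
    unfolding t_def by (rule bounded_cyclic_invariant[OF B iH L_def ms[OF that] iL])
  then have "\<forall>g\<in>F. \<exists>u. (\<forall>n::nat. u n \<in> A 0) \<and> (\<lambda>n. act \<pi> (u n) i) \<longlonglongrightarrow> t g"
  proof (intro ballI)
    fix g assume "g \<in> F" and "\<And>g. g \<in> F \<Longrightarrow> t g \<in> L"
    then have "t g \<in> closure ((\<lambda>b. act \<pi> b i) ` A 0)" by (simp add: L_def)
    then obtain v where v: "\<And>n. v n \<in> (\<lambda>b. act \<pi> b i) ` A 0" "v \<longlonglongrightarrow> t g" unfolding closure_sequential by blast
    then have "\<forall>n. \<exists>b\<in>A 0. v n = act \<pi> b i" by blast
    then obtain u where "\<And>n. u n \<in> A 0" "\<And>n. v n = act \<pi> (u n) i" by metis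
    then show "\<exists>u. (\<forall>n::nat. u n \<in> A 0) \<and> (\<lambda>n. act \<pi> (u n) i) \<longlonglongrightarrow> t g" 
    proof (intro exI[of _ u] conjI allI)
      have "v = (\<lambda>n. act \<pi> (u n) i)" by (rule ext) fact
      then show "(\<lambda>n. act \<pi> (u n) i) \<longlonglongrightarrow> t g" using v(2) by simp
    qed
  qed
  then obtain u where u: "\<And>g n. g \<in> F \<Longrightarrow> u g n \<in> A 0" "\<And>g. g \<in> F \<Longrightarrow> (\<lambda>n::nat. act \<pi> (u g n) i) \<longlonglongrightarrow> t g" by metis
  define s where "s n = (\<Sum>g\<in>F. f g * u g n)" for n
  have fix0: "E \<Delta>0 (t g) = t g" if "g \<in> F" for g
    unfolding t_def using E_Int[OF D0 ms[OF that] iH(1)] E_Int[OF ms[OF that] D0 iH(1)] iH(2) by (simp add: Int_commute)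
  have fixu: "E \<Delta>0 (act \<pi> (u g n) i) = act \<pi> (u g n) i" if "g \<in> F" for g n
    using act_E[OF u(1)[OF that] D0 iD] iH(2) by simp
  have tH: "t g \<in> H" if "g \<in> F" for g unfolding t_def using E_in[OF ms[OF that] iH(1)] .
  have tD: "t g \<in> D" if "g \<in> F" for g using bounding_dom[OF B tH[OF that] fix0[OF that]] .
  have conv: "(\<lambda>n. act \<pi> c (act \<pi> (u g n) i)) \<longlonglongrightarrow> act \<pi> c (t g)" if g: "g \<in> F" for c g
  proof -
    obtain C where C: "\<And>x. x \<in> H \<Longrightarrow> E \<Delta>0 x = x \<Longrightarrow> norm (act \<pi> c x) \<le> C * norm x" using bounding_bound[OF B, of c] by blast
    have uD: "act \<pi> (u g n) i \<in> D" for n using act_in[OF in_alg iD] .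
    have "norm (act \<pi> c (act \<pi> (u g n) i) - act \<pi> c (t g)) \<le> C * norm (act \<pi> (u g n) i - t g)" for n
      using C[OF csubspace_diff[OF hilb_sub dom_hilb[OF uD] tH[OF g]], of n] fixu[OF g] fix0[OF g]
        E_diff[OF D0 dom_hilb[OF uD] tH[OF g]] uD tD[OF g] by (simp add: act_diff)
    then show ?thesis using u(2)[OF g] by (rule LIMSEQ_norm_le)
  qed
  have target: "E \<Delta> (act \<pi> a i) = (\<Sum>g\<in>F. act \<pi> (f g) (t g))"
  proof -
    have "act \<pi> a i = (\<Sum>g\<in>F. act \<pi> (f g) i)" unfolding f(3) using iD by (intro act_sum_alg) auto
    then have "E \<Delta> (act \<pi> a i) = (\<Sum>g\<in>F. E \<Delta> (act \<pi> (f g) i))"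
      using E_sum[OF D, of F "\<lambda>g. act \<pi> (f g) i"] act_hilb[OF in_alg iD] by simp
    also have "\<dots> = (\<Sum>g\<in>F. act \<pi> (f g) (t g))"
      using E_transport[OF f(2) iD D] by (intro sum.cong) (auto simp: t_def)
    finally show ?thesis .
  qed
  have "(\<lambda>n. act \<pi> c (act \<pi> (s n) i)) \<longlonglongrightarrow> act \<pi> c (E \<Delta> (act \<pi> a i))" for c
  proof -
    have "act \<pi> c (act \<pi> (s n) i) = (\<Sum>g\<in>F. act \<pi> (c * f g) (act \<pi> (u g n) i))" for n
    proof -
      have "act \<pi> (s n) i = (\<Sum>g\<in>F. act \<pi> (f g * u g n) i)" unfolding s_def using iD by (intro act_sum_alg) auto
      also have "\<dots> = (\<Sum>g\<in>F. act \<pi> (f g) (act \<pi> (u g n) i))" using iD by (simp add: act_mult)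
      finally have "act \<pi> c (act \<pi> (s n) i) = (\<Sum>g\<in>F. act \<pi> c (act \<pi> (f g) (act \<pi> (u g n) i)))"
        using iD by (simp add: act_sum act_in)
      then show ?thesis using iD by (simp add: act_mult act_in)
    qed
    moreover have "act \<pi> c (E \<Delta> (act \<pi> a i)) = (\<Sum>g\<in>F. act \<pi> (c * f g) (t g))"
      unfolding target using tD by (simp add: act_sum act_in act_mult)
    ultimately show ?thesis using conv by (simp add: tendsto_sum)
  qed
  then show ?thesis by blast
qed

lemma csubspace_cyclic_span: "i \<in> D \<Longrightarrow> csubspace (cyclic_span i)"
  unfolding cyclic_span_def by (intro csubspace_closure csubspace_orbit) (simp_all add: csubspace_def)

lemma orbit_in_cyclic_span: "act \<pi> a i \<in> cyclic_span i"
  unfolding cyclic_span_def by (rule subsetD[OF closure_subset]) simp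

lemma E_invariant_cyclic_span: assumes i: "bounded_vector i" shows "E_invariant (cyclic_span i)"
proof -
  have iD: "i \<in> D" by (rule bounded_vector_dom[OF i])
  have KH: "cyclic_span i \<subseteq> H" unfolding cyclic_span_def using act_hilb[OF in_alg iD] by (intro closure_minimal hilb_closed) auto
  have orb: "E \<Delta> (act \<pi> a i) \<in> cyclic_span i" if D: "\<Delta> \<in> sets M" for \<Delta> a
  proof -
    obtain s where "\<And>c. (\<lambda>n::nat. act \<pi> c (act \<pi> (s n) i)) \<longlonglongrightarrow> act \<pi> c (E \<Delta> (act \<pi> a i))" using E_orbit_approx[OF i D, of a] by blast
    from this[of 1] have "(\<lambda>n. act \<pi> (s n) i) \<longlonglongrightarrow> E \<Delta> (act \<pi> a i)" using iD D by (simp add: act_one act_in E_dom)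
    then show ?thesis unfolding cyclic_span_def by (rule closure_sequenceI[rotated]) simp
  qed
  have "E \<Delta> x \<in> cyclic_span i" if D: "\<Delta> \<in> sets M" and x: "x \<in> cyclic_span i" for \<Delta> x
  proof -
    obtain u where u: "\<And>n. u n \<in> range (\<lambda>a. act \<pi> a i)" "u \<longlonglongrightarrow> x" using x unfolding cyclic_span_def closure_sequential by blast
    have "(\<lambda>n. E \<Delta> (u n)) \<longlonglongrightarrow> E \<Delta> x"
    proof (rule E_tendsto[OF D u(2)])
      have "u n \<in> H" for n using u(1)[of n] act_hilb[OF in_alg iD] by auto
      then show "\<forall>\<^sub>F n in sequentially. u n \<in> H" by simp
    qed (use x KH in blast)
    moreover have "E \<Delta> (u n) \<in> cyclic_span i" for n using u(1)[of n] orb[OF D] by auto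
    moreover have "closed (cyclic_span i)" by (simp add: cyclic_span_def)
    ultimately show ?thesis using closed_sequentially[of "cyclic_span i" "\<lambda>n. E \<Delta> (u n)" "E \<Delta> x"] by simp
  qed
  then show ?thesis using csubspace_cyclic_span[OF iD] KH by (auto simp: E_invariant_def cyclic_span_def)
qed

text \<open>The orbit is invariant, hence so is its orthogonal complement within the domain. That complement is dense in the
  complement of the closed span, because the projection preserves the domain, and symmetry then gives invariance of the span
  on the whole domain.\<close>

lemma reducing_cyclic_span: assumes i: "bounded_vector i" shows "reducing (cyclic_span i)"
  unfolding reducing_def
proof (intro conjI allI ballI)
  show K: "E_invariant (cyclic_span i)" by (rule E_invariant_cyclic_span[OF i])
  interpret K: closed_csubspace "cyclic_span i" by (rule E_invariant_closed_csubspace[OF K])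
  have iD: "i \<in> D" by (rule bounded_vector_dom[OF i])
  fix a x assume x: "x \<in> D \<inter> cyclic_span i"
  show "act \<pi> a x \<in> cyclic_span i"
  proof -
    have perp: "cinner (act \<pi> a x) y = 0" if y: "y \<in> D" and y0: "proj (cyclic_span i) y = 0" for y
    proof -
      have yK: "cinner y k = 0" if "k \<in> cyclic_span i" for k using K.porth[OF that, of y] y0 by simp
      have "proj (cyclic_span i) (act \<pi> (star a) y) = 0"
      proof (rule K.proj_0I)
        fix k assume "k \<in> cyclic_span i"
        then obtain u where u: "\<And>n. u n \<in> range (\<lambda>a. act \<pi> a i)" "u \<longlonglongrightarrow> k" unfolding cyclic_span_def closure_sequential by blast
        have "cinner (act \<pi> (star a) y) (u n) = 0" for n
        proof -
          obtain c where c: "u n = act \<pi> c i" using u(1)[of n] by blast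
          have "cinner (act \<pi> (star a) y) (u n) = cinner y (act \<pi> a (act \<pi> c i))"
            unfolding c using act_star[OF in_alg y act_in[OF in_alg iD], of "star a" c] by (simp add: star_star)
          also have "\<dots> = cinner y (act \<pi> (a * c) i)" using iD by (simp add: act_mult)
          also have "\<dots> = 0" by (rule yK[OF orbit_in_cyclic_span])
          finally show ?thesis .
        qed
        moreover have "(\<lambda>n. cinner (act \<pi> (star a) y) (u n)) \<longlonglongrightarrow> cinner (act \<pi> (star a) y) k" by (intro tendsto_cinner tendsto_const u)
        ultimately show "cinner (act \<pi> (star a) y) k = 0" by (rule limit_eq_zero)
      qed
      then have "cinner (act \<pi> (star a) y) x = 0" using K.porth[of x "act \<pi> (star a) y"] x by simp
      then have "cinner x (act \<pi> (star a) y) = 0" using cinner_commute[of x] by simp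
      then show ?thesis using act_star[OF in_alg, of x y a] x y by simp
    qed
    define w where "w = act \<pi> a x"
    have w: "w \<in> D" unfolding w_def using x act_in by simp
    have "cinner w (w - proj (cyclic_span i) w) = 0"
      using perp[of "w - proj (cyclic_span i) w"] csubspace_diff[OF dom_sub w proj_dom[OF K w]] by (simp add: K.proj_diff w_def)
    then have "cinner (w - proj (cyclic_span i) w) (w - proj (cyclic_span i) w) = 0"
      using K.proj_orth_right[of "proj (cyclic_span i) w" w] by (simp add: cinner_diff_left)
    then have "w = proj (cyclic_span i) w" by simp
    then show ?thesis using K.pin[of w] by (simp add: w_def)
  qed
qed

text \<open>A bounded vector generates its cyclic subspace also in the graph topology: a vector
  of the subspace is first cut down to a region where the given graph norm is bounded, and there norm approximation
  suffices.\<close>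

lemma cyclic_subrep: assumes i: "bounded_vector i" shows "cyclic_rep (subrep \<pi> (cyclic_span i))"
  unfolding cyclic_rep_def
proof (intro bexI[of _ i])
  have R: "reducing (cyclic_span i)" by (rule reducing_cyclic_span[OF i])
  have iD: "i \<in> D" by (rule bounded_vector_dom[OF i])
  have iK: "i \<in> cyclic_span i" using orbit_in_cyclic_span[of 1 i] act_one[OF iD] by simp
  show "i \<in> dom (subrep \<pi> (cyclic_span i))" using iD iK by simp
  have KH: "cyclic_span i \<subseteq> H" and K: "E_invariant (cyclic_span i)" using R by (auto simp: reducing_def E_invariant_def)
  interpret S: star_representation "subrep \<pi> (cyclic_span i)"
    using well_behaved_subrep[OF R] by unfold_locales (simp add: well_behaved_def)
  have dense: "\<exists>a. norm (act \<pi> a i - x) + norm (act \<pi> c (act \<pi> a i - x)) < \<epsilon>"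
    if x: "x \<in> D" "x \<in> cyclic_span i" and e: "\<epsilon> > 0" for x c \<epsilon>
  proof -
    obtain f F where f: "finite F" "\<And>g. g \<in> F \<Longrightarrow> f g \<in> A g" "c = (\<Sum>g\<in>F. f g)" by (rule ex_homogeneous_sum[of c]) (rule that)
    define b where "b g = star (f g) * f g" for g
    have b: "b g \<in> A 0" if "g \<in> F" for g unfolding b_def using f(2)[OF that] by (intro A0_star_mult)
    define S where "S n = {\<xi> \<in> X. (\<Sum>g\<in>F. cmod (\<xi> (b g))) \<le> real n}" for n :: nat
    have S: "S n \<in> sets M" for n
    proof -
      have "(\<lambda>\<xi>. \<Sum>g\<in>F. cmod (\<xi> (b g))) \<in> borel_measurable M"
      proof (rule borel_measurable_sum)
        fix g assume "g \<in> F"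
        then have [measurable]: "(\<lambda>\<xi>. \<xi> (b g)) \<in> borel_measurable M" by (intro eval_measurable b)
        show "(\<lambda>\<xi>. cmod (\<xi> (b g))) \<in> borel_measurable M" by measurable
      qed
      then have "{\<xi> \<in> space M. (\<Sum>g\<in>F. cmod (\<xi> (b g))) \<le> real n} \<in> sets M" by measurable
      then show ?thesis by (simp add: S_def)
    qed
    have bound: "norm (act \<pi> c y) \<le> (\<Sum>g\<in>F. sqrt (real n)) * norm y" if y: "y \<in> D" "E (S n) y = y" for y n
    proof -
      have "act \<pi> c y = (\<Sum>g\<in>F. act \<pi> (f g) y)" unfolding f(3) using y by (intro act_sum_alg) auto
      then have "norm (act \<pi> c y) \<le> (\<Sum>g\<in>F. sqrt (real n) * norm y)"
      proof (simp only:, intro sum_norm_le)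
        fix g assume g: "g \<in> F"
        have "cmod (\<xi> (b g)) \<le> real n" if "\<xi> \<in> S n" for \<xi>
          using that member_le_sum[OF g, of "\<lambda>g. cmod (\<xi> (b g))"] f(1) by (simp add: S_def)
        then show "norm (act \<pi> (f g) y) \<le> sqrt (real n) * norm y"
          by (intro norm_act_homogeneous_le[OF f(2)[OF g] y(1) S y(2)]) (auto simp: b_def)
      qed
      then show ?thesis by (simp only: sum_distrib_right)
    qed
    have lim: "(\<lambda>n. E (S n) y) \<longlonglongrightarrow> y" if y: "y \<in> H" for y
    proof -
      have "(\<lambda>n. E (S n) y) \<longlonglongrightarrow> E (\<Union>n. S n) y"
      proof (rule E_incseq[OF _ _ y])
        show "incseq S" by (intro monoI) (auto simp: S_def)
      qed (use S in auto)
      moreover have "(\<Union>n. S n) = space M" using real_arch_simple by (auto simp: S_def)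
      ultimately show ?thesis using E_space[OF y] by simp
    qed
    have lim_c: "(\<lambda>n. act \<pi> c (E (S n) x) ) \<longlonglongrightarrow> act \<pi> c x"
    proof -
      have d: "E (S n) x - x \<in> D" for n using E_dom[OF S x(1)] x(1) by (rule csubspace_diff[OF dom_sub])
      have "(\<lambda>n. norm (act \<pi> c (E (S n) x - x))) \<longlonglongrightarrow> 0"
      proof (rule act_tendsto_zero)
        show "\<forall>\<^sub>F n in sequentially. E (S n) x - x \<in> D" using d by (intro always_eventually allI)
        show "(\<lambda>n. norm (E (S n) x - x)) \<longlonglongrightarrow> 0" by (intro tendsto_norm_zero LIM_zero lim dom_hilb x)
        fix b assume b: "b \<in> A 0"
        have "act \<pi> b (E (S n) x - x) = E (S n) (act \<pi> b x) - act \<pi> b x" for n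
          using E_dom[OF S x(1)] x(1) act_E[OF b S x(1)] by (simp add: act_diff)
        then show "(\<lambda>n. norm (act \<pi> b (E (S n) x - x))) \<longlonglongrightarrow> 0"
          using x(1) by (simp add: tendsto_norm_zero LIM_zero lim act_hilb)
      qed
      then have "(\<lambda>n. act \<pi> c (E (S n) x) - act \<pi> c x) \<longlonglongrightarrow> 0"
        using E_dom[OF S x(1)] x(1) by (intro tendsto_norm_zero_cancel[of "\<lambda>n. act \<pi> c (E (S n) x) - act \<pi> c x"]) (simp add: act_diff)
      then show ?thesis by (rule LIM_zero_cancel)
    qed
    have "(\<lambda>n. norm (E (S n) x - x) + norm (act \<pi> c (E (S n) x) - act \<pi> c x)) \<longlonglongrightarrow> 0 + 0"
      by (intro tendsto_add tendsto_norm_zero LIM_zero lim lim_c dom_hilb x)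
    then have "\<forall>\<^sub>F n in sequentially. norm (E (S n) x - x) + norm (act \<pi> c (E (S n) x) - act \<pi> c x) < \<epsilon> / 3"
      using e by (intro order_tendstoD(2)[where y = "0 + 0"]) auto
    then obtain n where n: "norm (E (S n) x - x) + norm (act \<pi> c (E (S n) x) - act \<pi> c x) < \<epsilon> / 3"
      using eventually_happens sequentially_bot by blast
    obtain u where u: "\<And>k. u k \<in> range (\<lambda>a. act \<pi> a i)" "u \<longlonglongrightarrow> x" using x(2) unfolding cyclic_span_def closure_sequential by blast
    define C where "C = (\<Sum>g\<in>F. sqrt (real n))"
    have C: "0 \<le> C" unfolding C_def by (intro sum_nonneg) auto
    have "0 < \<epsilon> / 3 / (1 + C)" using e C by simp
    then have "\<forall>\<^sub>F k in sequentially. dist (u k) x < \<epsilon> / 3 / (1 + C)" by (rule tendstoD[OF u(2)])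
    then obtain k where k: "norm (u k - x) < \<epsilon> / 3 / (1 + C)" unfolding dist_norm using eventually_happens sequentially_bot by blast
    obtain a where a: "u k = act \<pi> a i" using u(1)[of k] by blast
    have uD: "u k \<in> D" unfolding a using act_in[OF in_alg iD] .
    define y where "y = E (S n) (u k)"
    have yD: "y \<in> D" unfolding y_def by (rule E_dom[OF S uD])
    have near: "norm (y - E (S n) x) + norm (act \<pi> c y - act \<pi> c (E (S n) x)) < \<epsilon> / 3"
    proof -
      have eq: "y - E (S n) x = E (S n) (u k - x)" unfolding y_def using E_diff[OF S] dom_hilb[OF uD] dom_hilb[OF x(1)] by simp
      have dH: "u k - x \<in> H" "u k - x \<in> D" using uD x(1) csubspace_diff[OF dom_sub] dom_hilb by auto
      have 1: "norm (y - E (S n) x) \<le> norm (u k - x)" unfolding eq by (rule E_le[OF S dH(1)])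
      have "norm (act \<pi> c (y - E (S n) x)) \<le> C * norm (y - E (S n) x)"
        unfolding eq C_def using E_dom[OF S dH(2)] E_idem[OF S dH(1)] by (intro bound)
      also have "\<dots> \<le> C * norm (u k - x)" using 1 C by (rule mult_left_mono)
      finally have "norm (act \<pi> c y - act \<pi> c (E (S n) x)) \<le> C * norm (u k - x)"
        using yD E_dom[OF S x(1)] by (simp add: act_diff)
      with 1 have "norm (y - E (S n) x) + norm (act \<pi> c y - act \<pi> c (E (S n) x)) \<le> (1 + C) * norm (u k - x)" by (simp add: distrib_right)
      also have "\<dots> < \<epsilon> / 3" using k C by (simp add: field_simps add_pos_nonneg)
      finally show ?thesis .
    qed
    obtain s where s: "\<And>c. (\<lambda>n::nat. act \<pi> c (act \<pi> (s n) i)) \<longlonglongrightarrow> act \<pi> c (E (S n) (act \<pi> a i))"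
      using E_orbit_approx[OF i S, of n a] by blast
    have s1: "(\<lambda>n. act \<pi> (s n) i) \<longlonglongrightarrow> y" using s[of 1] iD yD by (simp add: act_one act_in y_def a)
    have s2: "(\<lambda>n. act \<pi> c (act \<pi> (s n) i)) \<longlonglongrightarrow> act \<pi> c y" using s[of c] by (simp add: y_def a)
    have "(\<lambda>n. norm (act \<pi> (s n) i - y) + norm (act \<pi> c (act \<pi> (s n) i) - act \<pi> c y)) \<longlonglongrightarrow> 0 + 0"
      by (intro tendsto_add tendsto_norm_zero LIM_zero s1 s2)
    then have "\<forall>\<^sub>F n in sequentially. norm (act \<pi> (s n) i - y) + norm (act \<pi> c (act \<pi> (s n) i) - act \<pi> c y) < \<epsilon> / 3"
      using e by (intro order_tendstoD(2)[where y = "0 + 0"]) auto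
    then obtain m where m: "norm (act \<pi> (s m) i - y) + norm (act \<pi> c (act \<pi> (s m) i) - act \<pi> c y) < \<epsilon> / 3"
      using eventually_happens sequentially_bot by blast
    define p where "p = act \<pi> (s m) i"
    have pD: "p \<in> D" unfolding p_def using act_in[OF in_alg iD] .
    have t1: "norm (p - x) \<le> norm (p - y) + norm (y - E (S n) x) + norm (E (S n) x - x)"
      using norm_triangle_ineq[of "p - y + (y - E (S n) x)" "E (S n) x - x"] norm_triangle_ineq[of "p - y" "y - E (S n) x"] by simp
    have t2: "norm (act \<pi> c p - act \<pi> c x) \<le> norm (act \<pi> c p - act \<pi> c y) + norm (act \<pi> c y - act \<pi> c (E (S n) x)) + norm (act \<pi> c (E (S n) x) - act \<pi> c x)"
      using norm_triangle_ineq[of "act \<pi> c p - act \<pi> c y + (act \<pi> c y - act \<pi> c (E (S n) x))" "act \<pi> c (E (S n) x) - act \<pi> c x"]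
        norm_triangle_ineq[of "act \<pi> c p - act \<pi> c y" "act \<pi> c y - act \<pi> c (E (S n) x)"] by simp
    have "norm (p - x) + norm (act \<pi> c (p - x)) < \<epsilon>"
      using t1 t2 n near m pD x(1) unfolding p_def[symmetric] by (simp add: act_diff)
    then show ?thesis unfolding p_def by blast
  qed
  show "graph_topology (subrep \<pi> (cyclic_span i)) closure_of ((\<lambda>a. act (subrep \<pi> (cyclic_span i)) a i) ` alg (subrep \<pi> (cyclic_span i))) = dom (subrep \<pi> (cyclic_span i))"
  proof
    show "graph_topology (subrep \<pi> (cyclic_span i)) closure_of ((\<lambda>a. act (subrep \<pi> (cyclic_span i)) a i) ` alg (subrep \<pi> (cyclic_span i))) \<subseteq> dom (subrep \<pi> (cyclic_span i))"
      using closure_of_subset_topspace S.topspace_graph by metis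
    show "dom (subrep \<pi> (cyclic_span i)) \<subseteq> graph_topology (subrep \<pi> (cyclic_span i)) closure_of ((\<lambda>a. act (subrep \<pi> (cyclic_span i)) a i) ` alg (subrep \<pi> (cyclic_span i)))"
    proof
      fix x assume x: "x \<in> dom (subrep \<pi> (cyclic_span i))"
      show "x \<in> graph_topology (subrep \<pi> (cyclic_span i)) closure_of ((\<lambda>a. act (subrep \<pi> (cyclic_span i)) a i) ` alg (subrep \<pi> (cyclic_span i)))"
        unfolding in_closure_of S.topspace_graph
      proof (intro conjI allI impI x)
        fix U assume U: "x \<in> U \<and> openin (graph_topology (subrep \<pi> (cyclic_span i))) U"
        then obtain c \<epsilon> where c: "\<epsilon> > 0" "{\<psi> \<in> dom (subrep \<pi> (cyclic_span i)). graph_norm (subrep \<pi> (cyclic_span i)) c (\<psi> - x) < \<epsilon>} \<subseteq> U"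
          using S.graph_ball_subset by blast
        obtain a where "norm (act \<pi> a i - x) + norm (act \<pi> c (act \<pi> a i - x)) < \<epsilon>" using dense[of x \<epsilon> c] x c by auto
        then have "act \<pi> a i \<in> U" using c(2) act_in[OF in_alg iD] orbit_in_cyclic_span by (auto simp: graph_norm_def)
        then show "\<exists>y. y \<in> (\<lambda>a. act (subrep \<pi> (cyclic_span i)) a i) ` alg (subrep \<pi> (cyclic_span i)) \<and> y \<in> U" by auto
      qed
    qed
  qed
qed

end

section \<open>Orthogonal decomposition\<close>

lemma orth_closure:
  assumes "\<And>x y. x \<in> S \<Longrightarrow> y \<in> U \<Longrightarrow> cinner x y = 0" and x: "x \<in> closure S" and y: "y \<in> closure U"
  shows "cinner x y = 0"
proof -
  obtain u where u: "\<And>n. u n \<in> S" "u \<longlonglongrightarrow> x" using x unfolding closure_sequential by blast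
  obtain v where v: "\<And>n. v n \<in> U" "v \<longlonglongrightarrow> y" using y unfolding closure_sequential by blast
  have "(\<lambda>n. cinner (u n) (v n)) \<longlonglongrightarrow> cinner x y" by (intro tendsto_cinner u v)
  moreover have "cinner (u n) (v n) = 0" for n using assms(1) u v by blast
  ultimately show ?thesis by (rule limit_eq_zero[rotated])
qed

context regular_well_behaved_rep
begin

definition orthogonal_system :: "'h set \<Rightarrow> bool" where
  "orthogonal_system I \<longleftrightarrow> (\<forall>i\<in>I. bounded_vector i \<and> i \<noteq> 0) \<and>
     (\<forall>i\<in>I. \<forall>j\<in>I. i \<noteq> j \<longrightarrow> (\<forall>a. cinner (act \<pi> a i) j = 0))"

lemma ex_maximal_orthogonal_system:
  "\<exists>I. orthogonal_system I \<and> (\<forall>J. orthogonal_system J \<longrightarrow> I \<subseteq> J \<longrightarrow> J = I)"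
proof -
  have "\<exists>I\<in>{I. orthogonal_system I}. \<forall>J\<in>{I. orthogonal_system I}. I \<subseteq> J \<longrightarrow> J = I"
  proof (rule subset_Zorn')
    fix \<C> assume c: "subset.chain {I. orthogonal_system I} \<C>"
    have os: "orthogonal_system I" if "I \<in> \<C>" for I using c that by (auto simp: subset.chain_def)
    have "cinner (act \<pi> a i) j = 0" if ij: "i \<in> \<Union>\<C>" "j \<in> \<Union>\<C>" "i \<noteq> j" for i j a
    proof -
      obtain I J where IJ: "I \<in> \<C>" "i \<in> I" "J \<in> \<C>" "j \<in> J" using ij by blast
      then have "I \<subseteq> J \<or> J \<subseteq> I" using c unfolding subset.chain_def by blast
      then obtain K where "K \<in> \<C>" "i \<in> K" "j \<in> K" using IJ by blast
      then show ?thesis using os ij(3) unfolding orthogonal_system_def by blast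
    qed
    then show "\<Union>\<C> \<in> {I. orthogonal_system I}" using os unfolding orthogonal_system_def by blast
  qed
  then show ?thesis by blast
qed

lemma cyclic_span_orth:
  assumes I: "orthogonal_system I" and ij: "i \<in> I" "j \<in> I" "i \<noteq> j" and xy: "x \<in> cyclic_span i" "y \<in> cyclic_span j"
  shows "cinner x y = 0"
proof (rule orth_closure[OF _ xy[unfolded cyclic_span_def]])
  fix x y assume "x \<in> range (\<lambda>a. act \<pi> a i)" "y \<in> range (\<lambda>a. act \<pi> a j)"
  then obtain a c where xy: "x = act \<pi> a i" "y = act \<pi> c j" by blast
  have D: "i \<in> D" "j \<in> D" using I ij bounded_vector_dom by (auto simp: orthogonal_system_def)
  have "cinner (act \<pi> (star c * a) i) j = cinner (act \<pi> a i) (act \<pi> c j)"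
    using D by (simp add: act_mult act_star act_in star_star)
  then show "cinner x y = 0" using I ij unfolding xy orthogonal_system_def by metis
qed

text \<open>Nothing is left over: a vector orthogonal to all cyclic subspaces of a maximal system could be truncated
  to a nonzero bounded vector, still orthogonal to them because they are invariant under the spectral measure.\<close>

lemma maximal_system_complete:
  assumes I: "orthogonal_system I" and mx: "\<And>J. orthogonal_system J \<Longrightarrow> I \<subseteq> J \<Longrightarrow> J = I"
    and z: "z \<in> H" and perp: "\<And>i. i \<in> I \<Longrightarrow> proj (cyclic_span i) z = 0"
  shows "z = 0"
proof (rule ccontr)
  assume "z \<noteq> 0"
  then obtain \<Delta> where D: "bounding \<Delta>" "E \<Delta> z \<noteq> 0" using ex_bounding[OF z] by blast
  have Ds: "\<Delta> \<in> sets M" by (rule bounding_sets[OF D(1)])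
  define w where "w = E \<Delta> z"
  have w: "bounded_vector w" "w \<noteq> 0" unfolding bounded_vector_def w_def using D E_in[OF Ds z] E_idem[OF Ds z] by auto
  have wD: "w \<in> D" by (rule bounded_vector_dom[OF w(1)])
  have ww: "w \<in> cyclic_span w" using orbit_in_cyclic_span[of 1 w] act_one[OF wD] by simp
  have bv: "bounded_vector i" if "i \<in> I" for i using I that by (simp add: orthogonal_system_def)
  have orth: "cinner k w = 0" if i: "i \<in> I" and k: "k \<in> cyclic_span i" for i k
  proof -
    have K: "E_invariant (cyclic_span i)" by (rule E_invariant_cyclic_span[OF bv[OF i]])
    interpret K: closed_csubspace "cyclic_span i" by (rule E_invariant_closed_csubspace[OF K])
    have "proj (cyclic_span i) w = E \<Delta> 0" unfolding w_def using proj_E[OF K z Ds] perp[OF i] by simp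
    also have "\<dots> = 0" using orth_proj.P_sum[OF E_proj[OF Ds], of "{}"] by simp
    finally show ?thesis using K.proj_orth_right[OF k, of w] by simp
  qed
  have "orthogonal_system (insert w I)"
    unfolding orthogonal_system_def
  proof (intro conjI ballI impI allI)
    fix i assume "i \<in> insert w I"
    then show "bounded_vector i" "i \<noteq> 0" using I w by (auto simp: orthogonal_system_def)
    fix j a assume j: "j \<in> insert w I" and ne: "i \<noteq> j"
    show "cinner (act \<pi> a i) j = 0"
    proof (cases "i = w")
      case True
      then have jI: "j \<in> I" using j ne by auto
      have "cinner (act \<pi> (star a) j) w = 0" by (rule orth[OF jI orbit_in_cyclic_span])
      then have "cinner w (act \<pi> (star a) j) = 0" using cinner_commute[of w] by simp
      then show ?thesis using True act_star[OF in_alg wD bounded_vector_dom[OF bv[OF jI]]] by simp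
    next
      case False
      then have iI: "i \<in> I" using \<open>i \<in> insert w I\<close> by auto
      show ?thesis
      proof (cases "j = w")
        case True then show ?thesis using orth[OF iI orbit_in_cyclic_span] by simp
      next
        case False then show ?thesis using I iI j ne by (auto simp: orthogonal_system_def)
      qed
    qed
  qed
  then have "w \<in> I" using mx by blast
  then show False using orth[OF _ ww] w(2) by simp
qed

lemma maximal_system_sum:
  assumes I: "orthogonal_system I" and mx: "\<And>J. orthogonal_system J \<Longrightarrow> I \<subseteq> J \<Longrightarrow> J = I" and x: "x \<in> H"
  shows "((\<lambda>i. proj (cyclic_span i) x) has_sum x) I"
proof -
  have K: "closed_csubspace (cyclic_span i)" if "i \<in> I" for i
    using I that by (intro E_invariant_closed_csubspace E_invariant_cyclic_span) (simp add: orthogonal_system_def)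
  have KH: "cyclic_span i \<subseteq> H" if "i \<in> I" for i
    using I that E_invariant_cyclic_span[of i] by (simp add: orthogonal_system_def E_invariant_def)
  have pin: "proj (cyclic_span i) y \<in> cyclic_span i" if "i \<in> I" for i y using closed_csubspace.pin[OF K[OF that]] .
  have po: "cinner (proj (cyclic_span i) y) (proj (cyclic_span j) y') = 0" if "i \<in> I" "j \<in> I" "i \<noteq> j" for i j y y'
    using cyclic_span_orth[OF I that pin pin] that by blast
  have bessel: "(\<Sum>i\<in>F. (norm (proj (cyclic_span i) x))\<^sup>2) \<le> (norm x)\<^sup>2" if F: "finite F" "F \<subseteq> I" for F
  proof -
    define s where "s = (\<Sum>i\<in>F. proj (cyclic_span i) x)"
    have ns: "(norm s)\<^sup>2 = (\<Sum>i\<in>F. (norm (proj (cyclic_span i) x))\<^sup>2)" unfolding s_def using F by (intro norm_sum_orth po) auto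
    have "cinner (proj (cyclic_span i) x) (x - s) = 0" if i: "i \<in> F" for i
    proof -
      have iI: "i \<in> I" using i F by auto
      have "cinner (proj (cyclic_span i) x) s = (\<Sum>j\<in>F. if j = i then cinner (proj (cyclic_span i) x) (proj (cyclic_span i) x) else 0)"
        unfolding s_def cinner_sum_right using F po[OF iI] by (intro sum.cong) auto
      also have "\<dots> = cinner (proj (cyclic_span i) x) (proj (cyclic_span i) x)" using F i by simp
      finally have "cinner (proj (cyclic_span i) x) (x - s) = cinner (proj (cyclic_span i) x) (x - proj (cyclic_span i) x)" by (simp add: cinner_diff_right)
      also have "\<dots> = 0" by (rule closed_csubspace.proj_orth_right[OF K[OF iI] pin[OF iI]])
      finally show ?thesis .
    qed
    then have "cinner s (x - s) = 0" unfolding s_def cinner_sum_left by (intro sum.neutral) auto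
    from norm_add_orth[OF this] show ?thesis using ns by simp
  qed
  have "(\<lambda>i. (norm (proj (cyclic_span i) x))\<^sup>2) summable_on I"
    by (rule nonneg_bdd_above_summable_on) (auto intro!: bdd_aboveI2 bessel)
  then have "(\<lambda>i. proj (cyclic_span i) x) summable_on I" by (intro orth_summable po)
  then obtain y where y: "((\<lambda>i. proj (cyclic_span i) x) has_sum y) I" by (auto simp: summable_on_def)
  have pH: "proj (cyclic_span i) x \<in> H" if "i \<in> I" for i using pin[OF that] KH[OF that] by blast
  have yH: "y \<in> H"
  proof (rule Lim_in_closed_set[OF hilb_closed])
    show "(sum (\<lambda>i. proj (cyclic_span i) x) \<longlongrightarrow> y) (finite_subsets_at_top I)" using y by (simp add: has_sum_def)
    show "\<forall>\<^sub>F F in finite_subsets_at_top I. sum (\<lambda>i. proj (cyclic_span i) x) F \<in> H"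
      by (rule eventually_finite_subsets_at_top_weakI) (use pH in \<open>auto intro!: csubspace_sum[OF hilb_sub]\<close>)
  qed simp
  have pz: "proj (cyclic_span i) (x - y) = 0" if i: "i \<in> I" for i
  proof -
    interpret K: closed_csubspace "cyclic_span i" by (rule K[OF i])
    have "((\<lambda>j. proj (cyclic_span i) (proj (cyclic_span j) x)) has_sum proj (cyclic_span i) y) I"
      by (rule has_sum_bounded_linear[OF K.bounded_linear_proj y])
    moreover have "((\<lambda>j. proj (cyclic_span i) (proj (cyclic_span j) x)) has_sum proj (cyclic_span i) x) I"
    proof (rule has_sum_finite_neutralI[of "{i}"])
      show "proj (cyclic_span i) (proj (cyclic_span j) x) = 0" if "j \<in> I - {i}" for j
        using cyclic_span_orth[OF I _ i _ pin, of j] that by (intro K.proj_0I) auto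
    qed (use i in auto)
    ultimately show ?thesis using has_sum_unique by (simp add: K.proj_diff) blast
  qed
  have "x - y = 0" by (rule maximal_system_complete[OF I mx csubspace_diff[OF hilb_sub x yH] pz])
  then show ?thesis using y by simp
qed

text \<open>The components of a vector are its projections to the cyclic subspaces. Conversely a family in the domain of
  the direct sum is summable in every closed operator, which puts its sum into the domain.\<close>

theorem ex_cyclic_decomposition:
  "\<exists>(I :: 'h set) \<rho>. orthogonal_direct_sum \<pi> I \<rho> \<and> (\<forall>i\<in>I. cyclic_rep (\<rho> i) \<and> well_behaved A (\<rho> i))"
proof -
  obtain I where I: "orthogonal_system I" and mx: "\<And>J. orthogonal_system J \<Longrightarrow> I \<subseteq> J \<Longrightarrow> J = I"
    using ex_maximal_orthogonal_system by blast
  define \<rho> where "\<rho> i = subrep \<pi> (cyclic_span i)" for i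
  have bv: "bounded_vector i" if "i \<in> I" for i using I that by (simp add: orthogonal_system_def)
  have R: "reducing (cyclic_span i)" if "i \<in> I" for i by (rule reducing_cyclic_span[OF bv[OF that]])
  have Ei: "E_invariant (cyclic_span i)" if "i \<in> I" for i by (rule E_invariant_cyclic_span[OF bv[OF that]])
  have K: "closed_csubspace (cyclic_span i)" if "i \<in> I" for i by (rule E_invariant_closed_csubspace[OF Ei[OF that]])
  have KH: "cyclic_span i \<subseteq> H" if "i \<in> I" for i using Ei[OF that] by (simp add: E_invariant_def)
  have pin: "proj (cyclic_span i) y \<in> cyclic_span i" if "i \<in> I" for i y using closed_csubspace.pin[OF K[OF that]] .
  have wb: "well_behaved A (\<rho> i)" if "i \<in> I" for i unfolding \<rho>_def by (rule well_behaved_subrep[OF R[OF that]])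
  have orth: "cinner x y = 0" if "i \<in> I" "j \<in> I" "i \<noteq> j" "x \<in> cyclic_span i" "y \<in> cyclic_span j" for i j x y using cyclic_span_orth[OF I that] .
  have expand: "((\<lambda>i. proj (cyclic_span i) x) has_sum x) I" if "x \<in> H" for x by (rule maximal_system_sum[OF I mx that])
  have expand_sq: "(\<lambda>i. (norm (proj (cyclic_span i) x))\<^sup>2) summable_on I" if "x \<in> H" for x
    using has_sum_norm_orth[OF _ expand[OF that]] orth pin by (auto simp: summable_on_def)
  have sp: "(\<lambda>i\<in>I. proj (cyclic_span i) x) \<in> direct_sum_space I \<rho>" if "x \<in> H" for x
  proof -
    have "(\<lambda>i. (norm ((\<lambda>i\<in>I. proj (cyclic_span i) x) i))\<^sup>2) summable_on I \<longleftrightarrow> (\<lambda>i. (norm (proj (cyclic_span i) x))\<^sup>2) summable_on I"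
      by (rule summable_on_cong) simp
    then show ?thesis using expand_sq[OF that] pin by (auto simp: direct_sum_space_def \<rho>_def)
  qed
  have restr: "((\<lambda>i\<in>I. proj (cyclic_span i) x) has_sum x) I" if "x \<in> H" for x
    using expand[OF that] by (rule has_sum_cong[THEN iffD2, rotated]) simp
  have sum_act: "\<exists>y. ((\<lambda>i. act \<pi> a (\<Phi> i)) has_sum y) I \<and> (x, y) \<in> closure (rep_op \<pi> a)"
    if \<Phi>: "\<Phi> \<in> direct_sum_dom (alg \<pi>) I \<rho>" and x: "(\<Phi> has_sum x) I" for \<Phi> x a
  proof -
    have \<Phi>i: "\<Phi> i \<in> D" "\<Phi> i \<in> cyclic_span i" "act \<pi> a (\<Phi> i) \<in> cyclic_span i" if "i \<in> I" for i
      using \<Phi> that R[OF that] by (auto simp: direct_sum_dom_def \<rho>_def reducing_def)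
    have "(\<lambda>i. (norm (act \<pi> a (\<Phi> i)))\<^sup>2) summable_on I" using \<Phi> by (simp add: direct_sum_dom_def \<rho>_def)
    then have "(\<lambda>i. act \<pi> a (\<Phi> i)) summable_on I" using orth \<Phi>i by (intro orth_summable) auto
    then obtain y where y: "((\<lambda>i. act \<pi> a (\<Phi> i)) has_sum y) I" by (auto simp: summable_on_def)
    have "((\<lambda>F. (sum \<Phi> F, \<Sum>i\<in>F. act \<pi> a (\<Phi> i))) \<longlongrightarrow> (x, y)) (finite_subsets_at_top I)"
      using x y unfolding has_sum_def by (rule tendsto_Pair)
    moreover have "\<forall>\<^sub>F F in finite_subsets_at_top I. (sum \<Phi> F, \<Sum>i\<in>F. act \<pi> a (\<Phi> i)) \<in> closure (rep_op \<pi> a)"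
    proof (rule eventually_finite_subsets_at_top_weakI)
      fix F assume F: "finite F" "F \<subseteq> I"
      then have s: "sum \<Phi> F \<in> D" using \<Phi>i by (intro csubspace_sum[OF dom_sub]) auto
      have "act \<pi> a (sum \<Phi> F) = (\<Sum>i\<in>F. act \<pi> a (\<Phi> i))" using F \<Phi>i by (intro act_sum) auto
      then show "(sum \<Phi> F, \<Sum>i\<in>F. act \<pi> a (\<Phi> i)) \<in> closure (rep_op \<pi> a)" using rep_op_closure[OF s, of a] by simp
    qed
    ultimately have "(x, y) \<in> closure (rep_op \<pi> a)" by (intro Lim_in_closed_set[OF closed_closure]) auto
    with y show ?thesis by blast
  qed
  have dsum_dom: "x \<in> D" if "\<Phi> \<in> direct_sum_dom (alg \<pi>) I \<rho>" "(\<Phi> has_sum x) I" for \<Phi> x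
    using sum_act[OF that] by (intro in_domI) blast
  have "orthogonal_direct_sum \<pi> I \<rho>"
    unfolding orthogonal_direct_sum_def
  proof (intro conjI ballI allI impI)
    fix i assume i: "i \<in> I"
    show "alg (\<rho> i) = alg \<pi>" by (simp add: \<rho>_def)
    show "star_rep (\<rho> i)" using wb[OF i] by (simp add: well_behaved_def)
    show "closed_rep (\<rho> i)" using closed_rep_subrep[OF R[OF i] UNIV_subalgebra] by (simp add: \<rho>_def Res_UNIV_subrep)
    fix j x y assume "j \<in> I" "i \<noteq> j" "x \<in> hilb (\<rho> i)" "y \<in> hilb (\<rho> j)"
    then show "cinner x y = 0" using orth[OF i] by (simp add: \<rho>_def)
  next
    show "H = {x. \<exists>\<Phi>\<in>direct_sum_space I \<rho>. (\<Phi> has_sum x) I}"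
    proof (intro set_eqI iffI)
      fix x assume "x \<in> H"
      then show "x \<in> {x. \<exists>\<Phi>\<in>direct_sum_space I \<rho>. (\<Phi> has_sum x) I}" using sp restr by blast
    next
      fix x assume "x \<in> {x. \<exists>\<Phi>\<in>direct_sum_space I \<rho>. (\<Phi> has_sum x) I}"
      then obtain \<Phi> where \<Phi>: "\<Phi> \<in> direct_sum_space I \<rho>" "(\<Phi> has_sum x) I" by blast
      have \<Phi>H: "\<Phi> i \<in> H" if "i \<in> I" for i using \<Phi>(1) that KH[OF that] by (auto simp: direct_sum_space_def \<rho>_def)
      show "x \<in> H"
      proof (rule Lim_in_closed_set[OF hilb_closed])
        show "(sum \<Phi> \<longlongrightarrow> x) (finite_subsets_at_top I)" using \<Phi>(2) by (simp add: has_sum_def)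
        show "\<forall>\<^sub>F F in finite_subsets_at_top I. sum \<Phi> F \<in> H"
          by (rule eventually_finite_subsets_at_top_weakI) (use \<Phi>H in \<open>auto intro!: csubspace_sum[OF hilb_sub]\<close>)
      qed simp
    qed
    show "D = {x. \<exists>\<Phi>\<in>direct_sum_dom (alg \<pi>) I \<rho>. (\<Phi> has_sum x) I}"
    proof (intro set_eqI iffI)
      fix x assume x: "x \<in> D"
      have "(\<lambda>i\<in>I. proj (cyclic_span i) x) \<in> direct_sum_dom (alg \<pi>) I \<rho>"
        unfolding direct_sum_dom_def
      proof (intro CollectI conjI ballI)
        show "(\<lambda>i\<in>I. proj (cyclic_span i) x) \<in> direct_sum_space I \<rho>" by (rule sp[OF dom_hilb[OF x]])
        show "(\<lambda>i\<in>I. proj (cyclic_span i) x) i \<in> dom (\<rho> i)" if "i \<in> I" for i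
          using that pin[OF that] proj_dom[OF Ei[OF that] x] by (simp add: \<rho>_def)
        fix a
        have "(\<lambda>i. (norm (act (\<rho> i) a ((\<lambda>i\<in>I. proj (cyclic_span i) x) i)))\<^sup>2) summable_on I \<longleftrightarrow> (\<lambda>i. (norm (proj (cyclic_span i) (act \<pi> a x)))\<^sup>2) summable_on I"
          by (rule summable_on_cong) (simp add: \<rho>_def reducing_proj[OF R x])
        then show "(\<lambda>i. (norm (act (\<rho> i) a ((\<lambda>i\<in>I. proj (cyclic_span i) x) i)))\<^sup>2) summable_on I"
          using expand_sq[OF act_hilb[OF in_alg x]] by simp
      qed
      then show "x \<in> {x. \<exists>\<Phi>\<in>direct_sum_dom (alg \<pi>) I \<rho>. (\<Phi> has_sum x) I}" using restr[OF dom_hilb[OF x]] by blast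
    next
      fix x assume "x \<in> {x. \<exists>\<Phi>\<in>direct_sum_dom (alg \<pi>) I \<rho>. (\<Phi> has_sum x) I}"
      then show "x \<in> D" using dsum_dom by blast
    qed
    fix a \<Phi> x assume \<Phi>: "\<Phi> \<in> direct_sum_dom (alg \<pi>) I \<rho>" and x: "(\<Phi> has_sum x) I"
    obtain y where y: "((\<lambda>i. act \<pi> a (\<Phi> i)) has_sum y) I" "(x, y) \<in> closure (rep_op \<pi> a)" using sum_act[OF \<Phi> x] by blast
    have "y = act \<pi> a x" by (rule closure_rep_op_dom[OF in_alg y(2) dsum_dom[OF \<Phi> x]])
    then show "((\<lambda>i. act (\<rho> i) a (\<Phi> i)) has_sum act \<pi> a x) I" using y(1) by (simp add: \<rho>_def)
  qed
  moreover have "cyclic_rep (\<rho> i)" if "i \<in> I" for i unfolding \<rho>_def by (rule cyclic_subrep[OF bv[OF that]])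
  ultimately show ?thesis using wb by blast
qed

end

theorem proposition22:
  fixes A :: "'g::group_add \<Rightarrow> 'a::complex_star_algebra set"
    and \<pi> :: "('a, 'h::complex_hilbert_space) rep"
  assumes "standing_assumptions A"
    and "well_behaved A \<pi>"
    and "metrizable_space (graph_topology \<pi>)"
  shows "\<exists>(I :: 'h set) (\<rho> :: 'h \<Rightarrow> ('a, 'h) rep).
           orthogonal_direct_sum \<pi> I \<rho> \<and>
           (\<forall>i\<in>I. cyclic_rep (\<rho> i) \<and> well_behaved A (\<rho> i))"
proof -
  obtain E where E: "spectral_measure (char_borel A) (hilb \<pi>) E"
    "\<forall>b\<in>A 0. closure (rep_op \<pi> b) = spectral_integral (char_borel A) (hilb \<pi>) E (\<lambda>\<xi>. \<xi> b)"
    "\<forall>g. \<forall>a\<in>A g. \<forall>\<Delta>\<in>sets (char_borel A).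
       rep_op \<pi> a O op_graph (hilb \<pi>) (E (set_act A g \<Delta>)) \<subseteq> op_graph (hilb \<pi>) (E \<Delta>) O rep_op \<pi> a"
    using assms(2) unfolding well_behaved_def by blast
  interpret W: well_behaved_rep A \<pi> E
    using assms E by unfold_locales (auto simp: well_behaved_def)
  interpret R: regular_well_behaved_rep A \<pi> W.E_reg by (rule W.regular_well_behaved_rep_E_reg)
  show ?thesis by (rule R.ex_cyclic_decomposition)
qed

end
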